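(* Let $d\in\mathbb{N}$, $\alpha,\beta\in(0,1]$, $x_0\in\mathbb{R}^d$, and let $f\in \mathcal{C}_b^{\alpha,\beta}([0,1]\times\mathbb{R}^d;\mathbb{R}^d)$. Let $X=(X(t))_{t\in[0,1]}$ be the solution of the SDE $$\mathrm{d}X(t)=f(t,X(t))\,\mathrm{d}t+\mathrm{d}B(t),\quad t\in[0,1],\qquad X(0)=x_0,$$ and, for $n\in\mathbb{N}$, let $X^{(n)}$ be the randomised Euler–Maruyama approximation (in its continuous-time version) $$X^{(n)}_t=x_0+\int_0^t f\big(\kappa^\tau_n(s),X^{(n)}_{\kappa_n(s)}\big)\,\mathrm{d}s+B_t,\qquad t\in[0,1].$$ Then for any $p\geq 1$ and any $\epsilon\in(0,1/2)$ there exists a positive constant $C$ (depending on $d,p,x_0,\alpha,\beta,\epsilon$ and $f$, but not on $n$) such that for all $n\in\mathbb{N}$ $$\mathbb{E}\Big[\sup_{0\le t\le 1}\big|X(t)-X^{(n)}_t\big|^p\Big]\le C\,n^{-(1/2+\gamma-\epsilon)p},\qquad \gamma:=\alpha\wedge(\beta/2).$$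
   Context: $B$ is a $d$-dimensional Brownian motion on a probability space $(\Omega_B,\mathcal{F}^B,\mathbb{P}_B)$ with its filtration $(\mathcal{F}^B_t)$. $(\tau_j)_{j\in\mathbb{N}}$ is an i.i.d. family of uniform $\mathcal{U}(0,1)$ random variables on a probability space $(\Omega_\tau,\mathcal{F}^\tau,\mathbb{P}_\tau)$, with $\mathcal{F}^\tau_j=\sigma(\tau_1,\dots,\tau_j)$. Everything lives on the product space $(\Omega,\mathcal{F},\mathbb{P})=(\Omega_B\times\Omega_\tau,\mathcal{F}^B\otimes\mathcal{F}^\tau,\mathbb{P}_B\otimes\mathbb{P}_\tau)$, with filtration $\mathcal{F}^n_t=\mathcal{F}^B_t\otimes\mathcal{F}^\tau_{\lfloor tn\rfloor+1}$; $\mathbb{E}$ is expectation under $\mathbb{P}$. For $n\in\mathbb{N}$ and $r\in[0,1]$: $\kappa_n(r)=\lfloor nr\rfloor/n$ and $\kappa^\tau_n(r)=(\lfloor nr\rfloor+\tau_{\lfloor nr\rfloor+1})/n$; equivalently, on the grid $t_j=j/n$, $X^{(n)}_{t_j}=X^{(n)}_{t_{j-1}}+\frac1n f(t_{j-1}+\tau_j/n,X^{(n)}_{t_{j-1}})+B_{t_j}-B_{t_{j-1}}$. The space $\mathcal{C}_b^{\alpha,\beta}([0,1]\times\mathbb{R}^d;\mathbb{R}^d)$ consists of $g:[0,1]\times\mathbb{R}^d\to\mathbb{R}^d$ with finite norm $\|g\|_{\mathcal{C}_b^{\alpha,\beta}}=\sup_{t,x}|g(t,x)|+\sup_{x,s\ne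 t}\frac{|g(t,x)-g(s,x)|}{|t-s|^\alpha}+\sup_{t,x\ne y}\frac{|g(t,x)-g(t,y)|}{|x-y|^\beta}$. *)

theory Defs
  imports "HOL-Probability.Probability"
begin

definition holder_Cb :: "real \<Rightarrow> real \<Rightarrow> (real \<Rightarrow> real^'d \<Rightarrow> real^'d) \<Rightarrow> bool" where
  "holder_Cb \<alpha> \<beta> g \<longleftrightarrow>
     (\<exists>K. \<forall>t\<in>{0..1}. \<forall>x. norm (g t x) \<le> K) \<and>
     (\<exists>K. \<forall>x. \<forall>s\<in>{0..1}. \<forall>t\<in>{0..1}. norm (g t x - g s x) \<le> K * \<bar>t - s\<bar> powr \<alpha>) \<and>
     (\<exists>K. \<forall>t\<in>{0..1}. \<forall>x y. norm (g t x - g t y) \<le> K * norm (x - y) powr \<beta>)"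

definition brownian_motion :: "'a measure \<Rightarrow> (real \<Rightarrow> 'a \<Rightarrow> real^'d) \<Rightarrow> bool" where
  "brownian_motion M B \<longleftrightarrow> prob_space M \<and>
     (\<forall>t\<in>{0..1}. B t \<in> borel_measurable M) \<and>
     (AE \<omega> in M. B 0 \<omega> = 0 \<and> continuous_on {0..1} (\<lambda>t. B t \<omega>)) \<and>
     (\<forall>(ts::nat \<Rightarrow> real) k. (\<forall>j\<le>k. 0 \<le> ts j \<and> ts j \<le> 1) \<and> (\<forall>j<k. ts j < ts (Suc j)) \<longrightarrow>
        prob_space.indep_vars M (\<lambda>_. borel)
           (\<lambda>(i, j) \<omega>. (B (ts (Suc j)) \<omega> - B (ts j) \<omega>) $ i) (UNIV \<times> {..<k}) \<and>
        (\<forall>i. \<forall>j<k. distributed M lborel (\<lambda>\<omega>. (B (ts (Suc j)) \<omega> - B (ts j) \<omega>) $ i)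
                     (\<lambda>x. ennreal (normal_density 0 (sqrt (ts (Suc j) - ts j)) x))))"

definition nat_filtration :: "'a measure \<Rightarrow> (real \<Rightarrow> 'a \<Rightarrow> real^'d) \<Rightarrow> real \<Rightarrow> 'a measure" where
  "nat_filtration M B t = sigma (space M)
     ({B s -` A \<inter> space M | s A. s \<in> {0..t} \<and> A \<in> sets borel} \<union>
      {N \<in> sets M. emeasure M N = 0})"

definition kappa :: "nat \<Rightarrow> real \<Rightarrow> real" where
  "kappa n r = real_of_int \<lfloor>real n * r\<rfloor> / real n"

definition kappa_tau :: "(nat \<Rightarrow> 'b \<Rightarrow> real) \<Rightarrow> nat \<Rightarrow> real \<Rightarrow> 'b \<Rightarrow> real" where
  "kappa_tau tau n r w = (real_of_int \<lfloor>real n * r\<rfloor> + tau (nat \<lfloor>real n * r\<rfloor> + 1) w) / real n"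

end

theory Submission
  imports Defs
begin

text \<open>
  Write \<open>X - X\<^sup>n\<close> over a time window as the sum of three integrals: of \<open>f(s, X\<^sub>s) - f(s, X\<^sup>n\<^sub>s)\<close>, of
  \<open>f(s, X\<^sup>n\<^sub>s) - f(s, X\<^sup>n\<^bsub>\<kappa>(s)\<^esub>)\<close>, and of \<open>f(s, X\<^sup>n\<^bsub>\<kappa>(s)\<^esub>) - f(\<kappa>\<^sup>\<tau>(s), X\<^sup>n\<^bsub>\<kappa>(s)\<^esub>)\<close>.
  The last one is, given the Brownian path, a martingale in the sampling points, with increments of
  size \<open>n\<^bsup>-1-\<alpha>\<^esup>\<close>, hence of size \<open>n\<^bsup>-1/2-\<alpha>\<^esup>\<close> in every \<open>L\<^sup>q\<close>.
  For the other two, conditioning on the past replaces \<open>f\<close> by its image under the heat semigroup, whose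
  smoothing pays for the roughness of \<open>f\<close>. In the first integral a dyadic (stochastic sewing) argument
  bounds the contribution of a window of length \<open>\<Delta>\<close> by a power \<open>\<Delta>\<^bsup>(1+\<beta>)/2\<^esup>\<close> times the size of the error on
  that window; in the second, telescoping over the cells of the grid leaves martingale differences whose
  sum has order \<open>n\<^bsup>-\<theta>\<^esup>\<close> for every \<open>\<theta> < (1+\<beta>)/2\<close>.
  Both processes are Brownian motion plus a Lipschitz path, and this Lipschitz part only enters through
  the spatial regularity of the smoothed functions, so no change of measure is needed. On short windows
  the first term is absorbed, and finitely many windows cover \<open>[0, 1]\<close>. A union bound over the grid in
  \<open>L\<^sup>q\<close> with large \<open>q\<close> gives the supremum at the price of \<open>\<epsilon>\<close>.
\<close>

section \<open>Moment bounds\<close>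

text \<open>The drift is only \<beta>-Hoelder in space, so a Gronwall argument on |X - Y| does not
  close; the estimates run on increments over windows, where averaging along the noise replaces a
  Lipschitz bound. One exponent \<theta> is carried through: an error over a window of length
  \<Delta> is measured on the scale n^(-\<theta>) \<Delta>^\<eta> with \<eta> = 1 - \<theta>. On
  windows shorter than a cell the Lipschitz bound \<Delta> stays below this scale, while the dyadic
  sums converge if \<eta> > (1 - \<beta>)/2, that is \<theta> < (1 + \<beta>)/2. The quadrature adds
  \<theta> \<le> 1/2 + \<alpha>. The doubling argument behind the gradient bound for the heat flow
  gives a convergent geometric series for \<beta> < 1, so \<beta> is lowered slightly at the very
  end. Derivatives of the semigroup are replaced by first and second differences, obtained from a
  Cameron-Martin shift and the semigroup law. The two sources of randomness are decoupled: the
  filtration contains all sampling points from the start, so the drift of a cell is known at its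
  left end, and the quadrature error is treated for a frozen Brownian path in the filtration of the
  sampling points.\<close>

lemma powr_mono2_le_one:
  fixes x a b :: real
  assumes "0 \<le> x" "x \<le> 1" "b \<le> a"
  shows "x powr a \<le> x powr b"
proof (cases "x = 0")
  case False
  then show ?thesis
    using assms by (intro powr_mono') auto
qed simp

text \<open>Comparison with the integral of y^(-a) over [0, N \<delta>], which is the right-hand
  side. Each summand is at most the increment of the concave function y^(1-a)/(1-a) over its cell.
  The singularity at 0 is integrable because a < 1; the exponents of all later smoothing estimates
  come from this sum.\<close>

lemma sum_scaled_powr_le:
  fixes a \<delta> :: real
  assumes a: "0 \<le> a" "a < 1" and \<delta>: "0 < \<delta>"
  shows "(\<Sum>l=1..N. \<delta> * (real l * \<delta>) powr (-a)) \<le> (real N * \<delta>) powr (1 - a) / (1 - a)"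
proof (induction N)
  case 0
  then show ?case by simp
next
  case (Suc N)
  define y where "y = real (Suc N) * \<delta>"
  define x where "x = real N * \<delta>"
  have y: "y > 0" and x: "x \<ge> 0" and yx: "y - x = \<delta>"
    using \<delta> by (auto simp: y_def x_def distrib_right intro!: add_pos_nonneg)
  \<comment> \<open>Weighted AM-GM, playing the role of the tangent line to t^(1-a) at t =
    1.\<close>
  have yng: "(x / y) powr (1 - a) * 1 powr a \<le> (1 - a) * (x / y) + a * 1"
    using a x y by (cases "x = 0") (simp, intro Youngs_inequality_0, auto)
  have e1: "y powr (1 - a) = y * y powr (-a)"
    using y powr_add[of y 1 "-a"] by simp
  have "x powr (1 - a) = (x / y) powr (1 - a) * y powr (1 - a)"
    using x y powr_mult[of "x/y" y "1 - a"] by simp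
  also have "\<dots> \<le> ((1 - a) * (x / y) + a) * y powr (1 - a)"
    using yng by (intro mult_right_mono) auto
  also have "\<dots> = y powr (1 - a) - (1 - a) * (y - x) * y powr (-a)"
    using y by (simp add: e1 field_simps)
  finally have "(1 - a) * (\<delta> * y powr (-a)) \<le> y powr (1 - a) - x powr (1 - a)"
    unfolding yx by (simp add: mult_ac)
  then have "\<delta> * y powr (-a) \<le> y powr (1 - a) / (1 - a) - x powr (1 - a) / (1 - a)"
    using a by (simp add: le_divide_eq mult.commute flip: diff_divide_distrib)
  with Suc.IH show ?case
    by (simp add: x_def y_def)
qed

lemma sum_inverse_geometric_le:
  fixes x :: real
  assumes "0 \<le> x" "x < 1"
  shows "(\<Sum>k<n. x ^ k) \<le> 1 / (1 - x)"
  using assms by (simp add: sum_gp_strict divide_right_mono)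

text \<open>The term linear in \<open>z\<close> is kept exactly, with its sign, because its
  expectation will vanish; only terms of order two and higher are estimated. The constant 4^m =
  2^(2m) is the sum of all binomial coefficients.\<close>

lemma power_add_le_two_sided:
  fixes s z :: real and m :: nat
  assumes "1 \<le> m"
  shows "(s + z) ^ (2 * m) \<le> s ^ (2 * m) + real (2 * m) * s ^ (2 * m - 1) * z
           + 4 ^ m * (s ^ (2 * m - 2) * z\<^sup>2 + z ^ (2 * m))"
proof -
  let ?n = "2 * m"
  let ?R = "s ^ (?n - 2) * z\<^sup>2 + z ^ ?n"
  have R0: "0 \<le> ?R"
  proof -
    have "even (?n - 2)" by simp
    then show ?thesis by (intro add_nonneg_nonneg mult_nonneg_nonneg zero_le_even_power) auto
  qed
  \<comment> \<open>Every term of order between 2 and 2m lies below one of the two extreme ones,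
    depending on which of |s| and |z| is larger.\<close>
  have key: "s ^ (?n - k) * z ^ k \<le> ?R" if k: "2 \<le> k" "k \<le> ?n" for k
  proof -
    have e2: "s ^ (?n - 2) = \<bar>s\<bar> ^ (?n - 2)" "z ^ ?n = \<bar>z\<bar> ^ ?n" "z\<^sup>2 = \<bar>z\<bar>\<^sup>2"
      by (simp_all add: power_even_abs)
    have "s ^ (?n - k) * z ^ k \<le> \<bar>s\<bar> ^ (?n - k) * \<bar>z\<bar> ^ k"
      by (metis abs_ge_self abs_mult power_abs)
    also have "\<dots> \<le> \<bar>s\<bar> ^ (?n - 2) * \<bar>z\<bar>\<^sup>2 + \<bar>z\<bar> ^ ?n"
    proof (cases "\<bar>z\<bar> \<le> \<bar>s\<bar>")
      case True
      have "\<bar>s\<bar> ^ (?n - k) * \<bar>z\<bar> ^ k = \<bar>s\<bar> ^ (?n - k) * (\<bar>z\<bar> ^ (k - 2) * \<bar>z\<bar>\<^sup>2)"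
        using k by (subst power_add[of "\<bar>z\<bar>" "k - 2" 2, symmetric]) (simp only: le_add_diff_inverse2)
      also have "\<dots> \<le> \<bar>s\<bar> ^ (?n - k) * (\<bar>s\<bar> ^ (k - 2) * \<bar>z\<bar>\<^sup>2)"
        using True by (intro mult_left_mono mult_right_mono power_mono) auto
      also have "\<dots> = \<bar>s\<bar> ^ (?n - 2) * \<bar>z\<bar>\<^sup>2"
        using k by (simp add: mult.assoc[symmetric] flip: power_add)
      finally show ?thesis by (smt (verit) zero_le_power abs_ge_zero)
    next
      case False
      have "\<bar>s\<bar> ^ (?n - k) * \<bar>z\<bar> ^ k \<le> \<bar>z\<bar> ^ (?n - k) * \<bar>z\<bar> ^ k"
        using False by (intro mult_right_mono power_mono) auto
      also have "\<dots> = \<bar>z\<bar> ^ ?n"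
        using k by (simp flip: power_add)
      finally show ?thesis by (smt (verit) zero_le_power abs_ge_zero mult_nonneg_nonneg)
    qed
    finally show ?thesis by (simp only: e2)
  qed
  have split: "{..?n} = {0, 1} \<union> {2..?n}"
    using assms by auto
  have "(s + z) ^ ?n = (z + s) ^ ?n" by (simp add: add.commute)
  also have "\<dots> = (\<Sum>k\<le>?n. of_nat (?n choose k) * z ^ k * s ^ (?n - k))"
    by (rule binomial_ring)
  also have "\<dots> = s ^ ?n + real ?n * s ^ (?n - 1) * z + (\<Sum>k=2..?n. real (?n choose k) * z ^ k * s ^ (?n - k))"
    unfolding split by (subst sum.union_disjoint) auto
  also have "(\<Sum>k=2..?n. real (?n choose k) * z ^ k * s ^ (?n - k)) \<le> (\<Sum>k=2..?n. real (?n choose k) * ?R)"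
    using key by (intro sum_mono) (simp add: mult.assoc mult.commute mult_left_mono)
  also have "\<dots> = (\<Sum>k=2..?n. real (?n choose k)) * ?R"
    by (rule sum_distrib_right[symmetric])
  also have "\<dots> \<le> 4 ^ m * ?R"
  proof (rule mult_right_mono[OF _ R0])
    have "(\<Sum>k=2..?n. real (?n choose k)) \<le> (\<Sum>k\<le>?n. real (?n choose k))"
      by (intro sum_mono2) auto
    also have "\<dots> = real (2 ^ ?n)"
      by (simp only: choose_row_sum flip: of_nat_sum)
    also have "\<dots> = 4 ^ m" by (simp add: power_mult)
    finally show "(\<Sum>k=2..?n. real (?n choose k)) \<le> 4 ^ m" .
  qed
  finally show ?thesis by simp
qed

text \<open>A norm bound stated through q-th powers and a nonnegative integral: it makes sense
  before integrability is known, and it passes to limits by Fatou. The integer q allows the even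
  powers 2m to be expanded binomially.\<close>

definition Lq_le :: "'w measure \<Rightarrow> nat \<Rightarrow> real \<Rightarrow> ('w \<Rightarrow> real) \<Rightarrow> bool" where
  "Lq_le M q c Y \<longleftrightarrow> 0 \<le> c \<and> Y \<in> borel_measurable M \<and>
     (\<integral>\<^sup>+\<omega>. ennreal (\<bar>Y \<omega>\<bar> ^ q) \<partial>M) \<le> ennreal (c ^ q)"

lemma Lq_leD:
  assumes "Lq_le M q c Y"
  shows "0 \<le> c" "Y \<in> borel_measurable M" "(\<integral>\<^sup>+\<omega>. ennreal (\<bar>Y \<omega>\<bar> ^ q) \<partial>M) \<le> ennreal (c ^ q)"
  using assms by (auto simp: Lq_le_def)

lemma Lq_le_mono:
  assumes "Lq_le M q c Y" "c \<le> c'" "Y' \<in> borel_measurable M" "AE \<omega> in M. \<bar>Y' \<omega>\<bar> \<le> \<bar>Y \<omega>\<bar>"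
  shows "Lq_le M q c' Y'"
proof -
  note D = Lq_leD[OF assms(1)]
  have "(\<integral>\<^sup>+\<omega>. ennreal (\<bar>Y' \<omega>\<bar> ^ q) \<partial>M) \<le> (\<integral>\<^sup>+\<omega>. ennreal (\<bar>Y \<omega>\<bar> ^ q) \<partial>M)"
    using assms(4) by (intro nn_integral_mono_AE) (auto intro!: ennreal_leI power_mono)
  also have "\<dots> \<le> ennreal (c ^ q)" by (rule D)
  also have "\<dots> \<le> ennreal (c' ^ q)" using D(1) assms(2) by (intro ennreal_leI power_mono)
  finally show ?thesis using assms D(1) by (auto simp: Lq_le_def)
qed

lemma Lq_le_weaken: "Lq_le M q c Y \<Longrightarrow> c \<le> c' \<Longrightarrow> Lq_le M q c' Y"
  by (rule Lq_le_mono) (auto dest: Lq_leD)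

lemma Lq_le_cmult:
  assumes "Lq_le M q c Y"
  shows "Lq_le M q (\<bar>a\<bar> * c) (\<lambda>\<omega>. a * Y \<omega>)"
proof -
  note D = Lq_leD[OF assms]
  note [measurable] = D(2)
  have "(\<integral>\<^sup>+\<omega>. ennreal (\<bar>a * Y \<omega>\<bar> ^ q) \<partial>M) = (\<integral>\<^sup>+\<omega>. ennreal (\<bar>a\<bar> ^ q) * ennreal (\<bar>Y \<omega>\<bar> ^ q) \<partial>M)"
    by (simp add: abs_mult power_mult_distrib ennreal_mult)
  also have "\<dots> = ennreal (\<bar>a\<bar> ^ q) * (\<integral>\<^sup>+\<omega>. ennreal (\<bar>Y \<omega>\<bar> ^ q) \<partial>M)"
    by (intro nn_integral_cmult) simp
  also have "\<dots> \<le> ennreal (\<bar>a\<bar> ^ q) * ennreal (c ^ q)"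
    by (intro mult_left_mono D) simp
  also have "\<dots> = ennreal ((\<bar>a\<bar> * c) ^ q)"
    using D(1) by (simp add: power_mult_distrib ennreal_mult)
  finally show ?thesis using D by (auto simp: Lq_le_def)
qed

lemma (in prob_space) Lq_le_bounded:
  assumes "Y \<in> borel_measurable M" "AE \<omega> in M. \<bar>Y \<omega>\<bar> \<le> c" "0 \<le> c"
  shows "Lq_le M q c Y"
proof -
  have "(\<integral>\<^sup>+\<omega>. ennreal (\<bar>Y \<omega>\<bar> ^ q) \<partial>M) \<le> (\<integral>\<^sup>+\<omega>. ennreal (c ^ q) \<partial>M)"
    using assms(2) by (intro nn_integral_mono_AE) (auto intro!: ennreal_leI power_mono)
  also have "\<dots> = ennreal (c ^ q)" by (simp add: emeasure_space_1)
  finally show ?thesis using assms by (auto simp: Lq_le_def)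
qed

text \<open>Covers the degenerate case of Minkowski's inequality, in which a vanishing bound cannot
  serve as a normalising weight.\<close>

lemma Lq_le_zero_AE:
  assumes "Lq_le M q 0 Y" "1 \<le> q"
  shows "AE \<omega> in M. Y \<omega> = 0"
proof -
  note [measurable] = Lq_leD(2)[OF assms(1)]
  have "(\<integral>\<^sup>+\<omega>. ennreal (\<bar>Y \<omega>\<bar> ^ q) \<partial>M) = 0"
    using Lq_leD(3)[OF assms(1)] assms(2) by (simp add: power_0_left)
  then have "AE \<omega> in M. ennreal (\<bar>Y \<omega>\<bar> ^ q) = 0"
    by (subst (asm) nn_integral_0_iff_AE) auto
  then show ?thesis
  proof eventually_elim
    fix \<omega> assume "ennreal (\<bar>Y \<omega>\<bar> ^ q) = 0"
    then have "\<bar>Y \<omega>\<bar> ^ q = 0"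
      by (meson abs_ge_zero ennreal_eq_0_iff order_antisym zero_le_power)
    then show "Y \<omega> = 0" by simp
  qed
qed

lemma power_add_le_weighted:
  fixes x y c d :: real
  assumes "0 < c" "0 < d" "0 \<le> x" "0 \<le> y"
  shows "(x + y) ^ q \<le> (c + d) ^ q * (c / (c + d) * (x / c) ^ q + d / (c + d) * (y / d) ^ q)"
proof -
  have cv: "convex_on {0..} (\<lambda>t::real. t ^ q)"
  proof (rule convex_onI)
    fix t x y :: real
    assume t: "0 < t" "t < 1" and xy: "x \<in> {0..}" "y \<in> {0..}"
    show "((1 - t) *\<^sub>R x + t *\<^sub>R y) ^ q \<le> (1 - t) * x ^ q + t * y ^ q"
    proof (induction q)
      case 0
      then show ?case by simp
    next
      case (Suc q)
      \<comment> \<open>Both factors have the same sign. This is exactly the defect between the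
        product of two convex combinations and the convex combination of the products, so it drives
        the induction on the exponent.\<close>
      have "0 \<le> (x - y) * (x ^ q - y ^ q)"
      proof (cases "x \<le> y")
        case True
        then show ?thesis using xy by (intro mult_nonpos_nonpos) (auto intro!: power_mono)
      next
        case False
        then show ?thesis using xy by (intro mult_nonneg_nonneg) (auto intro!: power_mono)
      qed
      then have nn: "0 \<le> t * (1 - t) * ((x - y) * (x ^ q - y ^ q))"
        using t by simp
      have "((1 - t) *\<^sub>R x + t *\<^sub>R y) ^ Suc q \<le> ((1 - t) * x + t * y) * ((1 - t) * x ^ q + t * y ^ q)"
        using Suc t xy by (auto intro!: mult_left_mono add_nonneg_nonneg)
      also have "\<dots> = (1 - t) * x ^ Suc q + t * y ^ Suc q - t * (1 - t) * ((x - y) * (x ^ q - y ^ q))"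
        by (simp add: algebra_simps)
      finally show ?case using nn by linarith
    qed
  qed auto
  have "((1 - d / (c + d)) *\<^sub>R (x / c) + (d / (c + d)) *\<^sub>R (y / d)) ^ q
        \<le> (1 - d / (c + d)) * (x / c) ^ q + (d / (c + d)) * (y / d) ^ q"
    using assms by (intro convex_onD[OF cv]) auto
  moreover have "1 - d / (c + d) = c / (c + d)"
    using assms by (simp add: field_simps)
  moreover have "(c / (c + d)) *\<^sub>R (x / c) + (d / (c + d)) *\<^sub>R (y / d) = (x + y) / (c + d)"
    using assms by (simp add: add_divide_distrib)
  ultimately have "((x + y) / (c + d)) ^ q \<le> c / (c + d) * (x / c) ^ q + d / (c + d) * (y / d) ^ q"
    by simp
  then show ?thesis
    using assms by (simp add: power_divide pos_divide_le_eq mult.commute)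
qed

text \<open>Minkowski's inequality, from convexity of the \<open>q\<close>-th power with weights proportional to the bounds.\<close>

lemma Lq_le_add:
  assumes "Lq_le M q c Y" "Lq_le M q d Z" "1 \<le> q"
  shows "Lq_le M q (c + d) (\<lambda>\<omega>. Y \<omega> + Z \<omega>)"
proof -
  note D = Lq_leD[OF assms(1)] and E = Lq_leD[OF assms(2)]
  note [measurable] = D(2) E(2)
  consider "c = 0" | "d = 0" | "0 < c" "0 < d" using D(1) E(1) by linarith
  then show ?thesis
  proof cases
    case 1
    then have "AE \<omega> in M. Y \<omega> = 0" using assms Lq_le_zero_AE by blast
    then show ?thesis using 1 by (intro Lq_le_mono[OF assms(2)]) auto
  next
    case 2
    then have "AE \<omega> in M. Z \<omega> = 0" using assms Lq_le_zero_AE by blast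
    then show ?thesis using 2 by (intro Lq_le_mono[OF assms(1)]) auto
  next
    case 3
    define a where "a = (c + d) ^ q * (c / (c + d)) * (1 / c) ^ q"
    define b where "b = (c + d) ^ q * (d / (c + d)) * (1 / d) ^ q"
    have ab: "0 \<le> a" "0 \<le> b" using 3 by (auto simp: a_def b_def)
    have "(\<integral>\<^sup>+\<omega>. ennreal (\<bar>Y \<omega> + Z \<omega>\<bar> ^ q) \<partial>M)
        \<le> (\<integral>\<^sup>+\<omega>. ennreal a * ennreal (\<bar>Y \<omega>\<bar> ^ q) + ennreal b * ennreal (\<bar>Z \<omega>\<bar> ^ q) \<partial>M)"
    proof (intro nn_integral_mono)
      fix \<omega>
      have "\<bar>Y \<omega> + Z \<omega>\<bar> ^ q \<le> (\<bar>Y \<omega>\<bar> + \<bar>Z \<omega>\<bar>) ^ q"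
        by (intro power_mono) auto
      also have "\<dots> \<le> a * \<bar>Y \<omega>\<bar> ^ q + b * \<bar>Z \<omega>\<bar> ^ q"
        using power_add_le_weighted[OF 3, of "\<bar>Y \<omega>\<bar>" "\<bar>Z \<omega>\<bar>" q]
        by (simp add: a_def b_def power_divide algebra_simps)
      finally show "ennreal (\<bar>Y \<omega> + Z \<omega>\<bar> ^ q) \<le> ennreal a * ennreal (\<bar>Y \<omega>\<bar> ^ q) + ennreal b * ennreal (\<bar>Z \<omega>\<bar> ^ q)"
        using ab by (simp add: ennreal_leI flip: ennreal_mult ennreal_plus)
    qed
    also have "\<dots> = ennreal a * (\<integral>\<^sup>+\<omega>. ennreal (\<bar>Y \<omega>\<bar> ^ q) \<partial>M) + ennreal b * (\<integral>\<^sup>+\<omega>. ennreal (\<bar>Z \<omega>\<bar> ^ q) \<partial>M)"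
      by (subst nn_integral_add) (auto simp: nn_integral_cmult)
    also have "\<dots> \<le> ennreal a * ennreal (c ^ q) + ennreal b * ennreal (d ^ q)"
      by (intro add_mono mult_left_mono D E) auto
    also have "\<dots> = ennreal (a * c ^ q + b * d ^ q)"
      using ab 3 by (simp add: ennreal_mult)
    also have "a * c ^ q + b * d ^ q = (c + d) ^ q * (c / (c + d) + d / (c + d))"
      using 3 by (simp add: a_def b_def power_divide distrib_left)
    also have "\<dots> = (c + d) ^ q"
      using 3 by (simp flip: add_divide_distrib)
    finally show ?thesis using 3 by (auto simp: Lq_le_def)
  qed
qed

lemma Lq_le_sum:
  assumes "finite I" "1 \<le> q" "\<And>i. i \<in> I \<Longrightarrow> Lq_le M q (c i) (Y i)"
  shows "Lq_le M q (\<Sum>i\<in>I. c i) (\<lambda>\<omega>. \<Sum>i\<in>I. Y i \<omega>)"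
  using assms(1,3)
proof (induction I rule: finite_induct)
  case empty
  then show ?case using assms(2) by (simp add: Lq_le_def power_0_left)
next
  case (insert i I)
  then show ?case using Lq_le_add[of M q "c i" "Y i"] assms(2) by simp
qed

lemma Lq_le_diff:
  assumes "Lq_le M q c Y" "Lq_le M q d Z" "1 \<le> q"
  shows "Lq_le M q (c + d) (\<lambda>\<omega>. Y \<omega> - Z \<omega>)"
  using Lq_le_add[OF assms(1) Lq_le_cmult[OF assms(2), of "-1"] assms(3)] by simp

lemma Lq_le_sum_const:
  assumes "1 \<le> q" "\<And>i. i < n \<Longrightarrow> Lq_le M q c (Y i)"
  shows "Lq_le M q (real n * c) (\<lambda>\<omega>. \<Sum>i<n. Y i \<omega>)"
  using Lq_le_sum[of "{..<n}" q M "\<lambda>_. c" Y] assms by simp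

text \<open>Fatou's lemma. \<open>Z\<close> is only required to be dominated by the limit, so that
  an additive boundary error can be subtracted from the quantity of interest before the limit is
  taken.\<close>

lemma Lq_le_lim:
  assumes Y: "\<And>L. Lq_le M q c (Y L)" and Z: "Z \<in> borel_measurable M"
    and lim: "AE \<omega> in M. \<exists>l. (\<lambda>L. Y L \<omega>) \<longlonglongrightarrow> l \<and> \<bar>Z \<omega>\<bar> \<le> \<bar>l\<bar>"
  shows "Lq_le M q c Z"
proof -
  note [measurable] = Lq_leD(2)[OF Y] Z
  have "(\<integral>\<^sup>+\<omega>. ennreal (\<bar>Z \<omega>\<bar> ^ q) \<partial>M) \<le> (\<integral>\<^sup>+\<omega>. liminf (\<lambda>L. ennreal (\<bar>Y L \<omega>\<bar> ^ q)) \<partial>M)"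
  proof (intro nn_integral_mono_AE, use lim in eventually_elim)
    fix \<omega> assume "\<exists>l. (\<lambda>L. Y L \<omega>) \<longlonglongrightarrow> l \<and> \<bar>Z \<omega>\<bar> \<le> \<bar>l\<bar>"
    then obtain l where l: "(\<lambda>L. Y L \<omega>) \<longlonglongrightarrow> l" "\<bar>Z \<omega>\<bar> \<le> \<bar>l\<bar>" by blast
    have "(\<lambda>L. ennreal (\<bar>Y L \<omega>\<bar> ^ q)) \<longlonglongrightarrow> ennreal (\<bar>l\<bar> ^ q)"
      by (intro tendsto_ennrealI tendsto_power tendsto_rabs l)
    then have "liminf (\<lambda>L. ennreal (\<bar>Y L \<omega>\<bar> ^ q)) = ennreal (\<bar>l\<bar> ^ q)"
      by (intro lim_imp_Liminf) auto
    then show "ennreal (\<bar>Z \<omega>\<bar> ^ q) \<le> liminf (\<lambda>L. ennreal (\<bar>Y L \<omega>\<bar> ^ q))"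
      using l(2) by (simp add: ennreal_leI power_mono)
  qed
  also have "\<dots> \<le> liminf (\<lambda>L. \<integral>\<^sup>+\<omega>. ennreal (\<bar>Y L \<omega>\<bar> ^ q) \<partial>M)"
    by (intro nn_integral_liminf) auto
  also have "\<dots> \<le> ennreal (c ^ q)"
    using Lq_leD(3)[OF Y] by (intro Liminf_le) auto
  finally show ?thesis using Lq_leD(1)[OF Y] Z by (auto simp: Lq_le_def)
qed

lemma Lq_le_inf:
  assumes "\<And>k::nat. Lq_le M q (c + e k) Y" "e \<longlonglongrightarrow> 0"
  shows "Lq_le M q c Y"
proof -
  have lim: "(\<lambda>k. c + e k) \<longlonglongrightarrow> c"
    using tendsto_add[OF tendsto_const assms(2), of c] by simp
  have "0 \<le> c"
    by (rule LIMSEQ_le_const[OF lim]) (use Lq_leD(1)[OF assms(1)] in auto)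
  moreover have "(\<integral>\<^sup>+\<omega>. ennreal (\<bar>Y \<omega>\<bar> ^ q) \<partial>M) \<le> ennreal (c ^ q)"
    by (rule LIMSEQ_le_const[OF tendsto_ennrealI[OF tendsto_power[OF lim]]])
       (use Lq_leD(3)[OF assms(1)] in auto)
  ultimately show ?thesis using Lq_leD(2)[OF assms(1)] by (auto simp: Lq_le_def)
qed

text \<open>A Burkholder-type bound. Expanding \<open>(S + Z)\<^bsup>2m\<^esup>\<close>, the first-order term vanishes by
  orthogonality, so that the \<open>2m\<close>-th moment of the sum grows like \<open>N\<^sup>m\<close>.\<close>

lemma (in prob_space) Lq_le_martingale_sum:
  fixes Z :: "nat \<Rightarrow> 'a \<Rightarrow> real" and F :: "nat \<Rightarrow> 'a measure"
  assumes m: "1 \<le> m" and z: "0 < z"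
    and sub: "\<And>i. i \<le> N \<Longrightarrow> subalgebra M (F i)"
    and mono: "\<And>i j. i \<le> j \<Longrightarrow> j \<le> N \<Longrightarrow> sets (F i) \<subseteq> sets (F j)"
    and meas: "\<And>i. i < N \<Longrightarrow> Z i \<in> borel_measurable (F (Suc i))"
    and bdd: "\<And>i \<omega>. i < N \<Longrightarrow> \<omega> \<in> space M \<Longrightarrow> \<bar>Z i \<omega>\<bar> \<le> A"
    and orth: "\<And>i S Ab. i < N \<Longrightarrow> S \<in> borel_measurable (F i) \<Longrightarrow> (\<And>\<omega>. \<omega> \<in> space M \<Longrightarrow> \<bar>S \<omega>\<bar> \<le> Ab) \<Longrightarrow>
        expectation (\<lambda>\<omega>. S \<omega> * Z i \<omega>) = 0"
    and Lq: "\<And>i. i < N \<Longrightarrow> Lq_le M (2 * m) z (Z i)"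
  shows "Lq_le M (2 * m) (sqrt (3 * 4 ^ m) * sqrt (real N) * z) (\<lambda>\<omega>. \<Sum>i<N. Z i \<omega>)"
proof -
  define C :: real where "C = 4 ^ m"
  have C1: "1 \<le> C" by (simp add: C_def)
  define T where "T k \<omega> = (\<Sum>i<k. Z i \<omega>)" for k \<omega>
  have ZM: "Z i \<in> borel_measurable M" if "i < N" for i
    using measurable_from_subalg[OF sub meas[OF that]] that by simp
  have TF: "T k \<in> borel_measurable (F k)" if "k \<le> N" for k
    unfolding T_def
  proof (intro borel_measurable_sum)
    fix i assume "i \<in> {..<k}"
    then have i: "i < N" "Suc i \<le> k" using that by auto
    have "subalgebra (F k) (F (Suc i))"
      using sub[of k] sub[of "Suc i"] mono[OF i(2) that] i that by (auto simp: subalgebra_def)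
    then show "Z i \<in> borel_measurable (F k)"
      using measurable_from_subalg meas i by blast
  qed
  have TM: "T k \<in> borel_measurable M" if "k \<le> N" for k
    using measurable_from_subalg[OF sub TF] that by simp
  have TB: "\<bar>T k \<omega>\<bar> \<le> real k * A" if "k \<le> N" "\<omega> \<in> space M" for k \<omega>
  proof -
    have "\<bar>T k \<omega>\<bar> \<le> (\<Sum>i<k. \<bar>Z i \<omega>\<bar>)" unfolding T_def by (rule sum_abs)
    also have "\<dots> \<le> (\<Sum>i<k. A)" using that by (intro sum_mono bdd) auto
    finally show ?thesis by simp
  qed
  have int: "integrable M (\<lambda>\<omega>. T k \<omega> ^ a * Z k \<omega> ^ b)" if "k < N" for k a b
  proof (rule integrable_const_bound[where B = "(real k * A) ^ a * A ^ b"])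
    show "AE \<omega> in M. norm (T k \<omega> ^ a * Z k \<omega> ^ b) \<le> (real k * A) ^ a * A ^ b"
    proof (rule AE_I2)
      fix \<omega> assume w: "\<omega> \<in> space M"
      have "0 \<le> A" using bdd[OF that w] by linarith
      then show "norm (T k \<omega> ^ a * Z k \<omega> ^ b) \<le> (real k * A) ^ a * A ^ b"
        using TB[of k \<omega>] bdd[of k \<omega>] that w
        by (auto simp: abs_mult power_abs intro!: mult_mono power_mono)
    qed
  qed (use ZM TM that in \<open>auto intro!: borel_measurable_times borel_measurable_power\<close>)
  have EZ: "expectation (\<lambda>\<omega>. Z i \<omega> ^ (2 * m)) \<le> z ^ (2 * m)" if "i < N" for i
  proof -
    have "ennreal (expectation (\<lambda>\<omega>. Z i \<omega> ^ (2 * m))) = (\<integral>\<^sup>+\<omega>. ennreal (Z i \<omega> ^ (2 * m)) \<partial>M)"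
      using int[OF that, of 0 "2 * m"] by (intro nn_integral_eq_integral[symmetric]) auto
    also have "\<dots> \<le> ennreal (z ^ (2 * m))"
      using Lq_leD(3)[OF Lq[OF that]] by (simp add: power_even_abs)
    finally show ?thesis using z by (simp add: ennreal_le_iff)
  qed
  \<comment> \<open>The 3 collects two from the mixed moment and one from the pure power z^(2m).
    With it the induction step reads a^m + D z^2 a^(m-1) \<le> (a + D z^2)^m, and adding D z^2 to a
    = D k z^2 gives the next value.\<close>
  define D where "D = 3 * C"
  have D1: "1 \<le> D" using C1 by (simp add: D_def)
  have main: "k \<le> N \<Longrightarrow> expectation (\<lambda>\<omega>. T k \<omega> ^ (2 * m)) \<le> (D * real k * z\<^sup>2) ^ m" for k
  proof (induction k)
    case 0
    then show ?case using m by (simp add: T_def power_0_left)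
  next
    case (Suc k)
    then have k: "k < N" by simp
    show ?case
    proof (cases "k = 0")
      case True
      have "expectation (\<lambda>\<omega>. T (Suc k) \<omega> ^ (2 * m)) \<le> z ^ (2 * m)"
        using EZ[of 0] k True by (simp add: T_def)
      also have "\<dots> \<le> (D * real (Suc k) * z\<^sup>2) ^ m"
        unfolding power_mult using True D1 z by (intro power_mono) auto
      finally show ?thesis .
    next
      case False
      define a where "a = D * real k * z\<^sup>2"
      have a: "0 < a" using False z D1 by (simp add: a_def)
      have IH: "expectation (\<lambda>\<omega>. T k \<omega> ^ (2 * m)) \<le> a ^ m"
        using Suc k by (simp add: a_def)
      \<comment> \<open>Hoelder's inequality for the mixed moment is replaced by u^(m-1) v \<le> u^m
        + v^m with u, v normalised by the known bounds; after integration each quotient on the right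
        is at most 1. The normalisation divides by a, which is why k = 0 is treated
        separately.\<close>
      have e1: "x ^ (2 * m - 2) * y\<^sup>2 \<le> a ^ (m - 1) * z\<^sup>2 * (x ^ (2 * m) / a ^ m + y ^ (2 * m) / z ^ (2 * m))" for x y :: real
      proof -
        define u where "u = x\<^sup>2 / a"
        define v where "v = y\<^sup>2 / z\<^sup>2"
        have uv: "0 \<le> u" "0 \<le> v" using a z by (auto simp: u_def v_def)
        have "u ^ (m - 1) * v \<le> u ^ m + v ^ m"
        proof (cases "v \<le> u")
          case True
          have "u ^ (m - 1) * v \<le> u ^ (m - 1) * u" using True uv by (intro mult_left_mono) auto
          also have "\<dots> = u ^ m" using m by (metis power_minus_mult le_zero_eq not_one_le_zero neq0_conv)
          finally show ?thesis using uv by (smt (verit) zero_le_power)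
        next
          case False
          have "u ^ (m - 1) * v \<le> v ^ (m - 1) * v" using False uv by (intro mult_right_mono power_mono) auto
          also have "\<dots> = v ^ m" using m by (metis power_minus_mult le_zero_eq not_one_le_zero neq0_conv)
          finally show ?thesis using uv by (smt (verit) zero_le_power)
        qed
        moreover have "x ^ (2 * m - 2) * y\<^sup>2 = a ^ (m - 1) * z\<^sup>2 * (u ^ (m - 1) * v)"
        proof -
          have "x ^ (2 * m - 2) = (x\<^sup>2) ^ (m - 1)"
            unfolding power_mult[symmetric] using m by (simp add: diff_mult_distrib2)
          then show ?thesis using a z by (simp add: u_def v_def power_divide)
        qed
        moreover have "u ^ m = x ^ (2 * m) / a ^ m" "v ^ m = y ^ (2 * m) / z ^ (2 * m)"
          by (simp_all add: u_def v_def power_divide power_mult)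
        ultimately show ?thesis using a z by (simp add: mult_left_mono)
      qed
      have "expectation (\<lambda>\<omega>. T k \<omega> ^ (2 * m - 2) * Z k \<omega> ^ 2)
          \<le> expectation (\<lambda>\<omega>. a ^ (m - 1) * z\<^sup>2 * (T k \<omega> ^ (2 * m) / a ^ m + Z k \<omega> ^ (2 * m) / z ^ (2 * m)))"
        using int[OF k, of "2 * m" 0] int[OF k, of 0 "2 * m"] int[OF k, of "2*m-2" 2]
        by (intro integral_mono integrable_mult_right Bochner_Integration.integrable_add integrable_divide e1) auto
      also have "\<dots> = a ^ (m - 1) * z\<^sup>2 * (expectation (\<lambda>\<omega>. T k \<omega> ^ (2 * m)) / a ^ m + expectation (\<lambda>\<omega>. Z k \<omega> ^ (2 * m)) / z ^ (2 * m))"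
        using int[OF k, of "2 * m" 0] int[OF k, of 0 "2 * m"] by simp
      also have "\<dots> \<le> a ^ (m - 1) * z\<^sup>2 * (1 + 1)"
        using IH EZ[OF k] a z by (intro mult_left_mono add_mono) (auto simp: divide_le_eq_1)
      finally have mixed: "expectation (\<lambda>\<omega>. T k \<omega> ^ (2 * m - 2) * Z k \<omega> ^ 2) \<le> 2 * a ^ (m - 1) * z\<^sup>2" by simp
      have orth': "expectation (\<lambda>\<omega>. T k \<omega> ^ (2 * m - 1) * Z k \<omega>) = 0"
        by (rule orth[of k "\<lambda>\<omega>. T k \<omega> ^ (2 * m - 1)" "(real k * A) ^ (2 * m - 1)", OF k])
           (use TF[of k] TB[of k] k in \<open>auto simp: power_abs intro!: borel_measurable_power power_mono\<close>)
      have "expectation (\<lambda>\<omega>. T (Suc k) \<omega> ^ (2 * m))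
          \<le> expectation (\<lambda>\<omega>. T k \<omega> ^ (2 * m) + real (2 * m) * (T k \<omega> ^ (2 * m - 1) * Z k \<omega>)
             + C * (T k \<omega> ^ (2 * m - 2) * Z k \<omega> ^ 2 + Z k \<omega> ^ (2 * m)))"
      proof (intro integral_mono)
        show "integrable M (\<lambda>\<omega>. T k \<omega> ^ (2 * m) + real (2 * m) * (T k \<omega> ^ (2 * m - 1) * Z k \<omega>)
             + C * (T k \<omega> ^ (2 * m - 2) * Z k \<omega> ^ 2 + Z k \<omega> ^ (2 * m)))"
          using int[OF k, of "2 * m" 0] int[OF k, of 0 "2 * m"] int[OF k, of "2*m-2" 2] int[OF k, of "2*m-1" 1]
          by (intro Bochner_Integration.integrable_add integrable_mult_right) auto
        show "T (Suc k) \<omega> ^ (2 * m) \<le> T k \<omega> ^ (2 * m) + real (2 * m) * (T k \<omega> ^ (2 * m - 1) * Z k \<omega>)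
             + C * (T k \<omega> ^ (2 * m - 2) * Z k \<omega> ^ 2 + Z k \<omega> ^ (2 * m))" for \<omega>
          using power_add_le_two_sided[OF m, of "T k \<omega>" "Z k \<omega>"] by (simp add: T_def C_def mult.assoc)
        show "integrable M (\<lambda>\<omega>. T (Suc k) \<omega> ^ (2 * m))"
          by (rule integrable_const_bound[where B = "(real (Suc k) * A) ^ (2 * m)"])
             (use TB[of "Suc k"] TM[of "Suc k"] k in \<open>auto simp: power_abs intro!: power_mono AE_I2\<close>)
      qed
      also have "\<dots> = expectation (\<lambda>\<omega>. T k \<omega> ^ (2 * m))
             + C * (expectation (\<lambda>\<omega>. T k \<omega> ^ (2 * m - 2) * Z k \<omega> ^ 2) + expectation (\<lambda>\<omega>. Z k \<omega> ^ (2 * m)))"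
        using int[OF k, of "2 * m" 0] int[OF k, of 0 "2 * m"] int[OF k, of "2*m-2" 2] int[OF k, of "2*m-1" 1] orth'
        by simp
      also have "\<dots> \<le> a ^ m + C * (2 * a ^ (m - 1) * z\<^sup>2 + z ^ (2 * m))"
        using IH mixed EZ[OF k] C1 by (intro add_mono mult_left_mono) auto
      also have "z ^ (2 * m) \<le> a ^ (m - 1) * z\<^sup>2"
      proof -
        have "1 * 1 \<le> D * real k"
          using False D1 by (intro mult_mono) auto
        then have "1 * z\<^sup>2 \<le> a" unfolding a_def by (intro mult_right_mono) auto
        then have "(z\<^sup>2) ^ (m - 1) * z\<^sup>2 \<le> a ^ (m - 1) * z\<^sup>2"
          by (intro mult_right_mono power_mono) auto
        moreover have "z ^ (2 * m) = (z\<^sup>2) ^ (m - 1) * z\<^sup>2"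
          using m by (metis power_minus_mult power_mult less_le_trans zero_less_one)
        ultimately show ?thesis by simp
      qed
      also have "a ^ m + C * (2 * a ^ (m - 1) * z\<^sup>2 + a ^ (m - 1) * z\<^sup>2) = a ^ m + a ^ (m - 1) * (D * z\<^sup>2)"
        by (simp add: D_def algebra_simps)
      also have "\<dots> = a ^ (m - 1) * (a + D * z\<^sup>2)"
        using m power_minus_mult[of m a] by (simp add: algebra_simps)
      also have "\<dots> \<le> (a + D * z\<^sup>2) ^ (m - 1) * (a + D * z\<^sup>2)"
        using a D1 by (intro mult_right_mono power_mono) auto
      also have "\<dots> = (a + D * z\<^sup>2) ^ m"
        using m power_minus_mult[of m "a + D * z\<^sup>2"] by simp
      also have "a + D * z\<^sup>2 = D * real (Suc k) * z\<^sup>2"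
        by (simp add: a_def algebra_simps)
      finally show ?thesis using C1 by (simp add: add_mono mult_left_mono)
    qed
  qed
  have "(\<integral>\<^sup>+\<omega>. ennreal (\<bar>T N \<omega>\<bar> ^ (2 * m)) \<partial>M) = ennreal (expectation (\<lambda>\<omega>. T N \<omega> ^ (2 * m)))"
    unfolding power_even_abs[OF dvd_triv_left]
  proof (intro nn_integral_eq_integral)
    show "integrable M (\<lambda>\<omega>. T N \<omega> ^ (2 * m))"
      by (rule integrable_const_bound[where B = "(real N * A) ^ (2 * m)"])
         (use TB[of N] TM[of N] in \<open>auto simp: power_abs intro!: power_mono AE_I2\<close>)
  qed simp
  also have "\<dots> \<le> ennreal ((D * real N * z\<^sup>2) ^ m)"
    by (intro ennreal_leI main) simp
  also have "(D * real N * z\<^sup>2) ^ m = (sqrt (3 * 4 ^ m) * sqrt (real N) * z) ^ (2 * m)"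
    by (simp add: power_mult power_mult_distrib D_def C_def)
  finally show ?thesis
    using TM[of N] z by (auto simp: Lq_le_def T_def[abs_def])
qed

section \<open>The heat semigroup\<close>

definition gauss_density :: "real^'d \<Rightarrow> real" where
  "gauss_density z = (\<Prod>i\<in>UNIV. std_normal_density (z $ i))"

definition gauss :: "(real^'d) measure" where
  "gauss = density lborel (\<lambda>z. ennreal (gauss_density z))"

text \<open>The semigroup of half the Laplacian at time \<open>r\<close>, as an average over one
  fixed Gaussian vector scaled by sqrt r. All times share the same measure, which couples different
  times for free.\<close>

definition heat :: "real \<Rightarrow> (real^'d \<Rightarrow> real) \<Rightarrow> real^'d \<Rightarrow> real" where
  "heat r g x = (\<integral>z. g (x + sqrt r *\<^sub>R z) \<partial>gauss)"

lemma gauss_density_nonneg: "0 \<le> gauss_density z"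
  by (auto simp: gauss_density_def intro!: prod_nonneg)

lemma gauss_density_eq:
  fixes z :: "real^'d"
  shows "gauss_density z = (1 / sqrt (2 * pi)) ^ CARD('d) * exp (- (norm z)\<^sup>2 / 2)"
proof -
  have "gauss_density z = (\<Prod>i\<in>UNIV. (1 / sqrt (2 * pi)) * exp (- (z $ i)\<^sup>2 / 2))"
    by (simp add: gauss_density_def std_normal_density_def)
  also have "\<dots> = (1 / sqrt (2 * pi)) ^ CARD('d) * exp (\<Sum>i\<in>UNIV. - (z $ i)\<^sup>2 / 2)"
    by (simp only: prod.distrib prod_constant exp_sum[OF finite])
  also have "(\<Sum>i\<in>UNIV. - (z $ i)\<^sup>2 / 2) = - (norm z)\<^sup>2 / 2"
    by (simp add: norm_vec_def L2_set_def sum_nonneg sum_negf flip: sum_divide_distrib)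
  finally show ?thesis .
qed

lemma gauss_density_measurable [measurable]: "gauss_density \<in> borel_measurable borel"
  unfolding gauss_density_eq[abs_def] by measurable

lemma sets_gauss [simp, measurable_cong]: "sets gauss = sets borel"
  by (simp add: gauss_def)

lemma space_gauss [simp]: "space gauss = UNIV"
  by (simp add: gauss_def)

text \<open>Independence of the coordinates of the Gaussian vector, from the product structure of
  Lebesgue measure. It gives total mass one, and later identifies the law of a Brownian increment on
  orthants.\<close>

lemma nn_integral_gauss_prod:
  fixes f :: "'d::finite \<Rightarrow> real \<Rightarrow> ennreal"
  assumes [measurable]: "\<And>i. f i \<in> borel_measurable borel"
  shows "(\<integral>\<^sup>+z. (\<Prod>i\<in>UNIV. f i ((z::real^'d) $ i)) \<partial>gauss) =
    (\<Prod>i\<in>UNIV. (\<integral>\<^sup>+x. f i x \<partial>density lborel (\<lambda>x. ennreal (std_normal_density x))))"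
proof -
  define g where "g b x = f (axis_index b) x * ennreal (std_normal_density x)" for b :: "real^'d" and x
  have B: "(Basis :: (real^'d) set) = (\<lambda>i. axis i 1) ` UNIV"
    by (auto simp: Basis_vec_def)
  have inj: "inj (\<lambda>i::'d. axis i (1::real))"
    by (auto simp: inj_on_def axis_eq_axis)
  have [simp]: "axis_index (axis i (1::real) :: real^'d) = i" for i :: 'd
    by (auto simp: axis_index_def axis_eq_axis)
  have "(\<integral>\<^sup>+z. (\<Prod>i\<in>UNIV. f i ((z::real^'d) $ i)) \<partial>gauss)
      = (\<integral>\<^sup>+z. ennreal (gauss_density z) * (\<Prod>i\<in>UNIV. f i (z $ i)) \<partial>lborel)"
    unfolding gauss_def by (subst nn_integral_density) auto
  also have "\<dots> = (\<integral>\<^sup>+z. (\<Prod>b\<in>Basis. g b (z \<bullet> b)) \<partial>lborel)"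
    unfolding B by (subst prod.reindex[OF inj])
      (simp add: g_def inner_axis gauss_density_def prod.distrib prod_ennreal mult.commute flip: prod_ennreal)
  also have "\<dots> = (\<Prod>b\<in>Basis. (\<integral>\<^sup>+x. g b x \<partial>lborel))"
    by (intro nn_integral_lborel_prod) (auto simp: g_def)
  also have "\<dots> = (\<Prod>i\<in>UNIV. (\<integral>\<^sup>+x. f i x \<partial>density lborel (\<lambda>x. ennreal (std_normal_density x))))"
    unfolding B by (subst prod.reindex[OF inj]) (simp add: g_def[abs_def] nn_integral_density mult.commute)
  finally show ?thesis .
qed

lemma prob_space_gauss: "prob_space (gauss :: (real^'d) measure)"
proof
  interpret N: prob_space "density lborel (\<lambda>x. ennreal (std_normal_density x))"
    by (rule prob_space_normal_density) simp
  have "emeasure (gauss :: (real^'d) measure) (space gauss) = (\<integral>\<^sup>+z. (\<Prod>i\<in>UNIV. (\<lambda>_ _. 1) i ((z::real^'d) $ i)) \<partial>gauss)"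
    by simp
  also have "\<dots> = 1"
    by (subst nn_integral_gauss_prod) (auto simp: N.emeasure_space_1[simplified])
  finally show "emeasure (gauss :: (real^'d) measure) (space gauss) = 1" .
qed

interpretation gauss: prob_space "gauss :: (real^'d) measure"
  by (rule prob_space_gauss)

text \<open>This symmetry cancels the first-order term when the heat flow is expanded in time,
  leaving a second difference in space.\<close>

lemma gauss_reflect: "distr gauss borel uminus = (gauss :: (real^'d) measure)"
proof (rule measure_eqI)
  fix A :: "(real^'d) set" assume "A \<in> sets (distr gauss borel uminus)"
  then have [measurable]: "A \<in> sets borel" by simp
  have L: "distr lborel borel uminus = (lborel :: (real^'d) measure)"
    using lborel_affine[of "-1" "0 :: real^'d"] by (simp add: density_1 cong: distr_cong)
  have "emeasure (distr gauss borel uminus) A = (\<integral>\<^sup>+z. ennreal (gauss_density z) * indicator A (- z) \<partial>lborel)"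
    by (subst nn_integral_indicator[symmetric], simp, subst nn_integral_distr) (auto simp: gauss_def nn_integral_density)
  also have "\<dots> = (\<integral>\<^sup>+z. ennreal (gauss_density (- (- z))) * indicator A (- z) \<partial>lborel)"
    by simp
  also have "\<dots> = (\<integral>\<^sup>+z. ennreal (gauss_density (- z)) * indicator A z \<partial>distr lborel borel uminus)"
    by (subst nn_integral_distr) auto
  also have "\<dots> = emeasure gauss A"
    unfolding L by (simp add: gauss_def emeasure_density gauss_density_eq)
  finally show "emeasure (distr gauss borel uminus) A = emeasure gauss A" .
qed simp

text \<open>The Cameron-Martin density of the standard Gaussian measure translated by \<open>b\<close>.\<close>

definition cm_density :: "real^'d \<Rightarrow> real^'d \<Rightarrow> real" where
  "cm_density b z = exp (b \<bullet> z - (norm b)\<^sup>2 / 2)"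

lemma cm_density_nonneg: "0 \<le> cm_density b z"
  by (simp add: cm_density_def)

lemma cm_density_measurable [measurable]: "cm_density b \<in> borel_measurable borel"
  unfolding cm_density_def[abs_def] by measurable

text \<open>Completing the square in the exponent. A shift of the argument of g is traded for a
  weight, so that increments of \<open>heat r g\<close> can be bounded by the supremum of |g|
  alone.\<close>

lemma gauss_translate:
  fixes b :: "real^'d"
  shows "distr gauss borel (\<lambda>z. b + z) = density gauss (\<lambda>z. ennreal (cm_density b z))"
proof (rule measure_eqI)
  fix A :: "(real^'d) set" assume "A \<in> sets (distr gauss borel (\<lambda>z. b + z))"
  then have [measurable]: "A \<in> sets borel" by simp
  have e: "gauss_density (z - b) = gauss_density z * cm_density b z" for z :: "real^'d"
  proof -
    have "(norm (z - b))\<^sup>2 = (norm z)\<^sup>2 - 2 * (b \<bullet> z) + (norm b)\<^sup>2"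
      by (simp add: power2_norm_eq_inner inner_diff_left inner_diff_right inner_commute)
    then show ?thesis
      by (simp add: gauss_density_eq cm_density_def mult.assoc diff_divide_distrib add_divide_distrib flip: exp_add)
  qed
  have "emeasure (distr gauss borel (\<lambda>z. b + z)) A = (\<integral>\<^sup>+z. ennreal (gauss_density z) * indicator A (b + z) \<partial>lborel)"
    by (subst nn_integral_indicator[symmetric], simp, subst nn_integral_distr) (auto simp: gauss_def nn_integral_density)
  also have "\<dots> = (\<integral>\<^sup>+z. ennreal (gauss_density ((b + z) - b)) * indicator A (b + z) \<partial>lborel)"
    by simp
  also have "\<dots> = (\<integral>\<^sup>+z. ennreal (gauss_density (z - b)) * indicator A z \<partial>distr lborel borel ((+) b))"
    by (subst nn_integral_distr) auto
  also have "\<dots> = (\<integral>\<^sup>+z. ennreal (gauss_density z) * (ennreal (cm_density b z) * indicator A z) \<partial>lborel)"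
    unfolding lborel_distr_plus e
    by (simp add: ennreal_mult gauss_density_nonneg cm_density_def mult.assoc)
  also have "\<dots> = emeasure (density gauss (\<lambda>z. ennreal (cm_density b z))) A"
    unfolding gauss_def by (simp add: emeasure_density nn_integral_density)
  finally show "emeasure (distr gauss borel (\<lambda>z. b + z)) A = emeasure (density gauss (\<lambda>z. ennreal (cm_density b z))) A" .
qed simp

lemma has_integral_cm_density: "has_bochner_integral gauss (cm_density b) 1"
proof (rule has_bochner_integral_nn_integral)
  have "(\<integral>\<^sup>+z. ennreal (cm_density b z) \<partial>gauss) = emeasure (density gauss (\<lambda>z. ennreal (cm_density b z))) UNIV"
    by (simp add: emeasure_density)
  also have "\<dots> = emeasure (distr gauss borel (\<lambda>z. b + z)) UNIV"
    by (simp add: gauss_translate)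
  also have "\<dots> = 1"
    using gauss.emeasure_space_1 by (simp add: emeasure_distr)
  finally show "(\<integral>\<^sup>+z. ennreal (cm_density b z) \<partial>gauss) = ennreal 1" by simp
qed (auto simp: cm_density_def)

text \<open>The second moment of the density minus 1 is exp(|b|^2) - 1, at most 2 |b|^2 for |b|
  \<le> 1; the first moment follows as in Cauchy-Schwarz.\<close>

lemma cm_density_L1:
  fixes b :: "real^'d"
  assumes "norm b \<le> 1"
  shows "integrable gauss (\<lambda>z. \<bar>cm_density b z - 1\<bar>)" "(\<integral>z. \<bar>cm_density b z - 1\<bar> \<partial>gauss) \<le> 2 * norm b"
proof -
  note 1 = has_integral_cm_density[of b, unfolded has_bochner_integral_iff]
  note 2 = has_integral_cm_density[of "2 *\<^sub>R b", unfolded has_bochner_integral_iff]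
  show int: "integrable gauss (\<lambda>z. \<bar>cm_density b z - 1\<bar>)"
    using 1 by auto
  define E where "E = exp ((norm b)\<^sup>2)"
  \<comment> \<open>The square of the density for b is exp(|b|^2) times the density for 2b, whose
    integral is again 1.\<close>
  have sq: "(cm_density b z - 1)\<^sup>2 = E * cm_density (2 *\<^sub>R b) z - 2 * cm_density b z + 1" for z
  proof -
    have "(cm_density b z)\<^sup>2 = exp (2 * (b \<bullet> z - (norm b)\<^sup>2 / 2))"
      unfolding cm_density_def by (metis exp_double)
    also have "2 * (b \<bullet> z - (norm b)\<^sup>2 / 2) = (norm b)\<^sup>2 + ((2 *\<^sub>R b) \<bullet> z - (norm (2 *\<^sub>R b))\<^sup>2 / 2)"
      by (simp add: power_mult_distrib)
    also have "exp \<dots> = E * cm_density (2 *\<^sub>R b) z"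
      unfolding E_def cm_density_def by (rule exp_add)
    finally show ?thesis by (simp add: power2_diff)
  qed
  have intsq: "integrable gauss (\<lambda>z. (cm_density b z - 1)\<^sup>2)"
    unfolding sq using 1 2 by (intro Bochner_Integration.integrable_add Bochner_Integration.integrable_diff) auto
  have "(\<integral>z. (cm_density b z - 1)\<^sup>2 \<partial>gauss) = E * 1 - 2 * 1 + 1"
    unfolding sq using 1 2 gauss.prob_space[where 'd='d] by simp
  also have "\<dots> \<le> 2 * (norm b)\<^sup>2"
  proof -
    have "(norm b)\<^sup>2 \<le> 1" using assms by (simp add: power_le_one)
    then have "E \<le> 1 + (norm b)\<^sup>2 + ((norm b)\<^sup>2)\<^sup>2" "((norm b)\<^sup>2)\<^sup>2 \<le> (norm b)\<^sup>2"
      unfolding E_def using exp_bound[of "(norm b)\<^sup>2"] mult_left_le[of "(norm b)\<^sup>2" "(norm b)\<^sup>2"]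
      by (simp_all flip: power2_eq_square)
    then show ?thesis by simp
  qed
  finally have sqle: "(\<integral>z. (cm_density b z - 1)\<^sup>2 \<partial>gauss) \<le> 2 * (norm b)\<^sup>2" .
  show "(\<integral>z. \<bar>cm_density b z - 1\<bar> \<partial>gauss) \<le> 2 * norm b"
  proof (cases "b = 0")
    case True
    then show ?thesis by (simp add: cm_density_def)
  next
    case False
    then have b: "0 < norm b" by simp
    \<comment> \<open>AM-GM at the scale |b| of the expected answer, in place of the Cauchy-Schwarz
      inequality.\<close>
    have am: "\<bar>y\<bar> \<le> (y\<^sup>2 / norm b + norm b) / 2" for y :: real
    proof -
      have "0 \<le> (\<bar>y\<bar> - norm b)\<^sup>2" by simp
      then have "2 * (\<bar>y\<bar> * norm b) \<le> y\<^sup>2 + norm b * norm b"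
        unfolding power2_diff by (simp add: power2_eq_square)
      then show ?thesis using b by (simp add: field_simps)
    qed
    have "(\<integral>z. \<bar>cm_density b z - 1\<bar> \<partial>gauss) \<le> (\<integral>z. ((cm_density b z - 1)\<^sup>2 / norm b + norm b) / 2 \<partial>gauss)"
      using int intsq by (intro integral_mono am) auto
    also have "\<dots> = ((\<integral>z. (cm_density b z - 1)\<^sup>2 \<partial>gauss) / norm b + norm b) / 2"
      using intsq gauss.prob_space[where 'd='d] by simp
    also have "\<dots> \<le> ((2 * (norm b)\<^sup>2) / norm b + norm b) / 2"
      using sqle b by (intro divide_right_mono add_right_mono) auto
    also have "\<dots> = 3 / 2 * norm b" using b by (simp add: power2_eq_square)
    finally show ?thesis using b by linarith
  qed
qed

section \<open>Heat operators on bounded continuous functions\<close>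

definition bcont :: "(real^'d \<Rightarrow> real) \<Rightarrow> bool" where
  "bcont g \<longleftrightarrow> continuous_on UNIV g \<and> (\<exists>A. \<forall>x. \<bar>g x\<bar> \<le> A)"

lemma bcont_measurable: "bcont g \<Longrightarrow> g \<in> borel_measurable borel"
  by (auto simp: bcont_def intro: borel_measurable_continuous_onI)

lemma bcont_add: "bcont g \<Longrightarrow> bcont h \<Longrightarrow> bcont (\<lambda>x. g x + h x)"
  unfolding bcont_def
  by (auto intro!: continuous_intros) (metis abs_triangle_ineq add_mono order_trans)

lemma bcont_cmult: "bcont g \<Longrightarrow> bcont (\<lambda>x. c * g x)"
  unfolding bcont_def
  by (auto intro!: continuous_intros simp: abs_mult) (metis abs_ge_zero mult_left_mono)

lemma bcont_diff: "bcont g \<Longrightarrow> bcont h \<Longrightarrow> bcont (\<lambda>x. g x - h x)"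
  using bcont_add[of g "\<lambda>x. -1 * h x"] bcont_cmult[of h "-1"] by simp

lemma bcont_sum: "finite I \<Longrightarrow> (\<And>i. i \<in> I \<Longrightarrow> bcont (g i)) \<Longrightarrow> bcont (\<lambda>x. \<Sum>i\<in>I. g i x)"
proof (induction I rule: finite_induct)
  case empty
  then show ?case by (auto simp: bcont_def)
next
  case (insert i I)
  then show ?case using bcont_add[of "g i"] by simp
qed

lemma bcont_translate: "bcont g \<Longrightarrow> bcont (\<lambda>x. g (x + a))"
  unfolding bcont_def
  by (auto intro!: continuous_on_compose2[of UNIV g] continuous_intros)

lemma integrable_heat:
  assumes "bcont g"
  shows "integrable gauss (\<lambda>z. g (x + c *\<^sub>R z))"
proof -
  note [measurable] = bcont_measurable[OF assms]
  from assms obtain A where "\<And>x. \<bar>g x\<bar> \<le> A" by (auto simp: bcont_def)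
  then show ?thesis by (intro gauss.integrable_const_bound[where B = A]) auto
qed

lemma heat_bound:
  fixes g :: "real^'d \<Rightarrow> real"
  assumes "bcont g" "\<And>x. \<bar>g x\<bar> \<le> A"
  shows "\<bar>heat r g x\<bar> \<le> A"
proof -
  have "\<bar>heat r g x\<bar> \<le> (\<integral>z. \<bar>g (x + sqrt r *\<^sub>R z)\<bar> \<partial>gauss)"
    unfolding heat_def by (rule integral_abs_bound)
  also have "\<dots> \<le> (\<integral>z. A \<partial>(gauss :: (real^'d) measure))"
    using integrable_heat[OF assms(1)] assms(2) by (intro integral_mono) auto
  also have "\<dots> = A" using gauss.prob_space[where 'd='d] by simp
  finally show ?thesis .
qed

lemma bcont_heat:
  fixes g :: "real^'d \<Rightarrow> real"
  assumes "bcont g"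
  shows "bcont (heat r g)"
proof -
  note [measurable] = bcont_measurable[OF assms]
  from assms obtain A where A: "\<And>x. \<bar>g x\<bar> \<le> A" by (auto simp: bcont_def)
  have "isCont (heat r g) x" for x
    unfolding continuous_at_sequentially comp_def
  proof safe
    fix u assume u: "u \<longlonglongrightarrow> x"
    have g: "isCont g y" for y using assms by (auto simp: bcont_def continuous_on_eq_continuous_at)
    show "(\<lambda>n. heat r g (u n)) \<longlonglongrightarrow> heat r g x"
      unfolding heat_def
    proof (rule integral_dominated_convergence[where w = "\<lambda>_. A"])
      show "AE z in gauss. (\<lambda>n. g (u n + sqrt r *\<^sub>R z)) \<longlonglongrightarrow> g (x + sqrt r *\<^sub>R z)"
        by (intro AE_I2 isCont_tendsto_compose[OF g] tendsto_intros u)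
    qed (use A in auto)
  qed
  then show ?thesis
    using heat_bound[OF assms A] by (auto simp: bcont_def continuous_on_eq_continuous_at)
qed

lemma heat_diff: "bcont g \<Longrightarrow> bcont h \<Longrightarrow> heat r (\<lambda>x. g x - h x) x = heat r g x - heat r h x"
  unfolding heat_def by (intro Bochner_Integration.integral_diff integrable_heat)

lemma heat_cmult: "heat r (\<lambda>x. c * g x) x = c * heat r g x"
  unfolding heat_def by simp

lemma heat_sum: "(\<And>i. i \<in> I \<Longrightarrow> bcont (g i)) \<Longrightarrow> heat r (\<lambda>x. \<Sum>i\<in>I. g i x) x = (\<Sum>i\<in>I. heat r (g i) x)"
  unfolding heat_def by (intro Bochner_Integration.integral_sum integrable_heat)

lemma heat_translate: "heat r (\<lambda>x. g (x + a)) x = heat r g (x + a)"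
  by (simp add: heat_def add_ac)

lemma heat_0 [simp]: "heat 0 g = g"
  using gauss.prob_space by (auto simp: heat_def)

lemma heat_contraction:
  assumes "bcont g" "bcont h" "\<And>x. \<bar>g x - h x\<bar> \<le> A"
  shows "\<bar>heat r g x - heat r h x\<bar> \<le> A"
  using heat_bound[OF bcont_diff[OF assms(1,2)] assms(3), of r x] heat_diff[OF assms(1,2), of r x] by simp

text \<open>The heat operator commutes with translations and contracts the supremum norm, so a
  modulus of continuity of g is inherited by \<open>heat r g\<close>.\<close>

lemma heat_osc_le:
  assumes "bcont g" "\<And>x. \<bar>g (x + a) - g x\<bar> \<le> A"
  shows "\<bar>heat r g (x + a) - heat r g x\<bar> \<le> A"
  using heat_contraction[OF bcont_translate[OF assms(1)] assms(1,2)] by (simp add: heat_translate)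

text \<open>The gradient bound of order A / sqrt r, in difference form. If |x - y| \<le> sqrt r, the
  shift is absorbed into the Cameron-Martin weight, which is L1-close to 1; for more distant points
  the trivial bound 2A is already smaller.\<close>

lemma heat_lipschitz:
  assumes g: "bcont g" and A: "\<And>x. \<bar>g x\<bar> \<le> A" and r: "0 < r"
  shows "\<bar>heat r g x - heat r g y\<bar> \<le> 2 * A / sqrt r * norm (x - y)"
proof -
  note [measurable] = bcont_measurable[OF g]
  \<comment> \<open>The displacement in units of the Gaussian: x + sqrt r z = y + sqrt r (b +
    z).\<close>
  define b where "b = (1 / sqrt r) *\<^sub>R (x - y)"
  have nb: "norm b = norm (x - y) / sqrt r" using r by (simp add: b_def)
  have A0: "0 \<le> A" using A[of 0] by linarith
  have hy: "\<bar>heat r g u\<bar> \<le> A" for u by (rule heat_bound[OF g A])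
  show ?thesis
  proof (cases "norm b \<le> 1")
    case False
    have "\<bar>heat r g x - heat r g y\<bar> \<le> 2 * A" using hy[of x] hy[of y] by linarith
    also have "\<dots> \<le> 2 * A * norm b" using False A0 mult_left_mono[of 1 "norm b" "2 * A"] by simp
    finally show ?thesis by (simp add: nb)
  next
    case True
    let ?k = "\<lambda>z. g (y + sqrt r *\<^sub>R z)"
    have "heat r g x = (\<integral>z. ?k (b + z) \<partial>gauss)"
      using r by (simp add: heat_def b_def scaleR_add_right add.assoc[symmetric])
    also have "\<dots> = (\<integral>z. ?k z \<partial>distr gauss borel (\<lambda>z. b + z))"
      by (subst integral_distr) auto
    also have "\<dots> = (\<integral>z. cm_density b z * ?k z \<partial>gauss)"
      unfolding gauss_translate
      by (subst integral_density) (auto simp: cm_density_def)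
    finally have hx: "heat r g x = (\<integral>z. cm_density b z * ?k z \<partial>gauss)" .
    have i1: "integrable gauss (\<lambda>z. cm_density b z * ?k z)"
    proof (rule Bochner_Integration.integrable_bound)
      show "integrable gauss (\<lambda>z. A * cm_density b z)"
        using has_integral_cm_density[of b] by (auto simp: has_bochner_integral_iff)
      show "AE z in gauss. norm (cm_density b z * ?k z) \<le> norm (A * cm_density b z)"
        using A A0 by (auto simp: abs_mult cm_density_def mult.commute intro!: mult_right_mono)
    qed simp
    have "heat r g x - heat r g y = (\<integral>z. (cm_density b z - 1) * ?k z \<partial>gauss)"
      unfolding hx unfolding heat_def using i1 integrable_heat[OF g, of y "sqrt r"]
      by (simp add: left_diff_distrib)
    also have "\<bar>\<dots>\<bar> \<le> (\<integral>z. \<bar>(cm_density b z - 1) * ?k z\<bar> \<partial>gauss)"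
      by (rule integral_abs_bound)
    also have "\<dots> \<le> (\<integral>z. A * \<bar>cm_density b z - 1\<bar> \<partial>gauss)"
    proof (intro integral_mono)
      show "integrable gauss (\<lambda>z. A * \<bar>cm_density b z - 1\<bar>)"
        using cm_density_L1(1)[OF True] by simp
      show "integrable gauss (\<lambda>z. \<bar>(cm_density b z - 1) * ?k z\<bar>)"
        using i1 integrable_heat[OF g, of y "sqrt r"] by (simp add: left_diff_distrib)
      show "\<bar>(cm_density b z - 1) * ?k z\<bar> \<le> A * \<bar>cm_density b z - 1\<bar>" for z
        using mult_left_mono[OF A[of "y + sqrt r *\<^sub>R z"], of "\<bar>cm_density b z - 1\<bar>"] by (simp add: abs_mult mult.commute)
    qed
    also have "\<dots> = A * (\<integral>z. \<bar>cm_density b z - 1\<bar> \<partial>gauss)" by simp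
    also have "\<dots> \<le> A * (2 * norm b)"
      using cm_density_L1(2)[OF True] A0 by (intro mult_left_mono)
    finally show ?thesis by (simp add: nb mult_ac)
  qed
qed

section \<open>Gaussian moments\<close>

lemma power_le_fact_exp:
  fixes x :: real
  assumes "0 \<le> x"
  shows "x ^ k \<le> fact k * exp x"
proof -
  have "(\<Sum>n\<in>{k}. x ^ n /\<^sub>R fact n) \<le> exp x"
    unfolding exp_def using assms
    by (intro sum_le_suminf summable_exp_generic) auto
  then show ?thesis by (simp add: field_simps)
qed

text \<open>Powers of a coordinate are dominated by exponentials of plus and minus that coordinate,
  and these are multiples of Cameron-Martin densities with known integral 1.\<close>

lemma gauss_moment:
  "\<exists>c. Lq_le (gauss :: (real^'d) measure) q c norm"
proof (cases "q = 0")
  case True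
  have "Lq_le (gauss :: (real^'d) measure) q 1 norm"
    unfolding True using gauss.emeasure_space_1[where 'd='d] by (simp add: Lq_le_def)
  then show ?thesis by blast
next
  case False
  then have q: "1 \<le> q" by simp
  define C where "C = 2 * fact q * exp (1/2 :: real)"
  have C0: "0 \<le> C" by (simp add: C_def)
  have comp: "Lq_le (gauss :: (real^'d) measure) q (root q C) (\<lambda>z. z $ i)" for i
  proof -
    have pw: "\<bar>z $ i\<bar> ^ q \<le> fact q * exp (1/2) * (cm_density (axis i 1) z + cm_density (- axis i 1) z)" for z :: "real^'d"
    proof -
      have "\<bar>z $ i\<bar> ^ q \<le> fact q * exp \<bar>z $ i\<bar>" by (rule power_le_fact_exp) simp
      also have "\<dots> \<le> fact q * (exp (z $ i) + exp (- (z $ i)))"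
        by (intro mult_left_mono) (auto simp: abs_if)
      also have "exp (z $ i) = exp (1/2) * cm_density (axis i 1) z"
        by (simp add: cm_density_def norm_axis_1 inner_commute[of "axis i 1"] inner_axis flip: exp_add)
      also have "exp (- (z $ i)) = exp (1/2) * cm_density (- axis i 1) z"
        by (simp add: cm_density_def norm_axis_1 inner_commute[of "axis i 1"] inner_axis flip: exp_add)
      finally show ?thesis by (simp add: algebra_simps)
    qed
    have "(\<integral>\<^sup>+z. ennreal (\<bar>(z::real^'d) $ i\<bar> ^ q) \<partial>gauss)
        \<le> (\<integral>\<^sup>+z. ennreal (fact q * exp (1/2) * (cm_density (axis i 1) z + cm_density (- axis i 1) z)) \<partial>gauss)"
      by (intro nn_integral_mono ennreal_leI pw)
    also have "\<dots> = ennreal (\<integral>z. fact q * exp (1/2) * (cm_density (axis i 1) z + cm_density (- axis i 1) z) \<partial>gauss)"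
      using has_integral_cm_density[of "axis i 1 :: real^'d"] has_integral_cm_density[of "- axis i 1 :: real^'d"]
      by (intro nn_integral_eq_integral) (auto simp: has_bochner_integral_iff cm_density_nonneg)
    also have "\<dots> = ennreal C"
      using has_integral_cm_density[of "axis i 1 :: real^'d"] has_integral_cm_density[of "- axis i 1 :: real^'d"]
      by (simp add: has_bochner_integral_iff C_def)
    also have "C = root q C ^ q"
      using False C0 by simp
    finally show ?thesis using C0 False by (simp add: Lq_le_def real_root_ge_zero)
  qed
  have "Lq_le (gauss :: (real^'d) measure) q (\<Sum>i\<in>(UNIV::'d set). root q C) (\<lambda>z. \<Sum>i\<in>UNIV. \<bar>z $ i\<bar>)"
    by (intro Lq_le_sum q Lq_le_mono[OF comp]) auto
  then have "Lq_le (gauss :: (real^'d) measure) q (\<Sum>i\<in>(UNIV::'d set). root q C) norm"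
    by (rule Lq_le_mono) (auto intro!: AE_I2 norm_le_l1_cart[THEN order_trans])
  then show ?thesis by blast
qed

lemma integrable_gauss_norm_power: "integrable (gauss :: (real^'d) measure) (\<lambda>z. norm z ^ q)"
proof -
  obtain c where c: "Lq_le (gauss :: (real^'d) measure) q c norm" using gauss_moment by blast
  show ?thesis
    by (rule integrableI_bounded) (use Lq_leD(3)[OF c] in \<open>auto intro: le_less_trans\<close>)
qed

section \<open>Hoelder functions under the heat flow\<close>

definition holder :: "real \<Rightarrow> real \<Rightarrow> (real^'d \<Rightarrow> real) \<Rightarrow> bool" where
  "holder K \<beta> g \<longleftrightarrow> (\<forall>x. \<bar>g x\<bar> \<le> K) \<and> (\<forall>x y. \<bar>g x - g y\<bar> \<le> K * norm (x - y) powr \<beta>)"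

lemma holder_nonneg: "holder K \<beta> g \<Longrightarrow> 0 \<le> K"
  unfolding holder_def by (metis abs_ge_zero order_trans)

lemma holder_bcont:
  assumes "holder K \<beta> g" "0 < \<beta>"
  shows "bcont g"
proof -
  have "isCont g x" for x
    unfolding isCont_def
  proof (rule LIM_zero_cancel, rule Lim_null_comparison)
    show "\<forall>\<^sub>F y in at x. norm (g y - g x) \<le> K * norm (y - x) powr \<beta>"
      using assms by (auto simp: holder_def)
    have "((\<lambda>y. K * norm (y - x) powr \<beta>) \<longlongrightarrow> K * norm (x - x) powr \<beta>) (at x)"
      using assms by (intro tendsto_intros tendsto_powr' ) auto
    then show "((\<lambda>y. K * norm (y - x) powr \<beta>) \<longlongrightarrow> 0) (at x)" by simp
  qed
  then show ?thesis
    using assms by (auto simp: bcont_def holder_def continuous_on_eq_continuous_at)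
qed

text \<open>Both times use the same Gaussian vector, so the arguments differ by (sqrt r - sqrt q) z,
  and |sqrt r - sqrt q| \<le> sqrt |r - q|. The constant 1 + E|z| comes from |z|^\<beta> \<le> 1 +
  |z|.\<close>

lemma heat_time_diff_holder:
  fixes g :: "real^'d \<Rightarrow> real"
  assumes "holder K \<beta> g" "0 < \<beta>" "\<beta> \<le> 1" "0 \<le> r" "0 \<le> q"
  shows "\<bar>heat r g x - heat q g x\<bar> \<le> K * (1 + (\<integral>z. norm z \<partial>(gauss :: (real^'d) measure))) * \<bar>r - q\<bar> powr (\<beta> / 2)"
proof -
  note bc = holder_bcont[OF assms(1,2)]
  have K0: "0 \<le> K" using holder_nonneg[OF assms(1)] .
  note [measurable] = bcont_measurable[OF bc]
  have i1: "integrable (gauss :: (real^'d) measure) norm" using integrable_gauss_norm_power[of 1] by simp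
  let ?c = "\<bar>r - q\<bar> powr (\<beta> / 2)"
  have sq: "\<bar>sqrt r - sqrt q\<bar> \<le> sqrt \<bar>r - q\<bar>"
  proof -
    have *: "sqrt a - sqrt b \<le> sqrt (a - b)" if "0 \<le> b" "b \<le> a" for a b
      using sqrt_add_le_add_sqrt[of "a - b" b] that by simp
    show ?thesis using *[of q r] *[of r q] assms by (cases "q \<le> r") (auto simp: abs_if)
  qed
  have pw: "\<bar>g (x + sqrt r *\<^sub>R z) - g (x + sqrt q *\<^sub>R z)\<bar> \<le> K * ?c * (1 + norm z)" for z
  proof -
    have "\<bar>g (x + sqrt r *\<^sub>R z) - g (x + sqrt q *\<^sub>R z)\<bar> \<le> K * norm ((x + sqrt r *\<^sub>R z) - (x + sqrt q *\<^sub>R z)) powr \<beta>"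
      using assms(1) unfolding holder_def by blast
    also have "(x + sqrt r *\<^sub>R z) - (x + sqrt q *\<^sub>R z) = (sqrt r - sqrt q) *\<^sub>R z"
      by (simp add: scaleR_diff_left)
    also have "K * norm ((sqrt r - sqrt q) *\<^sub>R z) powr \<beta> \<le> K * (sqrt \<bar>r - q\<bar> * norm z) powr \<beta>"
      using sq assms K0 by (intro mult_left_mono powr_mono2) (auto intro!: mult_right_mono)
    also have "\<dots> = K * (sqrt \<bar>r - q\<bar> powr \<beta> * norm z powr \<beta>)"
      by (simp add: powr_mult)
    also have "sqrt \<bar>r - q\<bar> powr \<beta> = ?c"
      by (simp add: powr_powr flip: powr_half_sqrt)
    also have "norm z powr \<beta> \<le> 1 + norm z"
    proof (cases "norm z \<le> 1")
      case True
      then have "norm z powr \<beta> \<le> 1" using assms by (intro powr_le1) auto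
      then show ?thesis by (smt (verit) norm_ge_zero)
    next
      case False
      then have "norm z powr \<beta> \<le> norm z powr 1" using assms by (intro powr_mono) auto
      then show ?thesis by simp
    qed
    finally show ?thesis using K0 by (simp add: mult_left_mono mult.assoc)
  qed
  have "heat r g x - heat q g x = (\<integral>z. g (x + sqrt r *\<^sub>R z) - g (x + sqrt q *\<^sub>R z) \<partial>gauss)"
    unfolding heat_def by (intro Bochner_Integration.integral_diff[symmetric] integrable_heat bc)
  also have "\<bar>\<dots>\<bar> \<le> (\<integral>z. \<bar>g (x + sqrt r *\<^sub>R z) - g (x + sqrt q *\<^sub>R z)\<bar> \<partial>gauss)"
    by (rule integral_abs_bound)
  also have "\<dots> \<le> (\<integral>z. K * ?c * (1 + norm z) \<partial>(gauss :: (real^'d) measure))"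
    using i1 by (intro integral_mono pw integrable_abs Bochner_Integration.integrable_diff integrable_heat bc) auto
  also have "\<dots> = K * ?c * (1 + (\<integral>z. norm z \<partial>(gauss :: (real^'d) measure)))"
    using i1 gauss.prob_space[where 'd='d] by simp
  finally show ?thesis by (simp add: mult_ac)
qed

section \<open>Filtered Brownian motion\<close>

text \<open>The freezing lemma: (S, Y) and W have a product law, and Fubini integrates W out with Y
  fixed. It is phrased with a bounded test variable \<open>S\<close> rather than a conditional
  expectation, which is the form of orthogonality used by the martingale bound. It serves both for
  Brownian increments and for sampling points.\<close>

lemma (in prob_space) expectation_independent:
  fixes S :: "'a \<Rightarrow> real" and Y :: "'a \<Rightarrow> 'c::{second_countable_topology,topological_space}"
    and W :: "'a \<Rightarrow> 'e::{second_countable_topology,topological_space}" and h :: "'c \<times> 'e \<Rightarrow> real"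
  assumes sub: "subalgebra M F" and W: "W \<in> borel_measurable M"
    and ind: "\<And>A D. A \<in> sets F \<Longrightarrow> D \<in> sets borel \<Longrightarrow>
      emeasure M (A \<inter> {\<omega> \<in> space M. W \<omega> \<in> D}) = emeasure M A * emeasure (distr M borel W) D"
    and S: "S \<in> borel_measurable F" "\<And>\<omega>. \<omega> \<in> space M \<Longrightarrow> \<bar>S \<omega>\<bar> \<le> A"
    and Y: "Y \<in> borel_measurable F"
    and h: "h \<in> borel_measurable (borel \<Otimes>\<^sub>M borel)" "\<And>x. \<bar>h x\<bar> \<le> C"
  shows "integrable M (\<lambda>\<omega>. S \<omega> * h (Y \<omega>, W \<omega>))"
    and "expectation (\<lambda>\<omega>. S \<omega> * h (Y \<omega>, W \<omega>)) = expectation (\<lambda>\<omega>. S \<omega> * (\<integral>w. h (Y \<omega>, w) \<partial>distr M borel W))"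
proof -
  have [measurable]: "S \<in> borel_measurable M" "Y \<in> borel_measurable M"
    using measurable_from_subalg[OF sub S(1)] measurable_from_subalg[OF sub Y] .
  note [measurable] = W h(1)
  let ?P = "distr M (borel \<Otimes>\<^sub>M borel) (\<lambda>\<omega>. (S \<omega>, Y \<omega>))"
  let ?W = "distr M borel W"
  let ?h = "\<lambda>x. fst (fst x) * h (snd (fst x), snd x)"
  interpret P: prob_space ?P by (rule prob_space_distr) simp
  interpret W: prob_space ?W by (rule prob_space_distr) simp
  interpret PW: pair_prob_space ?P ?W ..
  have SY: "(\<lambda>\<omega>. (S \<omega>, Y \<omega>)) \<in> measurable F (borel \<Otimes>\<^sub>M borel)"
    using S(1) Y by measurable
  have eq: "?P \<Otimes>\<^sub>M ?W = distr M ((borel \<Otimes>\<^sub>M borel) \<Otimes>\<^sub>M borel) (\<lambda>\<omega>. ((S \<omega>, Y \<omega>), W \<omega>))"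
  proof (rule pair_measure_eqI)
    show "sigma_finite_measure ?P" "sigma_finite_measure ?W" by unfold_locales
    fix C D assume "C \<in> sets ?P" "D \<in> sets ?W"
    then have [measurable]: "C \<in> sets (borel \<Otimes>\<^sub>M borel)" "D \<in> sets borel" by auto
    have CF: "(\<lambda>\<omega>. (S \<omega>, Y \<omega>)) -` C \<inter> space M \<in> sets F"
      using measurable_sets[OF SY, of C] sub by (simp add: subalgebra_def)
    have "emeasure (distr M ((borel \<Otimes>\<^sub>M borel) \<Otimes>\<^sub>M borel) (\<lambda>\<omega>. ((S \<omega>, Y \<omega>), W \<omega>))) (C \<times> D)
       = emeasure M (((\<lambda>\<omega>. (S \<omega>, Y \<omega>)) -` C \<inter> space M) \<inter> {\<omega> \<in> space M. W \<omega> \<in> D})"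
      by (subst emeasure_distr) (auto intro!: arg_cong[where f = "emeasure M"])
    also have "\<dots> = emeasure M ((\<lambda>\<omega>. (S \<omega>, Y \<omega>)) -` C \<inter> space M) * emeasure ?W D"
      by (rule ind[OF CF]) simp
    also have "\<dots> = emeasure ?P C * emeasure ?W D"
      by (simp add: emeasure_distr)
    finally show "emeasure ?P C * emeasure ?W D
       = emeasure (distr M ((borel \<Otimes>\<^sub>M borel) \<Otimes>\<^sub>M borel) (\<lambda>\<omega>. ((S \<omega>, Y \<omega>), W \<omega>))) (C \<times> D)" ..
  qed (simp cong: sets_pair_measure_cong)
  have hm: "?h \<in> borel_measurable ((borel \<Otimes>\<^sub>M borel) \<Otimes>\<^sub>M borel)" by measurable
  show int0: "integrable M (\<lambda>\<omega>. S \<omega> * h (Y \<omega>, W \<omega>))"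
  proof (rule integrable_const_bound[where B = "\<bar>A\<bar> * \<bar>C\<bar>"])
    show "AE \<omega> in M. norm (S \<omega> * h (Y \<omega>, W \<omega>)) \<le> \<bar>A\<bar> * \<bar>C\<bar>"
    proof (rule AE_I2)
      fix \<omega> assume "\<omega> \<in> space M"
      then show "norm (S \<omega> * h (Y \<omega>, W \<omega>)) \<le> \<bar>A\<bar> * \<bar>C\<bar>"
        using S(2)[of \<omega>] h(2)[of "(Y \<omega>, W \<omega>)"] unfolding real_norm_def abs_mult
        by (intro mult_mono) linarith+
    qed
  qed simp
  then have int: "integrable (?P \<Otimes>\<^sub>M ?W) ?h"
    unfolding eq by (subst integrable_distr_eq) (auto simp: hm)
  have "expectation (\<lambda>\<omega>. S \<omega> * h (Y \<omega>, W \<omega>)) = (\<integral>x. ?h x \<partial>(?P \<Otimes>\<^sub>M ?W))"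
    unfolding eq by (subst integral_distr) (auto simp: hm)
  also have "\<dots> = (\<integral>p. (\<integral>w. ?h (p, w) \<partial>?W) \<partial>?P)"
    using PW.integral_fst'[OF int] by simp
  also have "\<dots> = (\<integral>p. fst p * (\<integral>w. h (snd p, w) \<partial>?W) \<partial>?P)"
    by simp
  also have "\<dots> = expectation (\<lambda>\<omega>. S \<omega> * (\<integral>w. h (Y \<omega>, w) \<partial>?W))"
    by (subst integral_distr) auto
  finally show "expectation (\<lambda>\<omega>. S \<omega> * h (Y \<omega>, W \<omega>)) = expectation (\<lambda>\<omega>. S \<omega> * (\<integral>w. h (Y \<omega>, w) \<partial>?W))" .
qed

text \<open>Independence of the past and the Gaussian law of an increment are encoded together in
  one product formula. \<open>F\<close> may be strictly larger than the filtration of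
  \<open>B\<close>, so that the sampling points can be adjoined to it.\<close>

locale filtered_bm = prob_space M for M :: "'w measure" +
  fixes F :: "real \<Rightarrow> 'w measure" and B :: "real \<Rightarrow> 'w \<Rightarrow> real^'d"
  assumes subalg: "0 \<le> t \<Longrightarrow> t \<le> 1 \<Longrightarrow> subalgebra M (F t)"
    and filtration_mono: "0 \<le> s \<Longrightarrow> s \<le> t \<Longrightarrow> t \<le> 1 \<Longrightarrow> sets (F s) \<subseteq> sets (F t)"
    and adapted: "0 \<le> t \<Longrightarrow> t \<le> 1 \<Longrightarrow> B t \<in> borel_measurable (F t)"
    and increment: "0 \<le> s \<Longrightarrow> s < t \<Longrightarrow> t \<le> 1 \<Longrightarrow> A \<in> sets (F s) \<Longrightarrow> D \<in> sets borel \<Longrightarrow>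
      emeasure M (A \<inter> {\<omega> \<in> space M. B t \<omega> - B s \<omega> \<in> D}) =
      emeasure M A * emeasure (distr gauss borel (\<lambda>z. sqrt (t - s) *\<^sub>R z)) D"
begin

lemma space_F: "0 \<le> t \<Longrightarrow> t \<le> 1 \<Longrightarrow> space (F t) = space M"
  using subalg by (auto simp: subalgebra_def)

lemma measurable_F_mono:
  assumes "X \<in> borel_measurable (F s)" "0 \<le> s" "s \<le> t" "t \<le> 1"
  shows "X \<in> borel_measurable (F t)"
proof (rule measurable_from_subalg[OF _ assms(1)])
  show "subalgebra (F t) (F s)"
    using space_F[of s] space_F[of t] filtration_mono[of s t] assms by (auto simp: subalgebra_def)
qed

lemma measurable_F_M:
  assumes "X \<in> borel_measurable (F s)" "0 \<le> s" "s \<le> 1"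
  shows "X \<in> borel_measurable M"
  using measurable_from_subalg[OF subalg assms(1)] assms by simp

lemma B_measurable: "0 \<le> t \<Longrightarrow> t \<le> 1 \<Longrightarrow> B t \<in> borel_measurable M"
  using measurable_F_M adapted by blast

lemma increment_law:
  assumes "0 \<le> s" "s < t" "t \<le> 1"
  shows "distr M borel (\<lambda>\<omega>. B t \<omega> - B s \<omega>) = distr gauss borel (\<lambda>z. sqrt (t - s) *\<^sub>R z)"
proof (rule measure_eqI)
  have [measurable]: "B t \<in> borel_measurable M" "B s \<in> borel_measurable M"
    using assms B_measurable by auto
  fix D assume "D \<in> sets (distr M borel (\<lambda>\<omega>. B t \<omega> - B s \<omega>))"
  then have D: "D \<in> sets borel" by simp
  have "space M \<in> sets (F s)"
    using space_F[of s] assms by (metis sets.top less_imp_le order_trans)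
  from increment[OF assms this D]
  show "emeasure (distr M borel (\<lambda>\<omega>. B t \<omega> - B s \<omega>)) D = emeasure (distr gauss borel (\<lambda>z. sqrt (t - s) *\<^sub>R z)) D"
  proof -
    have "(\<lambda>\<omega>. B t \<omega> - B s \<omega>) -` D \<inter> space M = space M \<inter> {\<omega> \<in> space M. B t \<omega> - B s \<omega> \<in> D}"
      by auto
    then show ?thesis
      using assms D \<open>emeasure M (space M \<inter> _) = _\<close> by (subst emeasure_distr) (simp_all add: emeasure_space_1)
  qed
qed simp

text \<open>The Markov property in weak form. The present position \<open>Y\<close> is any variable
  known at time s, in particular a Brownian position shifted by a drift.\<close>

lemma expectation_increment:
  fixes S :: "'w \<Rightarrow> real" and Y :: "'w \<Rightarrow> real^'d"
  assumes st: "0 \<le> s" "s \<le> t" "t \<le> 1"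
    and S: "S \<in> borel_measurable (F s)" "\<And>\<omega>. \<omega> \<in> space M \<Longrightarrow> \<bar>S \<omega>\<bar> \<le> A"
    and Y: "Y \<in> borel_measurable (F s)" and g: "bcont g"
  shows "expectation (\<lambda>\<omega>. S \<omega> * g (Y \<omega> + (B t \<omega> - B s \<omega>))) = expectation (\<lambda>\<omega>. S \<omega> * heat (t - s) g (Y \<omega>))"
proof (cases "s = t")
  case True
  then show ?thesis by simp
next
  case False
  with st have lt: "s < t" by simp
  obtain C where C: "\<And>x. \<bar>g x\<bar> \<le> C" using g by (auto simp: bcont_def)
  note [measurable] = bcont_measurable[OF g]
  have [measurable]: "B t \<in> borel_measurable M" "B s \<in> borel_measurable M"
    using st B_measurable by auto
  have "expectation (\<lambda>\<omega>. S \<omega> * (\<lambda>x. g (fst x + snd x)) (Y \<omega>, B t \<omega> - B s \<omega>))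
     = expectation (\<lambda>\<omega>. S \<omega> * (\<integral>w. (\<lambda>x. g (fst x + snd x)) (Y \<omega>, w) \<partial>distr M borel (\<lambda>\<omega>. B t \<omega> - B s \<omega>)))"
  proof (rule expectation_independent(2)[where F = "F s"])
    show "emeasure M (A \<inter> {\<omega> \<in> space M. B t \<omega> - B s \<omega> \<in> D})
       = emeasure M A * emeasure (distr M borel (\<lambda>\<omega>. B t \<omega> - B s \<omega>)) D" if "A \<in> sets (F s)" "D \<in> sets borel" for A D
      unfolding increment_law[OF st(1) lt st(3)] by (rule increment[OF st(1) lt st(3) that])
    show "(\<lambda>x. g (fst x + snd x)) \<in> borel_measurable (borel \<Otimes>\<^sub>M borel)" by measurable
  qed (use subalg[of s] st S Y C in auto)
  moreover have "(\<integral>w. g (y + w) \<partial>distr M borel (\<lambda>\<omega>. B t \<omega> - B s \<omega>)) = heat (t - s) g y" for y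
    unfolding increment_law[OF st(1) lt st(3)] heat_def by (subst integral_distr) auto
  ultimately show ?thesis by simp
qed

text \<open>Read off from the Brownian motion itself by conditioning at time q, instead of
  convolving Gaussian densities. The restriction r + q \<le> 1 reflects that \<open>B\<close> lives
  on [0, 1].\<close>

lemma heat_semigroup:
  fixes g :: "real^'d \<Rightarrow> real"
  assumes "bcont g" "0 \<le> r" "0 \<le> q" "r + q \<le> 1"
  shows "heat q (heat r g) x = heat (r + q) g x"
proof -
  have c: "(\<lambda>\<omega>. 1 :: real) \<in> borel_measurable (F s)" "(\<lambda>\<omega>. y :: real^'d) \<in> borel_measurable (F s)" for s y
    by auto
  have a: "expectation (\<lambda>\<omega>. h (x + (B t \<omega> - B 0 \<omega>))) = heat t h x" if "0 \<le> t" "t \<le> 1" "bcont h" for t h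
    using expectation_increment[OF order_refl that(1,2) c(1) _ c(2) that(3), of 1 x] prob_space by simp
  have "heat (r + q) g x = expectation (\<lambda>\<omega>. g (x + (B (r + q) \<omega> - B 0 \<omega>)))"
    using a[of "r + q" g] assms by simp
  also have "\<dots> = expectation (\<lambda>\<omega>. 1 * g ((x + (B q \<omega> - B 0 \<omega>)) + (B (r + q) \<omega> - B q \<omega>)))"
    by simp
  also have "\<dots> = expectation (\<lambda>\<omega>. 1 * heat (r + q - q) g (x + (B q \<omega> - B 0 \<omega>)))"
  proof (rule expectation_increment)
    have "B 0 \<in> borel_measurable (F q)"
      using measurable_F_mono[OF adapted] assms by simp
    then show "(\<lambda>\<omega>. x + (B q \<omega> - B 0 \<omega>)) \<in> borel_measurable (F q)"
      using adapted[of q] assms by (intro borel_measurable_add borel_measurable_diff) auto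
  qed (use assms in auto)
  also have "\<dots> = heat q (heat r g) x"
    using a[of q "heat r g"] assms bcont_heat[OF assms(1)] by simp
  finally show ?thesis ..
qed

section \<open>Smoothing estimates for Hoelder functions\<close>

text \<open>Doubling of time. The difference between times r and 2r is the heat image over time r/2
  of a function of size r^(\<beta>/2), so its Lipschitz constant is r^(\<beta>/2) r^(-1/2). Doubling
  up to a time above 1/2, where the sup bound suffices, sums a geometric series of ratio
  2^((\<beta>-1)/2), and here \<beta> < 1 enters.\<close>

lemma holder_heat_lipschitz:
  assumes \<beta>: "0 < \<beta>" "\<beta> < 1"
  shows "\<exists>C\<ge>1. \<forall>K (g :: real^'d \<Rightarrow> real) r x y. holder K \<beta> g \<longrightarrow> 0 < r \<longrightarrow> r \<le> 1 \<longrightarrow>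
    \<bar>heat r g x - heat r g y\<bar> \<le> C * K * r powr ((\<beta> - 1) / 2) * norm (x - y)"
proof -
  define c where "c = 1 + (\<integral>z. norm z \<partial>(gauss :: (real^'d) measure))"
  have c1: "1 \<le> c" by (simp add: c_def)
  define lam where "lam = 2 powr ((\<beta> - 1) / 2)"
  have lam: "0 < lam" "lam < 1" using \<beta> powr_less_mono[of "(\<beta> - 1) / 2" 0 2] by (auto simp: lam_def)
  \<comment> \<open>The solution of C = lam C + 4c: the constant inherited from time 2r plus that of
    one doubling step.\<close>
  define C where "C = 4 * c / (1 - lam)"
  have C4: "4 \<le> C"
  proof -
    have "4 * (1 - lam) \<le> 4 * c" using lam c1 by simp
    then show ?thesis using lam by (simp add: C_def pos_le_divide_eq)
  qed
  have step: "\<bar>heat r g x - heat r g y\<bar> \<le> C * K * r powr ((\<beta> - 1) / 2) * norm (x - y)"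
    if g: "holder K \<beta> g" and r: "1 / 2 ^ k < r" "r \<le> 1" for K and g :: "real^'d \<Rightarrow> real" and r k x y
    using r
  proof (induction k arbitrary: r x y)
    case 0
    then show ?case by simp
  next
    case (Suc k)
    have r0: "0 < r" using Suc.prems(1) by (rule less_trans[rotated]) simp
    have bc: "bcont g" using holder_bcont[OF g] \<beta> by simp
    have K0: "0 \<le> K" using holder_nonneg[OF g] .
    show ?case
    proof (cases "1 / 2 < r")
      case True
      have "\<bar>heat r g x - heat r g y\<bar> \<le> 2 * K / sqrt r * norm (x - y)"
        using g by (intro heat_lipschitz[OF bc _ r0]) (auto simp: holder_def)
      also have "\<dots> \<le> (C * K * r powr ((\<beta> - 1) / 2)) * norm (x - y)"
      proof (intro mult_right_mono)
        have "sqrt (1 / 4) \<le> sqrt r" using True by (intro real_sqrt_le_mono) simp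
        then have "2 / sqrt r \<le> 4" using r0 by (simp add: real_sqrt_divide field_simps)
        moreover have "1 \<le> r powr ((\<beta> - 1) / 2)"
        proof -
          have "(\<beta> - 1) / 2 \<le> 0" using \<beta> by simp
          then show ?thesis using powr_mono2_le_one[of r "(\<beta> - 1) / 2" 0] r0 Suc.prems by simp
        qed
        ultimately have "K * (2 / sqrt r) \<le> K * (C * r powr ((\<beta> - 1) / 2))"
          using K0 C4 mult_mono[of 4 C 1 "r powr ((\<beta> - 1) / 2)"] by (intro mult_left_mono) auto
        then show "2 * K / sqrt r \<le> C * K * r powr ((\<beta> - 1) / 2)" by (simp add: mult_ac)
      qed simp
      finally show ?thesis .
    next
      case False
      define h where "h u = heat (r/2) g u - heat (3 * r / 2) g u" for u
      have bh: "bcont h" unfolding h_def by (intro bcont_diff bcont_heat bc)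
      have hb: "\<bar>h u\<bar> \<le> K * c * r powr (\<beta> / 2)" for u
        using heat_time_diff_holder[OF g, of "r/2" "3*r/2" u] \<beta> r0 by (simp add: h_def c_def)
      have hh: "heat (r/2) h u = heat r g u - heat (2 * r) g u" for u
      proof -
        have "heat (r/2) h u = heat (r/2) (heat (r/2) g) u - heat (r/2) (heat (3 * r / 2) g) u"
          unfolding h_def[abs_def] by (intro heat_diff bcont_heat bc)
        also have "\<dots> = heat (r/2 + r/2) g u - heat (3 * r / 2 + r / 2) g u"
          using heat_semigroup[OF bc, of "r/2" "r/2" u] heat_semigroup[OF bc, of "3*r/2" "r/2" u] r0 False by simp
        finally show ?thesis by simp
      qed
      have "\<bar>heat (r/2) h x - heat (r/2) h y\<bar> \<le> 2 * (K * c * r powr (\<beta> / 2)) / sqrt (r/2) * norm (x - y)"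
        using r0 by (intro heat_lipschitz[OF bh hb]) simp
      moreover have "\<bar>heat (2 * r) g x - heat (2 * r) g y\<bar> \<le> C * K * (2 * r) powr ((\<beta> - 1) / 2) * norm (x - y)"
        using Suc.prems False by (intro Suc.IH) (auto simp: field_simps)
      ultimately have "\<bar>heat r g x - heat r g y\<bar> \<le>
          (C * K * (2 * r) powr ((\<beta> - 1) / 2) + 2 * (K * c * r powr (\<beta> / 2)) / sqrt (r/2)) * norm (x - y)"
        unfolding distrib_right hh by linarith
      also have "\<dots> \<le> (C * K * r powr ((\<beta> - 1) / 2)) * norm (x - y)"
      proof (intro mult_right_mono)
        have p: "r powr (\<beta> / 2) / sqrt r = r powr ((\<beta> - 1) / 2)"
          using r0 by (simp add: diff_divide_distrib powr_diff powr_half_sqrt)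
        have s2: "sqrt 2 \<le> 2" using real_sqrt_le_mono[of 2 4] by simp
        have "2 * (K * c * r powr (\<beta> / 2)) / sqrt (r/2) = 2 * K * c * sqrt 2 * (r powr (\<beta> / 2) / sqrt r)"
          by (simp add: real_sqrt_divide)
        also have "\<dots> \<le> 4 * K * c * r powr ((\<beta> - 1) / 2)"
          unfolding p using s2 K0 c1 mult_left_mono[OF s2, of "2 * K * c"]
          by (intro mult_right_mono) (auto simp: mult_ac)
        also have "\<dots> = C * (1 - lam) * K * r powr ((\<beta> - 1) / 2)"
          using lam by (simp add: C_def)
        finally have "2 * (K * c * r powr (\<beta> / 2)) / sqrt (r/2) \<le> C * (1 - lam) * K * r powr ((\<beta> - 1) / 2)" .
        moreover have "C * K * (2 * r) powr ((\<beta> - 1) / 2) = C * lam * K * r powr ((\<beta> - 1) / 2)"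
          using r0 by (simp add: powr_mult lam_def)
        ultimately have parts: "2 * (K * c * r powr (\<beta> / 2)) / sqrt (r/2) \<le> C * (1 - lam) * K * r powr ((\<beta> - 1) / 2)"
          "C * K * (2 * r) powr ((\<beta> - 1) / 2) = C * lam * K * r powr ((\<beta> - 1) / 2)" .
        show "C * K * (2 * r) powr ((\<beta> - 1) / 2) + 2 * (K * c * r powr (\<beta> / 2)) / sqrt (r/2) \<le> C * K * r powr ((\<beta> - 1) / 2)"
        proof -
          have "C * lam * K * r powr ((\<beta> - 1) / 2) + C * (1 - lam) * K * r powr ((\<beta> - 1) / 2) = C * K * r powr ((\<beta> - 1) / 2)"
            by (simp add: algebra_simps)
          with parts show ?thesis by linarith
        qed
      qed simp
      finally show ?thesis .
    qed
  qed
  show ?thesis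
  proof (intro exI[of _ C] conjI allI impI)
    fix K r :: real and g :: "real^'d \<Rightarrow> real" and x y
    assume "holder K \<beta> g" "0 < r" "r \<le> 1"
    moreover obtain k where "(1/2) ^ k < r"
      using real_arch_pow_inv[of r "1/2"] \<open>0 < r\<close> by auto
    ultimately show "\<bar>heat r g x - heat r g y\<bar> \<le> C * K * r powr ((\<beta> - 1) / 2) * norm (x - y)"
      using step[of K g k r x y] by (simp add: power_one_over)
  qed (use C4 in simp)
qed

text \<open>The time is split in half. One half makes the increment in direction \<open>a\<close>
  small uniformly, the other smooths this increment in direction \<open>b\<close>; the exponents
  (\<beta>-1)/2 and -1/2 add up.\<close>

lemma holder_heat_second_diff:
  assumes \<beta>: "0 < \<beta>" "\<beta> < 1"
  shows "\<exists>C\<ge>1. \<forall>K (g :: real^'d \<Rightarrow> real) r x a b. holder K \<beta> g \<longrightarrow> 0 < r \<longrightarrow> r \<le> 1 \<longrightarrow>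
    \<bar>(heat r g (x + a + b) - heat r g (x + b)) - (heat r g (x + a) - heat r g x)\<bar>
      \<le> C * K * r powr ((\<beta> - 2) / 2) * norm a * norm b"
proof -
  obtain C where C: "1 \<le> C" and lip: "\<And>K (g :: real^'d \<Rightarrow> real) r x y. holder K \<beta> g \<Longrightarrow> 0 < r \<Longrightarrow> r \<le> 1 \<Longrightarrow>
    \<bar>heat r g x - heat r g y\<bar> \<le> C * K * r powr ((\<beta> - 1) / 2) * norm (x - y)"
    using holder_heat_lipschitz[OF \<beta>] by blast
  have "\<bar>(heat r g (x + a + b) - heat r g (x + b)) - (heat r g (x + a) - heat r g x)\<bar>
      \<le> 4 * C * K * r powr ((\<beta> - 2) / 2) * norm a * norm b"
    if g: "holder K \<beta> g" and r: "0 < r" "r \<le> 1" for K and g :: "real^'d \<Rightarrow> real" and r x a b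
  proof -
    have bc: "bcont g" using holder_bcont[OF g] \<beta> by simp
    have K0: "0 \<le> K" using holder_nonneg[OF g] .
    define h where "h u = heat (r/2) g (u + a) - heat (r/2) g u" for u
    have bh: "bcont h" unfolding h_def by (intro bcont_diff bcont_translate bcont_heat bc)
    have hb: "\<bar>h u\<bar> \<le> C * K * (r/2) powr ((\<beta> - 1) / 2) * norm a" for u
      using lip[OF g, of "r/2" "u + a" u] r by (simp add: h_def)
    have hh: "heat (r/2) h u = heat r g (u + a) - heat r g u" for u
    proof -
      have "heat (r/2) h u = heat (r/2) (heat (r/2) g) (u + a) - heat (r/2) (heat (r/2) g) u"
        unfolding h_def[abs_def] by (subst heat_diff) (auto intro!: bcont_translate bcont_heat bc simp: heat_translate)
      then show ?thesis
        using heat_semigroup[OF bc, of "r/2" "r/2"] r by simp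
    qed
    have "\<bar>heat (r/2) h (x + b) - heat (r/2) h x\<bar>
       \<le> 2 * (C * K * (r/2) powr ((\<beta> - 1) / 2) * norm a) / sqrt (r/2) * norm (x + b - x)"
      using r by (intro heat_lipschitz[OF bh hb]) simp
    also have "\<dots> = 2 * C * K * ((r/2) powr ((\<beta> - 1) / 2) / sqrt (r/2)) * norm a * norm b"
      by simp
    also have "(r/2) powr ((\<beta> - 1) / 2) / sqrt (r/2) = (r/2) powr ((\<beta> - 2) / 2)"
    proof -
      have "(\<beta> - 2) / 2 = (\<beta> - 1) / 2 - 1 / 2" by (simp add: field_simps)
      then show ?thesis using r by (simp only: powr_diff powr_half_sqrt)
    qed
    also have "\<dots> = r powr ((\<beta> - 2) / 2) * 2 powr ((2 - \<beta>) / 2)"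
    proof -
      have "(2 - \<beta>) / 2 = - ((\<beta> - 2) / 2)" by (simp only: minus_divide_left minus_diff_eq)
      then have "2 powr ((2 - \<beta>) / 2) = inverse (2 powr ((\<beta> - 2) / 2))"
        by (simp only: powr_minus)
      moreover have "(r/2) powr ((\<beta> - 2) / 2) = r powr ((\<beta> - 2) / 2) / 2 powr ((\<beta> - 2) / 2)"
        using r by (simp only: powr_divide)
      ultimately show ?thesis by (simp only: divide_inverse[of "r powr _"])
    qed
    also have "2 * C * K * (r powr ((\<beta> - 2) / 2) * 2 powr ((2 - \<beta>) / 2)) * norm a * norm b
       \<le> 2 * C * K * (r powr ((\<beta> - 2) / 2) * 2) * norm a * norm b"
      using K0 C \<beta> powr_mono[of "(2 - \<beta>) / 2" 1 2] by (intro mult_right_mono mult_left_mono) auto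
    finally show ?thesis unfolding hh by (simp add: add_ac mult_ac)
  qed
  then show ?thesis using C by (intro exI[of _ "4 * C"]) auto
qed

text \<open>Interpolation between \<delta>^(\<beta>/2), valid without smoothing, and \<delta>
  q^(\<beta>/2-1), valid for \<delta> \<le> q. The second bound is the heat equation in difference
  form: a time step \<delta> costs a second difference in space at distance sqrt \<delta>.\<close>

lemma holder_heat_time_diff:
  assumes \<beta>: "0 < \<beta>" "\<beta> < 1" and \<theta>: "\<beta> / 2 \<le> \<theta>" "\<theta> \<le> 1"
  shows "\<exists>C\<ge>1. \<forall>K (g :: real^'d \<Rightarrow> real) q \<delta> x. holder K \<beta> g \<longrightarrow> 0 < q \<longrightarrow> 0 \<le> \<delta> \<longrightarrow> q + \<delta> \<le> 1 \<longrightarrow>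
    \<bar>heat (q + \<delta>) g x - heat q g x\<bar> \<le> C * K * \<delta> powr \<theta> * q powr (\<beta> / 2 - \<theta>)"
proof -
  obtain C where C: "1 \<le> C" and sd: "\<And>K (g :: real^'d \<Rightarrow> real) r x a b. holder K \<beta> g \<Longrightarrow> 0 < r \<Longrightarrow> r \<le> 1 \<Longrightarrow>
    \<bar>(heat r g (x + a + b) - heat r g (x + b)) - (heat r g (x + a) - heat r g x)\<bar>
      \<le> C * K * r powr ((\<beta> - 2) / 2) * norm a * norm b"
    using holder_heat_second_diff[OF \<beta>] by blast
  define m1 where "m1 = (\<integral>z. norm z \<partial>(gauss :: (real^'d) measure))"
  define m2 where "m2 = (\<integral>z. norm z ^ 2 \<partial>(gauss :: (real^'d) measure))"
  have m0: "0 \<le> m1" "0 \<le> m2" by (auto simp: m1_def m2_def)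
  define D where "D = C * m2 + 1 + m1"
  have D: "C * m2 \<le> D" "1 + m1 \<le> D" "1 \<le> D" using m0 C by (auto simp: D_def)
  have "\<bar>heat (q + \<delta>) g x - heat q g x\<bar> \<le> D * K * \<delta> powr \<theta> * q powr (\<beta> / 2 - \<theta>)"
    if g: "holder K \<beta> g" and q: "0 < q" "0 \<le> \<delta>" "q + \<delta> \<le> 1" for K and g :: "real^'d \<Rightarrow> real" and q \<delta> x
  proof -
    have bc: "bcont g" using holder_bcont[OF g] \<beta> by simp
    have K0: "0 \<le> K" using holder_nonneg[OF g] .
    define G where "G = heat q g"
    have bG: "bcont G" unfolding G_def by (intro bcont_heat bc)
    note [measurable] = bcont_measurable[OF bG]
    have i2: "integrable (gauss :: (real^'d) measure) (\<lambda>z. norm z ^ 2)"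
      by (rule integrable_gauss_norm_power)
    show ?thesis
    proof (cases "\<delta> \<le> q")
      case True
      have "heat (q + \<delta>) g x = (\<integral>z. G (x + sqrt \<delta> *\<^sub>R z) \<partial>gauss)"
        using heat_semigroup[OF bc, of q \<delta> x] q by (simp add: heat_def G_def)
      moreover have "heat (q + \<delta>) g x = (\<integral>z. G (x - sqrt \<delta> *\<^sub>R z) \<partial>gauss)"
      proof -
        have "(\<integral>z. G (x + sqrt \<delta> *\<^sub>R z) \<partial>gauss) = (\<integral>z. G (x + sqrt \<delta> *\<^sub>R z) \<partial>distr gauss borel uminus)"
          by (simp only: gauss_reflect)
        also have "\<dots> = (\<integral>z. G (x - sqrt \<delta> *\<^sub>R z) \<partial>gauss)"
          by (subst integral_distr) auto
        finally show ?thesis using heat_semigroup[OF bc, of q \<delta> x] q by (simp add: heat_def G_def)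
      qed
      \<comment> \<open>Averaging over z and -z turns twice the time difference into the integral of
        a symmetric second difference of G.\<close>
      ultimately have "2 * (heat (q + \<delta>) g x - heat q g x)
         = (\<integral>z. G (x + sqrt \<delta> *\<^sub>R z) \<partial>gauss) + (\<integral>z. G (x - sqrt \<delta> *\<^sub>R z) \<partial>gauss) - 2 * G x"
        by (simp add: G_def)
      also have "\<dots> = (\<integral>z. G (x + sqrt \<delta> *\<^sub>R z) + G (x - sqrt \<delta> *\<^sub>R z) - 2 * G x \<partial>gauss)"
        using integrable_heat[OF bG, of x "sqrt \<delta>"] integrable_heat[OF bG, of x "- sqrt \<delta>"] gauss.prob_space[where 'd='d]
        by simp
      finally have e: "2 * (heat (q + \<delta>) g x - heat q g x) = \<dots>" .
      have "\<bar>\<integral>z. G (x + sqrt \<delta> *\<^sub>R z) + G (x - sqrt \<delta> *\<^sub>R z) - 2 * G x \<partial>gauss\<bar>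
        \<le> (\<integral>z. \<bar>G (x + sqrt \<delta> *\<^sub>R z) + G (x - sqrt \<delta> *\<^sub>R z) - 2 * G x\<bar> \<partial>gauss)"
        by (rule integral_abs_bound)
      also have "\<dots> \<le> (\<integral>z. C * K * q powr ((\<beta> - 2) / 2) * \<delta> * norm z ^ 2 \<partial>(gauss :: (real^'d) measure))"
      proof (intro integral_mono integrable_abs)
        show "\<bar>G (x + sqrt \<delta> *\<^sub>R z) + G (x - sqrt \<delta> *\<^sub>R z) - 2 * G x\<bar> \<le> C * K * q powr ((\<beta> - 2) / 2) * \<delta> * norm z ^ 2" for z
        proof -
          have "(x - sqrt \<delta> *\<^sub>R z) + sqrt \<delta> *\<^sub>R z = x" by simp
          then have "\<bar>(G (x + sqrt \<delta> *\<^sub>R z) - G x) - (G x - G (x - sqrt \<delta> *\<^sub>R z))\<bar>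
              \<le> C * K * q powr ((\<beta> - 2) / 2) * norm (sqrt \<delta> *\<^sub>R z) * norm (sqrt \<delta> *\<^sub>R z)"
            using sd[OF g, of q "x - sqrt \<delta> *\<^sub>R z" "sqrt \<delta> *\<^sub>R z" "sqrt \<delta> *\<^sub>R z"] q by (simp only: G_def)
          also have "\<dots> = C * K * q powr ((\<beta> - 2) / 2) * (sqrt \<delta> * sqrt \<delta>) * norm z ^ 2"
            using q by (simp add: power2_eq_square)
          also have "sqrt \<delta> * sqrt \<delta> = \<delta>" using q by simp
          finally show ?thesis by (simp add: algebra_simps)
        qed
      qed (use i2 integrable_heat[OF bG, of x "sqrt \<delta>"] integrable_heat[OF bG, of x "- sqrt \<delta>"] in auto)
      also have "\<dots> = C * m2 * K * (\<delta> * q powr ((\<beta> - 2) / 2))"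
        by (simp add: m2_def)
      also have "\<dots> \<le> D * K * (\<delta> powr \<theta> * q powr (\<beta> / 2 - \<theta>))"
      proof (rule mult_mono)
        show "C * m2 * K \<le> D * K" using D K0 by (intro mult_right_mono) auto
        show "\<delta> * q powr ((\<beta> - 2) / 2) \<le> \<delta> powr \<theta> * q powr (\<beta> / 2 - \<theta>)"
        proof (cases "\<delta> = 0")
          case False
          with q have d: "0 < \<delta>" by simp
          have "\<delta> * q powr ((\<beta> - 2) / 2) = \<delta> powr \<theta> * \<delta> powr (1 - \<theta>) * q powr (\<beta> / 2 - 1)"
            using d powr_add[of \<delta> \<theta> "1 - \<theta>"] by (simp add: diff_divide_distrib)
          also have "\<dots> \<le> \<delta> powr \<theta> * q powr (1 - \<theta>) * q powr (\<beta> / 2 - 1)"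
            using True d \<theta> by (intro mult_right_mono mult_left_mono powr_mono2) auto
          also have "\<dots> = \<delta> powr \<theta> * q powr (\<beta> / 2 - \<theta>)"
          proof -
            have "q powr (1 - \<theta>) * q powr (\<beta> / 2 - 1) = q powr ((1 - \<theta>) + (\<beta> / 2 - 1))"
              by (rule powr_add[symmetric])
            then show ?thesis by (simp add: mult.assoc)
          qed
          finally show ?thesis .
        qed simp
      qed (use K0 D q m0 C in auto)
      finally have "\<bar>2 * (heat (q + \<delta>) g x - heat q g x)\<bar> \<le> D * K * (\<delta> powr \<theta> * q powr (\<beta> / 2 - \<theta>))"
        unfolding e .
      then show ?thesis by (simp add: mult.assoc)
    next
      case False
      then have d: "0 < \<delta>" "q < \<delta>" using q by auto
      have "\<bar>heat (q + \<delta>) g x - heat q g x\<bar> \<le> K * (1 + m1) * \<delta> powr (\<beta> / 2)"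
        using heat_time_diff_holder[OF g, of "q + \<delta>" q x] \<beta> q by (simp add: m1_def)
      also have "\<dots> \<le> K * D * (\<delta> powr \<theta> * q powr (\<beta> / 2 - \<theta>))"
      proof (intro mult_mono D order_refl)
        have "\<delta> powr (\<beta> / 2) = \<delta> powr \<theta> * \<delta> powr (\<beta> / 2 - \<theta>)"
          using d by (simp flip: powr_add)
        also have "\<dots> \<le> \<delta> powr \<theta> * q powr (\<beta> / 2 - \<theta>)"
          using d q \<theta> by (intro mult_left_mono powr_mono2') auto
        finally show "\<delta> powr (\<beta> / 2) \<le> \<delta> powr \<theta> * q powr (\<beta> / 2 - \<theta>)" .
      qed (use K0 D m0 in auto)
      finally show ?thesis by (simp add: mult_ac)
    qed
  qed
  then show ?thesis using D by blast
qed

text \<open>Half of the time \<open>q\<close> pays for the time difference, the other half for the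
  Lipschitz bound, at the price of one more factor q^(-1/2).\<close>

lemma holder_heat_time_diff_lipschitz:
  assumes \<beta>: "0 < \<beta>" "\<beta> < 1" and \<theta>: "\<beta> / 2 \<le> \<theta>" "\<theta> \<le> 1"
  shows "\<exists>C\<ge>1. \<forall>K (g :: real^'d \<Rightarrow> real) q \<delta> x y. holder K \<beta> g \<longrightarrow> 0 < q \<longrightarrow> 0 \<le> \<delta> \<longrightarrow> q + \<delta> \<le> 1 \<longrightarrow>
    \<bar>(heat (q + \<delta>) g x - heat q g x) - (heat (q + \<delta>) g y - heat q g y)\<bar>
      \<le> C * K * \<delta> powr \<theta> * q powr (\<beta> / 2 - \<theta> - 1 / 2) * norm (x - y)"
proof -
  obtain C where C: "1 \<le> C" and td: "\<And>K (g :: real^'d \<Rightarrow> real) q \<delta> x. holder K \<beta> g \<Longrightarrow> 0 < q \<Longrightarrow> 0 \<le> \<delta> \<Longrightarrow> q + \<delta> \<le> 1 \<Longrightarrow>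
    \<bar>heat (q + \<delta>) g x - heat q g x\<bar> \<le> C * K * \<delta> powr \<theta> * q powr (\<beta> / 2 - \<theta>)"
    using holder_heat_time_diff[OF \<beta> \<theta>] by blast
  define D where "D = 2 * C * 2 powr (\<theta> - \<beta> / 2 + 1 / 2)"
  have "1 \<le> 2 powr (\<theta> - \<beta> / 2 + 1 / 2)" using \<theta> by (intro ge_one_powr_ge_zero) auto
  then have "1 * 1 \<le> (2 * C) * 2 powr (\<theta> - \<beta> / 2 + 1 / 2)" using C by (intro mult_mono) auto
  then have D1: "1 \<le> D" by (simp add: D_def)
  have "\<bar>(heat (q + \<delta>) g x - heat q g x) - (heat (q + \<delta>) g y - heat q g y)\<bar>
      \<le> D * K * \<delta> powr \<theta> * q powr (\<beta> / 2 - \<theta> - 1 / 2) * norm (x - y)"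
    if g: "holder K \<beta> g" and q: "0 < q" "0 \<le> \<delta>" "q + \<delta> \<le> 1" for K and g :: "real^'d \<Rightarrow> real" and q \<delta> x y
  proof -
    have bc: "bcont g" using holder_bcont[OF g] \<beta> by simp
    define h where "h u = heat (q/2 + \<delta>) g u - heat (q/2) g u" for u
    have bh: "bcont h" unfolding h_def by (intro bcont_diff bcont_heat bc)
    have hb: "\<bar>h u\<bar> \<le> C * K * \<delta> powr \<theta> * (q/2) powr (\<beta> / 2 - \<theta>)" for u
      using td[OF g, of "q/2" \<delta> u] q by (simp add: h_def)
    have hh: "heat (q/2) h u = heat (q + \<delta>) g u - heat q g u" for u
    proof -
      have "heat (q/2) h u = heat (q/2) (heat (q/2 + \<delta>) g) u - heat (q/2) (heat (q/2) g) u"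
        unfolding h_def[abs_def] by (intro heat_diff bcont_heat bc)
      moreover have "q / 2 + \<delta> + q / 2 = q + \<delta>" by simp
      ultimately show ?thesis
        using heat_semigroup[OF bc, of "q/2 + \<delta>" "q/2" u] heat_semigroup[OF bc, of "q/2" "q/2" u] q by simp
    qed
    have "\<bar>heat (q/2) h x - heat (q/2) h y\<bar>
       \<le> 2 * (C * K * \<delta> powr \<theta> * (q/2) powr (\<beta> / 2 - \<theta>)) / sqrt (q/2) * norm (x - y)"
      using q by (intro heat_lipschitz[OF bh hb]) simp
    also have "\<dots> = 2 * C * K * \<delta> powr \<theta> * ((q/2) powr (\<beta> / 2 - \<theta>) / sqrt (q/2)) * norm (x - y)"
      by simp
    also have "(q/2) powr (\<beta> / 2 - \<theta>) / sqrt (q/2) = (q/2) powr (\<beta> / 2 - \<theta> - 1 / 2)"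
      using q by (simp add: powr_diff powr_half_sqrt)
    also have "\<dots> = q powr (\<beta> / 2 - \<theta> - 1 / 2) * 2 powr (\<theta> - \<beta> / 2 + 1 / 2)"
    proof -
      have "\<theta> - \<beta> / 2 + 1 / 2 = - (\<beta> / 2 - \<theta> - 1 / 2)" by simp
      then have "2 powr (\<theta> - \<beta> / 2 + 1 / 2) = inverse (2 powr (\<beta> / 2 - \<theta> - 1 / 2))"
        by (simp only: powr_minus)
      moreover have "(q/2) powr (\<beta> / 2 - \<theta> - 1 / 2) = q powr (\<beta> / 2 - \<theta> - 1 / 2) / 2 powr (\<beta> / 2 - \<theta> - 1 / 2)"
        using q by (simp only: powr_divide)
      ultimately show ?thesis by (simp only: divide_inverse[of "q powr _"])
    qed
    finally show ?thesis unfolding hh by (simp add: D_def mult_ac)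
  qed
  then show ?thesis using D1 by blast
qed

end

section \<open>Dyadic stochastic sewing\<close>

lemma sum_double_index: "(\<Sum>j<2 * P. f j) = (\<Sum>i<P. f (2 * i) + f (Suc (2 * i)))" for f :: "nat \<Rightarrow> real"
  by (induction P) auto

lemma sum_telescope_diff: "(\<Sum>k<L. f k - f (Suc k)) = f 0 - f L" for f :: "nat \<Rightarrow> real"
  by (induction L) auto

text \<open>\<open>QS g s N \<delta> x\<close> is the right-endpoint Riemann sum of
  \<open>r \<mapsto> E g(r, x + B\<^sub>r - B\<^sub>s)\<close> on \<open>[s, s + N \<delta>]\<close>.\<close>

definition QS :: "(real \<Rightarrow> real^'d \<Rightarrow> real) \<Rightarrow> real \<Rightarrow> nat \<Rightarrow> real \<Rightarrow> real^'d \<Rightarrow> real" where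
  "QS g s N \<delta> x = \<delta> * (\<Sum>l=1..N. heat (real l * \<delta>) (g (s + real l * \<delta>)) x)"

lemma bcont_QS: "(\<And>t. bcont (g t)) \<Longrightarrow> bcont (QS g s N \<delta>)"
  unfolding QS_def by (intro bcont_cmult bcont_sum bcont_heat) auto

lemma QS_bound:
  assumes "\<And>t. bcont (g t)" "\<And>t x. \<bar>g t x\<bar> \<le> K" "0 \<le> \<delta>"
  shows "\<bar>QS g s N \<delta> x\<bar> \<le> K * (real N * \<delta>)"
proof -
  have "\<bar>\<Sum>l=1..N. heat (real l * \<delta>) (g (s + real l * \<delta>)) x\<bar> \<le> (\<Sum>l=1..N. K)"
    using heat_bound[OF assms(1) assms(2)] by (intro sum_abs[THEN order_trans] sum_mono) auto
  then have "\<delta> * \<bar>\<Sum>l=1..N. heat (real l * \<delta>) (g (s + real l * \<delta>)) x\<bar> \<le> \<delta> * (\<Sum>l=1..N. K)"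
    by (rule mult_left_mono[OF _ assms(3)])
  then show ?thesis using assms(3) by (simp add: QS_def abs_mult mult_ac)
qed

context filtered_bm
begin

text \<open>Tower property: a later block seen from the start is the heat image of the block seen
  from its own left end. Hence refining a partition changes the sums only by one-step prediction
  errors.\<close>

lemma QS_split:
  assumes "\<And>t. bcont (g t)" "0 \<le> \<delta>" "real (N + N') * \<delta> \<le> 1"
  shows "QS g s (N + N') \<delta> x = QS g s N \<delta> x + heat (real N * \<delta>) (QS g (s + real N * \<delta>) N' \<delta>) (x :: real^'d)"
proof -
  have "heat (real N * \<delta>) (QS g (s + real N * \<delta>) N' \<delta>) x
      = \<delta> * (\<Sum>l=1..N'. heat (real N * \<delta>) (heat (real l * \<delta>) (g (s + real N * \<delta> + real l * \<delta>))) x)"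
    unfolding QS_def by (simp add: heat_cmult heat_sum bcont_heat assms(1))
  also have "(\<Sum>l=1..N'. heat (real N * \<delta>) (heat (real l * \<delta>) (g (s + real N * \<delta> + real l * \<delta>))) x)
      = (\<Sum>l=1..N'. heat (real (l + N) * \<delta>) (g (s + real (l + N) * \<delta>)) x)"
  proof (rule sum.cong)
    fix l assume l: "l \<in> {1..N'}"
    have "real l * \<delta> + real N * \<delta> \<le> 1"
    proof -
      have "real (l + N) * \<delta> \<le> real (N + N') * \<delta>"
        using l assms(2) by (intro mult_right_mono) auto
      then show ?thesis using assms(3) by (simp add: distrib_right)
    qed
    then show "heat (real N * \<delta>) (heat (real l * \<delta>) (g (s + real N * \<delta> + real l * \<delta>))) x
       = heat (real (l + N) * \<delta>) (g (s + real (l + N) * \<delta>)) x"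
      using heat_semigroup[OF assms(1), of "real l * \<delta>" "real N * \<delta>"] assms(2)
      by (simp add: distrib_right add_ac)
  qed simp
  also have "\<dots> = (\<Sum>l=1+N..N'+N. heat (real l * \<delta>) (g (s + real l * \<delta>)) x)"
    by (rule sum.shift_bounds_cl_nat_ivl[symmetric])
  finally have e: "heat (real N * \<delta>) (QS g (s + real N * \<delta>) N' \<delta>) x = \<delta> * \<dots>" .
  have "{1..N + N'} = {1..N} \<union> {1 + N..N' + N}" by auto
  then have "(\<Sum>l=1..N+N'. heat (real l * \<delta>) (g (s + real l * \<delta>)) x)
     = (\<Sum>l=1..N. heat (real l * \<delta>) (g (s + real l * \<delta>)) x) + (\<Sum>l=1+N..N'+N. heat (real l * \<delta>) (g (s + real l * \<delta>)) x)"
    by (simp only:) (subst sum.union_disjoint, auto)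
  then show ?thesis unfolding e by (simp add: QS_def distrib_left)
qed

text \<open>Sums the pointwise smoothing bounds, with singularities of order (\<beta>-1)/2 and
  (\<beta>-2)/2 in the elapsed time. Both are integrable at 0, and integration adds one to each
  exponent. The constant depends on neither the mesh nor \<open>g\<close>.\<close>

lemma QS_regularity:
  assumes \<beta>: "0 < \<beta>" "\<beta> < 1"
  shows "\<exists>C\<ge>1. \<forall>K (g :: real \<Rightarrow> real^'d \<Rightarrow> real) s N \<delta>. (\<forall>t. holder K \<beta> (g t)) \<longrightarrow> 0 < \<delta> \<longrightarrow> real N * \<delta> \<le> 1 \<longrightarrow>
    (\<forall>x y. \<bar>QS g s N \<delta> x - QS g s N \<delta> y\<bar> \<le> C * K * (real N * \<delta>) powr ((1 + \<beta>) / 2) * norm (x - y)) \<and>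
    (\<forall>x a b. \<bar>(QS g s N \<delta> (x + a + b) - QS g s N \<delta> (x + b)) - (QS g s N \<delta> (x + a) - QS g s N \<delta> x)\<bar>
       \<le> C * K * (real N * \<delta>) powr (\<beta> / 2) * norm a * norm b)"
proof -
  obtain C1 where C1: "1 \<le> C1" and lip: "\<And>K (g :: real^'d \<Rightarrow> real) r x y. holder K \<beta> g \<Longrightarrow> 0 < r \<Longrightarrow> r \<le> 1 \<Longrightarrow>
    \<bar>heat r g x - heat r g y\<bar> \<le> C1 * K * r powr ((\<beta> - 1) / 2) * norm (x - y)"
    using holder_heat_lipschitz[OF \<beta>] by blast
  obtain C2 where C2: "1 \<le> C2" and sd: "\<And>K (g :: real^'d \<Rightarrow> real) r x a b. holder K \<beta> g \<Longrightarrow> 0 < r \<Longrightarrow> r \<le> 1 \<Longrightarrow>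
    \<bar>(heat r g (x + a + b) - heat r g (x + b)) - (heat r g (x + a) - heat r g x)\<bar>
      \<le> C2 * K * r powr ((\<beta> - 2) / 2) * norm a * norm b"
    using holder_heat_second_diff[OF \<beta>] by blast
  define C where "C = 2 * C1 + 2 / \<beta> * C2"
  have CC: "C1 / ((1 + \<beta>) / 2) \<le> C" "C2 / (\<beta> / 2) \<le> C" "1 \<le> C"
  proof -
    have "C1 / ((1 + \<beta>) / 2) = 2 * (C1 / (1 + \<beta>))" by simp
    also have "\<dots> \<le> 2 * C1" using C1 \<beta> by (simp add: divide_le_eq mult_le_cancel_left1)
    finally show "C1 / ((1 + \<beta>) / 2) \<le> C" using C2 \<beta> by (simp add: C_def) (smt (verit) divide_nonneg_nonneg)
    show "C2 / (\<beta> / 2) \<le> C" using C1 by (simp add: C_def mult.commute)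
    have "0 \<le> 2 / \<beta> * C2" using C2 \<beta> by simp
    then show "1 \<le> C" using C1 by (simp add: C_def)
  qed
  show ?thesis
  proof (intro exI[of _ C] conjI allI impI)
    fix K s \<delta> :: real and g :: "real \<Rightarrow> real^'d \<Rightarrow> real" and N x y
    assume g: "\<forall>t. holder K \<beta> (g t)" and \<delta>: "0 < \<delta>" and N: "real N * \<delta> \<le> 1"
    have K0: "0 \<le> K" using g holder_nonneg by blast
    have l: "0 < real l * \<delta>" "real l * \<delta> \<le> 1" if "l \<in> {1..N}" for l
    proof -
      have "real l * \<delta> \<le> real N * \<delta>" using that \<delta> by (intro mult_right_mono) auto
      then show "real l * \<delta> \<le> 1" using N by linarith
      show "0 < real l * \<delta>" using that \<delta> by auto
    qed
    have "\<bar>QS g s N \<delta> x - QS g s N \<delta> y\<bar>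
       = \<delta> * \<bar>\<Sum>l=1..N. heat (real l * \<delta>) (g (s + real l * \<delta>)) x - heat (real l * \<delta>) (g (s + real l * \<delta>)) y\<bar>"
      using \<delta> by (simp add: QS_def right_diff_distrib[symmetric] sum_subtractf[symmetric] abs_mult)
    also have "\<dots> \<le> \<delta> * (\<Sum>l=1..N. C1 * K * (real l * \<delta>) powr ((\<beta> - 1) / 2) * norm (x - y))"
      using \<delta> lip g l by (intro mult_left_mono sum_abs[THEN order_trans] sum_mono) auto
    also have "\<dots> = C1 * K * norm (x - y) * (\<Sum>l=1..N. \<delta> * (real l * \<delta>) powr (- ((1 - \<beta>) / 2)))"
      by (simp add: sum_distrib_left mult_ac minus_divide_left)
    also have "\<dots> \<le> C1 * K * norm (x - y) * ((real N * \<delta>) powr (1 - (1 - \<beta>) / 2) / (1 - (1 - \<beta>) / 2))"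
      using C1 K0 \<beta> \<delta> by (intro mult_left_mono sum_scaled_powr_le) auto
    also have "1 - (1 - \<beta>) / 2 = (1 + \<beta>) / 2" by (simp add: field_simps)
    also have "C1 * K * norm (x - y) * ((real N * \<delta>) powr ((1 + \<beta>) / 2) / ((1 + \<beta>) / 2))
       = (C1 / ((1 + \<beta>) / 2)) * (K * (real N * \<delta>) powr ((1 + \<beta>) / 2) * norm (x - y))"
      by simp
    also have "\<dots> \<le> C * (K * (real N * \<delta>) powr ((1 + \<beta>) / 2) * norm (x - y))"
      using CC K0 by (intro mult_right_mono) auto
    finally show "\<bar>QS g s N \<delta> x - QS g s N \<delta> y\<bar> \<le> C * K * (real N * \<delta>) powr ((1 + \<beta>) / 2) * norm (x - y)"
      by (simp add: mult.assoc)
  next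
    fix K s \<delta> :: real and g :: "real \<Rightarrow> real^'d \<Rightarrow> real" and N x a b
    assume g: "\<forall>t. holder K \<beta> (g t)" and \<delta>: "0 < \<delta>" and N: "real N * \<delta> \<le> 1"
    have K0: "0 \<le> K" using g holder_nonneg by blast
    have l: "0 < real l * \<delta>" "real l * \<delta> \<le> 1" if "l \<in> {1..N}" for l
    proof -
      have "real l * \<delta> \<le> real N * \<delta>" using that \<delta> by (intro mult_right_mono) auto
      then show "real l * \<delta> \<le> 1" using N by linarith
      show "0 < real l * \<delta>" using that \<delta> by auto
    qed
    define h where "h l u = heat (real l * \<delta>) (g (s + real l * \<delta>)) u" for l u
    have "\<bar>(QS g s N \<delta> (x + a + b) - QS g s N \<delta> (x + b)) - (QS g s N \<delta> (x + a) - QS g s N \<delta> x)\<bar>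
       = \<delta> * \<bar>\<Sum>l=1..N. (h l (x + a + b) - h l (x + b)) - (h l (x + a) - h l x)\<bar>"
      using \<delta> by (simp add: QS_def h_def right_diff_distrib[symmetric] sum_subtractf[symmetric] abs_mult)
    also have "\<dots> \<le> \<delta> * (\<Sum>l=1..N. C2 * K * (real l * \<delta>) powr ((\<beta> - 2) / 2) * norm a * norm b)"
      using \<delta> sd g l unfolding h_def by (intro mult_left_mono sum_abs[THEN order_trans] sum_mono) auto
    also have "\<dots> = C2 * K * (norm a * norm b) * (\<Sum>l=1..N. \<delta> * (real l * \<delta>) powr (- ((2 - \<beta>) / 2)))"
      by (simp add: sum_distrib_left mult_ac minus_divide_left)
    also have "\<dots> \<le> C2 * K * (norm a * norm b) * ((real N * \<delta>) powr (1 - (2 - \<beta>) / 2) / (1 - (2 - \<beta>) / 2))"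
      using C2 K0 \<beta> \<delta> by (intro mult_left_mono sum_scaled_powr_le) auto
    also have "1 - (2 - \<beta>) / 2 = \<beta> / 2" by (simp add: field_simps)
    also have "C2 * K * (norm a * norm b) * ((real N * \<delta>) powr (\<beta> / 2) / (\<beta> / 2))
       = (C2 / (\<beta> / 2)) * (K * (real N * \<delta>) powr (\<beta> / 2) * (norm a * norm b))"
      by simp
    also have "\<dots> \<le> C * (K * (real N * \<delta>) powr (\<beta> / 2) * (norm a * norm b))"
      using CC K0 by (intro mult_right_mono) auto
    finally show "\<bar>(QS g s N \<delta> (x + a + b) - QS g s N \<delta> (x + b)) - (QS g s N \<delta> (x + a) - QS g s N \<delta> x)\<bar>
       \<le> C * K * (real N * \<delta>) powr (\<beta> / 2) * norm a * norm b"
      by (simp add: mult.assoc)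
  qed (use CC in simp)
qed

lemma orthogonal_increment:
  fixes S :: "'w \<Rightarrow> real" and Y :: "'w \<Rightarrow> real^'d"
  assumes st: "0 \<le> s" "s \<le> t" "t \<le> 1"
    and S: "S \<in> borel_measurable (F s)" "\<And>\<omega>. \<omega> \<in> space M \<Longrightarrow> \<bar>S \<omega>\<bar> \<le> A"
    and Y: "Y \<in> borel_measurable (F s)" and g: "bcont g"
  shows "integrable M (\<lambda>\<omega>. S \<omega> * (heat (t - s) g (Y \<omega>) - g (Y \<omega> + (B t \<omega> - B s \<omega>))))"
    and "expectation (\<lambda>\<omega>. S \<omega> * (heat (t - s) g (Y \<omega>) - g (Y \<omega> + (B t \<omega> - B s \<omega>)))) = 0"
proof -
  have [measurable]: "S \<in> borel_measurable M" "Y \<in> borel_measurable M"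
    "B t \<in> borel_measurable M" "B s \<in> borel_measurable M"
    using measurable_F_M[OF S(1)] measurable_F_M[OF Y] st B_measurable by auto
  note [measurable] = bcont_measurable[OF g] bcont_measurable[OF bcont_heat[OF g]]
  have int: "integrable M (\<lambda>\<omega>. S \<omega> * h (Z \<omega>))"
    if h: "bcont h" and [measurable]: "Z \<in> borel_measurable M" for h :: "real^'d \<Rightarrow> real" and Z
  proof -
    obtain A' where A': "\<And>x. \<bar>h x\<bar> \<le> A'" using h by (auto simp: bcont_def)
    note [measurable] = bcont_measurable[OF h]
    show ?thesis
    proof (rule integrable_const_bound[where B = "\<bar>A\<bar> * \<bar>A'\<bar>"])
      show "AE \<omega> in M. norm (S \<omega> * h (Z \<omega>)) \<le> \<bar>A\<bar> * \<bar>A'\<bar>"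
      proof (rule AE_I2)
        fix \<omega> assume "\<omega> \<in> space M"
        then show "norm (S \<omega> * h (Z \<omega>)) \<le> \<bar>A\<bar> * \<bar>A'\<bar>"
          using S(2)[of \<omega>] A'[of "Z \<omega>"] unfolding real_norm_def abs_mult by (intro mult_mono) linarith+
      qed
    qed simp
  qed
  have i: "integrable M (\<lambda>\<omega>. S \<omega> * heat (t - s) g (Y \<omega>))" "integrable M (\<lambda>\<omega>. S \<omega> * g (Y \<omega> + (B t \<omega> - B s \<omega>)))"
    by (rule int[OF bcont_heat[OF g]], simp) (rule int[OF g], simp)
  show "integrable M (\<lambda>\<omega>. S \<omega> * (heat (t - s) g (Y \<omega>) - g (Y \<omega> + (B t \<omega> - B s \<omega>))))"
    using i by (simp add: right_diff_distrib)
  show "expectation (\<lambda>\<omega>. S \<omega> * (heat (t - s) g (Y \<omega>) - g (Y \<omega> + (B t \<omega> - B s \<omega>)))) = 0"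
    using i expectation_increment[OF st S Y g] by (simp add: right_diff_distrib)
qed

text \<open>Brownian motion plus an adapted K-Lipschitz path, the common form of the solution and of
  the scheme. The exceptional null set may depend on the two times, since only finitely many times
  are evaluated in any one Riemann sum.\<close>

definition drifted :: "real \<Rightarrow> (real \<Rightarrow> 'w \<Rightarrow> real^'d) \<Rightarrow> bool" where
  "drifted K X \<longleftrightarrow> (\<forall>t\<in>{0..1}. X t \<in> borel_measurable (F t)) \<and>
     (\<forall>s\<in>{0..1}. \<forall>u\<in>{0..1}. s \<le> u \<longrightarrow>
        (AE \<omega> in M. norm (X u \<omega> - X s \<omega> - (B u \<omega> - B s \<omega>)) \<le> K * (u - s)))"

lemma driftedD:
  assumes "drifted K X"
  shows "0 \<le> t \<Longrightarrow> t \<le> 1 \<Longrightarrow> X t \<in> borel_measurable (F t)"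
    and "0 \<le> t \<Longrightarrow> t \<le> 1 \<Longrightarrow> X t \<in> borel_measurable M"
    and "0 \<le> s \<Longrightarrow> s \<le> u \<Longrightarrow> u \<le> 1 \<Longrightarrow> AE \<omega> in M. norm (X u \<omega> - X s \<omega> - (B u \<omega> - B s \<omega>)) \<le> K * (u - s)"
  using assms measurable_F_M[of "X t" t] by (auto simp: drifted_def)

text \<open>One level of the dyadic sewing argument: \<open>P\<close> blocks of length \<open>2 H\<close>, with the increment over
  the first half of each block split into a martingale difference and a remainder that only sees
  the drifts.\<close>

lemma sewing_level:
  fixes g :: "real \<Rightarrow> real^'d \<Rightarrow> real"
  assumes \<beta>: "0 < \<beta>" "\<beta> < 1" and m: "1 \<le> m" and K: "0 < K" and a: "0 < a" and N0: "0 \<le> N"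
    and g: "\<And>t. holder K \<beta> (g t)"
    and X: "drifted K X" and Y: "drifted K Y"
    and ST: "0 \<le> S" "S + real P * (2 * H) \<le> 1" and H: "H = real n * \<delta>" "0 < \<delta>" "1 \<le> n"
    and E: "\<And>t. S \<le> t \<Longrightarrow> t \<le> S + real P * (2 * H) \<Longrightarrow> Lq_le M (2 * m) a (\<lambda>\<omega>. norm (X t \<omega> - Y t \<omega>))"
    and N: "\<And>s t. S \<le> s \<Longrightarrow> s < t \<Longrightarrow> t \<le> S + real P * (2 * H) \<Longrightarrow>
        Lq_le M (2 * m) (N * (t - s) powr \<eta>) (\<lambda>\<omega>. norm ((X t \<omega> - Y t \<omega>) - (X s \<omega> - Y s \<omega>)))"
    and C: "1 \<le> C"
    and QL: "\<And>s x y. \<bar>QS g s n \<delta> x - QS g s n \<delta> y\<bar> \<le> C * K * H powr ((1 + \<beta>) / 2) * norm (x - y)"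
    and QD: "\<And>s x a b. \<bar>(QS g s n \<delta> (x + a + b) - QS g s n \<delta> (x + b)) - (QS g s n \<delta> (x + a) - QS g s n \<delta> x)\<bar>
       \<le> C * K * H powr (\<beta> / 2) * norm a * norm b"
  defines "s \<equiv> \<lambda>i. S + real i * (2 * H)"
  defines "q \<equiv> \<lambda>i. QS g (s i + H) n \<delta>"
  shows "Lq_le M (2 * m)
    (sqrt (3 * 4 ^ m) * sqrt (real P) * (2 * (C * K * H powr ((1 + \<beta>) / 2)) * a)
      + real P * (C * K * H powr (\<beta> / 2) * (K * H) * a + C * K * H powr ((1 + \<beta>) / 2) * (N * H powr \<eta>)))
    (\<lambda>\<omega>. \<Sum>i<P. (heat H (q i) (X (s i) \<omega>) - q i (X (s i + H) \<omega>)) - (heat H (q i) (Y (s i) \<omega>) - q i (Y (s i + H) \<omega>)))"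
proof -
  have H0: "0 < H" using H by simp
  define \<Lambda> where "\<Lambda> = C * K * H powr ((1 + \<beta>) / 2)"
  have \<Lambda>: "0 < \<Lambda>" using C K H0 by (simp add: \<Lambda>_def)
  have gbc: "bcont (g t)" for t using holder_bcont[OF g] \<beta> by simp
  have gb: "\<bar>g t x\<bar> \<le> K" for t x using g by (auto simp: holder_def)
  have qbc: "bcont (q i)" for i unfolding q_def by (intro bcont_QS gbc)
  have qb: "\<bar>q i x\<bar> \<le> K * H" for i x
    unfolding q_def H(1) using H by (intro QS_bound gbc gb) auto
  have ql: "\<bar>q i x - q i y\<bar> \<le> \<Lambda> * norm (x - y)" for i x y
    unfolding q_def \<Lambda>_def by (rule QL)
  have si: "0 \<le> s i" "s i \<le> s i + H" "s i + H \<le> s (Suc i)" "s (Suc i) \<le> S + real P * (2 * H)" "s (Suc i) \<le> 1" "S \<le> s i"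
    if "i < P" for i
  proof -
    have "real (Suc i) * (2 * H) \<le> real P * (2 * H)" using that H0 by (intro mult_right_mono) auto
    then show "s (Suc i) \<le> S + real P * (2 * H)" "s (Suc i) \<le> 1" using ST by (auto simp: s_def)
  qed (use ST H0 in \<open>auto simp: s_def algebra_simps\<close>)
  have s_le: "0 \<le> s i" "s i \<le> 1" if "i \<le> P" for i
  proof -
    have "real i * (2 * H) \<le> real P * (2 * H)" using that H0 by (intro mult_right_mono) auto
    then show "s i \<le> 1" using ST by (auto simp: s_def)
  qed (use ST H0 in \<open>auto simp: s_def\<close>)
  define dB where "dB i \<omega> = B (s i + H) \<omega> - B (s i) \<omega>" for i \<omega>
  \<comment> \<open>The prediction from s_i is compared with the value at the point reached by the
    Brownian increment alone. It is conditionally centred for X and for Y separately; the difference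
    of the two is moreover small when X and Y are close.\<close>
  define Mt where "Mt i \<omega> = (heat H (q i) (X (s i) \<omega>) - q i (X (s i) \<omega> + dB i \<omega>))
     - (heat H (q i) (Y (s i) \<omega>) - q i (Y (s i) \<omega> + dB i \<omega>))" for i \<omega>
  \<comment> \<open>The correction for the drift accumulated over the half block, again as a
    difference between X and Y.\<close>
  define Dt where "Dt i \<omega> = (q i (X (s i) \<omega> + dB i \<omega>) - q i (X (s i + H) \<omega>))
     - (q i (Y (s i) \<omega> + dB i \<omega>) - q i (Y (s i + H) \<omega>))" for i \<omega>
  have qm [measurable]: "q i \<in> borel_measurable borel" "heat H (q i) \<in> borel_measurable borel" for i
    using bcont_measurable[OF qbc] bcont_measurable[OF bcont_heat[OF qbc]] by auto
  have MtF: "Mt i \<in> borel_measurable (F (s (Suc i)))" if i: "i < P" for i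
  proof -
    have [measurable]: "X (s i) \<in> borel_measurable (F (s (Suc i)))" "Y (s i) \<in> borel_measurable (F (s (Suc i)))"
      "B (s i) \<in> borel_measurable (F (s (Suc i)))" "B (s i + H) \<in> borel_measurable (F (s (Suc i)))"
      using si[OF i] driftedD(1)[OF X, of "s i"] driftedD(1)[OF Y, of "s i"] adapted[of "s i"] adapted[of "s i + H"]
      by (auto intro: measurable_F_mono)
    show ?thesis unfolding Mt_def[abs_def] dB_def by measurable
  qed
  have XM [measurable]: "X (s i) \<in> borel_measurable M" "X (s i + H) \<in> borel_measurable M"
    "Y (s i) \<in> borel_measurable M" "Y (s i + H) \<in> borel_measurable M" 
    "B (s i) \<in> borel_measurable M" "B (s i + H) \<in> borel_measurable M" if "i < P" for i
    using si[OF that] driftedD(2)[OF X] driftedD(2)[OF Y] B_measurable by auto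
  have hqb: "\<bar>heat H (q i) x\<bar> \<le> K * H" for i x by (rule heat_bound[OF qbc qb])
  have hql: "\<bar>heat H (q i) x - heat H (q i) y\<bar> \<le> \<Lambda> * norm (x - y)" for i x y
  proof -
    have "\<bar>q i (u + (x - y)) - q i u\<bar> \<le> \<Lambda> * norm (x - y)" for u
      using ql[of i "u + (x - y)" u] by simp
    from heat_osc_le[OF qbc this, of H y] show ?thesis by simp
  qed
  have MtL: "\<bar>Mt i \<omega>\<bar> \<le> 2 * \<Lambda> * norm (X (s i) \<omega> - Y (s i) \<omega>)" for i \<omega>
    using hql[of i "X (s i) \<omega>" "Y (s i) \<omega>"] ql[of i "X (s i) \<omega> + dB i \<omega>" "Y (s i) \<omega> + dB i \<omega>"]
    unfolding Mt_def by simp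
  have MtLq: "Lq_le M (2 * m) (2 * \<Lambda> * a) (Mt i)" if i: "i < P" for i
  proof (rule Lq_le_mono)
    show "Lq_le M (2 * m) (\<bar>2 * \<Lambda>\<bar> * a) (\<lambda>\<omega>. 2 * \<Lambda> * norm (X (s i) \<omega> - Y (s i) \<omega>))"
      using si[OF i] by (intro Lq_le_cmult E) auto
    show "Mt i \<in> borel_measurable M"
      using XM[OF i] unfolding Mt_def[abs_def] dB_def by measurable
    show "AE \<omega> in M. \<bar>Mt i \<omega>\<bar> \<le> \<bar>2 * \<Lambda> * norm (X (s i) \<omega> - Y (s i) \<omega>)\<bar>"
      using MtL \<Lambda> by (intro AE_I2) (auto simp: abs_mult)
  qed (use \<Lambda> in simp)
  have "Lq_le M (2 * m) (sqrt (3 * 4 ^ m) * sqrt (real P) * (2 * \<Lambda> * a)) (\<lambda>\<omega>. \<Sum>i<P. Mt i \<omega>)"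
  proof (rule Lq_le_martingale_sum[where F = "\<lambda>i. F (s i)" and A = "4 * (K * H)"])
    show "subalgebra M (F (s i))" if "i \<le> P" for i using s_le[OF that] by (rule subalg)
    show "sets (F (s i)) \<subseteq> sets (F (s j))" if "i \<le> j" "j \<le> P" for i j
    proof -
      have "real i * (2 * H) \<le> real j * (2 * H)" using that H0 by (intro mult_right_mono) auto
      then show ?thesis using s_le[of i] s_le[of j] that by (intro filtration_mono) (auto simp: s_def)
    qed
    show "\<bar>Mt i \<omega>\<bar> \<le> 4 * (K * H)" for i \<omega>
      using hqb[of i "X (s i) \<omega>"] hqb[of i "Y (s i) \<omega>"] qb[of i "X (s i) \<omega> + dB i \<omega>"] qb[of i "Y (s i) \<omega> + dB i \<omega>"]
      unfolding Mt_def by linarith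
    show "expectation (\<lambda>\<omega>. Z \<omega> * Mt i \<omega>) = 0"
      if i: "i < P" and Z: "Z \<in> borel_measurable (F (s i))" "\<And>\<omega>. \<omega> \<in> space M \<Longrightarrow> \<bar>Z \<omega>\<bar> \<le> Ab" for i Z Ab
    proof -
      have sH: "0 \<le> s i" "s i \<le> s i + H" "s i + H \<le> 1" using si[OF i] by auto
      note oX = orthogonal_increment[OF sH Z driftedD(1)[OF X] qbc, of i]
      note oY = orthogonal_increment[OF sH Z driftedD(1)[OF Y] qbc, of i]
      have "expectation (\<lambda>\<omega>. Z \<omega> * Mt i \<omega>) =
         expectation (\<lambda>\<omega>. Z \<omega> * (heat H (q i) (X (s i) \<omega>) - q i (X (s i) \<omega> + dB i \<omega>)))
         - expectation (\<lambda>\<omega>. Z \<omega> * (heat H (q i) (Y (s i) \<omega>) - q i (Y (s i) \<omega> + dB i \<omega>)))"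
        unfolding Mt_def right_diff_distrib[of "Z _" "heat H (q i) (X (s i) _) - _" "heat H (q i) (Y (s i) _) - _"]
        using oX(1) oY(1) sH by (intro Bochner_Integration.integral_diff) (auto simp: dB_def)
      also have "\<dots> = 0" using oX(2) oY(2) sH by (simp add: dB_def)
      finally show ?thesis .
    qed
  qed (use m a \<Lambda> MtF MtLq in auto)
  moreover have "Lq_le M (2 * m) (real P * (C * K * H powr (\<beta> / 2) * (K * H) * a + \<Lambda> * (N * H powr \<eta>))) (\<lambda>\<omega>. \<Sum>i<P. Dt i \<omega>)"
  proof (rule Lq_le_sum_const)
    fix i assume i: "i < P"
    define c where "c = C * K * H powr (\<beta> / 2) * (K * H)"
    have c0: "0 \<le> c" using C K H0 by (simp add: c_def)
    let ?E = "\<lambda>t \<omega>. X t \<omega> - Y t \<omega>"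
    have "Lq_le M (2 * m) (\<bar>c\<bar> * a + \<bar>\<Lambda>\<bar> * (N * (s i + H - s i) powr \<eta>))
       (\<lambda>\<omega>. c * norm (?E (s i) \<omega>) + \<Lambda> * norm (?E (s i + H) \<omega> - ?E (s i) \<omega>))"
      using si[OF i] m H0 by (intro Lq_le_add Lq_le_cmult E N) auto
    then have "Lq_le M (2 * m) (c * a + \<Lambda> * (N * H powr \<eta>))
       (\<lambda>\<omega>. c * norm (?E (s i) \<omega>) + \<Lambda> * norm (?E (s i + H) \<omega> - ?E (s i) \<omega>))"
      using c0 \<Lambda> by simp
    then show "Lq_le M (2 * m) (C * K * H powr (\<beta> / 2) * (K * H) * a + \<Lambda> * (N * H powr \<eta>)) (Dt i)"
      unfolding c_def[symmetric]
    proof (rule Lq_le_mono)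
      show "Dt i \<in> borel_measurable M"
        using XM[OF i] unfolding Dt_def[abs_def] dB_def by measurable
      have "AE \<omega> in M. norm (X (s i + H) \<omega> - X (s i) \<omega> - (B (s i + H) \<omega> - B (s i) \<omega>)) \<le> K * (s i + H - s i)"
        using si[OF i] by (intro driftedD(3)[OF X]) auto
      then show "AE \<omega> in M. \<bar>Dt i \<omega>\<bar> \<le> \<bar>c * norm (?E (s i) \<omega>) + \<Lambda> * norm (?E (s i + H) \<omega> - ?E (s i) \<omega>)\<bar>"
      proof eventually_elim
        case (elim \<omega>)
        define x where "x = X (s i) \<omega> + dB i \<omega>"
        define y where "y = Y (s i) \<omega> + dB i \<omega>"
        define u where "u = X (s i + H) \<omega> - x"
        define v where "v = Y (s i + H) \<omega> - y"
        have u: "norm u \<le> K * H" using elim by (simp add: u_def x_def dB_def algebra_simps)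
        \<comment> \<open>X moves by its drift u and Y by v. The common shift u is charged to a
          second difference, which is small in both u and x - y; what remains is a shift by v - u,
          minus the increment of X - Y over the half block.\<close>
        have "Dt i \<omega> = - ((q i (y + u + (x - y)) - q i (y + (x - y))) - (q i (y + u) - q i y)) + (q i (y + v) - q i (y + u))"
          by (simp add: Dt_def x_def[symmetric] y_def[symmetric] u_def v_def)
        moreover have "\<bar>(q i (y + u + (x - y)) - q i (y + (x - y))) - (q i (y + u) - q i y)\<bar>
            \<le> C * K * H powr (\<beta> / 2) * norm u * norm (x - y)"
          unfolding q_def by (rule QD)
        moreover have "\<dots> \<le> C * K * H powr (\<beta> / 2) * (K * H) * norm (x - y)"
          using u C K by (intro mult_right_mono mult_left_mono) auto
        moreover have "\<bar>q i (y + v) - q i (y + u)\<bar> \<le> \<Lambda> * norm ((y + v) - (y + u))" by (rule ql)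
        ultimately have bd: "\<bar>Dt i \<omega>\<bar> \<le> c * norm (x - y) + \<Lambda> * norm ((y + v) - (y + u))"
          unfolding c_def by linarith
        have nn: "norm ((y + v) - (y + u)) = norm (?E (s i + H) \<omega> - ?E (s i) \<omega>)"
        proof -
          have "(y + v) - (y + u) = - (?E (s i + H) \<omega> - ?E (s i) \<omega>)"
            by (simp add: u_def v_def x_def y_def)
          then show ?thesis by (simp only: norm_minus_cancel)
        qed
        have "x - y = ?E (s i) \<omega>" by (simp add: x_def y_def)
        with bd have "\<bar>Dt i \<omega>\<bar> \<le> c * norm (?E (s i) \<omega>) + \<Lambda> * norm (?E (s i + H) \<omega> - ?E (s i) \<omega>)"
          unfolding nn by simp
        then show ?case by linarith
      qed
    qed simp
  qed (use m in simp)
  ultimately have "Lq_le M (2 * m) (sqrt (3 * 4 ^ m) * sqrt (real P) * (2 * \<Lambda> * a)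
     + real P * (C * K * H powr (\<beta> / 2) * (K * H) * a + \<Lambda> * (N * H powr \<eta>))) (\<lambda>\<omega>. (\<Sum>i<P. Mt i \<omega>) + (\<Sum>i<P. Dt i \<omega>))"
    using m by (intro Lq_le_add) auto
  also have "(\<lambda>\<omega>. (\<Sum>i<P. Mt i \<omega>) + (\<Sum>i<P. Dt i \<omega>)) = (\<lambda>\<omega>. \<Sum>i<P. (heat H (q i) (X (s i) \<omega>) - q i (X (s i + H) \<omega>)) - (heat H (q i) (Y (s i) \<omega>) - q i (Y (s i + H) \<omega>)))"
    by (auto simp: Mt_def Dt_def sum.distrib[symmetric] intro!: ext sum.cong)
  finally show ?thesis by (simp add: \<Lambda>_def)
qed

end

section \<open>Riemann sums and the limit of infinite refinement\<close>

lemma left_riemann_error: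
  fixes \<phi> :: "real \<Rightarrow> real"
  assumes cont: "continuous_on {a..a + real k * h} \<phi>" and h: "0 \<le> h"
    and osc: "\<And>x y. x \<in> {a..a + real k * h} \<Longrightarrow> y \<in> {a..a + real k * h} \<Longrightarrow> \<bar>x - y\<bar> \<le> h \<Longrightarrow> \<bar>\<phi> x - \<phi> y\<bar> \<le> e"
  shows "\<bar>integral {a..a + real k * h} \<phi> - h * (\<Sum>i<k. \<phi> (a + real i * h))\<bar> \<le> e * (real k * h)"
  using cont osc
proof (induction k)
  case 0
  then show ?case by simp
next
  case (Suc k)
  let ?c = "a + real k * h" and ?d = "a + real (Suc k) * h"
  have cd: "a \<le> ?c" "?c \<le> ?d" "?d - ?c = h" using h by (auto simp: algebra_simps)
  have sub: "{a..?c} \<subseteq> {a..?d}" "{?c..?d} \<subseteq> {a..?d}" using cd by auto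
  have IH: "\<bar>integral {a..?c} \<phi> - h * (\<Sum>i<k. \<phi> (a + real i * h))\<bar> \<le> e * (real k * h)"
    using sub by (intro Suc.IH continuous_on_subset[OF Suc.prems(1)] Suc.prems(2)) auto
  have int: "\<phi> integrable_on {a..?d}" "\<phi> integrable_on {?c..?d}"
    using Suc.prems(1) continuous_on_subset[OF Suc.prems(1) sub(2)] by (auto intro!: integrable_continuous_real)
  have comb: "integral {a..?d} \<phi> = integral {a..?c} \<phi> + integral {?c..?d} \<phi>"
    using Henstock_Kurzweil_Integration.integral_combine[OF cd(1,2) int(1)] by simp
  have "integral {?c..?d} \<phi> - h * \<phi> ?c = integral {?c..?d} (\<lambda>x. \<phi> x - \<phi> ?c)"
    using int(2) cd by (subst integral_diff) auto
  also have "\<bar>\<dots>\<bar> \<le> e * (?d - ?c)"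
  proof -
    have "norm (integral {?c..?d} (\<lambda>x. \<phi> x - \<phi> ?c)) \<le> e * (?d - ?c)"
    proof (rule integral_bound)
      fix t assume "t \<in> {?c..?d}"
      then have "t \<in> {a..?d}" "?c \<in> {a..?d}" "\<bar>t - ?c\<bar> \<le> h"
        using cd unfolding atLeastAtMost_iff by linarith+
      then show "norm (\<phi> t - \<phi> ?c) \<le> e" using Suc.prems(2) by simp
    next
      show "continuous_on {?c..?d} (\<lambda>x. \<phi> x - \<phi> ?c)"
        by (intro continuous_intros continuous_on_subset[OF Suc.prems(1) sub(2)])
    qed (rule cd(2))
    then show ?thesis by simp
  qed
  finally have "\<bar>integral {?c..?d} \<phi> - h * \<phi> ?c\<bar> \<le> e * h" using cd(3) by simp
  with IH show ?case unfolding comb by (simp add: algebra_simps)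
qed

lemma left_riemann_sums_converge:
  fixes \<phi> :: "real \<Rightarrow> real"
  assumes "a \<le> b" "continuous_on {a..b} \<phi>"
  shows "(\<lambda>n. (b - a) / real n * (\<Sum>i<n. \<phi> (a + real i * ((b - a) / real n)))) \<longlonglongrightarrow> integral {a..b} \<phi>"
proof (rule LIMSEQ_I)
  fix e :: real assume e: "0 < e"
  define e' where "e' = e / (b - a + 1)"
  have e': "0 < e'" "e' * (b - a) < e" using e assms(1) by (auto simp: e'_def divide_less_eq)
  have "uniformly_continuous_on {a..b} \<phi>"
    using assms(2) by (intro compact_uniformly_continuous) auto
  from this[unfolded uniformly_continuous_on_def, rule_format, OF e'(1)]
  obtain d where d: "0 < d" "\<And>x y. x \<in> {a..b} \<Longrightarrow> y \<in> {a..b} \<Longrightarrow> dist y x < d \<Longrightarrow> dist (\<phi> y) (\<phi> x) < e'"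
    by blast
  obtain n0 where n0: "(b - a) / d < real n0" using reals_Archimedean2 by blast
  show "\<exists>no. \<forall>n\<ge>no. norm ((b - a) / real n * (\<Sum>i<n. \<phi> (a + real i * ((b - a) / real n))) - integral {a..b} \<phi>) < e"
  proof (intro exI allI impI)
    fix n assume n: "max 1 n0 \<le> n"
    define h where "h = (b - a) / real n"
    have h: "0 \<le> h" "real n * h = b - a" using n assms(1) by (auto simp: h_def)
    have "(b - a) / d < real n" using n n0 by simp
    then have hd: "h < d" using n d(1) by (simp add: h_def field_simps)
    have "\<bar>integral {a..a + real n * h} \<phi> - h * (\<Sum>i<n. \<phi> (a + real i * h))\<bar> \<le> e' * (real n * h)"
    proof (rule left_riemann_error)
      fix x y assume "x \<in> {a..a + real n * h}" "y \<in> {a..a + real n * h}" "\<bar>x - y\<bar> \<le> h"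
      then show "\<bar>\<phi> x - \<phi> y\<bar> \<le> e'" using d(2)[of y x] h hd by (auto simp: dist_real_def)
    qed (use h assms in auto)
    then show "norm ((b - a) / real n * (\<Sum>i<n. \<phi> (a + real i * ((b - a) / real n))) - integral {a..b} \<phi>) < e"
      using h e' by (simp add: h_def[symmetric])
  qed
qed

text \<open>2^(k c) stands for a number of blocks, or its square root, and H^p for the size of one
  contribution. The surplus of p over c produces the geometric decay in the level, and \<Delta>
  \<le> 1 allows the power of \<Delta> to be lowered to the common value e.\<close>

lemma dyadic_powr_le:
  fixes \<Delta> p c e lam :: real
  assumes "0 < \<Delta>" "\<Delta> \<le> 1" "0 \<le> p" "e \<le> p" "c + lam \<le> p" and H: "H = \<Delta> / 2 ^ Suc k"
  shows "2 powr (real k * c) * H powr p \<le> \<Delta> powr e * (2 powr (- lam)) ^ k"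
proof -
  have "H \<le> \<Delta> * 2 powr (- real k)"
    using assms(1) by (simp add: H powr_minus powr_realpow field_simps)
  then have "H powr p \<le> (\<Delta> * 2 powr (- real k)) powr p"
    using assms by (intro powr_mono2) auto
  also have "\<dots> = \<Delta> powr p * 2 powr (- real k * p)"
    using assms(1) by (simp add: powr_mult powr_powr)
  finally have "2 powr (real k * c) * H powr p \<le> 2 powr (real k * c) * (\<Delta> powr p * 2 powr (- real k * p))"
    by (intro mult_left_mono) auto
  also have "\<dots> = \<Delta> powr p * 2 powr (real k * c - real k * p)"
    by (simp add: powr_diff powr_minus divide_inverse)
  also have "\<dots> \<le> \<Delta> powr e * 2 powr (- lam * real k)"
  proof (rule mult_mono)
    show "\<Delta> powr p \<le> \<Delta> powr e" using assms by (intro powr_mono2_le_one) auto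
    have "real k * (c + lam) \<le> real k * p" using assms by (intro mult_left_mono) auto
    then show "2 powr (real k * c - real k * p) \<le> 2 powr (- lam * real k)"
      by (intro powr_mono) (auto simp: algebra_simps)
  qed auto
  also have "2 powr (- lam * real k) = (2 powr (- lam)) ^ k"
    by (metis powr_powr powr_realpow powr_gt_zero zero_neq_numeral)
  finally show ?thesis .
qed

lemma QS_one: "QS g s (Suc 0) \<delta> x = \<delta> * heat \<delta> (g (s + \<delta>)) x"
  by (simp add: QS_def)

text \<open>At the finest level every block holds a single point, whose term is \<delta> times the
  heat image of g over time \<delta>. It differs from the left Riemann term by \<delta> times a
  quantity of order \<delta>^(\<beta>/2) + \<delta>^\<alpha>, so both sums have the same
  limit.\<close>

lemma QS_sums_converge:
  fixes g :: "real \<Rightarrow> real^'d \<Rightarrow> real" and x :: "real \<Rightarrow> real^'d"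
  assumes ab: "0 < \<alpha>" "0 < \<beta>" "\<beta> \<le> 1" and g: "\<And>t. holder K \<beta> (g t)"
    and gt: "\<And>s t u. \<bar>g s u - g t u\<bar> \<le> K * \<bar>s - t\<bar> powr \<alpha>"
    and ST: "S < T" and x: "continuous_on {S..T} x"
  shows "continuous_on {S..T} (\<lambda>r. g r (x r))"
    and "(\<lambda>L. \<Sum>i<2^L. QS g (S + real i * ((T - S) / 2^L)) 1 ((T - S) / 2^L) (x (S + real i * ((T - S) / 2^L))))
       \<longlonglongrightarrow> integral {S..T} (\<lambda>r. g r (x r))"
proof -
  define c where "c = 1 + (\<integral>z. norm z \<partial>(gauss :: (real^'d) measure))"
  have K0: "0 \<le> K" using holder_nonneg[OF g] .
  show cont: "continuous_on {S..T} (\<lambda>r. g r (x r))"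
    unfolding continuous_on_def
  proof
    fix r assume r: "r \<in> {S..T}"
    show "((\<lambda>s. g s (x s)) \<longlongrightarrow> g r (x r)) (at r within {S..T})"
    proof (rule LIM_zero_cancel, rule Lim_null_comparison)
      show "\<forall>\<^sub>F s in at r within {S..T}. norm (g s (x s) - g r (x r)) \<le> K * \<bar>s - r\<bar> powr \<alpha> + K * norm (x s - x r) powr \<beta>"
      proof (rule always_eventually, rule allI)
        fix s
        have "\<bar>g r (x s) - g r (x r)\<bar> \<le> K * norm (x s - x r) powr \<beta>"
          using g[of r] unfolding holder_def by blast
        then show "norm (g s (x s) - g r (x r)) \<le> K * \<bar>s - r\<bar> powr \<alpha> + K * norm (x s - x r) powr \<beta>"
          using gt[of s "x s" r] by simp
      qed
      have xr: "(x \<longlongrightarrow> x r) (at r within {S..T})" using x r by (auto simp: continuous_on_def)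
      have "((\<lambda>s. K * \<bar>s - r\<bar> powr \<alpha> + K * norm (x s - x r) powr \<beta>) \<longlongrightarrow> K * \<bar>r - r\<bar> powr \<alpha> + K * norm (x r - x r) powr \<beta>) (at r within {S..T})"
        using ab by (intro tendsto_intros tendsto_powr' xr) auto
      then show "((\<lambda>s. K * \<bar>s - r\<bar> powr \<alpha> + K * norm (x s - x r) powr \<beta>) \<longlongrightarrow> 0) (at r within {S..T})" by simp
    qed
  qed
  define dl where "dl L = (T - S) / 2 ^ L" for L :: nat
  have dl0: "0 < dl L" for L using ST by (simp add: dl_def)
  have dllim: "dl \<longlonglongrightarrow> 0"
    unfolding dl_def by (intro real_tendsto_divide_at_top[OF tendsto_const] filterlim_at_infinity_imp_filterlim_at_top)
      (auto simp: filterlim_at_infinity_imp_filterlim_at_top intro!: filterlim_realpow_sequentially_gt1[where x = "2::real"] always_eventually)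
  define R where "R L = dl L * (\<Sum>i<2^L. g (S + real i * dl L) (x (S + real i * dl L)))" for L
  have "(\<lambda>L. (T - S) / real (2^L) * (\<Sum>i<2^L. g (S + real i * ((T - S) / real (2^L))) (x (S + real i * ((T - S) / real (2^L))))))
     \<longlonglongrightarrow> integral {S..T} (\<lambda>r. g r (x r))"
    by (rule filterlim_compose[OF left_riemann_sums_converge[of S T "\<lambda>r. g r (x r)"], of "\<lambda>L. 2^L"])
       (use ST cont in \<open>auto intro!: filterlim_subseq simp: strict_mono_def\<close>)
  then have Rlim: "R \<longlonglongrightarrow> integral {S..T} (\<lambda>r. g r (x r))"
    unfolding R_def dl_def by simp
  define J where "J L = (\<Sum>i<2^L. QS g (S + real i * dl L) 1 (dl L) (x (S + real i * dl L)))" for L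
  have "(\<lambda>L. J L - R L) \<longlonglongrightarrow> 0"
  proof (rule Lim_null_comparison)
    show "\<forall>\<^sub>F L in sequentially. norm (J L - R L) \<le> (T - S) * (K * c * dl L powr (\<beta> / 2) + K * dl L powr \<alpha>)"
    proof (rule always_eventually, rule allI)
      fix L
      have "\<bar>heat (dl L) (g (S + real i * dl L + dl L)) u - g (S + real i * dl L) u\<bar> \<le> K * c * dl L powr (\<beta> / 2) + K * dl L powr \<alpha>" for i u
        using heat_time_diff_holder[OF g ab(2,3), of "dl L" 0 "S + real i * dl L + dl L" u]
          gt[of "S + real i * dl L + dl L" u "S + real i * dl L"] dl0[of L]
        by (simp add: c_def)
      then have *: "\<bar>\<Sum>i<2^L. heat (dl L) (g (S + real i * dl L + dl L)) (x (S + real i * dl L)) - g (S + real i * dl L) (x (S + real i * dl L))\<bar>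
         \<le> (\<Sum>i<(2::nat)^L. K * c * dl L powr (\<beta> / 2) + K * dl L powr \<alpha>)"
        by (intro sum_abs[THEN order_trans] sum_mono)
      have "norm (J L - R L) = dl L * \<bar>\<Sum>i<2^L. heat (dl L) (g (S + real i * dl L + dl L)) (x (S + real i * dl L)) - g (S + real i * dl L) (x (S + real i * dl L))\<bar>"
        using dl0[of L] by (simp add: J_def R_def QS_one sum_distrib_left[symmetric] right_diff_distrib[symmetric] sum_subtractf abs_mult)
      also have "\<dots> \<le> dl L * (\<Sum>i<(2::nat)^L. K * c * dl L powr (\<beta> / 2) + K * dl L powr \<alpha>)"
        using * dl0[of L] by (intro mult_left_mono) auto
      also have "\<dots> = (T - S) * (K * c * dl L powr (\<beta> / 2) + K * dl L powr \<alpha>)"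
        by (simp add: dl_def)
      finally show "norm (J L - R L) \<le> (T - S) * (K * c * dl L powr (\<beta> / 2) + K * dl L powr \<alpha>)" .
    qed
    have "(\<lambda>L. (T - S) * (K * c * dl L powr (\<beta> / 2) + K * dl L powr \<alpha>)) \<longlonglongrightarrow> (T - S) * (K * c * 0 powr (\<beta> / 2) + K * 0 powr \<alpha>)"
      using ab dl0 by (intro tendsto_intros tendsto_powr' dllim) (auto intro!: always_eventually less_imp_le)
    then show "(\<lambda>L. (T - S) * (K * c * dl L powr (\<beta> / 2) + K * dl L powr \<alpha>)) \<longlonglongrightarrow> 0" by simp
  qed
  from tendsto_add[OF this Rlim] show "(\<lambda>L. \<Sum>i<2^L. QS g (S + real i * ((T - S) / 2^L)) 1 ((T - S) / 2^L) (x (S + real i * ((T - S) / 2^L))))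
       \<longlonglongrightarrow> integral {S..T} (\<lambda>r. g r (x r))"
    by (simp add: J_def dl_def)
qed

context filtered_bm
begin

text \<open>The coarsest level is one block, controlled by the Lipschitz bound for
  \<open>QS\<close>. Each refinement adds a martingale part of order 2^(k/2) H^((1+\<beta>)/2), a
  second-difference part 2^k H^(1+\<beta>/2), and a part 2^k H^((1+\<beta>)/2+\<eta>) from the
  increments of X - Y. All three are summable in k, so the bound is uniform in the depth
  \<open>L\<close>.\<close>

lemma sewing_bound:
  assumes \<beta>: "0 < \<beta>" "\<beta> < 1" and m: "1 \<le> m" and K: "0 < K" and \<eta>: "0 \<le> \<eta>" "\<eta> \<le> 1 / 2" "1 / 2 < \<eta> + \<beta> / 2"
  shows "\<exists>G>0. \<forall>(g :: real \<Rightarrow> real^'d \<Rightarrow> real) X Y S T L a N.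
    (\<forall>t. holder K \<beta> (g t)) \<longrightarrow> drifted K X \<longrightarrow> drifted K Y \<longrightarrow> 0 \<le> S \<longrightarrow> S < T \<longrightarrow> T \<le> 1 \<longrightarrow> 0 < a \<longrightarrow> 0 \<le> N \<longrightarrow>
    (\<forall>t. S \<le> t \<longrightarrow> t \<le> T \<longrightarrow> Lq_le M (2 * m) a (\<lambda>\<omega>. norm (X t \<omega> - Y t \<omega>))) \<longrightarrow>
    (\<forall>s t. S \<le> s \<longrightarrow> s < t \<longrightarrow> t \<le> T \<longrightarrow>
        Lq_le M (2 * m) (N * (t - s) powr \<eta>) (\<lambda>\<omega>. norm ((X t \<omega> - Y t \<omega>) - (X s \<omega> - Y s \<omega>)))) \<longrightarrow>
    Lq_le M (2 * m) (G * (a + N) * (T - S) powr ((1 + \<beta>) / 2))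
      (\<lambda>\<omega>. \<Sum>i<2^L. QS g (S + real i * ((T - S) / 2^L)) 1 ((T - S) / 2^L) (X (S + real i * ((T - S) / 2^L)) \<omega>)
          - QS g (S + real i * ((T - S) / 2^L)) 1 ((T - S) / 2^L) (Y (S + real i * ((T - S) / 2^L)) \<omega>))"
proof -
  obtain C where C: "1 \<le> C" and QR: "\<And>K (g :: real \<Rightarrow> real^'d \<Rightarrow> real) s N \<delta>. (\<And>t. holder K \<beta> (g t)) \<Longrightarrow> 0 < \<delta> \<Longrightarrow> real N * \<delta> \<le> 1 \<Longrightarrow>
    (\<forall>x y. \<bar>QS g s N \<delta> x - QS g s N \<delta> y\<bar> \<le> C * K * (real N * \<delta>) powr ((1 + \<beta>) / 2) * norm (x - y)) \<and>
    (\<forall>x a b. \<bar>(QS g s N \<delta> (x + a + b) - QS g s N \<delta> (x + b)) - (QS g s N \<delta> (x + a) - QS g s N \<delta> x)\<bar>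
       \<le> C * K * (real N * \<delta>) powr (\<beta> / 2) * norm a * norm b)"
    using QS_regularity[OF \<beta>] by blast
  \<comment> \<open>The decay rate of the third contribution; since \<eta> \<le> 1/2 it is at most
    \<beta>/2, the rate of the other two.\<close>
  define lam where "lam = \<eta> + \<beta> / 2 - 1 / 2"
  define \<mu> where "\<mu> = 2 powr (- lam)"
  have lam: "0 < lam" "lam \<le> \<beta> / 2" using \<eta> by (auto simp: lam_def)
  have \<mu>: "0 < \<mu>" "\<mu> < 1" using lam powr_less_mono[of "-lam" 0 2] by (auto simp: \<mu>_def)
  define cm where "cm = sqrt (3 * 4 ^ m)"
  have cm: "0 < cm" by (simp add: cm_def)
  define G0 where "G0 = 2 * cm * C * K + C * K * K + C * K"
  have G0: "0 < G0" using cm C K by (auto simp: G0_def intro!: add_pos_pos)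
  define G where "G = C * K + G0 / (1 - \<mu>)"
  have Gp: "0 < G" using G0 C K \<mu> by (auto simp: G_def intro!: add_pos_pos)
  define e where "e = (1 + \<beta>) / 2"
  show ?thesis
  proof (intro exI[of _ G] conjI allI impI)
    fix g :: "real \<Rightarrow> real^'d \<Rightarrow> real" and X Y S T L a N
    assume g: "\<forall>t. holder K \<beta> (g t)" and X: "drifted K X" and Y: "drifted K Y" and ST: "0 \<le> S" "S < T" "T \<le> 1"
      and a: "0 < a" and N: "0 \<le> N"
      and E: "\<forall>t. S \<le> t \<longrightarrow> t \<le> T \<longrightarrow> Lq_le M (2 * m) a (\<lambda>\<omega>. norm (X t \<omega> - Y t \<omega>))"
      and EN: "\<forall>s t. S \<le> s \<longrightarrow> s < t \<longrightarrow> t \<le> T \<longrightarrow>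
        Lq_le M (2 * m) (N * (t - s) powr \<eta>) (\<lambda>\<omega>. norm ((X t \<omega> - Y t \<omega>) - (X s \<omega> - Y s \<omega>)))"
    define \<Delta> where "\<Delta> = T - S"
    have \<Delta>: "0 < \<Delta>" "\<Delta> \<le> 1" using ST by (auto simp: \<Delta>_def)
    define \<delta> where "\<delta> = \<Delta> / 2 ^ L"
    have \<delta>: "0 < \<delta>" using \<Delta> by (simp add: \<delta>_def)
    have gbc: "bcont (g t)" for t using g holder_bcont \<beta> by blast
    define hk where "hk k = \<Delta> / 2 ^ k" for k :: nat
    \<comment> \<open>Level k: 2^k blocks, each holding 2^(L-k) points of the finest mesh, with the
      process observed only at the left end of its block.\<close>
    define A where "A Z k \<omega> = (\<Sum>i<2^k. QS g (S + real i * hk k) (2^(L-k)) \<delta> (Z (S + real i * hk k) \<omega>))"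
      for Z :: "real \<Rightarrow> 'w \<Rightarrow> real^'d" and k \<omega>
    define J where "J k \<omega> = A X k \<omega> - A Y k \<omega>" for k \<omega>
    have level: "Lq_le M (2 * m) (G0 * (a + N) * \<Delta> powr e * \<mu> ^ k) (\<lambda>\<omega>. J k \<omega> - J (Suc k) \<omega>)" if k: "k < L" for k
    proof -
      define n :: nat where "n = 2 ^ (L - Suc k)"
      define H where "H = real n * \<delta>"
      have Lk: "L - k = Suc (L - Suc k)" using k by simp
      have n2: "2 ^ (L - k) = n + n" unfolding Lk n_def by simp
      have n1: "1 \<le> n" by (simp add: n_def)
      have Hk: "H = \<Delta> / 2 ^ Suc k"
      proof -
        have "L = (L - Suc k) + Suc k" using k by simp
        then have "(2::real) ^ L = 2 ^ (L - Suc k) * 2 ^ Suc k" by (metis power_add)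
        then show ?thesis by (simp add: H_def n_def \<delta>_def)
      qed
      have hkk: "hk k = 2 * H" "hk (Suc k) = H" by (auto simp: hk_def Hk)
      have H0: "0 < H" using \<Delta> by (simp add: Hk)
      have PH: "real (2 ^ k) * (2 * H) = \<Delta>" by (simp add: Hk)
      have nd: "real n * \<delta> \<le> 1" "real (n + n) * \<delta> \<le> 1"
      proof -
        have "2 * H \<le> \<Delta>" using \<Delta> unfolding Hk by (simp add: divide_le_eq)
        then show "real (n + n) * \<delta> \<le> 1" using \<Delta> by (simp add: H_def distrib_right)
        then show "real n * \<delta> \<le> 1" using H0 by (simp add: H_def distrib_right)
      qed
      have AZ: "A Z k \<omega> - A Z (Suc k) \<omega> = (\<Sum>i<2^k. heat H (QS g (S + real i * (2 * H) + H) n \<delta>) (Z (S + real i * (2 * H)) \<omega>)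
          - QS g (S + real i * (2 * H) + H) n \<delta> (Z (S + real i * (2 * H) + H) \<omega>))" for Z \<omega>
      proof -
        have "A Z (Suc k) \<omega> = (\<Sum>j<2 * 2^k. QS g (S + real j * H) n \<delta> (Z (S + real j * H) \<omega>))"
          by (simp add: A_def hkk n_def)
        also have "\<dots> = (\<Sum>i<2^k. QS g (S + real i * (2 * H)) n \<delta> (Z (S + real i * (2 * H)) \<omega>)
            + QS g (S + real i * (2 * H) + H) n \<delta> (Z (S + real i * (2 * H) + H) \<omega>))"
          unfolding sum_double_index by (intro sum.cong) (auto simp: algebra_simps)
        finally have 1: "A Z (Suc k) \<omega> = \<dots>" .
        have "A Z k \<omega> = (\<Sum>i<2^k. QS g (S + real i * (2 * H)) n \<delta> (Z (S + real i * (2 * H)) \<omega>)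
            + heat H (QS g (S + real i * (2 * H) + H) n \<delta>) (Z (S + real i * (2 * H)) \<omega>))"
          unfolding A_def hkk n2 H_def
          by (intro sum.cong QS_split[OF gbc _ nd(2)]) (use \<delta> in auto)
        then show ?thesis unfolding 1 by (simp flip: sum_subtractf)
      qed
      have "Lq_le M (2 * m)
        (sqrt (3 * 4 ^ m) * sqrt (real (2^k)) * (2 * (C * K * H powr ((1 + \<beta>) / 2)) * a)
          + real (2^k) * (C * K * H powr (\<beta> / 2) * (K * H) * a + C * K * H powr ((1 + \<beta>) / 2) * (N * H powr \<eta>)))
        (\<lambda>\<omega>. \<Sum>i<2^k. (heat H (QS g (S + real i * (2 * H) + H) n \<delta>) (X (S + real i * (2 * H)) \<omega>) - QS g (S + real i * (2 * H) + H) n \<delta> (X (S + real i * (2 * H) + H) \<omega>))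
           - (heat H (QS g (S + real i * (2 * H) + H) n \<delta>) (Y (S + real i * (2 * H)) \<omega>) - QS g (S + real i * (2 * H) + H) n \<delta> (Y (S + real i * (2 * H) + H) \<omega>)))"
      proof (rule sewing_level[OF \<beta> m K a N _ X Y ST(1) _ H_def \<delta> n1 _ _ C])
        show "holder K \<beta> (g t)" for t using g by blast
        show "S + real (2 ^ k) * (2 * H) \<le> 1" unfolding PH using ST by (simp add: \<Delta>_def)
        show "Lq_le M (2 * m) a (\<lambda>\<omega>. norm (X t \<omega> - Y t \<omega>))" if "S \<le> t" "t \<le> S + real (2 ^ k) * (2 * H)" for t
          using that E unfolding PH by (simp add: \<Delta>_def)
        show "Lq_le M (2 * m) (N * (t - s) powr \<eta>) (\<lambda>\<omega>. norm ((X t \<omega> - Y t \<omega>) - (X s \<omega> - Y s \<omega>)))"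
          if "S \<le> s" "s < t" "t \<le> S + real (2 ^ k) * (2 * H)" for s t
          using that EN unfolding PH by (simp add: \<Delta>_def)
        show "\<bar>QS g s n \<delta> x - QS g s n \<delta> y\<bar> \<le> C * K * H powr ((1 + \<beta>) / 2) * norm (x - y)" for s x y
          unfolding H_def using QR[OF _ \<delta> nd(1), of K g s] g by blast
        show "\<bar>(QS g s n \<delta> (x + a + b) - QS g s n \<delta> (x + b)) - (QS g s n \<delta> (x + a) - QS g s n \<delta> x)\<bar>
           \<le> C * K * H powr (\<beta> / 2) * norm a * norm b" for s x a b
          unfolding H_def using QR[OF _ \<delta> nd(1), of K g s] g by blast
      qed
      moreover have "(\<lambda>\<omega>. J k \<omega> - J (Suc k) \<omega>) = (\<lambda>\<omega>. \<Sum>i<2^k. (heat H (QS g (S + real i * (2 * H) + H) n \<delta>) (X (S + real i * (2 * H)) \<omega>) - QS g (S + real i * (2 * H) + H) n \<delta> (X (S + real i * (2 * H) + H) \<omega>))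
           - (heat H (QS g (S + real i * (2 * H) + H) n \<delta>) (Y (S + real i * (2 * H)) \<omega>) - QS g (S + real i * (2 * H) + H) n \<delta> (Y (S + real i * (2 * H) + H) \<omega>)))"
      proof
        fix \<omega>
        have "J k \<omega> - J (Suc k) \<omega> = (A X k \<omega> - A X (Suc k) \<omega>) - (A Y k \<omega> - A Y (Suc k) \<omega>)"
          by (simp add: J_def)
        then show "J k \<omega> - J (Suc k) \<omega> = (\<Sum>i<2^k. (heat H (QS g (S + real i * (2 * H) + H) n \<delta>) (X (S + real i * (2 * H)) \<omega>) - QS g (S + real i * (2 * H) + H) n \<delta> (X (S + real i * (2 * H) + H) \<omega>))
           - (heat H (QS g (S + real i * (2 * H) + H) n \<delta>) (Y (S + real i * (2 * H)) \<omega>) - QS g (S + real i * (2 * H) + H) n \<delta> (Y (S + real i * (2 * H) + H) \<omega>)))"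
          unfolding AZ by (simp only: sum_subtractf)
      qed
      moreover have "sqrt (3 * 4 ^ m) * sqrt (real (2^k)) * (2 * (C * K * H powr ((1 + \<beta>) / 2)) * a)
          + real (2^k) * (C * K * H powr (\<beta> / 2) * (K * H) * a + C * K * H powr ((1 + \<beta>) / 2) * (N * H powr \<eta>))
          \<le> G0 * (a + N) * \<Delta> powr e * \<mu> ^ k"
      proof -
        define U where "U = \<Delta> powr e * \<mu> ^ k"
        have U0: "0 \<le> U" using \<mu> by (simp add: U_def)
        have p2: "real (2 ^ k) = 2 powr (real k * 1)" by (simp add: powr_realpow)
        have sq: "sqrt (real (2 ^ k)) = 2 powr (real k * (1/2))"
          unfolding p2 by (simp add: powr_half_sqrt[symmetric] powr_powr)
        have 1: "sqrt (real (2 ^ k)) * H powr e \<le> U"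
          unfolding sq U_def \<mu>_def using \<Delta> \<beta> lam by (intro dyadic_powr_le[OF _ _ _ _ _ Hk]) (auto simp: e_def field_simps)
        have 2: "real (2 ^ k) * (H powr (\<beta> / 2) * H) \<le> U"
        proof -
          have "H powr (\<beta> / 2) * H = H powr (\<beta> / 2 + 1)" using H0 by (simp add: powr_add)
          then show ?thesis
            unfolding p2 U_def \<mu>_def using \<Delta> \<beta> lam
            by (simp only:) (intro dyadic_powr_le[OF _ _ _ _ _ Hk], auto simp: e_def field_simps)
        qed
        have 3: "real (2 ^ k) * (H powr e * H powr \<eta>) \<le> U"
        proof -
          have "H powr e * H powr \<eta> = H powr (e + \<eta>)" by (simp add: powr_add)
          then show ?thesis
            unfolding p2 U_def \<mu>_def using \<Delta> \<beta> \<eta>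
            by (simp only:) (intro dyadic_powr_le[OF _ _ _ _ _ Hk], auto simp: e_def lam_def field_simps)
        qed
        have "sqrt (3 * 4 ^ m) * sqrt (real (2^k)) * (2 * (C * K * H powr ((1 + \<beta>) / 2)) * a)
          + real (2^k) * (C * K * H powr (\<beta> / 2) * (K * H) * a + C * K * H powr ((1 + \<beta>) / 2) * (N * H powr \<eta>))
          = (2 * cm * C * K * a) * (sqrt (real (2 ^ k)) * H powr e) + (C * K * K * a) * (real (2 ^ k) * (H powr (\<beta> / 2) * H))
            + (C * K * N) * (real (2 ^ k) * (H powr e * H powr \<eta>))"
          by (simp add: cm_def e_def algebra_simps)
        also have "\<dots> \<le> (2 * cm * C * K * a) * U + (C * K * K * a) * U + (C * K * N) * U"
          using 1 2 3 cm C K a N by (intro add_mono mult_left_mono) auto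
        also have "\<dots> \<le> G0 * (a + N) * U"
        proof -
          have "G0 * (a + N) = (2 * cm * C * K * a + C * K * K * a + C * K * N) + (2 * cm * C * K * N + C * K * K * N + C * K * a)"
            by (simp add: G0_def algebra_simps)
          moreover have "0 \<le> 2 * cm * C * K * N + C * K * K * N + C * K * a"
            using cm C K a N by (intro add_nonneg_nonneg mult_nonneg_nonneg) auto
          ultimately have "2 * cm * C * K * a + C * K * K * a + C * K * N \<le> G0 * (a + N)" by linarith
          from mult_right_mono[OF this U0] show ?thesis by (simp add: algebra_simps)
        qed
        finally show ?thesis by (simp add: U_def mult.assoc)
      qed
      ultimately show ?thesis using Lq_le_weaken by auto
    qed
    have J0: "Lq_le M (2 * m) (C * K * \<Delta> powr e * a) (J 0)"
    proof (rule Lq_le_mono)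
      have c0: "0 \<le> C * K * \<Delta> powr e" using C K by simp
      show "Lq_le M (2 * m) (\<bar>C * K * \<Delta> powr e\<bar> * a) (\<lambda>\<omega>. C * K * \<Delta> powr e * norm (X S \<omega> - Y S \<omega>))"
        using E ST by (intro Lq_le_cmult) auto
      show "\<bar>C * K * \<Delta> powr e\<bar> * a \<le> C * K * \<Delta> powr e * a" using c0 by simp
      have L\<delta>: "real (2 ^ L) * \<delta> = \<Delta>" by (simp add: \<delta>_def)
      have J0eq: "J 0 \<omega> = QS g S (2 ^ L) \<delta> (X S \<omega>) - QS g S (2 ^ L) \<delta> (Y S \<omega>)" for \<omega>
        by (simp add: J_def A_def)
      have [measurable]: "X S \<in> borel_measurable M" "Y S \<in> borel_measurable M"
        using driftedD(2)[OF X] driftedD(2)[OF Y] ST by auto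
      have [measurable]: "QS g S (2 ^ L) \<delta> \<in> borel_measurable borel"
        using bcont_measurable[OF bcont_QS[OF gbc]] by auto
      show "J 0 \<in> borel_measurable M" unfolding J0eq[abs_def] by measurable
      show "AE \<omega> in M. \<bar>J 0 \<omega>\<bar> \<le> \<bar>C * K * \<Delta> powr e * norm (X S \<omega> - Y S \<omega>)\<bar>"
      proof (rule AE_I2)
        fix \<omega>
        have "\<bar>J 0 \<omega>\<bar> \<le> C * K * \<Delta> powr e * norm (X S \<omega> - Y S \<omega>)"
          using QR[OF _ \<delta>, of K g "2 ^ L" S] g \<Delta> unfolding L\<delta> J0eq e_def by blast
        then show "\<bar>J 0 \<omega>\<bar> \<le> \<bar>C * K * \<Delta> powr e * norm (X S \<omega> - Y S \<omega>)\<bar>" by linarith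
      qed
    qed
    have "Lq_le M (2 * m) (\<Sum>k<L. G0 * (a + N) * \<Delta> powr e * \<mu> ^ k) (\<lambda>\<omega>. \<Sum>k<L. J k \<omega> - J (Suc k) \<omega>)"
      using m level by (intro Lq_le_sum) auto
    then have "Lq_le M (2 * m) (C * K * \<Delta> powr e * a + (\<Sum>k<L. G0 * (a + N) * \<Delta> powr e * \<mu> ^ k)) (J L)"
    proof -
      have "J 0 \<omega> - (\<Sum>k<L. J k \<omega> - J (Suc k) \<omega>) = J L \<omega>" for \<omega>
        using sum_telescope_diff[of "\<lambda>k. J k \<omega>" L] by simp
      then show ?thesis using m Lq_le_diff[OF J0 \<open>Lq_le M (2 * m) (\<Sum>k<L. _ k) _\<close>] by simp
    qed
    then have "Lq_le M (2 * m) (G * (a + N) * \<Delta> powr e) (J L)"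
    proof (rule Lq_le_weaken)
      have "(\<Sum>k<L. G0 * (a + N) * \<Delta> powr e * \<mu> ^ k) = G0 * (a + N) * \<Delta> powr e * (\<Sum>k<L. \<mu> ^ k)"
        by (simp add: sum_distrib_left)
      also have "\<dots> \<le> G0 * (a + N) * \<Delta> powr e * (1 / (1 - \<mu>))"
        using \<mu> G0 a N by (intro mult_left_mono sum_inverse_geometric_le) auto
      finally have "C * K * \<Delta> powr e * a + (\<Sum>k<L. G0 * (a + N) * \<Delta> powr e * \<mu> ^ k)
         \<le> C * K * \<Delta> powr e * (a + N) + G0 * (a + N) * \<Delta> powr e * (1 / (1 - \<mu>))"
        using C K N by (intro add_mono mult_left_mono) auto
      also have "\<dots> = G * (a + N) * \<Delta> powr e"
        by (simp add: G_def algebra_simps add_divide_distrib)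
      finally show "C * K * \<Delta> powr e * a + (\<Sum>k<L. G0 * (a + N) * \<Delta> powr e * \<mu> ^ k) \<le> G * (a + N) * \<Delta> powr e" .
    qed
    then show "Lq_le M (2 * m) (G * (a + N) * (T - S) powr ((1 + \<beta>) / 2))
      (\<lambda>\<omega>. \<Sum>i<2^L. QS g (S + real i * ((T - S) / 2^L)) 1 ((T - S) / 2^L) (X (S + real i * ((T - S) / 2^L)) \<omega>)
          - QS g (S + real i * ((T - S) / 2^L)) 1 ((T - S) / 2^L) (Y (S + real i * ((T - S) / 2^L)) \<omega>))"
      by (simp add: J_def[abs_def] A_def hk_def \<Delta>_def \<delta>_def e_def sum_subtractf)
  qed (use Gp in simp)
qed

end

section \<open>Replacing the scheme by its grid values\<close>

text \<open>\<open>UC g h L k q x\<close> is the Riemann sum over the \<open>k\<close>-th cell of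
  \<open>E g(r, x + B\<^bsub>q + r - t\<^esub>) - E g(r, x + B\<^sub>q)\<close> with \<open>t = k h\<close>; \<open>GC g h L b j x\<close> collects these for the
  cells from \<open>j\<close> to \<open>b - 1\<close>, seen from time \<open>j h\<close>.\<close>

definition UC :: "(real \<Rightarrow> real^'d \<Rightarrow> real) \<Rightarrow> real \<Rightarrow> nat \<Rightarrow> nat \<Rightarrow> real \<Rightarrow> real^'d \<Rightarrow> real" where
  "UC g h L k q x = (h / real L) * (\<Sum>l<L. heat (q + real l * (h / real L)) (g (real k * h + real l * (h / real L))) x
      - heat q (g (real k * h + real l * (h / real L))) x)"

definition GC :: "(real \<Rightarrow> real^'d \<Rightarrow> real) \<Rightarrow> real \<Rightarrow> nat \<Rightarrow> nat \<Rightarrow> nat \<Rightarrow> real^'d \<Rightarrow> real" where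
  "GC g h L b j x = (\<Sum>k\<in>{j..<b}. UC g h L k (real (k - j) * h) x)"

lemma bcont_UC: "(\<And>t. bcont (g t)) \<Longrightarrow> bcont (UC g h L k q)"
  unfolding UC_def by (intro bcont_cmult bcont_sum bcont_diff bcont_heat) auto

lemma bcont_GC: "(\<And>t. bcont (g t)) \<Longrightarrow> bcont (GC g h L b j)"
  unfolding GC_def by (intro bcont_sum bcont_UC) auto

lemma cell_point:
  assumes "0 < h" "l < L"
  shows "0 \<le> real l * (h / real L)" "real l * (h / real L) \<le> h"
proof -
  have "real l * h \<le> h * real L" using assms by (subst mult.commute) (intro mult_left_mono, auto)
  then show "real l * (h / real L) \<le> h" using assms by (simp add: divide_le_eq)
qed (use assms in auto)

lemma abs_average_le:
  fixes c :: "nat \<Rightarrow> real"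
  assumes "0 < h" "1 \<le> L" "\<And>l. l < L \<Longrightarrow> \<bar>c l\<bar> \<le> A"
  shows "\<bar>(h / real L) * (\<Sum>l<L. c l)\<bar> \<le> h * A"
proof -
  have "\<bar>\<Sum>l<L. c l\<bar> \<le> real L * A"
    using order_trans[OF sum_abs sum_mono, of "{..<L}" c "\<lambda>_. A"] assms(3) by simp
  then have "(h / real L) * \<bar>\<Sum>l<L. c l\<bar> \<le> (h / real L) * (real L * A)"
    using assms by (intro mult_left_mono) auto
  also have "\<dots> = h * A" using assms by simp
  finally show ?thesis using assms by (simp add: abs_mult)
qed

lemma UC_bound_trivial:
  assumes "\<And>t. bcont (g t)" "\<And>t x. \<bar>g t x\<bar> \<le> K" "0 < h" "1 \<le> L"
  shows "\<bar>UC g h L k q x\<bar> \<le> h * (2 * K)"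
  unfolding UC_def using assms(3,4)
proof (rule abs_average_le)
  fix l
  show "\<bar>heat (q + real l * (h / real L)) (g (real k * h + real l * (h / real L))) x
      - heat q (g (real k * h + real l * (h / real L))) x\<bar> \<le> 2 * K"
    using heat_bound[OF assms(1,2), of "q + real l * (h / real L)" "real k * h + real l * (h / real L)" x]
      heat_bound[OF assms(1,2), of q "real k * h + real l * (h / real L)" x] by linarith
qed

lemma GC_bound_trivial:
  assumes "\<And>t. bcont (g t)" "\<And>t x. \<bar>g t x\<bar> \<le> K" "0 < h" "1 \<le> L" "real b * h \<le> 1"
  shows "\<bar>GC g h L b j x\<bar> \<le> 2 * K"
proof -
  have K0: "0 \<le> K" using assms(2)[of 0 0] by linarith
  have "\<bar>GC g h L b j x\<bar> \<le> (\<Sum>k\<in>{j..<b}. h * (2 * K))"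
    unfolding GC_def by (intro sum_abs[THEN order_trans] sum_mono UC_bound_trivial assms)
  also have "\<dots> = (real (b - j) * h) * (2 * K)" by simp
  also have "real (b - j) * h \<le> real b * h" using assms(3) by (intro mult_right_mono) auto
  then have "(real (b - j) * h) * (2 * K) \<le> 1 * (2 * K)"
    using assms(5) K0 by (intro mult_right_mono) auto
  finally show ?thesis by simp
qed

context filtered_bm
begin

lemma heat_UC:
  assumes "\<And>t. bcont (g t)" "0 < h" "0 \<le> q" "q + h + h \<le> 1"
  shows "heat h (UC g h L k q) x = UC g h L k (q + h) (x :: real^'d)"
proof -
  have "heat h (UC g h L k q) x = (h / real L) * (\<Sum>l<L. heat h (heat (q + real l * (h / real L)) (g (real k * h + real l * (h / real L)))) x
      - heat h (heat q (g (real k * h + real l * (h / real L)))) x)"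
    unfolding UC_def heat_cmult
    by (subst heat_sum) (intro bcont_diff bcont_heat assms(1), simp only: heat_diff bcont_heat assms(1))
  also have "(\<Sum>l<L. heat h (heat (q + real l * (h / real L)) (g (real k * h + real l * (h / real L)))) x
      - heat h (heat q (g (real k * h + real l * (h / real L)))) x)
     = (\<Sum>l<L. heat (q + h + real l * (h / real L)) (g (real k * h + real l * (h / real L))) x
      - heat (q + h) (g (real k * h + real l * (h / real L))) x)"
  proof (rule sum.cong)
    fix l assume "l \<in> {..<L}"
    then have l: "0 \<le> real l * (h / real L)" "real l * (h / real L) \<le> h"
      using cell_point[OF assms(2), of l L] by auto
    let ?g = "g (real k * h + real l * (h / real L))"
    have "heat h (heat (q + real l * (h / real L)) ?g) x = heat ((q + real l * (h / real L)) + h) ?g x"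
      using l assms by (intro heat_semigroup) auto
    also have "(q + real l * (h / real L)) + h = q + h + real l * (h / real L)" by simp
    finally have 1: "heat h (heat (q + real l * (h / real L)) ?g) x = heat (q + h + real l * (h / real L)) ?g x" .
    have 2: "heat h (heat q ?g) x = heat (q + h) ?g x"
      using assms by (intro heat_semigroup) auto
    show "heat h (heat (q + real l * (h / real L)) ?g) x - heat h (heat q ?g) x
       = heat (q + h + real l * (h / real L)) ?g x - heat (q + h) ?g x"
      unfolding 1 2 ..
  qed simp
  finally show ?thesis by (simp only: UC_def[of g h L k "q + h" x])
qed

lemma heat_GC:
  assumes "\<And>t. bcont (g t)" "0 < h" "real b * h \<le> 1"
  shows "heat h (GC g h L b (Suc j)) x = (\<Sum>k\<in>{Suc j..<b}. UC g h L k (real (k - j) * h) (x :: real^'d))"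
proof -
  have "heat h (GC g h L b (Suc j)) x = (\<Sum>k\<in>{Suc j..<b}. heat h (UC g h L k (real (k - Suc j) * h)) x)"
    unfolding GC_def by (intro heat_sum bcont_UC assms)
  also have "\<dots> = (\<Sum>k\<in>{Suc j..<b}. UC g h L k (real (k - j) * h) x)"
  proof (rule sum.cong)
    fix k assume k: "k \<in> {Suc j..<b}"
    then have kj: "k - j = Suc (k - Suc j)" by auto
    have "real (k - Suc j + 2) * h \<le> real b * h" using k assms(2) by (intro mult_right_mono) auto
    then have "real (k - Suc j) * h + h + h \<le> 1" using assms(3) by (simp add: distrib_right)
    from heat_UC[OF assms(1,2) _ this, where L = L and k = k and x = x]
    show "heat h (UC g h L k (real (k - Suc j) * h)) x = UC g h L k (real (k - j) * h) x"
      using assms(2) unfolding kj by (simp add: distrib_right add.commute)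
  qed simp
  finally show ?thesis .
qed

text \<open>A discrete backward equation with source \<open>UC\<close> and terminal value 0:
  \<open>GC\<close> acts as a corrector. It lets the predicted contribution of a cell be exchanged
  for a telescoping difference plus a one-step prediction error.\<close>

lemma GC_step:
  assumes "\<And>t. bcont (g t)" "0 < h" "real b * h \<le> 1" "j < b"
  shows "GC g h L b j x = UC g h L j 0 x + heat h (GC g h L b (Suc j)) (x :: real^'d)"
  unfolding heat_GC[OF assms(1-3)] GC_def using assms(4)
  by (simp add: sum.atLeast_Suc_lessThan)

text \<open>Cells after the present one have been smoothed for a time at least h and contribute a
  singular sum in the distance to the cell. The present cell has q = 0 and no smoothing; it yields
  the extra Hoelder term in the modulus of \<open>GC\<close>. In the size bound the singularity is
  at most q^(-1/2), whose sum is the square root of the remaining length.\<close>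

lemma GC_regularity:
  assumes \<beta>: "0 < \<beta>" "\<beta> < 1" and \<theta>: "1 / 2 \<le> \<theta>" "\<theta> < 1 / 2 + \<beta> / 2"
  shows "\<exists>C\<ge>1. \<forall>K (g :: real \<Rightarrow> real^'d \<Rightarrow> real) h L b. (\<forall>t. holder K \<beta> (g t)) \<longrightarrow> 0 < h \<longrightarrow> 1 \<le> L \<longrightarrow> real b * h \<le> 1 \<longrightarrow>
    (\<forall>j x y. \<bar>heat h (GC g h L b (Suc j)) x - heat h (GC g h L b (Suc j)) y\<bar> \<le> C * K * h powr \<theta> * norm (x - y)) \<and>
    (\<forall>j x y. \<bar>GC g h L b j x - GC g h L b j y\<bar> \<le> C * K * h powr \<theta> * norm (x - y) + 2 * h * K * norm (x - y) powr \<beta>) \<and>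
    (\<forall>j x. j < b \<longrightarrow> \<bar>GC g h L b j x\<bar> \<le> C * K * h powr \<theta> * sqrt (real (b - j) * h))"
proof -
  have \<theta>': "\<beta> / 2 \<le> \<theta>" "\<theta> \<le> 1" using \<beta> \<theta> by auto
  obtain C7 where C7: "1 \<le> C7" and td: "\<And>K (g :: real^'d \<Rightarrow> real) q \<delta> x. holder K \<beta> g \<Longrightarrow> 0 < q \<Longrightarrow> 0 \<le> \<delta> \<Longrightarrow> q + \<delta> \<le> 1 \<Longrightarrow>
    \<bar>heat (q + \<delta>) g x - heat q g x\<bar> \<le> C7 * K * \<delta> powr \<theta> * q powr (\<beta> / 2 - \<theta>)"
    using holder_heat_time_diff[OF \<beta> \<theta>'] by blast
  obtain C8 where C8: "1 \<le> C8" and tl: "\<And>K (g :: real^'d \<Rightarrow> real) q \<delta> x y. holder K \<beta> g \<Longrightarrow> 0 < q \<Longrightarrow> 0 \<le> \<delta> \<Longrightarrow> q + \<delta> \<le> 1 \<Longrightarrow>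
    \<bar>(heat (q + \<delta>) g x - heat q g x) - (heat (q + \<delta>) g y - heat q g y)\<bar>
      \<le> C8 * K * \<delta> powr \<theta> * q powr (\<beta> / 2 - \<theta> - 1 / 2) * norm (x - y)"
    using holder_heat_time_diff_lipschitz[OF \<beta> \<theta>'] by blast
  define c where "c = 1 + (\<integral>z. norm z \<partial>(gauss :: (real^'d) measure))"
  have c1: "1 \<le> c" by (simp add: c_def)
  \<comment> \<open>The order of the singularity in the Lipschitz bound; it is summable exactly
    because \<theta> < 1/2 + \<beta>/2.\<close>
  define a where "a = \<theta> + 1 / 2 - \<beta> / 2"
  have a: "0 \<le> a" "a < 1" using \<theta> \<beta> by (auto simp: a_def)
  define C where "C = C8 / (1 - a) + c + 2 * C7"
  have CC: "C8 / (1 - a) \<le> C" "c + 2 * C7 \<le> C" "1 \<le> C"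
  proof -
    have "0 \<le> C8 / (1 - a)" using C8 a by simp
    then show "C8 / (1 - a) \<le> C" "c + 2 * C7 \<le> C" "1 \<le> C"
      using C7 c1 by (auto simp: C_def)
  qed
  have main: "\<bar>heat h (GC g h L b (Suc j)) x - heat h (GC g h L b (Suc j)) y\<bar> \<le> C * K * h powr \<theta> * norm (x - y)"
      "\<bar>GC g h L b j x - GC g h L b j y\<bar> \<le> C * K * h powr \<theta> * norm (x - y) + 2 * h * K * norm (x - y) powr \<beta>"
      "j < b \<Longrightarrow> \<bar>GC g h L b j x\<bar> \<le> C * K * h powr \<theta> * sqrt (real (b - j) * h)"
    if g: "\<And>t. holder K \<beta> (g t)" and h: "0 < h" and L: "1 \<le> L" and b: "real b * h \<le> 1"
    for K and g :: "real \<Rightarrow> real^'d \<Rightarrow> real" and h L b j x y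
  proof -
    have K0: "0 \<le> K" using holder_nonneg[OF g] .
    have gbc: "bcont (g t)" for t using holder_bcont[OF g] \<beta> by simp
    have kb: "0 < real (k - j) * h" "\<And>l. l < L \<Longrightarrow> real (k - j) * h + real l * (h / real L) \<le> 1" if "k \<in> {Suc j..<b}" for k
    proof -
      show "0 < real (k - j) * h" using that h by simp
      have "real (k - j + 1) * h \<le> real b * h" using that h by (intro mult_right_mono) auto
      then show "real (k - j) * h + real l * (h / real L) \<le> 1" if "l < L" for l
        using cell_point[OF h that] b by (simp add: distrib_right)
    qed
    have shift: "(\<Sum>k\<in>{Suc j..<b}. \<phi> (k - j)) = (\<Sum>i=1..b - Suc j. \<phi> i)" for \<phi> :: "nat \<Rightarrow> real"
      by (rule sum.reindex_bij_witness[of _ "\<lambda>i. i + j" "\<lambda>k. k - j"]) auto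
    show lip: "\<bar>heat h (GC g h L b (Suc j)) x - heat h (GC g h L b (Suc j)) y\<bar> \<le> C * K * h powr \<theta> * norm (x - y)" for x y
    proof -
      have U: "\<bar>UC g h L k (real (k - j) * h) x - UC g h L k (real (k - j) * h) y\<bar>
         \<le> h * (C8 * K * h powr \<theta> * (real (k - j) * h) powr (\<beta> / 2 - \<theta> - 1 / 2) * norm (x - y))" if k: "k \<in> {Suc j..<b}" for k
        unfolding UC_def right_diff_distrib[symmetric] sum_subtractf[symmetric]
      proof (rule abs_average_le[OF h L])
        fix l assume l: "l < L"
        let ?g = "g (real k * h + real l * (h / real L))" and ?q = "real (k - j) * h" and ?d = "real l * (h / real L)"
        have "\<bar>(heat (?q + ?d) ?g x - heat ?q ?g x) - (heat (?q + ?d) ?g y - heat ?q ?g y)\<bar>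
          \<le> C8 * K * ?d powr \<theta> * ?q powr (\<beta> / 2 - \<theta> - 1 / 2) * norm (x - y)"
          by (rule tl[OF g kb(1)[OF k] cell_point(1)[OF h l] kb(2)[OF k l]])
        also have "\<dots> \<le> C8 * K * h powr \<theta> * ?q powr (\<beta> / 2 - \<theta> - 1 / 2) * norm (x - y)"
          using C8 K0 cell_point[OF h l] \<theta> by (intro mult_right_mono mult_left_mono powr_mono2) auto
        finally show "\<bar>(heat (?q + ?d) ?g x - heat ?q ?g x) - (heat (?q + ?d) ?g y - heat ?q ?g y)\<bar>
          \<le> C8 * K * h powr \<theta> * ?q powr (\<beta> / 2 - \<theta> - 1 / 2) * norm (x - y)" .
      qed
      have "\<bar>heat h (GC g h L b (Suc j)) x - heat h (GC g h L b (Suc j)) y\<bar>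
         \<le> (\<Sum>k\<in>{Suc j..<b}. h * (C8 * K * h powr \<theta> * (real (k - j) * h) powr (\<beta> / 2 - \<theta> - 1 / 2) * norm (x - y)))"
        unfolding heat_GC[OF gbc h b] sum_subtractf[symmetric]
        by (intro sum_abs[THEN order_trans] sum_mono U)
      also have "\<dots> = C8 * K * h powr \<theta> * norm (x - y) * (\<Sum>k\<in>{Suc j..<b}. h * (real (k - j) * h) powr (- a))"
        by (simp add: sum_distrib_left a_def algebra_simps)
      also have "(\<Sum>k\<in>{Suc j..<b}. h * (real (k - j) * h) powr (- a)) = (\<Sum>i=1..b - Suc j. h * (real i * h) powr (- a))"
        by (rule shift)
      also have "C8 * K * h powr \<theta> * norm (x - y) * \<dots> \<le> C8 * K * h powr \<theta> * norm (x - y) * ((real (b - Suc j) * h) powr (1 - a) / (1 - a))"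
        using C8 K0 a h by (intro mult_left_mono sum_scaled_powr_le) auto
      also have "\<dots> \<le> C8 * K * h powr \<theta> * norm (x - y) * (1 / (1 - a))"
      proof (intro mult_left_mono divide_right_mono)
        have "real (b - Suc j) * h \<le> real b * h" using h by (intro mult_right_mono) auto
        then have "real (b - Suc j) * h \<le> 1" using b by linarith
        moreover have "0 \<le> real (b - Suc j) * h" using h by simp
        ultimately show "(real (b - Suc j) * h) powr (1 - a) \<le> 1"
          using a powr_mono2[of "1 - a" "real (b - Suc j) * h" 1] by simp
      qed (use a h C8 K0 in auto)
      also have "\<dots> = (C8 / (1 - a)) * (K * h powr \<theta> * norm (x - y))" by simp
      also have "\<dots> \<le> C * (K * h powr \<theta> * norm (x - y))"
        using CC K0 by (intro mult_right_mono) auto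
      finally show ?thesis by (simp add: mult.assoc)
    qed
    show "\<bar>GC g h L b j x - GC g h L b j y\<bar> \<le> C * K * h powr \<theta> * norm (x - y) + 2 * h * K * norm (x - y) powr \<beta>"
    proof (cases "j < b")
      case False
      then show ?thesis using CC K0 h by (auto simp: GC_def)
    next
      case True
      have "\<bar>UC g h L j 0 x - UC g h L j 0 y\<bar> \<le> h * (2 * (K * norm (x - y) powr \<beta>))"
        unfolding UC_def right_diff_distrib[symmetric] sum_subtractf[symmetric]
      proof (rule abs_average_le[OF h L])
        fix l
        let ?g = "g (real j * h + real l * (h / real L))" and ?d = "0 + real l * (h / real L)"
        have g1: "\<bar>?g u - ?g v\<bar> \<le> K * norm (u - v) powr \<beta>" for u v
          using g[of "real j * h + real l * (h / real L)"] unfolding holder_def by blast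
        have "\<bar>?g (u + (x - y)) - ?g u\<bar> \<le> K * norm (x - y) powr \<beta>" for u
          using g1[of "u + (x - y)" u] by simp
        from heat_osc_le[OF gbc this, of ?d y]
        show "\<bar>(heat ?d ?g x - heat 0 ?g x) - (heat ?d ?g y - heat 0 ?g y)\<bar> \<le> 2 * (K * norm (x - y) powr \<beta>)"
          using g1[of x y] by simp
      qed
      then show ?thesis
        using lip[of x y] unfolding GC_step[OF gbc h b True] by (simp add: mult_ac)
    qed
    show "\<bar>GC g h L b j x\<bar> \<le> C * K * h powr \<theta> * sqrt (real (b - j) * h)" if jb: "j < b"
    proof -
      have h1: "h \<le> 1"
      proof -
        have "1 * h \<le> real b * h" using jb h by (intro mult_right_mono) auto
        then show ?thesis using b by linarith
      qed
      have sh: "sqrt h \<le> sqrt (real (b - j) * h)"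
        using jb h mult_right_mono[of 1 "real (b - j)" h] by (intro real_sqrt_le_mono) auto
      have "\<bar>UC g h L j 0 x\<bar> \<le> h * (K * c * h powr (\<beta> / 2))"
        unfolding UC_def
      proof (rule abs_average_le[OF h L])
        fix l assume l: "l < L"
        let ?g = "g (real j * h + real l * (h / real L))" and ?d = "0 + real l * (h / real L)"
        have "\<bar>heat ?d ?g x - heat 0 ?g x\<bar> \<le> K * c * \<bar>?d - 0\<bar> powr (\<beta> / 2)"
          unfolding c_def using cell_point[OF h l] \<beta> by (intro heat_time_diff_holder[OF g]) auto
        also have "\<dots> \<le> K * c * h powr (\<beta> / 2)"
          using cell_point[OF h l] K0 c1 \<beta> by (intro mult_left_mono powr_mono2) auto
        finally show "\<bar>heat ?d ?g x - heat 0 ?g x\<bar> \<le> K * c * h powr (\<beta> / 2)" .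
      qed
      also have "\<dots> = K * c * (h powr 1 * h powr (\<beta> / 2))" using h by simp
      also have "h powr 1 * h powr (\<beta> / 2) = h powr (1 + \<beta> / 2)" by (rule powr_add[symmetric])
      also have "K * c * h powr (1 + \<beta> / 2) \<le> K * c * h powr (\<theta> + 1 / 2)"
        using K0 c1 h h1 \<theta> by (intro mult_left_mono powr_mono2_le_one) auto
      also have "h powr (\<theta> + 1 / 2) = h powr \<theta> * sqrt h"
        using h by (simp add: powr_add powr_half_sqrt)
      also have "K * c * (h powr \<theta> * sqrt h) \<le> K * c * (h powr \<theta> * sqrt (real (b - j) * h))"
        using K0 c1 sh by (intro mult_left_mono) auto
      finally have U0: "\<bar>UC g h L j 0 x\<bar> \<le> K * c * (h powr \<theta> * sqrt (real (b - j) * h))" .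
      have U: "\<bar>UC g h L k (real (k - j) * h) x\<bar>
         \<le> h * (C7 * K * h powr \<theta> * (real (k - j) * h) powr (- (1 / 2)))" if k: "k \<in> {Suc j..<b}" for k
        unfolding UC_def
      proof (rule abs_average_le[OF h L])
        fix l assume l: "l < L"
        let ?g = "g (real k * h + real l * (h / real L))" and ?q = "real (k - j) * h" and ?d = "real l * (h / real L)"
        have q1: "?q \<le> 1" using kb(2)[OF k l] cell_point[OF h l] by linarith
        have "\<bar>heat (?q + ?d) ?g x - heat ?q ?g x\<bar> \<le> C7 * K * ?d powr \<theta> * ?q powr (\<beta> / 2 - \<theta>)"
          by (rule td[OF g kb(1)[OF k] cell_point(1)[OF h l] kb(2)[OF k l]])
        also have "\<dots> \<le> C7 * K * h powr \<theta> * ?q powr (- (1 / 2))"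
        proof (rule mult_mono)
          show "C7 * K * ?d powr \<theta> \<le> C7 * K * h powr \<theta>"
            using C7 K0 cell_point[OF h l] \<theta> by (intro mult_left_mono powr_mono2) auto
          show "?q powr (\<beta> / 2 - \<theta>) \<le> ?q powr (- (1 / 2))"
            using \<theta> by (intro powr_mono2_le_one[OF less_imp_le[OF kb(1)[OF k]] q1]) linarith
        qed (use C7 K0 in auto)
        finally show "\<bar>heat (?q + ?d) ?g x - heat ?q ?g x\<bar> \<le> C7 * K * h powr \<theta> * ?q powr (- (1 / 2))" .
      qed
      have "\<bar>heat h (GC g h L b (Suc j)) x\<bar>
         \<le> (\<Sum>k\<in>{Suc j..<b}. h * (C7 * K * h powr \<theta> * (real (k - j) * h) powr (- (1 / 2))))"
        unfolding heat_GC[OF gbc h b] by (intro sum_abs[THEN order_trans] sum_mono U)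
      also have "\<dots> = C7 * K * h powr \<theta> * (\<Sum>k\<in>{Suc j..<b}. h * (real (k - j) * h) powr (- (1 / 2)))"
        by (simp add: sum_distrib_left algebra_simps)
      also have "(\<Sum>k\<in>{Suc j..<b}. h * (real (k - j) * h) powr (- (1 / 2))) = (\<Sum>i=1..b - Suc j. h * (real i * h) powr (- (1 / 2)))"
        by (rule shift)
      also have "C7 * K * h powr \<theta> * \<dots> \<le> C7 * K * h powr \<theta> * ((real (b - Suc j) * h) powr (1 - 1 / 2) / (1 - 1 / 2))"
        using C7 K0 h by (intro mult_left_mono sum_scaled_powr_le) auto
      also have "(real (b - Suc j) * h) powr (1 - 1 / 2) / (1 - 1 / 2) = 2 * sqrt (real (b - Suc j) * h)"
        using h by (simp add: powr_half_sqrt)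
      also have "C7 * K * h powr \<theta> * (2 * sqrt (real (b - Suc j) * h)) \<le> C7 * K * h powr \<theta> * (2 * sqrt (real (b - j) * h))"
        using C7 K0 h by (intro mult_left_mono real_sqrt_le_mono mult_right_mono) auto
      finally have "\<bar>heat h (GC g h L b (Suc j)) x\<bar> \<le> C7 * K * h powr \<theta> * (2 * sqrt (real (b - j) * h))" .
      with U0 have "\<bar>GC g h L b j x\<bar> \<le> (c + 2 * C7) * (K * h powr \<theta> * sqrt (real (b - j) * h))"
        unfolding GC_step[OF gbc h b jb] by (simp add: algebra_simps)
      also have "\<dots> \<le> C * (K * h powr \<theta> * sqrt (real (b - j) * h))"
        using CC K0 h by (intro mult_right_mono) auto
      finally show ?thesis by (simp add: mult.assoc)
    qed
  qed
  show ?thesis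
    by (intro exI[of _ C] conjI allI impI CC main) auto
qed

section \<open>Size of one-step martingale differences\<close>

lemma Lq_le_scaled_increment:
  assumes "0 \<le> s" "s < t" "t \<le> 1" "Lq_le (gauss :: (real^'d) measure) q c norm"
  shows "Lq_le M q c (\<lambda>\<omega>. norm (B t \<omega> - B s \<omega>) / sqrt (t - s))"
proof -
  have [measurable]: "B t \<in> borel_measurable M" "B s \<in> borel_measurable M"
    using assms B_measurable by auto
  have "(\<integral>\<^sup>+\<omega>. ennreal (\<bar>norm (B t \<omega> - B s \<omega>) / sqrt (t - s)\<bar> ^ q) \<partial>M)
     = (\<integral>\<^sup>+w. ennreal (\<bar>norm w / sqrt (t - s)\<bar> ^ q) \<partial>distr M borel (\<lambda>\<omega>. B t \<omega> - B s \<omega>))"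
    by (subst nn_integral_distr) auto
  also have "\<dots> = (\<integral>\<^sup>+z. ennreal (\<bar>norm (sqrt (t - s) *\<^sub>R z) / sqrt (t - s)\<bar> ^ q) \<partial>(gauss :: (real^'d) measure))"
    unfolding increment_law[OF assms(1-3)] by (subst nn_integral_distr) auto
  also have "\<dots> = (\<integral>\<^sup>+z. ennreal (\<bar>norm z\<bar> ^ q) \<partial>(gauss :: (real^'d) measure))"
    using assms(2) by simp
  finally show ?thesis using Lq_leD[OF assms(4)] by (auto simp: Lq_le_def)
qed

text \<open>The prediction and the realised value are both compared with \<phi>(W); only the modulus
  of \<phi> at distance sqrt(t - s) matters. The mixed modulus, Lipschitz plus Hoelder, is the one
  available for \<open>GC\<close>.\<close>

lemma Lq_le_orthogonal_increment:
  assumes \<beta>: "0 < \<beta>" "\<beta> \<le> 1" and q: "1 \<le> q"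
  shows "\<exists>c\<ge>1. \<forall>(\<phi> :: real^'d \<Rightarrow> real) A A' s t W. bcont \<phi> \<longrightarrow> 0 \<le> A \<longrightarrow> 0 \<le> A' \<longrightarrow> 0 \<le> s \<longrightarrow> s \<le> t \<longrightarrow> t \<le> 1 \<longrightarrow>
     W \<in> borel_measurable M \<longrightarrow> (\<forall>x y. \<bar>\<phi> x - \<phi> y\<bar> \<le> A * norm (x - y) + A' * norm (x - y) powr \<beta>) \<longrightarrow>
     Lq_le M q (c * (A * sqrt (t - s) + A' * (t - s) powr (\<beta> / 2))) (\<lambda>\<omega>. heat (t - s) \<phi> (W \<omega>) - \<phi> (W \<omega> + (B t \<omega> - B s \<omega>)))"
proof -
  obtain cq where cq: "Lq_le (gauss :: (real^'d) measure) q cq norm" using gauss_moment by blast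
  have cq0: "0 \<le> cq" using Lq_leD[OF cq] by simp
  define m1 where "m1 = (\<integral>z. norm z \<partial>(gauss :: (real^'d) measure))"
  have m10: "0 \<le> m1" by (simp add: m1_def)
  have i1: "integrable (gauss :: (real^'d) measure) norm" using integrable_gauss_norm_power[of 1] by simp
  show ?thesis
  proof (intro exI[of _ "(1 + m1) + (1 + cq)"] conjI allI impI)
    fix \<phi> :: "real^'d \<Rightarrow> real" and A A' s t :: real and W :: "'w \<Rightarrow> real^'d"
    assume bc: "bcont \<phi>" and A: "0 \<le> A" "0 \<le> A'" and st: "0 \<le> s" "s \<le> t" "t \<le> 1"
      and [measurable]: "W \<in> borel_measurable M"
      and mod: "\<forall>x y. \<bar>\<phi> x - \<phi> y\<bar> \<le> A * norm (x - y) + A' * norm (x - y) powr \<beta>"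
    define \<Lambda> where "\<Lambda> = A * sqrt (t - s) + A' * (t - s) powr (\<beta> / 2)"
    have \<Lambda>0: "0 \<le> \<Lambda>" using A st by (simp add: \<Lambda>_def)
    note [measurable] = bcont_measurable[OF bc] bcont_measurable[OF bcont_heat[OF bc]]
    have [measurable]: "B t \<in> borel_measurable M" "B s \<in> borel_measurable M"
      using st B_measurable by auto
    have md: "\<bar>\<phi> (x + sqrt (t - s) *\<^sub>R z) - \<phi> x\<bar> \<le> \<Lambda> * (1 + norm z)" for x z
    proof -
      have "\<bar>\<phi> (x + sqrt (t - s) *\<^sub>R z) - \<phi> x\<bar> \<le> A * norm (sqrt (t - s) *\<^sub>R z) + A' * norm (sqrt (t - s) *\<^sub>R z) powr \<beta>"
        using mod[rule_format, of "x + sqrt (t - s) *\<^sub>R z" x] by simp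
      also have "\<dots> = A * sqrt (t - s) * norm z + A' * ((t - s) powr (\<beta> / 2) * norm z powr \<beta>)"
        using st by (simp add: powr_mult powr_half_sqrt[symmetric] powr_powr)
      also have "\<dots> \<le> A * sqrt (t - s) * (1 + norm z) + A' * ((t - s) powr (\<beta> / 2) * (1 + norm z))"
      proof (intro add_mono mult_left_mono)
        show "norm z powr \<beta> \<le> 1 + norm z"
      proof (cases "norm z \<le> 1")
        case True
        then have "norm z powr \<beta> \<le> 1" using \<beta> by (intro powr_le1) auto
        then show ?thesis by (smt (verit) norm_ge_zero)
      next
        case False
        then have "norm z powr \<beta> \<le> norm z powr 1" using \<beta> by (intro powr_mono) auto
        then show ?thesis by simp
      qed
      qed (use A st in auto)
      finally show ?thesis by (simp add: \<Lambda>_def distrib_right mult.assoc)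
    qed
    have h1: "\<bar>heat (t - s) \<phi> x - \<phi> x\<bar> \<le> \<Lambda> * (1 + m1)" for x
    proof -
      have "heat (t - s) \<phi> x - \<phi> x = (\<integral>z. \<phi> (x + sqrt (t - s) *\<^sub>R z) - \<phi> x \<partial>gauss)"
        unfolding heat_def using integrable_heat[OF bc, of x "sqrt (t - s)"] gauss.prob_space[where 'd='d] by simp
      also have "\<bar>\<dots>\<bar> \<le> (\<integral>z. \<bar>\<phi> (x + sqrt (t - s) *\<^sub>R z) - \<phi> x\<bar> \<partial>gauss)"
        by (rule integral_abs_bound)
      also have "\<dots> \<le> (\<integral>z. \<Lambda> * (1 + norm z) \<partial>(gauss :: (real^'d) measure))"
        using i1 integrable_heat[OF bc, of x "sqrt (t - s)"] by (intro integral_mono md) auto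
      also have "\<dots> = \<Lambda> * (1 + m1)"
        using i1 gauss.prob_space[where 'd='d] by (simp add: m1_def)
      finally show ?thesis .
    qed
    have "Lq_le M q (\<Lambda> * (1 + m1)) (\<lambda>\<omega>. heat (t - s) \<phi> (W \<omega>) - \<phi> (W \<omega>))"
      using h1 \<Lambda>0 m10 by (intro Lq_le_bounded) auto
    moreover have "Lq_le M q (\<Lambda> * (1 + cq)) (\<lambda>\<omega>. \<phi> (W \<omega> + (B t \<omega> - B s \<omega>)) - \<phi> (W \<omega>))"
    proof (cases "s = t")
      case True
      then show ?thesis using \<Lambda>0 cq0 q by (simp add: Lq_le_def power_0_left)
    next
      case False
      then have lt: "s < t" using st by simp
      have "Lq_le M q (\<bar>\<Lambda>\<bar> * (1 + cq)) (\<lambda>\<omega>. \<Lambda> * (1 + norm (B t \<omega> - B s \<omega>) / sqrt (t - s)))"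
        using st lt q by (intro Lq_le_cmult Lq_le_add Lq_le_scaled_increment cq Lq_le_bounded) auto
      then show ?thesis
      proof (rule Lq_le_mono)
        show "AE \<omega> in M. \<bar>\<phi> (W \<omega> + (B t \<omega> - B s \<omega>)) - \<phi> (W \<omega>)\<bar> \<le> \<bar>\<Lambda> * (1 + norm (B t \<omega> - B s \<omega>) / sqrt (t - s))\<bar>"
        proof (rule AE_I2)
          fix \<omega>
          have "B t \<omega> - B s \<omega> = sqrt (t - s) *\<^sub>R ((1 / sqrt (t - s)) *\<^sub>R (B t \<omega> - B s \<omega>))"
            using lt by simp
          then have "\<bar>\<phi> (W \<omega> + (B t \<omega> - B s \<omega>)) - \<phi> (W \<omega>)\<bar> \<le> \<Lambda> * (1 + norm ((1 / sqrt (t - s)) *\<^sub>R (B t \<omega> - B s \<omega>)))"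
            using md[of "W \<omega>" "(1 / sqrt (t - s)) *\<^sub>R (B t \<omega> - B s \<omega>)"] by simp
          then show "\<bar>\<phi> (W \<omega> + (B t \<omega> - B s \<omega>)) - \<phi> (W \<omega>)\<bar> \<le> \<bar>\<Lambda> * (1 + norm (B t \<omega> - B s \<omega>) / sqrt (t - s))\<bar>"
            using st by simp
        qed
      qed (use \<Lambda>0 in auto)
    qed
    ultimately have "Lq_le M q (\<Lambda> * (1 + m1) + \<Lambda> * (1 + cq))
       (\<lambda>\<omega>. (heat (t - s) \<phi> (W \<omega>) - \<phi> (W \<omega>)) - (\<phi> (W \<omega> + (B t \<omega> - B s \<omega>)) - \<phi> (W \<omega>)))"
      using q by (intro Lq_le_diff)
    then show "Lq_le M q ((1 + m1 + (1 + cq)) * (A * sqrt (t - s) + A' * (t - s) powr (\<beta> / 2)))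
       (\<lambda>\<omega>. heat (t - s) \<phi> (W \<omega>) - \<phi> (W \<omega> + (B t \<omega> - B s \<omega>)))"
      by (simp add: \<Lambda>_def[symmetric] algebra_simps)
  qed (use m10 cq0 in simp)
qed

end

lemma Lq_le_average:
  assumes "0 < h" "1 \<le> L" "1 \<le> q" "\<And>l. l < L \<Longrightarrow> Lq_le M q A (c l)"
  shows "Lq_le M q (h * A) (\<lambda>\<omega>. (h / real L) * (\<Sum>l<L. c l \<omega>))"
proof -
  have "Lq_le M q (\<bar>h / real L\<bar> * (real L * A)) (\<lambda>\<omega>. (h / real L) * (\<Sum>l<L. c l \<omega>))"
    using assms by (intro Lq_le_cmult Lq_le_sum_const)
  then show ?thesis using assms(1,2) by simp
qed

context filtered_bm
begin

text \<open>The drift \<open>v j\<close> of a cell must be known at the left grid point although it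
  depends on the sampling point of that cell; this is consistent because the filtration may contain
  all sampling points. The representation inside a cell is required at every \<omega>, so it can be
  substituted as an identity.\<close>

definition euler_scheme :: "real \<Rightarrow> nat \<Rightarrow> (real \<Rightarrow> 'w \<Rightarrow> real^'d) \<Rightarrow> (nat \<Rightarrow> 'w \<Rightarrow> real^'d) \<Rightarrow> bool" where
  "euler_scheme K n Y v \<longleftrightarrow> (\<forall>t\<in>{0..1}. Y t \<in> borel_measurable (F t)) \<and>
     (\<forall>j<n. v j \<in> borel_measurable (F (real j / real n)) \<and>
       (\<forall>\<omega>\<in>space M. norm (v j \<omega>) \<le> K \<and>
         (\<forall>r\<in>{real j / real n..real (Suc j) / real n}.
            Y r \<omega> = Y (real j / real n) \<omega> + (r - real j / real n) *\<^sub>R v j \<omega> + (B r \<omega> - B (real j / real n) \<omega>))))"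

text \<open>Within a cell the drift of the Euler scheme is known at the left grid point. Putting it into the
  argument of the heat operator leaves exact martingale differences.\<close>

lemma euler_cells_bound:
  assumes \<beta>: "0 < \<beta>" "\<beta> < 1" and \<theta>: "1 / 2 \<le> \<theta>" "\<theta> < 1 / 2 + \<beta> / 2" and m: "1 \<le> m" and K: "0 < K"
  shows "\<exists>G>0. \<forall>(g :: real \<Rightarrow> real^'d \<Rightarrow> real) Y v n L a b.
    (\<forall>t. holder K \<beta> (g t)) \<longrightarrow> euler_scheme K n Y v \<longrightarrow> 1 \<le> n \<longrightarrow> 1 \<le> L \<longrightarrow> a < b \<longrightarrow> b \<le> n \<longrightarrow>
    Lq_le M (2 * m) (G * (1 / real n) powr \<theta> * sqrt (real (b - a) / real n))
      (\<lambda>\<omega>. \<Sum>j\<in>{a..<b}. (1 / real n / real L) * (\<Sum>l<L.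
          g (real j / real n + real l * (1 / real n / real L)) (Y (real j / real n + real l * (1 / real n / real L)) \<omega>)
        - g (real j / real n + real l * (1 / real n / real L)) (Y (real j / real n) \<omega>)))"
proof -
  obtain C4 where C4: "1 \<le> C4" and lip: "\<And>K (g :: real^'d \<Rightarrow> real) r x y. holder K \<beta> g \<Longrightarrow> 0 < r \<Longrightarrow> r \<le> 1 \<Longrightarrow>
    \<bar>heat r g x - heat r g y\<bar> \<le> C4 * K * r powr ((\<beta> - 1) / 2) * norm (x - y)"
    using holder_heat_lipschitz[OF \<beta>] by blast
  obtain C where C: "1 \<le> C" and GR: "\<And>K (g :: real \<Rightarrow> real^'d \<Rightarrow> real) h L b. (\<And>t. holder K \<beta> (g t)) \<Longrightarrow> 0 < h \<Longrightarrow> 1 \<le> L \<Longrightarrow> real b * h \<le> 1 \<Longrightarrow>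
    (\<forall>j x y. \<bar>heat h (GC g h L b (Suc j)) x - heat h (GC g h L b (Suc j)) y\<bar> \<le> C * K * h powr \<theta> * norm (x - y)) \<and>
    (\<forall>j x y. \<bar>GC g h L b j x - GC g h L b j y\<bar> \<le> C * K * h powr \<theta> * norm (x - y) + 2 * h * K * norm (x - y) powr \<beta>) \<and>
    (\<forall>j x. j < b \<longrightarrow> \<bar>GC g h L b j x\<bar> \<le> C * K * h powr \<theta> * sqrt (real (b - j) * h))"
    using GC_regularity[OF \<beta> \<theta>] by blast
  have m2: "1 \<le> 2 * m" using m by simp
  have \<beta>1: "\<beta> \<le> 1" using \<beta> by simp
  obtain c where c: "1 \<le> c" and OI: "\<And>(\<phi> :: real^'d \<Rightarrow> real) A A' s t W. bcont \<phi> \<Longrightarrow> 0 \<le> A \<Longrightarrow> 0 \<le> A' \<Longrightarrow> 0 \<le> s \<Longrightarrow> s \<le> t \<Longrightarrow> t \<le> 1 \<Longrightarrow>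
     W \<in> borel_measurable M \<Longrightarrow> (\<And>x y. \<bar>\<phi> x - \<phi> y\<bar> \<le> A * norm (x - y) + A' * norm (x - y) powr \<beta>) \<Longrightarrow>
     Lq_le M (2 * m) (c * (A * sqrt (t - s) + A' * (t - s) powr (\<beta> / 2))) (\<lambda>\<omega>. heat (t - s) \<phi> (W \<omega>) - \<phi> (W \<omega> + (B t \<omega> - B s \<omega>)))"
    using Lq_le_orthogonal_increment[OF \<beta>(1) \<beta>1 m2] by blast
  define cm where "cm = sqrt (3 * 4 ^ m)"
  have cm: "0 < cm" by (simp add: cm_def)
  \<comment> \<open>The three summands belong to the martingale part, to the drift inside the heat
    operators, and to the initial value of the corrector.\<close>
  define G where "G = cm * (c * K * (C + 3)) + K * K * (C4 + C) + C * K"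
  have G0: "0 < G" using cm c K C C4 by (auto simp: G_def intro!: add_pos_pos mult_pos_pos)
  show ?thesis
  proof (intro exI[of _ G] conjI allI impI)
    fix g :: "real \<Rightarrow> real^'d \<Rightarrow> real" and Y v and n L a b :: nat
    assume g: "\<forall>t. holder K \<beta> (g t)" and es: "euler_scheme K n Y v" and n: "1 \<le> n" and L: "1 \<le> L" and ab: "a < b" and bn: "b \<le> n"
    define h where "h = 1 / real n"
    have h: "0 < h" "h \<le> 1" using n by (auto simp: h_def)
    define t where "t j = real j / real n" for j
    have th: "t j = real j * h" for j by (simp add: t_def h_def)
    have tS: "t (Suc j) = t j + h" for j by (simp add: th algebra_simps)
    have t01: "0 \<le> t j" "j \<le> n \<Longrightarrow> t j \<le> 1" for j using n by (auto simp: t_def divide_le_eq)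
    have bh: "real b * h \<le> 1" using t01[of b] bn by (simp add: th)
    define \<rho> where "\<rho> l = real l * (h / real L)" for l
    have \<rho>: "0 \<le> \<rho> l" "\<rho> l \<le> h" if "l < L" for l using cell_point[OF h(1) that] by (auto simp: \<rho>_def)
    have holg: "holder K \<beta> (g s)" for s using g by blast
    have gbc: "bcont (g s)" for s using holder_bcont[OF holg] \<beta> by simp
    have gb: "\<bar>g s x\<bar> \<le> K" for s x using holg by (auto simp: holder_def)
    have gm [measurable]: "g s \<in> borel_measurable borel" for s using bcont_measurable[OF gbc] .
    define GG where "GG j = GC g h L b j" for j
    have GGbc: "bcont (GG j)" for j unfolding GG_def by (intro bcont_GC gbc)
    have GGm [measurable]: "GG j \<in> borel_measurable borel" "heat h (GG j) \<in> borel_measurable borel" for j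
      using bcont_measurable[OF GGbc] bcont_measurable[OF bcont_heat[OF GGbc]] by auto
    have GG1: "\<bar>heat h (GG (Suc j)) x - heat h (GG (Suc j)) y\<bar> \<le> C * K * h powr \<theta> * norm (x - y)" for j x y
      unfolding GG_def using GR[of K g, OF holg h(1) L bh] by blast
    have GG2: "\<bar>GG j x - GG j y\<bar> \<le> C * K * h powr \<theta> * norm (x - y) + 2 * h * K * norm (x - y) powr \<beta>" for j x y
      unfolding GG_def using GR[of K g, OF holg h(1) L bh] by blast
    have GG3: "j < b \<Longrightarrow> \<bar>GG j x\<bar> \<le> C * K * h powr \<theta> * sqrt (real (b - j) * h)" for j x
      unfolding GG_def using GR[of K g, OF holg h(1) L bh] by blast
    have GG4: "\<bar>GG j x\<bar> \<le> 2 * K" for j x unfolding GG_def by (rule GC_bound_trivial[of g K, OF gbc gb h(1) L bh])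
    have GGb: "GG b x = 0" for x by (simp add: GG_def GC_def)
    have YF: "Y s \<in> borel_measurable (F s)" if "0 \<le> s" "s \<le> 1" for s
      using es that by (auto simp: euler_scheme_def)
    have vF: "v j \<in> borel_measurable (F (t j))" if "j < n" for j
      using es that by (auto simp: euler_scheme_def t_def)
    have vK: "norm (v j \<omega>) \<le> K" if "j < n" "\<omega> \<in> space M" for j \<omega>
      using es that by (auto simp: euler_scheme_def)
    have Yr: "Y (t j + r) \<omega> = Y (t j) \<omega> + r *\<^sub>R v j \<omega> + (B (t j + r) \<omega> - B (t j) \<omega>)"
      if "j < n" "\<omega> \<in> space M" "0 \<le> r" "r \<le> h" for j \<omega> r
    proof -
      have "t j + r \<in> {real j / real n..real (Suc j) / real n}"
        using that tS[of j] by (simp add: t_def)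
      then have "Y (t j + r) \<omega> = Y (real j / real n) \<omega> + (t j + r - real j / real n) *\<^sub>R v j \<omega> + (B (t j + r) \<omega> - B (real j / real n) \<omega>)"
        using es that(1,2) unfolding euler_scheme_def by blast
      then show ?thesis by (simp add: t_def)
    qed
    \<comment> \<open>The position after time \<rho> l in the cell with the Brownian increment
      removed; it is known at the left grid point, so the heat operator applied there predicts
      exactly.\<close>
    define w where "w j l \<omega> = Y (t j) \<omega> + \<rho> l *\<^sub>R v j \<omega>" for j l \<omega>
    define u where "u j \<omega> = Y (t j) \<omega> + h *\<^sub>R v j \<omega>" for j \<omega>
    have wF: "w j l \<in> borel_measurable (F (t j))" if "j < n" for j l
      unfolding w_def[abs_def] using YF[of "t j"] vF[OF that] t01[of j] that by (intro borel_measurable_add borel_measurable_scaleR) auto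
    have uF: "u j \<in> borel_measurable (F (t j))" if "j < n" for j
      unfolding u_def[abs_def] using YF[of "t j"] vF[OF that] t01[of j] that by (intro borel_measurable_add borel_measurable_scaleR) auto
    define Mt where "Mt j \<omega> = (h / real L) * (\<Sum>l<L. heat (\<rho> l) (g (t j + \<rho> l)) (w j l \<omega>) - g (t j + \<rho> l) (w j l \<omega> + (B (t j + \<rho> l) \<omega> - B (t j) \<omega>)))" for j \<omega>
    define Mtt where "Mtt j \<omega> = heat h (GG (Suc j)) (u j \<omega>) - GG (Suc j) (u j \<omega> + (B (t (Suc j)) \<omega> - B (t j) \<omega>))" for j \<omega>
    define D1 where "D1 j \<omega> = (h / real L) * (\<Sum>l<L. heat (\<rho> l) (g (t j + \<rho> l)) (w j l \<omega>) - heat (\<rho> l) (g (t j + \<rho> l)) (Y (t j) \<omega>))" for j \<omega>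
    define D2 where "D2 j \<omega> = heat h (GG (Suc j)) (u j \<omega>) - heat h (GG (Suc j)) (Y (t j) \<omega>)" for j \<omega>
    define cell where "cell j \<omega> = (h / real L) * (\<Sum>l<L. g (t j + \<rho> l) (Y (t j + \<rho> l) \<omega>) - g (t j + \<rho> l) (Y (t j) \<omega>))" for j \<omega>
    \<comment> \<open>\<open>Mt\<close> and \<open>Mtt\<close> are the prediction errors inside the
      cell and of the corrector, \<open>D1\<close> and \<open>D2\<close> remove the drift from the
      arguments again, and the remaining difference of correctors telescopes over the cells.\<close>
    have cell_eq: "cell j \<omega> = - (Mt j \<omega> + Mtt j \<omega>) + (D1 j \<omega> + D2 j \<omega>) + (GG j (Y (t j) \<omega>) - GG (Suc j) (Y (t (Suc j)) \<omega>))"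
      if j: "j < b" and \<omega>: "\<omega> \<in> space M" for j \<omega>
    proof -
      have jn: "j < n" using j bn by simp
      have U: "UC g h L j 0 (Y (t j) \<omega>) = (h / real L) * (\<Sum>l<L. heat (\<rho> l) (g (t j + \<rho> l)) (Y (t j) \<omega>) - g (t j + \<rho> l) (Y (t j) \<omega>))"
        by (simp add: UC_def \<rho>_def th)
      have "cell j \<omega> = (h / real L) * (\<Sum>l<L. g (t j + \<rho> l) (w j l \<omega> + (B (t j + \<rho> l) \<omega> - B (t j) \<omega>)) - g (t j + \<rho> l) (Y (t j) \<omega>))"
        unfolding cell_def w_def using Yr[OF jn \<omega>] \<rho> by (intro arg_cong2[where f = times] sum.cong) auto
      also have "\<dots> = - Mt j \<omega> + D1 j \<omega> + UC g h L j 0 (Y (t j) \<omega>)"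
        unfolding Mt_def D1_def U by (simp only: sum_subtractf) (simp add: algebra_simps)
      also have "UC g h L j 0 (Y (t j) \<omega>) = GG j (Y (t j) \<omega>) - heat h (GG (Suc j)) (Y (t j) \<omega>)"
        unfolding GG_def GC_step[OF gbc h(1) bh j] by simp
      also have "\<dots> = GG j (Y (t j) \<omega>) - GG (Suc j) (Y (t (Suc j)) \<omega>) - Mtt j \<omega> + D2 j \<omega>"
        using Yr[OF jn \<omega>, of h] h by (simp add: Mtt_def D2_def u_def tS)
      finally show ?thesis by simp
    qed
    define P where "P = b - a"
    have P1: "1 \<le> P" and Pb: "\<And>i. i < P \<Longrightarrow> a + i < b" "\<And>i. i < P \<Longrightarrow> a + i < n" "a + P = b"
      using ab bn by (auto simp: P_def)
    \<comment> \<open>C comes from the Lipschitz part of the corrector; the 3 is 1 from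
      \<open>Mt\<close> plus 2 from the Hoelder part of the corrector, both of order
      h^(1+\<beta>/2).\<close>
    define z where "z = c * K * (C + 3) * (h powr \<theta> * sqrt h)"
    have z0: "0 < z" using c K C h by (simp add: z_def)
    have hp: "h * h powr (\<beta> / 2) \<le> h powr \<theta> * sqrt h"
    proof -
      have "h * h powr (\<beta> / 2) = h powr (1 + \<beta> / 2)" using h by (simp add: powr_add)
      also have "\<dots> \<le> h powr (\<theta> + 1 / 2)" using h \<theta> by (intro powr_mono2_le_one) auto
      also have "\<dots> = h powr \<theta> * sqrt h" using h by (simp add: powr_add powr_half_sqrt)
      finally show ?thesis .
    qed
    have tr: "0 \<le> t j" "t j \<le> t j + \<rho> l" "t j + \<rho> l \<le> t (Suc j)" "t (Suc j) \<le> 1" if "j < n" "l < L" for j l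
      using t01[of j] t01[of "Suc j"] \<rho>[OF that(2)] that(1) tS[of j] by auto
    have ts: "t j \<le> t (Suc j)" for j using tS h by simp
    have MtLq: "Lq_le M (2 * m) z (\<lambda>\<omega>. Mt j \<omega> + Mtt j \<omega>)" if j: "j < n" for j
    proof -
      have 1: "Lq_le M (2 * m) (h * (c * (K * h powr (\<beta> / 2)))) (Mt j)"
        unfolding Mt_def[abs_def]
      proof (rule Lq_le_average[OF h(1) L m2])
        fix l assume l: "l < L"
        note tt = tr[OF j l]
        have "Lq_le M (2 * m) (c * (0 * sqrt (t j + \<rho> l - t j) + K * (t j + \<rho> l - t j) powr (\<beta> / 2)))
          (\<lambda>\<omega>. heat (t j + \<rho> l - t j) (g (t j + \<rho> l)) (w j l \<omega>) - g (t j + \<rho> l) (w j l \<omega> + (B (t j + \<rho> l) \<omega> - B (t j) \<omega>)))"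
          using tt K holg measurable_F_M[OF wF[OF j]] by (intro OI gbc) (auto simp: holder_def)
        then show "Lq_le M (2 * m) (c * (K * h powr (\<beta> / 2)))
          (\<lambda>\<omega>. heat (\<rho> l) (g (t j + \<rho> l)) (w j l \<omega>) - g (t j + \<rho> l) (w j l \<omega> + (B (t j + \<rho> l) \<omega> - B (t j) \<omega>)))"
          using c K \<rho>[OF l] \<beta> by (intro Lq_le_weaken[where c' = "c * (K * h powr (\<beta> / 2))" and c = "c * (K * \<rho> l powr (\<beta> / 2))"])
            (auto intro!: mult_left_mono powr_mono2)
      qed
      have 2: "Lq_le M (2 * m) (c * (C * K * h powr \<theta> * sqrt (t (Suc j) - t j) + 2 * h * K * (t (Suc j) - t j) powr (\<beta> / 2))) 
         (\<lambda>\<omega>. heat (t (Suc j) - t j) (GG (Suc j)) (u j \<omega>) - GG (Suc j) (u j \<omega> + (B (t (Suc j)) \<omega> - B (t j) \<omega>)))"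
        using t01[of j] t01[of "Suc j"] ts[of j] j C K h measurable_F_M[OF uF[OF j]] by (intro OI GGbc GG2) auto
      then have 2: "Lq_le M (2 * m) (c * (C * K * h powr \<theta> * sqrt h + 2 * h * K * h powr (\<beta> / 2))) (Mtt j)"
        by (simp add: Mtt_def[abs_def] tS)
      have "h * (c * (K * h powr (\<beta> / 2))) + c * (C * K * h powr \<theta> * sqrt h + 2 * h * K * h powr (\<beta> / 2))
         = c * K * (3 * (h * h powr (\<beta> / 2)) + C * (h powr \<theta> * sqrt h))"
        by (simp add: algebra_simps)
      also have "\<dots> \<le> c * K * (3 * (h powr \<theta> * sqrt h) + C * (h powr \<theta> * sqrt h))"
        using hp c K by (intro mult_left_mono add_right_mono) auto
      also have "\<dots> = z" by (simp add: z_def algebra_simps)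
      finally show ?thesis by (rule Lq_le_weaken[OF Lq_le_add[OF 1 2 m2]])
    qed
    have mart: "Lq_le M (2 * m) (cm * sqrt (real P) * z) (\<lambda>\<omega>. \<Sum>i<P. Mt (a + i) \<omega> + Mtt (a + i) \<omega>)"
      unfolding cm_def
    proof (rule Lq_le_martingale_sum[where F = "\<lambda>i. F (t (a + i))" and A = "6 * K"])
      fix i assume i: "i < P"
      then have j: "a + i < n" using Pb by simp
      let ?j = "a + i"
      have FS: "X \<in> borel_measurable (F (t (Suc ?j)))" if "X \<in> borel_measurable (F (t ?j))" for X :: "'w \<Rightarrow> real^'d"
        using measurable_F_mono[OF that] t01[of ?j] t01[of "Suc ?j"] ts[of ?j] j by simp
      have [measurable]: "w ?j l \<in> borel_measurable (F (t (Suc ?j)))" "u ?j \<in> borel_measurable (F (t (Suc ?j)))"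
        "B (t ?j) \<in> borel_measurable (F (t (Suc ?j)))" "B (t (Suc ?j)) \<in> borel_measurable (F (t (Suc ?j)))" for l
        using FS[OF wF[OF j]] FS[OF uF[OF j]] FS[OF adapted] adapted[of "t (Suc ?j)"] t01[of ?j] t01[of "Suc ?j"] j by auto
      have Bl: "B (t ?j + \<rho> l) \<in> borel_measurable (F (t (Suc ?j)))" if "l < L" for l
        using tr[OF j that] by (intro measurable_F_mono[OF adapted]) auto
      have hm: "heat r (g s) \<in> borel_measurable borel" for r s
        using bcont_measurable[OF bcont_heat[OF gbc]] .
      have "Mt ?j \<in> borel_measurable (F (t (Suc ?j)))"
        unfolding Mt_def[abs_def]
      proof (intro borel_measurable_times borel_measurable_const borel_measurable_sum borel_measurable_diff)
        fix l assume "l \<in> {..<L}"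
        then have [measurable]: "B (t ?j + \<rho> l) \<in> borel_measurable (F (t (Suc ?j)))" using Bl by simp
        note [measurable] = hm
        show "(\<lambda>\<omega>. heat (\<rho> l) (g (t ?j + \<rho> l)) (w ?j l \<omega>)) \<in> borel_measurable (F (t (Suc ?j)))"
          "(\<lambda>\<omega>. g (t ?j + \<rho> l) (w ?j l \<omega> + (B (t ?j + \<rho> l) \<omega> - B (t ?j) \<omega>))) \<in> borel_measurable (F (t (Suc ?j)))"
          by measurable
      qed
      moreover have "Mtt ?j \<in> borel_measurable (F (t (Suc ?j)))"
        unfolding Mtt_def[abs_def] by measurable
      ultimately show "(\<lambda>\<omega>. Mt ?j \<omega> + Mtt ?j \<omega>) \<in> borel_measurable (F (t (a + Suc i)))"
        by simp
      fix \<omega> assume "\<omega> \<in> space M"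
      have "\<bar>Mt ?j \<omega>\<bar> \<le> h * (2 * K)"
        unfolding Mt_def
      proof (rule abs_average_le[OF h(1) L])
        fix l
        show "\<bar>heat (\<rho> l) (g (t ?j + \<rho> l)) (w ?j l \<omega>) - g (t ?j + \<rho> l) (w ?j l \<omega> + (B (t ?j + \<rho> l) \<omega> - B (t ?j) \<omega>))\<bar> \<le> 2 * K"
          using heat_bound[OF gbc gb, of "\<rho> l" "t ?j + \<rho> l" "w ?j l \<omega>"] gb[of "t ?j + \<rho> l" "w ?j l \<omega> + (B (t ?j + \<rho> l) \<omega> - B (t ?j) \<omega>)"]
          by linarith
      qed
      also have "\<dots> \<le> 1 * (2 * K)" using h K by (intro mult_right_mono) auto
      finally have "\<bar>Mt ?j \<omega>\<bar> \<le> 2 * K" by simp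
      moreover have "\<bar>Mtt ?j \<omega>\<bar> \<le> 4 * K"
        using heat_bound[OF GGbc GG4, of h "Suc ?j" "u ?j \<omega>"] GG4[of "Suc ?j" "u ?j \<omega> + (B (t (Suc ?j)) \<omega> - B (t ?j) \<omega>)"]
        unfolding Mtt_def by linarith
      ultimately show "\<bar>Mt ?j \<omega> + Mtt ?j \<omega>\<bar> \<le> 6 * K" by linarith
    next
      fix i :: nat and S :: "'w \<Rightarrow> real" and Ab :: real assume i: "i < P" and S: "S \<in> borel_measurable (F (t (a + i)))" "\<And>\<omega>. \<omega> \<in> space M \<Longrightarrow> \<bar>S \<omega>\<bar> \<le> Ab"
      let ?j = "a + i"
      have j: "?j < n" using Pb i by simp
      have tj: "0 \<le> t ?j" "t (Suc ?j) \<le> 1" using t01(1)[of ?j] t01(2)[of "Suc ?j"] j by auto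
      note o2 = orthogonal_increment[OF tj(1) ts tj(2) S uF[OF j] GGbc[of "Suc ?j"]]
      define c1 where "c1 l \<omega> = S \<omega> * (heat (\<rho> l) (g (t ?j + \<rho> l)) (w ?j l \<omega>) - g (t ?j + \<rho> l) (w ?j l \<omega> + (B (t ?j + \<rho> l) \<omega> - B (t ?j) \<omega>)))" for l \<omega>
      have o1: "integrable M (c1 l)" "expectation (c1 l) = 0" if "l < L" for l
      proof -
        have "t ?j + \<rho> l \<le> 1" using tr[OF j that] by simp
        from orthogonal_increment[OF tj(1) tr(2)[OF j that] this S wF[OF j, of l] gbc[of "t ?j + \<rho> l"]]
        show "integrable M (c1 l)" "expectation (c1 l) = 0" by (auto simp: c1_def[abs_def])
      qed
      have "(\<lambda>\<omega>. S \<omega> * (Mt ?j \<omega> + Mtt ?j \<omega>)) = (\<lambda>\<omega>. (h / real L) * (\<Sum>l<L. c1 l \<omega>) + S \<omega> * Mtt ?j \<omega>)"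
        by (simp add: Mt_def c1_def sum_distrib_left distrib_left mult_ac)
      moreover have "integrable M (\<lambda>\<omega>. \<Sum>l<L. c1 l \<omega>)" "expectation (\<lambda>\<omega>. \<Sum>l<L. c1 l \<omega>) = 0"
        using o1 by (auto intro!: Bochner_Integration.integrable_sum simp: Bochner_Integration.integral_sum)
      moreover have "integrable M (\<lambda>\<omega>. S \<omega> * Mtt ?j \<omega>)" "expectation (\<lambda>\<omega>. S \<omega> * Mtt ?j \<omega>) = 0"
        using o2 j by (auto simp: Mtt_def tS)
      ultimately show "expectation (\<lambda>\<omega>. S \<omega> * (Mt ?j \<omega> + Mtt ?j \<omega>)) = 0"
        by (simp add: Bochner_Integration.integral_add)
    next
      fix i assume "i \<le> P"
      then show "subalgebra M (F (t (a + i)))" using t01[of "a + i"] Pb bn by (intro subalg) auto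
    next
      fix i j assume "i \<le> j" "j \<le> P"
      then show "sets (F (t (a + i))) \<subseteq> sets (F (t (a + j)))"
        using t01[of "a + i"] t01[of "a + j"] Pb bn h by (intro filtration_mono) (auto simp: th)
    next
      fix i assume "i < P"
      then show "Lq_le M (2 * m) z (\<lambda>\<omega>. Mt (a + i) \<omega> + Mtt (a + i) \<omega>)" using Pb by (intro MtLq) auto
    qed (use m z0 in auto)
    have Ph: "real P * h \<le> 1"
    proof -
      have "real P * h \<le> real b * h" using h Pb by (intro mult_right_mono) auto
      then show ?thesis using bh by linarith
    qed
    define Q where "Q = h powr \<theta> * sqrt (real P * h)"
    have Q0: "0 \<le> Q" using h by (simp add: Q_def)
    have D: "\<bar>D1 j \<omega> + D2 j \<omega>\<bar> \<le> K * K * (C4 + C) * h powr \<theta> * h" if j: "j < n" and \<omega>: "\<omega> \<in> space M" for j \<omega>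
    proof -
      have "\<bar>D1 j \<omega>\<bar> \<le> h * (C4 * K * K * h powr \<theta>)"
        unfolding D1_def
      proof (rule abs_average_le[OF h(1) L])
        fix l assume l: "l < L"
        show "\<bar>heat (\<rho> l) (g (t j + \<rho> l)) (w j l \<omega>) - heat (\<rho> l) (g (t j + \<rho> l)) (Y (t j) \<omega>)\<bar> \<le> C4 * K * K * h powr \<theta>"
        proof (cases "\<rho> l = 0")
          case True
          then show ?thesis using C4 K by (simp add: w_def)
        next
          case False
          then have r: "0 < \<rho> l" "\<rho> l \<le> 1" using \<rho>[OF l] h by auto
          have "\<bar>heat (\<rho> l) (g (t j + \<rho> l)) (w j l \<omega>) - heat (\<rho> l) (g (t j + \<rho> l)) (Y (t j) \<omega>)\<bar>
             \<le> C4 * K * \<rho> l powr ((\<beta> - 1) / 2) * norm (w j l \<omega> - Y (t j) \<omega>)"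
            by (rule lip[OF holg r])
          also have "norm (w j l \<omega> - Y (t j) \<omega>) = \<rho> l * norm (v j \<omega>)" using r by (simp add: w_def)
          also have "C4 * K * \<rho> l powr ((\<beta> - 1) / 2) * (\<rho> l * norm (v j \<omega>)) \<le> C4 * K * \<rho> l powr ((\<beta> - 1) / 2) * (\<rho> l * K)"
            using vK[OF j \<omega>] r C4 K by (intro mult_left_mono) auto
          also have "\<dots> = C4 * K * K * (\<rho> l powr ((\<beta> - 1) / 2) * \<rho> l powr 1)" using r by simp
          also have "\<rho> l powr ((\<beta> - 1) / 2) * \<rho> l powr 1 = \<rho> l powr ((\<beta> - 1) / 2 + 1)" by (rule powr_add[symmetric])
          also have "C4 * K * K * \<rho> l powr ((\<beta> - 1) / 2 + 1) \<le> C4 * K * K * h powr ((\<beta> - 1) / 2 + 1)"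
            using \<rho>[OF l] C4 K \<beta> by (intro mult_left_mono powr_mono2) (auto simp: field_simps)
          also have "\<dots> \<le> C4 * K * K * h powr \<theta>"
            using h C4 K \<theta> by (intro mult_left_mono powr_mono2_le_one) (auto simp: field_simps)
          finally show ?thesis .
        qed
      qed
      moreover have "\<bar>D2 j \<omega>\<bar> \<le> C * K * h powr \<theta> * (h * norm (v j \<omega>))"
        using GG1[of j "u j \<omega>" "Y (t j) \<omega>"] h by (simp add: D2_def u_def)
      moreover have "C * K * h powr \<theta> * (h * norm (v j \<omega>)) \<le> C * K * h powr \<theta> * (h * K)"
        using vK[OF j \<omega>] h C K by (intro mult_left_mono) auto
      ultimately have "\<bar>D1 j \<omega> + D2 j \<omega>\<bar> \<le> h * (C4 * K * K * h powr \<theta>) + C * K * h powr \<theta> * (h * K)"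
        by linarith
      then show ?thesis by (simp add: algebra_simps)
    qed
    have cellM: "cell j \<in> borel_measurable M" if j: "j < n" for j
      unfolding cell_def[abs_def]
    proof (intro borel_measurable_times borel_measurable_const borel_measurable_sum borel_measurable_diff)
      fix l assume "l \<in> {..<L}"
      then have l: "l < L" by simp
      have [measurable]: "Y (t j) \<in> borel_measurable M" "Y (t j + \<rho> l) \<in> borel_measurable M"
        using tr[OF j l] by (auto intro!: measurable_F_M[OF YF])
      show "(\<lambda>\<omega>. g (t j + \<rho> l) (Y (t j + \<rho> l) \<omega>)) \<in> borel_measurable M"
        "(\<lambda>\<omega>. g (t j + \<rho> l) (Y (t j) \<omega>)) \<in> borel_measurable M"
        by measurable
    qed
    have sumeq: "(\<Sum>j\<in>{a..<b}. cell j \<omega>) = (\<Sum>i<P. cell (a + i) \<omega>)" for \<omega>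
      by (rule sum.reindex_bij_witness[of _ "\<lambda>i. a + i" "\<lambda>j. j - a"]) (auto simp: P_def)
    have tot: "\<bar>(\<Sum>i<P. cell (a + i) \<omega>)\<bar> \<le> \<bar>- (\<Sum>i<P. Mt (a + i) \<omega> + Mtt (a + i) \<omega>)\<bar> + (K * K * (C4 + C) + C * K) * Q"
      if \<omega>: "\<omega> \<in> space M" for \<omega>
    proof -
      have "(\<Sum>i<P. cell (a + i) \<omega>) = (\<Sum>i<P. - (Mt (a + i) \<omega> + Mtt (a + i) \<omega>) + (D1 (a + i) \<omega> + D2 (a + i) \<omega>)
           + (GG (a + i) (Y (t (a + i)) \<omega>) - GG (a + Suc i) (Y (t (a + Suc i)) \<omega>)))"
        using cell_eq[OF Pb(1) \<omega>] by (intro sum.cong) auto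
      also have "\<dots> = - (\<Sum>i<P. Mt (a + i) \<omega> + Mtt (a + i) \<omega>) + (\<Sum>i<P. D1 (a + i) \<omega> + D2 (a + i) \<omega>)
           + (\<Sum>i<P. GG (a + i) (Y (t (a + i)) \<omega>) - GG (a + Suc i) (Y (t (a + Suc i)) \<omega>))"
        by (simp only: sum.distrib sum_negf)
      \<comment> \<open>The corrector vanishes at the right end \<open>b\<close>, so only its value
        at the left end survives.\<close>
      also have "(\<Sum>i<P. GG (a + i) (Y (t (a + i)) \<omega>) - GG (a + Suc i) (Y (t (a + Suc i)) \<omega>)) = GG a (Y (t a) \<omega>)"
        using sum_telescope_diff[of "\<lambda>i. GG (a + i) (Y (t (a + i)) \<omega>)" P] Pb(3) GGb by simp
      finally have e: "(\<Sum>i<P. cell (a + i) \<omega>) = - (\<Sum>i<P. Mt (a + i) \<omega> + Mtt (a + i) \<omega>) + (\<Sum>i<P. D1 (a + i) \<omega> + D2 (a + i) \<omega>) + GG a (Y (t a) \<omega>)" .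
      have "\<bar>\<Sum>i<P. D1 (a + i) \<omega> + D2 (a + i) \<omega>\<bar> \<le> (\<Sum>i<P. K * K * (C4 + C) * h powr \<theta> * h)"
        using D[OF Pb(2) \<omega>] by (intro sum_abs[THEN order_trans] sum_mono) auto
      also have "\<dots> = K * K * (C4 + C) * h powr \<theta> * (real P * h)" by simp
      also have "\<dots> \<le> K * K * (C4 + C) * h powr \<theta> * sqrt (real P * h)"
      proof (rule mult_left_mono)
        define x where "x = real P * h"
        have "0 \<le> x" "x \<le> 1" using Ph h by (auto simp: x_def)
        then have "x * x \<le> x * 1" by (intro mult_left_mono) auto
        then have "x \<le> sqrt x" by (intro real_le_rsqrt) (simp add: power2_eq_square)
        then show "real P * h \<le> sqrt (real P * h)" by (simp add: x_def)
      qed (use K C4 C in auto)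
      finally have "\<bar>\<Sum>i<P. D1 (a + i) \<omega> + D2 (a + i) \<omega>\<bar> \<le> K * K * (C4 + C) * Q" by (simp add: Q_def mult.assoc)
      moreover have "\<bar>GG a (Y (t a) \<omega>)\<bar> \<le> C * K * Q"
        using GG3[OF ab, of "Y (t a) \<omega>"] by (simp add: Q_def P_def mult.assoc)
      ultimately show ?thesis unfolding e distrib_right by linarith
    qed
    have "Lq_le M (2 * m) (\<bar>- 1\<bar> * (cm * sqrt (real P) * z)) (\<lambda>\<omega>. - 1 * (\<Sum>i<P. Mt (a + i) \<omega> + Mtt (a + i) \<omega>))"
      by (rule Lq_le_cmult[OF mart])
    then have "Lq_le M (2 * m) (cm * sqrt (real P) * z) (\<lambda>\<omega>. \<bar>- (\<Sum>i<P. Mt (a + i) \<omega> + Mtt (a + i) \<omega>)\<bar>)"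
      by (rule Lq_le_mono) (use Lq_leD(2)[OF mart] in \<open>auto\<close>)
    moreover have "Lq_le M (2 * m) ((K * K * (C4 + C) + C * K) * Q) (\<lambda>_. (K * K * (C4 + C) + C * K) * Q)"
      using K C4 C Q0 by (intro Lq_le_bounded) (auto intro!: mult_nonneg_nonneg add_nonneg_nonneg)
    ultimately have "Lq_le M (2 * m) (cm * sqrt (real P) * z + (K * K * (C4 + C) + C * K) * Q)
       (\<lambda>\<omega>. \<bar>- (\<Sum>i<P. Mt (a + i) \<omega> + Mtt (a + i) \<omega>)\<bar> + (K * K * (C4 + C) + C * K) * Q)"
      by (rule Lq_le_add[OF _ _ m2])
    moreover have "cm * sqrt (real P) * z + (K * K * (C4 + C) + C * K) * Q = G * Q"
      by (simp add: z_def Q_def G_def real_sqrt_mult algebra_simps)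
    ultimately have "Lq_le M (2 * m) (G * Q) (\<lambda>\<omega>. \<bar>- (\<Sum>i<P. Mt (a + i) \<omega> + Mtt (a + i) \<omega>)\<bar> + (K * K * (C4 + C) + C * K) * Q)"
      by simp
    then have "Lq_le M (2 * m) (G * Q) (\<lambda>\<omega>. \<Sum>j\<in>{a..<b}. cell j \<omega>)"
    proof (rule Lq_le_mono)
      show "(\<lambda>\<omega>. \<Sum>j\<in>{a..<b}. cell j \<omega>) \<in> borel_measurable M"
        using bn by (intro borel_measurable_sum cellM) auto
      show "AE \<omega> in M. \<bar>\<Sum>j\<in>{a..<b}. cell j \<omega>\<bar> \<le> \<bar>\<bar>- (\<Sum>i<P. Mt (a + i) \<omega> + Mtt (a + i) \<omega>)\<bar> + (K * K * (C4 + C) + C * K) * Q\<bar>"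
        unfolding sumeq using tot by (intro AE_I2) (rule order_trans[OF _ abs_ge_self])
    qed simp
    then show "Lq_le M (2 * m) (G * (1 / real n) powr \<theta> * sqrt (real (b - a) / real n))
      (\<lambda>\<omega>. \<Sum>j\<in>{a..<b}. (1 / real n / real L) * (\<Sum>l<L.
          g (real j / real n + real l * (1 / real n / real L)) (Y (real j / real n + real l * (1 / real n / real L)) \<omega>)
        - g (real j / real n + real l * (1 / real n / real L)) (Y (real j / real n) \<omega>)))"
      by (simp add: Q_def P_def cell_def[abs_def] h_def t_def \<rho>_def mult.assoc)
  qed (rule G0)
qed

end

section \<open>Closing the estimate\<close>

text \<open>Bootstrapping on short windows: on a window of length \<open>1 / W\<close> the increment bound \<open>N\<close> improves to
  \<open>N / 2 + const\<close>, so it may be iterated down to its fixed point, starting from the Lipschitz bound.\<close>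

lemma (in prob_space) window_closing:
  fixes G K \<beta> \<eta> :: real
  assumes G: "0 < G" and K: "0 \<le> K" and \<beta>: "0 < \<beta>" and \<eta>: "0 \<le> \<eta>" "\<eta> \<le> 1 / 2" and q: "1 \<le> q"
  shows "\<exists>C>0. \<forall>\<rho> (E :: real \<Rightarrow> 'a \<Rightarrow> real^'d). 0 < \<rho> \<longrightarrow> (\<forall>t\<in>{0..1}. E t \<in> borel_measurable M) \<longrightarrow> (AE \<omega> in M. E 0 \<omega> = 0) \<longrightarrow>
    (\<forall>s t. 0 \<le> s \<longrightarrow> s < t \<longrightarrow> t \<le> 1 \<longrightarrow> (AE \<omega> in M. norm (E t \<omega> - E s \<omega>) \<le> 2 * K * (t - s))) \<longrightarrow>
    (\<forall>S T a N. 0 \<le> S \<longrightarrow> S < T \<longrightarrow> T \<le> 1 \<longrightarrow> 0 < a \<longrightarrow> 0 \<le> N \<longrightarrow>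
       (\<forall>t. S \<le> t \<longrightarrow> t \<le> T \<longrightarrow> Lq_le M q a (\<lambda>\<omega>. norm (E t \<omega>))) \<longrightarrow>
       (\<forall>s t. S \<le> s \<longrightarrow> s < t \<longrightarrow> t \<le> T \<longrightarrow> Lq_le M q (N * (t - s) powr \<eta>) (\<lambda>\<omega>. norm (E t \<omega> - E s \<omega>))) \<longrightarrow>
       Lq_le M q (G * (a + N) * (T - S) powr ((1 + \<beta>) / 2) + G * \<rho> * (T - S) powr \<eta>) (\<lambda>\<omega>. norm (E T \<omega> - E S \<omega>))) \<longrightarrow>
    (\<forall>t. 0 \<le> t \<longrightarrow> t \<le> 1 \<longrightarrow> Lq_le M q (C * \<rho>) (\<lambda>\<omega>. norm (E t \<omega>)))"
proof -
  \<comment> \<open>Enough windows to make G \<Delta>^(\<beta>/2) \<le> 1/4, so that the error terms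
    of the increment bound can be absorbed.\<close>
  obtain W0 :: nat where W0: "(4 * G) powr (2 / \<beta>) < real W0" using reals_Archimedean2 by blast
  define W where "W = max 1 W0"
  define \<Delta> where "\<Delta> = 1 / real W"
  have W1: "1 \<le> W" by (simp add: W_def)
  have \<Delta>: "0 < \<Delta>" "\<Delta> \<le> 1" using W1 by (auto simp: \<Delta>_def)
  have G\<Delta>: "G * \<Delta> powr (\<beta> / 2) \<le> 1 / 4"
  proof -
    have "(4 * G) powr (2 / \<beta>) \<le> real W" using W0 by (simp add: W_def)
    then have "((4 * G) powr (2 / \<beta>)) powr (\<beta> / 2) \<le> real W powr (\<beta> / 2)"
      using \<beta> by (intro powr_mono2) auto
    then have "4 * G \<le> real W powr (\<beta> / 2)" using G \<beta> by (simp add: powr_powr)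
    moreover have "\<Delta> powr (\<beta> / 2) = 1 / real W powr (\<beta> / 2)"
      using W1 by (simp add: \<Delta>_def powr_divide)
    moreover have "0 < real W powr (\<beta> / 2)" using W1 by simp
    ultimately show ?thesis by (simp add: divide_le_eq)
  qed
  show ?thesis
  \<comment> \<open>The error level starts at 2 G \<rho> and at most triples from one window to the
    next. Starting there rather than at 0 keeps the level positive and lets it dominate the source
    term.\<close>
  proof (intro exI[of _ "3 ^ W * (2 * G)"] conjI allI impI)
    show "0 < 3 ^ W * (2 * G)" using G by simp
    fix \<rho> :: real and E :: "real \<Rightarrow> 'a \<Rightarrow> real^'d" and t0 :: real
    assume \<rho>: "0 < \<rho>" and meas: "\<forall>t\<in>{0..1}. E t \<in> borel_measurable M" and E0: "AE \<omega> in M. E 0 \<omega> = 0"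
      and lip: "\<forall>s t. 0 \<le> s \<longrightarrow> s < t \<longrightarrow> t \<le> 1 \<longrightarrow> (AE \<omega> in M. norm (E t \<omega> - E s \<omega>) \<le> 2 * K * (t - s))"
      and step: "\<forall>S T a N. 0 \<le> S \<longrightarrow> S < T \<longrightarrow> T \<le> 1 \<longrightarrow> 0 < a \<longrightarrow> 0 \<le> N \<longrightarrow>
       (\<forall>t. S \<le> t \<longrightarrow> t \<le> T \<longrightarrow> Lq_le M q a (\<lambda>\<omega>. norm (E t \<omega>))) \<longrightarrow>
       (\<forall>s t. S \<le> s \<longrightarrow> s < t \<longrightarrow> t \<le> T \<longrightarrow> Lq_le M q (N * (t - s) powr \<eta>) (\<lambda>\<omega>. norm (E t \<omega> - E s \<omega>))) \<longrightarrow>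
       Lq_le M q (G * (a + N) * (T - S) powr ((1 + \<beta>) / 2) + G * \<rho> * (T - S) powr \<eta>) (\<lambda>\<omega>. norm (E T \<omega> - E S \<omega>))"
      and t0: "0 \<le> t0" "t0 \<le> 1"
    have Em: "E t \<in> borel_measurable M" if "0 \<le> t" "t \<le> 1" for t using meas that by auto
    have window: "Lq_le M q (3 * a0) (\<lambda>\<omega>. norm (E t \<omega>))"
      if S0: "0 \<le> S0" and t: "S0 \<le> t" "t \<le> S0 + \<Delta>" "t \<le> 1" and a0: "2 * G * \<rho> \<le> a0" and LS: "Lq_le M q a0 (\<lambda>\<omega>. norm (E S0 \<omega>))"
      for S0 t a0
    proof -
      have a0p: "0 < a0" using a0 G \<rho> by (smt (verit) mult_pos_pos)
      define S1 where "S1 = min 1 (S0 + \<Delta>)"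
      have S1: "S1 \<le> 1" "S1 \<le> S0 + \<Delta>" "t \<le> S1" using t by (auto simp: S1_def)
      \<comment> \<open>The fixed point of N = a0/4 + N/2 + G \<rho>, the map that one application
        of the increment bound induces on a window.\<close>
      define A where "A = a0 / 2 + 2 * G * \<rho>"
      have A0: "0 \<le> A" using a0p G \<rho> by (simp add: A_def)
      have triv: "Lq_le M q (b + c) (\<lambda>\<omega>. norm (E u \<omega>))"
        if "Lq_le M q b (\<lambda>\<omega>. norm (E S0 \<omega>))" "Lq_le M q c (\<lambda>\<omega>. norm (E u \<omega> - E S0 \<omega>))" "S0 \<le> u" "u \<le> 1" for b c u
        by (rule Lq_le_mono[OF Lq_le_add[OF that(1,2) q]])
           (use that Em[of u] S0 norm_triangle_sub in \<open>auto intro!: AE_I2\<close>)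
      \<comment> \<open>The excess over the fixed point is halved in every round. The start is
        legitimate because the difference is 2K-Lipschitz and u - s \<le> (u - s)^\<eta>.\<close>
      have iter: "S0 \<le> s \<Longrightarrow> s < u \<Longrightarrow> u \<le> S1 \<Longrightarrow>
          Lq_le M q ((A + 2 * K / 2 ^ k) * (u - s) powr \<eta>) (\<lambda>\<omega>. norm (E u \<omega> - E s \<omega>))" for k s u
      proof (induction k arbitrary: s u)
        case 0
        have us: "0 < u - s" "u - s \<le> 1" "0 \<le> s" "u \<le> 1" using 0 S0 S1 by auto
        have [measurable]: "E u \<in> borel_measurable M" "E s \<in> borel_measurable M" using Em us by auto
        have "Lq_le M q (2 * K * (u - s)) (\<lambda>\<omega>. norm (E u \<omega> - E s \<omega>))"
          using lip us K by (intro Lq_le_bounded) auto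
        then show ?case
        proof (rule Lq_le_weaken)
          have "(u - s) powr 1 \<le> (u - s) powr \<eta>" using us \<eta> by (intro powr_mono2_le_one) auto
          then have "2 * K * (u - s) \<le> 2 * K * (u - s) powr \<eta>" using us K by (intro mult_left_mono) auto
          also have "\<dots> \<le> (A + 2 * K / 2 ^ 0) * (u - s) powr \<eta>" using A0 by (intro mult_right_mono) auto
          finally show "2 * K * (u - s) \<le> (A + 2 * K / 2 ^ 0) * (u - s) powr \<eta>" .
        qed
      next
        case (Suc k)
        define N where "N = A + 2 * K / 2 ^ k"
        have N0: "0 \<le> N" using A0 K by (simp add: N_def)
        have us: "0 < u - s" "u - s \<le> \<Delta>" "u - s \<le> 1" "0 \<le> s" "u \<le> 1" using Suc.prems S0 S1 \<Delta> by auto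
        have bd: "Lq_le M q (a0 + N) (\<lambda>\<omega>. norm (E r \<omega>))" if "S0 \<le> r" "r \<le> S1" for r
        proof (cases "r = S0")
          case True
          then show ?thesis using LS N0 by (auto intro: Lq_le_weaken)
        next
          case False
          have "Lq_le M q (N * (r - S0) powr \<eta>) (\<lambda>\<omega>. norm (E r \<omega> - E S0 \<omega>))"
            unfolding N_def using that False by (intro Suc.IH) auto
          moreover have "N * (r - S0) powr \<eta> \<le> N * 1"
          proof (rule mult_left_mono[OF _ N0])
            show "(r - S0) powr \<eta> \<le> 1"
              using powr_mono2[of \<eta> "r - S0" 1] that S1 \<Delta> \<eta> by simp
          qed
          ultimately have "Lq_le M q N (\<lambda>\<omega>. norm (E r \<omega> - E S0 \<omega>))" by (auto intro: Lq_le_weaken)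
          then show ?thesis using that S1 by (intro triv LS) auto
        qed
        have "Lq_le M q (G * ((a0 + N) + N) * (u - s) powr ((1 + \<beta>) / 2) + G * \<rho> * (u - s) powr \<eta>) (\<lambda>\<omega>. norm (E u \<omega> - E s \<omega>))"
        proof (rule step[rule_format])
          show "Lq_le M q (a0 + N) (\<lambda>\<omega>. norm (E r \<omega>))" if "s \<le> r" "r \<le> u" for r
            using that Suc.prems by (intro bd) auto
          show "Lq_le M q (N * (r' - r) powr \<eta>) (\<lambda>\<omega>. norm (E r' \<omega> - E r \<omega>))" if "s \<le> r" "r < r'" "r' \<le> u" for r r'
            unfolding N_def using that Suc.prems by (intro Suc.IH) auto
        qed (use us a0p N0 Suc.prems in auto)
        then show ?case
        proof (rule Lq_le_weaken)
          have "(u - s) powr ((1 + \<beta>) / 2) \<le> (u - s) powr (\<eta> + \<beta> / 2)"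
            using us \<eta> \<beta> by (intro powr_mono2_le_one) (auto simp: field_simps)
          also have "\<dots> = (u - s) powr \<eta> * (u - s) powr (\<beta> / 2)" by (rule powr_add)
          also have "\<dots> \<le> (u - s) powr \<eta> * \<Delta> powr (\<beta> / 2)"
            using us \<beta> by (intro mult_left_mono powr_mono2) auto
          finally have p: "(u - s) powr ((1 + \<beta>) / 2) \<le> (u - s) powr \<eta> * \<Delta> powr (\<beta> / 2)" .
          have "G * ((a0 + N) + N) * (u - s) powr ((1 + \<beta>) / 2) \<le> G * ((a0 + N) + N) * ((u - s) powr \<eta> * \<Delta> powr (\<beta> / 2))"
            using p G a0p N0 by (intro mult_left_mono) auto
          also have "\<dots> = (G * \<Delta> powr (\<beta> / 2)) * ((a0 + 2 * N) * (u - s) powr \<eta>)" by (simp add: algebra_simps)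
          also have "\<dots> \<le> (1 / 4) * ((a0 + 2 * N) * (u - s) powr \<eta>)"
            using G\<Delta> a0p N0 by (intro mult_right_mono) auto
          finally have "G * ((a0 + N) + N) * (u - s) powr ((1 + \<beta>) / 2) + G * \<rho> * (u - s) powr \<eta>
             \<le> (a0 / 4 + N / 2 + G * \<rho>) * (u - s) powr \<eta>" by (simp add: algebra_simps)
          also have "a0 / 4 + N / 2 + G * \<rho> = A + 2 * K / 2 ^ Suc k"
            by (simp add: N_def A_def field_simps)
          finally show "G * ((a0 + N) + N) * (u - s) powr ((1 + \<beta>) / 2) + G * \<rho> * (u - s) powr \<eta> \<le> (A + 2 * K / 2 ^ Suc k) * (u - s) powr \<eta>" .
        qed
      qed
      show ?thesis
      proof (cases "t = S0")
        case True
        then show ?thesis using LS a0p by (auto intro: Lq_le_weaken)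
      next
        case False
        then have lt: "S0 < t" using t by simp
        have "Lq_le M q (A * (t - S0) powr \<eta>) (\<lambda>\<omega>. norm (E t \<omega> - E S0 \<omega>))"
        proof (rule Lq_le_inf)
          show "Lq_le M q (A * (t - S0) powr \<eta> + (2 * K * (t - S0) powr \<eta>) * (1 / 2) ^ k) (\<lambda>\<omega>. norm (E t \<omega> - E S0 \<omega>))" for k
            using iter[of S0 t k] lt S1 by (simp add: algebra_simps power_divide)
          show "(\<lambda>k. (2 * K * (t - S0) powr \<eta>) * (1 / 2) ^ k) \<longlonglongrightarrow> 0"
            by (intro tendsto_mult_right_zero LIMSEQ_power_zero) simp
        qed
        moreover have "A * (t - S0) powr \<eta> \<le> A * 1"
        proof (rule mult_left_mono[OF _ A0])
          show "(t - S0) powr \<eta> \<le> 1"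
            using powr_mono2[of \<eta> "t - S0" 1] lt t \<Delta> \<eta> by simp
        qed
        ultimately have "Lq_le M q A (\<lambda>\<omega>. norm (E t \<omega> - E S0 \<omega>))" by (auto intro: Lq_le_weaken)
        then have "Lq_le M q (a0 + A) (\<lambda>\<omega>. norm (E t \<omega>))" using t by (intro triv LS) auto
        then show ?thesis
        proof (rule Lq_le_weaken)
          show "a0 + A \<le> 3 * a0" using a0 a0p unfolding A_def by linarith
        qed
      qed
    qed
    have all: "w \<le> W \<Longrightarrow> 0 \<le> t \<Longrightarrow> t \<le> real w * \<Delta> \<Longrightarrow> Lq_le M q (3 ^ w * (2 * G * \<rho>)) (\<lambda>\<omega>. norm (E t \<omega>))" for w t
    proof (induction w arbitrary: t)
      case 0
      then have "t = 0" by simp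
      moreover have "Lq_le M q (2 * G * \<rho>) (\<lambda>\<omega>. norm (E 0 \<omega>))"
      proof (rule Lq_le_bounded)
        show "(\<lambda>\<omega>. norm (E 0 \<omega>)) \<in> borel_measurable M" using Em[of 0] by simp
        show "AE \<omega> in M. \<bar>norm (E 0 \<omega>)\<bar> \<le> 2 * G * \<rho>" using E0 G \<rho> by auto
      qed (use G \<rho> in auto)
      ultimately show ?case by simp
    next
      case (Suc w)
      have big: "2 * G * \<rho> \<le> 3 ^ w * (2 * G * \<rho>)"
        using mult_right_mono[of 1 "3 ^ w" "2 * G * \<rho>"] G \<rho> by simp
      have wd: "real w * \<Delta> + \<Delta> \<le> 1" "0 \<le> real w * \<Delta>"
      proof -
        have "real (Suc w) * \<Delta> \<le> real W * \<Delta>" using Suc.prems \<Delta> by (intro mult_right_mono) auto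
        then show "real w * \<Delta> + \<Delta> \<le> 1" using W1 by (simp add: \<Delta>_def field_simps)
      qed (use \<Delta> in simp)
      show ?case
      proof (cases "t \<le> real w * \<Delta>")
        case True
        have "Lq_le M q (3 ^ w * (2 * G * \<rho>)) (\<lambda>\<omega>. norm (E t \<omega>))" using Suc True by auto
        then show ?thesis using G \<rho> by (auto intro: Lq_le_weaken)
      next
        case False
        have "Lq_le M q (3 * (3 ^ w * (2 * G * \<rho>))) (\<lambda>\<omega>. norm (E t \<omega>))"
        proof (rule window[of "real w * \<Delta>"])
          show "Lq_le M q (3 ^ w * (2 * G * \<rho>)) (\<lambda>\<omega>. norm (E (real w * \<Delta>) \<omega>))"
            using Suc.prems wd by (intro Suc.IH) auto
          show "t \<le> real w * \<Delta> + \<Delta>" using Suc.prems by (simp add: distrib_right)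
          then show "t \<le> 1" using wd by linarith
        qed (use False wd big in auto)
        then show ?thesis by (simp add: mult.assoc)
      qed
    qed
    have "t0 \<le> real W * \<Delta>" using t0 W1 by (simp add: \<Delta>_def)
    from all[OF order_refl t0(1) this] show "Lq_le M q (3 ^ W * (2 * G) * \<rho>) (\<lambda>\<omega>. norm (E t0 \<omega>))"
      by (simp add: mult.assoc)
  qed
qed

section \<open>Globally regular drifts, grid indices and the error of the scheme\<close>

definition reg_drift :: "real \<Rightarrow> real \<Rightarrow> real \<Rightarrow> (real \<Rightarrow> real^'d \<Rightarrow> real^'d) \<Rightarrow> bool" where
  "reg_drift K \<alpha> \<beta> f \<longleftrightarrow> (\<forall>t x. norm (f t x) \<le> K) \<and>
     (\<forall>t x y. norm (f t x - f t y) \<le> K * norm (x - y) powr \<beta>) \<and>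
     (\<forall>s t x. norm (f s x - f t x) \<le> K * \<bar>s - t\<bar> powr \<alpha>)"

lemma borel_measurable_component [measurable (raw)]:
  fixes h :: "'w \<Rightarrow> real^'d"
  assumes "h \<in> borel_measurable M"
  shows "(\<lambda>\<omega>. h \<omega> $ i) \<in> borel_measurable M"
  using assms by (simp add: cart_eq_inner_axis)

lemma reg_drift_component:
  fixes f :: "real \<Rightarrow> real^'d \<Rightarrow> real^'d"
  assumes "reg_drift K \<alpha> \<beta> f"
  shows "holder K \<beta> (\<lambda>x. f t x $ i)" "\<bar>f s x $ i - f t x $ i\<bar> \<le> K * \<bar>s - t\<bar> powr \<alpha>"
proof -
  have c: "\<bar>y $ i\<bar> \<le> norm y" for y :: "real^'d" by (rule component_le_norm_cart)
  show "holder K \<beta> (\<lambda>x. f t x $ i)"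
    unfolding holder_def
  proof (intro conjI allI)
    show "\<bar>f t x $ i\<bar> \<le> K" for x using assms c[of "f t x"] unfolding reg_drift_def by (meson order_trans)
    show "\<bar>f t x $ i - f t y $ i\<bar> \<le> K * norm (x - y) powr \<beta>" for x y
      using assms c[of "f t x - f t y"] unfolding reg_drift_def vector_minus_component by (meson order_trans)
  qed
  show "\<bar>f s x $ i - f t x $ i\<bar> \<le> K * \<bar>s - t\<bar> powr \<alpha>"
    using assms c[of "f s x - f t x"] unfolding reg_drift_def vector_minus_component by (meson order_trans)
qed

lemma reg_drift_nonneg: "reg_drift K \<alpha> \<beta> f \<Longrightarrow> 0 \<le> K"
  unfolding reg_drift_def by (meson norm_ge_zero order_trans)

lemma reg_drift_continuous:
  fixes f :: "real \<Rightarrow> real^'d \<Rightarrow> real^'d"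
  assumes f: "reg_drift K \<alpha> \<beta> f" and ab: "0 < \<alpha>" "0 < \<beta>" and x: "continuous_on A x"
  shows "continuous_on A (\<lambda>r. f r (x r))"
  unfolding continuous_on_def
proof
  fix r assume r: "r \<in> A"
  show "((\<lambda>s. f s (x s)) \<longlongrightarrow> f r (x r)) (at r within A)"
  proof (rule LIM_zero_cancel, rule Lim_null_comparison)
    show "\<forall>\<^sub>F s in at r within A. norm (f s (x s) - f r (x r)) \<le> K * \<bar>s - r\<bar> powr \<alpha> + K * norm (x s - x r) powr \<beta>"
    proof (rule always_eventually, rule allI)
      fix s
      have "norm (f r (x s) - f r (x r)) \<le> K * norm (x s - x r) powr \<beta>"
        "norm (f s (x s) - f r (x s)) \<le> K * \<bar>s - r\<bar> powr \<alpha>"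
        using f by (auto simp: reg_drift_def)
      then show "norm (f s (x s) - f r (x r)) \<le> K * \<bar>s - r\<bar> powr \<alpha> + K * norm (x s - x r) powr \<beta>"
        using norm_triangle_ineq[of "f s (x s) - f r (x s)" "f r (x s) - f r (x r)"] by simp
    qed
    have xr: "(x \<longlongrightarrow> x r) (at r within A)" using x r by (auto simp: continuous_on_def)
    have "((\<lambda>s. K * \<bar>s - r\<bar> powr \<alpha> + K * norm (x s - x r) powr \<beta>) \<longlongrightarrow> K * \<bar>r - r\<bar> powr \<alpha> + K * norm (x r - x r) powr \<beta>) (at r within A)"
      using ab by (intro tendsto_intros tendsto_powr' xr) auto
    then show "((\<lambda>s. K * \<bar>s - r\<bar> powr \<alpha> + K * norm (x s - x r) powr \<beta>) \<longlongrightarrow> 0) (at r within A)" by simp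
  qed
qed

lemma integral_sum_cells:
  fixes \<phi> :: "real \<Rightarrow> real" and t :: "nat \<Rightarrow> real"
  assumes "a \<le> b" "\<And>i j. i \<le> j \<Longrightarrow> t i \<le> t j" "continuous_on {t a..t b} \<phi>"
  shows "(\<Sum>j\<in>{a..<b}. integral {t j..t (Suc j)} \<phi>) = integral {t a..t b} \<phi>"
  using assms(1,3)
proof (induction b rule: dec_induct)
  case base
  then show ?case by simp
next
  case (step b)
  have sub: "{t a..t b} \<subseteq> {t a..t (Suc b)}" using assms(2)[of b "Suc b"] by auto
  have "integral {t a..t b} \<phi> + integral {t b..t (Suc b)} \<phi> = integral {t a..t (Suc b)} \<phi>"
    using step assms(2) by (intro Henstock_Kurzweil_Integration.integral_combine integrable_continuous_real) auto
  then show ?case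
    using step.IH[OF continuous_on_subset[OF step.prems sub]] step.hyps by simp
qed

lemma integral_diff_subinterval:
  fixes \<phi> :: "real \<Rightarrow> real"
  assumes "a \<le> S" "S \<le> b" "b \<le> T" "continuous_on {a..T} \<phi>"
  shows "integral {S..T} \<phi> - integral {a..b} \<phi> = integral {b..T} \<phi> - integral {a..S} \<phi>"
proof -
  have i: "\<phi> integrable_on {a..T}" using assms by (intro integrable_continuous_real)
  have "integral {a..S} \<phi> + integral {S..T} \<phi> = integral {a..T} \<phi>" "integral {a..b} \<phi> + integral {b..T} \<phi> = integral {a..T} \<phi>"
    using assms i by (intro Henstock_Kurzweil_Integration.integral_combine; simp)+
  then show ?thesis by linarith
qed

lemma grid_index:
  assumes "1 \<le> n" "0 \<le> S" "S \<le> 1"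
  defines "a \<equiv> nat \<lfloor>real n * S\<rfloor>"
  shows "real a / real n \<le> S" "S \<le> real a / real n + 1 / real n" "a \<le> n"
proof -
  have fl: "0 \<le> \<lfloor>real n * S\<rfloor>" using assms by simp
  have ra: "real a = of_int \<lfloor>real n * S\<rfloor>" using fl by (simp add: a_def)
  have 1: "real a \<le> real n * S" "real n * S \<le> real a + 1" unfolding ra by linarith+
  show "real a / real n \<le> S" using 1 assms(1) by (simp add: divide_le_eq mult.commute)
  show "S \<le> real a / real n + 1 / real n" using 1 assms(1) by (simp add: le_divide_eq mult.commute flip: add_divide_distrib)
  have "real a \<le> real n * 1" using 1 assms mult_left_mono[of S 1 "real n"] by linarith
  then show "a \<le> n" by simp
qed

text \<open>One coordinate of the one-point quadrature error on a cell. The spatial argument is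
  frozen at the grid value, so only the regularity of f in time enters.\<close>

definition quad_error :: "(real \<Rightarrow> real^'d \<Rightarrow> real^'d) \<Rightarrow> nat \<Rightarrow> (real \<Rightarrow> 'w \<Rightarrow> real^'d) \<Rightarrow> (nat \<Rightarrow> 'w \<Rightarrow> real^'d) \<Rightarrow> 'd \<Rightarrow> nat \<Rightarrow> 'w \<Rightarrow> real" where
  "quad_error f n Y v i j \<omega> = integral {real j / real n..real (Suc j) / real n} (\<lambda>r. f r (Y (real j / real n) \<omega>) $ i) - v j \<omega> $ i / real n"

context filtered_bm
begin

lemma drifted_solution:
  assumes f: "reg_drift K \<alpha> \<beta> f" and ab: "0 < \<alpha>" "0 < \<beta>"
    and X: "\<And>t. t \<in> {0..1} \<Longrightarrow> X t \<in> borel_measurable (F t)"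
    and cont: "AE \<omega> in M. continuous_on {0..1} (\<lambda>t. X t \<omega>)"
    and sde: "AE \<omega> in M. \<forall>t\<in>{0..1}. X t \<omega> = x0 + integral {0..t} (\<lambda>s. f s (X s \<omega>)) + B t \<omega>"
  shows "drifted K X"
    and "0 \<le> s \<Longrightarrow> s \<le> u \<Longrightarrow> u \<le> 1 \<Longrightarrow> AE \<omega> in M. X u \<omega> - X s \<omega> - (B u \<omega> - B s \<omega>) = integral {s..u} (\<lambda>r. f r (X r \<omega>))"
proof -
  have K0: "0 \<le> K" using reg_drift_nonneg[OF f] .
  have inc: "AE \<omega> in M. X u \<omega> - X s \<omega> - (B u \<omega> - B s \<omega>) = integral {s..u} (\<lambda>r. f r (X r \<omega>)) \<and>
      norm (integral {s..u} (\<lambda>r. f r (X r \<omega>))) \<le> K * (u - s)" if su: "0 \<le> s" "s \<le> u" "u \<le> 1" for s u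
    using cont sde
  proof eventually_elim
    case (elim \<omega>)
    have c: "continuous_on {0..1} (\<lambda>r. f r (X r \<omega>))" using reg_drift_continuous[OF f ab elim(1)] .
    have "integral {0..s} (\<lambda>r. f r (X r \<omega>)) + integral {s..u} (\<lambda>r. f r (X r \<omega>)) = integral {0..u} (\<lambda>r. f r (X r \<omega>))"
      using su by (intro Henstock_Kurzweil_Integration.integral_combine integrable_continuous_real continuous_on_subset[OF c]) auto
    moreover have "X u \<omega> = x0 + integral {0..u} (\<lambda>s. f s (X s \<omega>)) + B u \<omega>" "X s \<omega> = x0 + integral {0..s} (\<lambda>s. f s (X s \<omega>)) + B s \<omega>"
      using elim(2) su by auto
    moreover have "norm (integral {s..u} (\<lambda>r. f r (X r \<omega>))) \<le> K * (u - s)"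
      using su f by (intro integral_bound continuous_on_subset[OF c]) (auto simp: reg_drift_def)
    ultimately show ?case by (auto simp: algebra_simps)
  qed
  show "drifted K X"
    unfolding drifted_def
  proof (intro conjI ballI impI)
    fix s u :: real assume "s \<in> {0..1}" "u \<in> {0..1}" "s \<le> u"
    then show "AE \<omega> in M. norm (X u \<omega> - X s \<omega> - (B u \<omega> - B s \<omega>)) \<le> K * (u - s)"
      using inc[of s u] by auto
  qed (rule X)
  show "0 \<le> s \<Longrightarrow> s \<le> u \<Longrightarrow> u \<le> 1 \<Longrightarrow> AE \<omega> in M. X u \<omega> - X s \<omega> - (B u \<omega> - B s \<omega>) = integral {s..u} (\<lambda>r. f r (X r \<omega>))"
    using inc[of s u] by auto
qed

text \<open>On a window between grid points, X - Y is the limit of a sewing sum, a sum of cell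
  errors and the quadrature error, each with its own bound. Aligning the window with the grid costs
  four pieces shorter than a cell. The result is the increment inequality that the window argument
  closes.\<close>

lemma euler_error_bound:
  fixes f :: "real \<Rightarrow> real^'d \<Rightarrow> real^'d"
  assumes \<beta>: "0 < \<beta>" "\<beta> < 1" and \<alpha>: "0 < \<alpha>" and \<theta>: "1 / 2 \<le> \<theta>" "\<theta> < 1 / 2 + \<beta> / 2" and m: "1 \<le> m" and K: "0 < K"
    and G3: "0 \<le> G3" and f: "reg_drift K \<alpha> \<beta> f"
    and X: "\<And>t. t \<in> {0..1} \<Longrightarrow> X t \<in> borel_measurable (F t)"
    and contX: "AE \<omega> in M. continuous_on {0..1} (\<lambda>t. X t \<omega>)"
    and sde: "AE \<omega> in M. \<forall>t\<in>{0..1}. X t \<omega> = x0 + integral {0..t} (\<lambda>s. f s (X s \<omega>)) + B t \<omega>"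
  shows "\<exists>C>0. \<forall>n Y v. 1 \<le> n \<longrightarrow> euler_scheme K n Y v \<longrightarrow> drifted K Y \<longrightarrow> (AE \<omega> in M. continuous_on {0..1} (\<lambda>t. Y t \<omega>)) \<longrightarrow>
    (AE \<omega> in M. Y 0 \<omega> = X 0 \<omega>) \<longrightarrow>
    (\<forall>a b i. a < b \<longrightarrow> b \<le> n \<longrightarrow> Lq_le M (2 * m) (G3 * (1 / real n) powr \<theta> * sqrt (real (b - a) / real n)) (\<lambda>\<omega>. \<Sum>j\<in>{a..<b}. quad_error f n Y v i j \<omega>)) \<longrightarrow>
    (\<forall>t. 0 \<le> t \<longrightarrow> t \<le> 1 \<longrightarrow> Lq_le M (2 * m) (C * (1 / real n) powr \<theta>) (\<lambda>\<omega>. norm (X t \<omega> - Y t \<omega>)))"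
proof -
  \<comment> \<open>With this choice 1/n \<le> n^(-\<theta>) (T-S)^\<eta> for T - S \<ge> 1/n, and T
    - S \<le> n^(-\<theta>) (T-S)^\<eta> for shorter windows.\<close>
  define \<eta> where "\<eta> = 1 - \<theta>"
  have \<eta>: "0 \<le> \<eta>" "\<eta> \<le> 1 / 2" "1 / 2 < \<eta> + \<beta> / 2" using \<theta> \<beta> by (auto simp: \<eta>_def)
  obtain G1 where G1: "0 < G1" and sew: "\<And>(g :: real \<Rightarrow> real^'d \<Rightarrow> real) X Y S T L a N.
    (\<forall>t. holder K \<beta> (g t)) \<Longrightarrow> drifted K X \<Longrightarrow> drifted K Y \<Longrightarrow> 0 \<le> S \<Longrightarrow> S < T \<Longrightarrow> T \<le> 1 \<Longrightarrow> 0 < a \<Longrightarrow> 0 \<le> N \<Longrightarrow>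
    (\<forall>t. S \<le> t \<longrightarrow> t \<le> T \<longrightarrow> Lq_le M (2 * m) a (\<lambda>\<omega>. norm (X t \<omega> - Y t \<omega>))) \<Longrightarrow>
    (\<forall>s t. S \<le> s \<longrightarrow> s < t \<longrightarrow> t \<le> T \<longrightarrow>
        Lq_le M (2 * m) (N * (t - s) powr \<eta>) (\<lambda>\<omega>. norm ((X t \<omega> - Y t \<omega>) - (X s \<omega> - Y s \<omega>)))) \<Longrightarrow>
    Lq_le M (2 * m) (G1 * (a + N) * (T - S) powr ((1 + \<beta>) / 2))
      (\<lambda>\<omega>. \<Sum>i<2^L. QS g (S + real i * ((T - S) / 2^L)) 1 ((T - S) / 2^L) (X (S + real i * ((T - S) / 2^L)) \<omega>)
          - QS g (S + real i * ((T - S) / 2^L)) 1 ((T - S) / 2^L) (Y (S + real i * ((T - S) / 2^L)) \<omega>))"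
    using sewing_bound[OF \<beta> m K \<eta>] by blast
  obtain G2 where G2: "0 < G2" and cells: "\<And>(g :: real \<Rightarrow> real^'d \<Rightarrow> real) Y v n L a b.
    (\<forall>t. holder K \<beta> (g t)) \<Longrightarrow> euler_scheme K n Y v \<Longrightarrow> 1 \<le> n \<Longrightarrow> 1 \<le> L \<Longrightarrow> a < b \<Longrightarrow> b \<le> n \<Longrightarrow>
    Lq_le M (2 * m) (G2 * (1 / real n) powr \<theta> * sqrt (real (b - a) / real n))
      (\<lambda>\<omega>. \<Sum>j\<in>{a..<b}. (1 / real n / real L) * (\<Sum>l<L.
          g (real j / real n + real l * (1 / real n / real L)) (Y (real j / real n + real l * (1 / real n / real L)) \<omega>)
        - g (real j / real n + real l * (1 / real n / real L)) (Y (real j / real n) \<omega>)))"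
    using euler_cells_bound[OF \<beta> \<theta> m K] by blast
  have m2: "1 \<le> 2 * m" using m by simp
  \<comment> \<open>The factor 2 comes from comparing the grid-aligned length with T - S, and 4K
    from the four boundary pieces.\<close>
  define G4 where "G4 = 2 * (G2 + G3) + 4 * K"
  define G where "G = real CARD('d) * (G1 + G4)"
  have G4: "0 < G4" using G2 G3 K by (simp add: G4_def)
  have G0: "0 < G" using G1 G4 by (simp add: G_def)
  have dX: "drifted K X" by (rule drifted_solution(1)[OF f \<alpha> \<beta>(1) X contX sde])
  obtain C where C: "0 < C" and close: "\<And>\<rho> (E :: real \<Rightarrow> 'w \<Rightarrow> real^'d). 0 < \<rho> \<Longrightarrow> (\<forall>t\<in>{0..1}. E t \<in> borel_measurable M) \<Longrightarrow> (AE \<omega> in M. E 0 \<omega> = 0) \<Longrightarrow>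
    (\<forall>s t. 0 \<le> s \<longrightarrow> s < t \<longrightarrow> t \<le> 1 \<longrightarrow> (AE \<omega> in M. norm (E t \<omega> - E s \<omega>) \<le> 2 * K * (t - s))) \<Longrightarrow>
    (\<forall>S T a N. 0 \<le> S \<longrightarrow> S < T \<longrightarrow> T \<le> 1 \<longrightarrow> 0 < a \<longrightarrow> 0 \<le> N \<longrightarrow>
       (\<forall>t. S \<le> t \<longrightarrow> t \<le> T \<longrightarrow> Lq_le M (2 * m) a (\<lambda>\<omega>. norm (E t \<omega>))) \<longrightarrow>
       (\<forall>s t. S \<le> s \<longrightarrow> s < t \<longrightarrow> t \<le> T \<longrightarrow> Lq_le M (2 * m) (N * (t - s) powr \<eta>) (\<lambda>\<omega>. norm (E t \<omega> - E s \<omega>))) \<longrightarrow>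
       Lq_le M (2 * m) (G * (a + N) * (T - S) powr ((1 + \<beta>) / 2) + G * \<rho> * (T - S) powr \<eta>) (\<lambda>\<omega>. norm (E T \<omega> - E S \<omega>))) \<Longrightarrow>
    (\<forall>t. 0 \<le> t \<longrightarrow> t \<le> 1 \<longrightarrow> Lq_le M (2 * m) (C * \<rho>) (\<lambda>\<omega>. norm (E t \<omega>)))"
    using window_closing[OF G0 less_imp_le[OF K] \<beta>(1) \<eta>(1,2) m2] by blast
  show ?thesis
  proof (intro exI[of _ C] conjI C allI impI)
    fix n :: nat and Y :: "real \<Rightarrow> 'w \<Rightarrow> real^'d" and v and t0 :: real
    assume n: "1 \<le> n" and es: "euler_scheme K n Y v" and dY: "drifted K Y" and contY: "AE \<omega> in M. continuous_on {0..1} (\<lambda>t. Y t \<omega>)"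
      and Y0: "AE \<omega> in M. Y 0 \<omega> = X 0 \<omega>"
      and quad: "\<forall>a b i. a < b \<longrightarrow> b \<le> n \<longrightarrow> Lq_le M (2 * m) (G3 * (1 / real n) powr \<theta> * sqrt (real (b - a) / real n)) (\<lambda>\<omega>. \<Sum>j\<in>{a..<b}. quad_error f n Y v i j \<omega>)"
      and t0: "0 \<le> t0" "t0 \<le> 1"
    define \<rho> where "\<rho> = (1 / real n) powr \<theta>"
    have \<rho>0: "0 < \<rho>" using n by (simp add: \<rho>_def)
    define E where "E t \<omega> = X t \<omega> - Y t \<omega>" for t \<omega>
    have Em: "E t \<in> borel_measurable M" if "0 \<le> t" "t \<le> 1" for t
      unfolding E_def[abs_def] using driftedD(2)[OF dX that] driftedD(2)[OF dY that] by simp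
    have lip: "AE \<omega> in M. norm (E t \<omega> - E s \<omega>) \<le> 2 * K * (t - s)" if "0 \<le> s" "s < t" "t \<le> 1" for s t
    proof -
      have "AE \<omega> in M. norm (X t \<omega> - X s \<omega> - (B t \<omega> - B s \<omega>)) \<le> K * (t - s)" "AE \<omega> in M. norm (Y t \<omega> - Y s \<omega> - (B t \<omega> - B s \<omega>)) \<le> K * (t - s)"
        using driftedD(3)[OF dX, of s t] driftedD(3)[OF dY, of s t] that by auto
      then show ?thesis
      proof eventually_elim
        case (elim \<omega>)
        have "E t \<omega> - E s \<omega> = (X t \<omega> - X s \<omega> - (B t \<omega> - B s \<omega>)) - (Y t \<omega> - Y s \<omega> - (B t \<omega> - B s \<omega>))"
          by (simp add: E_def)
        then show ?case using elim norm_triangle_ineq4[of "X t \<omega> - X s \<omega> - (B t \<omega> - B s \<omega>)" "Y t \<omega> - Y s \<omega> - (B t \<omega> - B s \<omega>)"] by simp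
      qed
    qed
    have comp: "Lq_le M (2 * m) (G1 * (a0 + N) * (T - S) powr ((1 + \<beta>) / 2) + G4 * \<rho> * (T - S) powr \<eta>) (\<lambda>\<omega>. (E T \<omega> - E S \<omega>) $ i)"
      if ST: "0 \<le> S" "S < T" "T \<le> 1" and a0: "0 < a0" and N: "0 \<le> N"
        and Ea: "\<forall>t. S \<le> t \<longrightarrow> t \<le> T \<longrightarrow> Lq_le M (2 * m) a0 (\<lambda>\<omega>. norm (E t \<omega>))"
        and EN: "\<forall>s t. S \<le> s \<longrightarrow> s < t \<longrightarrow> t \<le> T \<longrightarrow> Lq_le M (2 * m) (N * (t - s) powr \<eta>) (\<lambda>\<omega>. norm (E t \<omega> - E s \<omega>))"
      for S T a0 N i
    proof -
      have [measurable]: "E T \<in> borel_measurable M" "E S \<in> borel_measurable M" using Em ST by auto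
      have compm: "(\<lambda>\<omega>. (E T \<omega> - E S \<omega>) $ i) \<in> borel_measurable M" by measurable
      have nn: "0 \<le> G1 * (a0 + N) * (T - S) powr ((1 + \<beta>) / 2)" using G1 a0 N by simp
      show ?thesis
      \<comment> \<open>Below the mesh size there may be no complete cell, and the Lipschitz bound
        is already of the required order.\<close>
      proof (cases "T - S < 1 / real n")
        case True
        have "Lq_le M (2 * m) (2 * K * (T - S)) (\<lambda>\<omega>. (E T \<omega> - E S \<omega>) $ i)"
        proof (rule Lq_le_bounded[OF compm])
          show "AE \<omega> in M. \<bar>(E T \<omega> - E S \<omega>) $ i\<bar> \<le> 2 * K * (T - S)"
            using lip[OF ST] by eventually_elim (rule order_trans[OF component_le_norm_cart])
        qed (use K ST in simp)
        then show ?thesis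
        proof (rule Lq_le_weaken)
          have "2 * K * (T - S) = 2 * K * ((T - S) powr \<theta> * (T - S) powr \<eta>)"
            using ST by (simp add: \<eta>_def flip: powr_add)
          also have "\<dots> \<le> G4 * (\<rho> * (T - S) powr \<eta>)"
            using ST True \<theta> \<eta> K G2 G3 unfolding \<rho>_def G4_def by (intro mult_mono powr_mono2) auto
          finally show "2 * K * (T - S) \<le> G1 * (a0 + N) * (T - S) powr ((1 + \<beta>) / 2) + G4 * \<rho> * (T - S) powr \<eta>"
            using nn by simp
        qed
      next
        case False
        define g where "g t x = f t x $ i" for t x
        have hg: "holder K \<beta> (g t)" for t unfolding g_def by (rule reg_drift_component(1)[OF f])
        have gt: "\<bar>g s x - g t x\<bar> \<le> K * \<bar>s - t\<bar> powr \<alpha>" for s t x unfolding g_def by (rule reg_drift_component(2)[OF f])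
        have gb: "\<bar>g t x\<bar> \<le> K" for t x using hg by (auto simp: holder_def)
        define a where "a = nat \<lfloor>real n * S\<rfloor>"
        define b where "b = nat \<lfloor>real n * T\<rfloor>"
        define t where "t j = real j / real n" for j
        have ta: "t a \<le> S" "S \<le> t a + 1 / real n" "a \<le> n"
          using grid_index[OF n, of S] ST by (auto simp: a_def t_def)
        have tb: "t b \<le> T" "T \<le> t b + 1 / real n" "b \<le> n"
          using grid_index[OF n, of T] ST by (auto simp: b_def t_def)
        have tmono: "i \<le> j \<Longrightarrow> t i \<le> t j" for i j by (auto simp: t_def divide_right_mono)
        have t01: "0 \<le> t j" "j \<le> n \<Longrightarrow> t j \<le> 1" for j using n by (auto simp: t_def divide_le_eq)
        have ab: "a < b"
        proof -
          have "real n * S + 1 \<le> real n * T" using False n by (simp add: field_simps)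
          then have "\<lfloor>real n * S\<rfloor> + 1 \<le> \<lfloor>real n * T\<rfloor>"
            by (metis floor_mono floor_add_int of_int_1)
          moreover have "0 \<le> \<lfloor>real n * S\<rfloor>" using ST by simp
          ultimately show ?thesis
            unfolding a_def b_def using nat_less_eq_zless[of "\<lfloor>real n * S\<rfloor>" "\<lfloor>real n * T\<rfloor>"] by linarith
        qed
        have Sb: "S \<le> t b"
        proof -
          have "t (Suc a) \<le> t b" using ab by (intro tmono) simp
          then show ?thesis using ta by (simp add: t_def add_divide_distrib)
        qed
        define Jt where "Jt L \<omega> = (\<Sum>i<2^L. QS g (S + real i * ((T - S) / 2^L)) 1 ((T - S) / 2^L) (X (S + real i * ((T - S) / 2^L)) \<omega>)
          - QS g (S + real i * ((T - S) / 2^L)) 1 ((T - S) / 2^L) (Y (S + real i * ((T - S) / 2^L)) \<omega>))" for L \<omega>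
        define cl where "cl L \<omega> = (\<Sum>j\<in>{a..<b}. (1 / real n / real (Suc L)) * (\<Sum>l<Suc L.
          g (t j + real l * (1 / real n / real (Suc L))) (Y (t j + real l * (1 / real n / real (Suc L))) \<omega>)
        - g (t j + real l * (1 / real n / real (Suc L))) (Y (t j) \<omega>)))" for L \<omega>
        define qe where "qe \<omega> = (\<Sum>j\<in>{a..<b}. quad_error f n Y v i j \<omega>)" for \<omega>
        let ?c = "G1 * (a0 + N) * (T - S) powr ((1 + \<beta>) / 2) + G2 * \<rho> * sqrt (real (b - a) / real n) + G3 * \<rho> * sqrt (real (b - a) / real n)"
        \<comment> \<open>\<open>L\<close> indexes both the dyadic depth and, as
          \<open>Suc L\<close>, the number of points per cell; the bound does not depend on it, so
          both Riemann sums can be refined at once.\<close>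
        have seq: "Lq_le M (2 * m) ?c (\<lambda>\<omega>. Jt L \<omega> + cl L \<omega> + qe \<omega>)" for L
        proof (intro Lq_le_add m2)
          show "Lq_le M (2 * m) (G1 * (a0 + N) * (T - S) powr ((1 + \<beta>) / 2)) (Jt L)"
            unfolding Jt_def using sew[of g X Y S T a0 N L] hg dX dY ST a0 N Ea EN by (simp add: E_def)
          show "Lq_le M (2 * m) (G2 * \<rho> * sqrt (real (b - a) / real n)) (cl L)"
            unfolding cl_def \<rho>_def t_def using hg es n ab tb by (intro cells) auto
          show "Lq_le M (2 * m) (G3 * \<rho> * sqrt (real (b - a) / real n)) qe"
            unfolding qe_def \<rho>_def using quad ab tb by auto
        qed
        \<comment> \<open>The limit only controls the increment up to boundary pieces of total size
          4K/n; these are subtracted here and added back after Fatou.\<close>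
        define Z where "Z \<omega> = max 0 (\<bar>(E T \<omega> - E S \<omega>) $ i\<bar> - 4 * K / real n)" for \<omega>
        have Zm: "Z \<in> borel_measurable M" unfolding Z_def[abs_def] by measurable
        have YB: "AE \<omega> in M. \<bar>(Y u \<omega> - Y s \<omega> - (B u \<omega> - B s \<omega>)) $ i\<bar> \<le> K / real n" if "0 \<le> s" "s \<le> u" "u \<le> 1" "u \<le> s + 1 / real n" for s u
          using driftedD(3)[OF dY that(1-3)]
        proof eventually_elim
          case (elim \<omega>)
          have "K * (u - s) \<le> K * (1 / real n)" using that K by (intro mult_left_mono) auto
          then show ?case using elim order_trans[OF component_le_norm_cart, of "Y u \<omega> - Y s \<omega> - (B u \<omega> - B s \<omega>)" _ i] by simp
        qed
        have inc: "AE \<omega> in M. X T \<omega> - X S \<omega> - (B T \<omega> - B S \<omega>) = integral {S..T} (\<lambda>r. f r (X r \<omega>))"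
          by (rule drifted_solution(2)[OF f \<alpha> \<beta>(1) X contX sde]) (use ST in auto)
        have YBa: "AE \<omega> in M. \<bar>(Y S \<omega> - Y (t a) \<omega> - (B S \<omega> - B (t a) \<omega>)) $ i\<bar> \<le> K / real n"
          using ta t01 ST by (intro YB) auto
        have YBb: "AE \<omega> in M. \<bar>(Y T \<omega> - Y (t b) \<omega> - (B T \<omega> - B (t b) \<omega>)) $ i\<bar> \<le> K / real n"
          using tb t01 ST by (intro YB) auto
        have lim: "AE \<omega> in M. \<exists>l. (\<lambda>L. Jt L \<omega> + cl L \<omega> + qe \<omega>) \<longlonglongrightarrow> l \<and> \<bar>Z \<omega>\<bar> \<le> \<bar>l\<bar>"
          using contX contY inc YBa YBb AE_space
        proof eventually_elim
          case (elim \<omega>)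
          have cX: "continuous_on {0..1} (\<lambda>r. f r (X r \<omega>))" "continuous_on {0..1} (\<lambda>r. f r (Y r \<omega>))"
            using reg_drift_continuous[OF f \<alpha> \<beta>(1)] elim(1,2) by auto
          have cY: "continuous_on {0..1} (\<lambda>r. g r (Y r \<omega>))"
            unfolding g_def by (intro continuous_on_component cX)
          have cYj: "continuous_on A (\<lambda>r. g r (Y (t j) \<omega>))" for A j
            unfolding g_def by (intro continuous_on_component reg_drift_continuous[OF f \<alpha> \<beta>(1)] continuous_on_const)
          have sub: "{S..T} \<subseteq> {0..1}" using ST by auto
          have "(\<lambda>L. Jt L \<omega>) \<longlonglongrightarrow> integral {S..T} (\<lambda>r. g r (X r \<omega>)) - integral {S..T} (\<lambda>r. g r (Y r \<omega>))"
            unfolding Jt_def sum_subtractf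
            using \<beta> elim(1,2) sub ST by (intro tendsto_diff QS_sums_converge(2)[OF \<alpha> \<beta>(1) _ hg gt]) (auto intro: continuous_on_subset)
          moreover have "(\<lambda>L. cl L \<omega>) \<longlonglongrightarrow> (\<Sum>j\<in>{a..<b}. integral {t j..t (Suc j)} (\<lambda>r. g r (Y r \<omega>) - g r (Y (t j) \<omega>)))"
            unfolding cl_def
          proof (intro tendsto_sum)
            fix j assume "j \<in> {a..<b}"
            then have j: "Suc j \<le> n" using tb by auto
            have d: "t (Suc j) - t j = 1 / real n" by (simp add: t_def flip: diff_divide_distrib)
            have "(\<lambda>L. (t (Suc j) - t j) / real (Suc L) * (\<Sum>l<Suc L. (\<lambda>r. g r (Y r \<omega>) - g r (Y (t j) \<omega>)) (t j + real l * ((t (Suc j) - t j) / real (Suc L)))))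
               \<longlonglongrightarrow> integral {t j..t (Suc j)} (\<lambda>r. g r (Y r \<omega>) - g r (Y (t j) \<omega>))"
              using t01[of j] t01[of "Suc j"] j tmono[of j "Suc j"]
              by (intro LIMSEQ_Suc left_riemann_sums_converge continuous_on_diff continuous_on_subset[OF cY] cYj) auto
            then show "(\<lambda>L. (1 / real n / real (Suc L)) * (\<Sum>l<Suc L.
                g (t j + real l * (1 / real n / real (Suc L))) (Y (t j + real l * (1 / real n / real (Suc L))) \<omega>)
              - g (t j + real l * (1 / real n / real (Suc L))) (Y (t j) \<omega>)))
               \<longlonglongrightarrow> integral {t j..t (Suc j)} (\<lambda>r. g r (Y r \<omega>) - g r (Y (t j) \<omega>))"
              unfolding d .
          qed
          ultimately have lim1: "(\<lambda>L. Jt L \<omega> + cl L \<omega> + qe \<omega>) \<longlonglongrightarrow> integral {S..T} (\<lambda>r. g r (X r \<omega>)) - integral {S..T} (\<lambda>r. g r (Y r \<omega>))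
             + (\<Sum>j\<in>{a..<b}. integral {t j..t (Suc j)} (\<lambda>r. g r (Y r \<omega>) - g r (Y (t j) \<omega>))) + qe \<omega>" (is "_ \<longlonglongrightarrow> ?l")
            by (intro tendsto_add tendsto_const)
          have vj: "v j \<omega> $ i / real n = (Y (t (Suc j)) \<omega> - B (t (Suc j)) \<omega>) $ i - (Y (t j) \<omega> - B (t j) \<omega>) $ i" if "j \<in> {a..<b}" for j
          proof -
            have jn: "j < n" using that tb by auto
            have "t (Suc j) \<in> {real j / real n..real (Suc j) / real n}" using tmono[of j "Suc j"] by (simp add: t_def)
            then have "Y (t (Suc j)) \<omega> = Y (real j / real n) \<omega> + (t (Suc j) - real j / real n) *\<^sub>R v j \<omega> + (B (t (Suc j)) \<omega> - B (real j / real n) \<omega>)"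
              using es jn elim(6) unfolding euler_scheme_def by blast
            moreover have "t (Suc j) - real j / real n = 1 / real n" by (simp add: t_def flip: diff_divide_distrib)
            ultimately show ?thesis by (simp add: t_def)
          qed
          have "(\<Sum>j\<in>{a..<b}. integral {t j..t (Suc j)} (\<lambda>r. g r (Y r \<omega>) - g r (Y (t j) \<omega>))) + qe \<omega>
             = (\<Sum>j\<in>{a..<b}. integral {t j..t (Suc j)} (\<lambda>r. g r (Y r \<omega>)) - v j \<omega> $ i / real n)"
            unfolding qe_def sum.distrib[symmetric]
          proof (rule sum.cong)
            fix j assume "j \<in> {a..<b}"
            then have j: "Suc j \<le> n" using tb by auto
            have "integral {t j..t (Suc j)} (\<lambda>r. g r (Y r \<omega>) - g r (Y (t j) \<omega>)) = integral {t j..t (Suc j)} (\<lambda>r. g r (Y r \<omega>)) - integral {t j..t (Suc j)} (\<lambda>r. g r (Y (t j) \<omega>))"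
              using t01[of j] t01[of "Suc j"] j
              by (intro Henstock_Kurzweil_Integration.integral_diff integrable_continuous_real continuous_on_subset[OF cY] cYj) auto
            then show "integral {t j..t (Suc j)} (\<lambda>r. g r (Y r \<omega>) - g r (Y (t j) \<omega>)) + quad_error f n Y v i j \<omega>
               = integral {t j..t (Suc j)} (\<lambda>r. g r (Y r \<omega>)) - v j \<omega> $ i / real n"
              by (simp add: quad_error_def g_def t_def)
          qed simp
          also have "\<dots> = integral {t a..t b} (\<lambda>r. g r (Y r \<omega>)) - (\<Sum>j\<in>{a..<b}. v j \<omega> $ i / real n)"
            unfolding sum_subtractf using ab tmono t01[of a] t01[of b] tb
            by (subst integral_sum_cells) (auto intro!: continuous_on_subset[OF cY])
          also have "(\<Sum>j\<in>{a..<b}. v j \<omega> $ i / real n) = (Y (t b) \<omega> - B (t b) \<omega>) $ i - (Y (t a) \<omega> - B (t a) \<omega>) $ i"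
          proof -
            have "(\<Sum>j\<in>{a..<b}. v j \<omega> $ i / real n) = (\<Sum>j\<in>{a..<b}. (Y (t (Suc j)) \<omega> - B (t (Suc j)) \<omega>) $ i - (Y (t j) \<omega> - B (t j) \<omega>) $ i)"
              using vj by (intro sum.cong) auto
            also have "\<dots> = (Y (t b) \<omega> - B (t b) \<omega>) $ i - (Y (t a) \<omega> - B (t a) \<omega>) $ i"
              using ab by (intro sum_Suc_diff') simp
            finally show ?thesis .
          qed
          finally have s1: "(\<Sum>j\<in>{a..<b}. integral {t j..t (Suc j)} (\<lambda>r. g r (Y r \<omega>) - g r (Y (t j) \<omega>))) + qe \<omega>
             = integral {t a..t b} (\<lambda>r. g r (Y r \<omega>)) - ((Y (t b) \<omega> - B (t b) \<omega>) $ i - (Y (t a) \<omega> - B (t a) \<omega>) $ i)" .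
          have s2: "integral {S..T} (\<lambda>r. g r (X r \<omega>)) = (X T \<omega> - X S \<omega> - (B T \<omega> - B S \<omega>)) $ i"
            unfolding elim(3) g_def using cX sub
            by (subst integral_component_eq_cart) (auto intro!: integrable_continuous_real intro: continuous_on_subset)
          have s3: "integral {S..T} (\<lambda>r. g r (Y r \<omega>)) - integral {t a..t b} (\<lambda>r. g r (Y r \<omega>))
             = integral {t b..T} (\<lambda>r. g r (Y r \<omega>)) - integral {t a..S} (\<lambda>r. g r (Y r \<omega>))"
            using ta tb Sb ST t01[of a] by (intro integral_diff_subinterval continuous_on_subset[OF cY]) auto
          have ib: "\<bar>integral {p..q} (\<lambda>r. g r (Y r \<omega>))\<bar> \<le> K / real n" if "0 \<le> p" "p \<le> q" "q \<le> 1" "q \<le> p + 1 / real n" for p q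
          proof -
            have "norm (integral {p..q} (\<lambda>r. g r (Y r \<omega>))) \<le> K * (q - p)"
              using that gb by (intro integral_bound continuous_on_subset[OF cY]) auto
            also have "\<dots> \<le> K * (1 / real n)" using that K by (intro mult_left_mono) auto
            finally show ?thesis by simp
          qed
          have i1: "\<bar>integral {t b..T} (\<lambda>r. g r (Y r \<omega>))\<bar> \<le> K / real n" using tb t01 ST by (intro ib) auto
          have i2: "\<bar>integral {t a..S} (\<lambda>r. g r (Y r \<omega>))\<bar> \<le> K / real n" using ta t01 ST by (intro ib) auto
          \<comment> \<open>What is left after matching the limit: two integrals over partial cells,
            and the drift of Y over the same two partial cells.\<close>
          have "(E T \<omega> - E S \<omega>) $ i - ?l = (integral {t b..T} (\<lambda>r. g r (Y r \<omega>)) - integral {t a..S} (\<lambda>r. g r (Y r \<omega>)))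
              - ((Y T \<omega> - Y (t b) \<omega> - (B T \<omega> - B (t b) \<omega>)) $ i - (Y S \<omega> - Y (t a) \<omega> - (B S \<omega> - B (t a) \<omega>)) $ i)"
            using s1 s3 unfolding s2 by (simp add: E_def)
          then have "\<bar>(E T \<omega> - E S \<omega>) $ i\<bar> \<le> \<bar>?l\<bar> + 4 * (K / real n)"
            using i1 i2 elim(4,5) by linarith
          then have "\<bar>Z \<omega>\<bar> \<le> \<bar>?l\<bar>" unfolding Z_def by simp
          with lim1 show ?case by blast
        qed
        have "Lq_le M (2 * m) ?c Z" by (rule Lq_le_lim[OF seq Zm lim])
        moreover have "Lq_le M (2 * m) (4 * K / real n) (\<lambda>_. 4 * K / real n)"
          using K by (intro Lq_le_bounded) auto
        ultimately have "Lq_le M (2 * m) (?c + 4 * K / real n) (\<lambda>\<omega>. Z \<omega> + 4 * K / real n)"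
          by (rule Lq_le_add[OF _ _ m2])
        then show ?thesis
        proof (rule Lq_le_mono[OF _ _ compm])
          show "AE \<omega> in M. \<bar>(E T \<omega> - E S \<omega>) $ i\<bar> \<le> \<bar>Z \<omega> + 4 * K / real n\<bar>"
            unfolding Z_def using K by (intro AE_I2) (auto simp: max_def)
          \<comment> \<open>The indices are rounded down, so the aligned window exceeds [S, T] by at
            most one cell, and a cell is no longer than T - S in this case.\<close>
          have sq: "sqrt (real (b - a) / real n) \<le> 2 * (T - S) powr \<eta>"
          proof -
            have "real (b - a) / real n = t b - t a" using ab by (simp add: t_def of_nat_diff diff_divide_distrib)
            also have "\<dots> \<le> 2 * (T - S)"
            proof -
              define w where "w = 1 / real n"
              have "S \<le> t a + w" "w \<le> T - S" using ta(2) False unfolding w_def by auto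
              then have "t b - t a \<le> T - (S - w)" using tb(1) by linarith
              also have "\<dots> \<le> T - (S - (T - S))" using \<open>w \<le> T - S\<close> by linarith
              also have "\<dots> = 2 * (T - S)" by simp
              finally show ?thesis .
            qed
            also have "\<dots> \<le> 4 * (T - S)" using ST by simp
            finally have "sqrt (real (b - a) / real n) \<le> sqrt (4 * (T - S))" by (rule real_sqrt_le_mono)
            also have "\<dots> = 2 * (T - S) powr (1 / 2)" using ST by (subst real_sqrt_mult) (simp add: powr_half_sqrt)
            also have "\<dots> \<le> 2 * (T - S) powr \<eta>" using ST \<eta> by (intro mult_left_mono powr_mono2_le_one) auto
            finally show ?thesis .
          qed
          have n1: "1 / real n \<le> \<rho> * (T - S) powr \<eta>"
          proof -
            have "1 / real n = (1 / real n) powr (\<theta> + \<eta>)" using n by (simp add: \<eta>_def)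
            also have "\<dots> = \<rho> * (1 / real n) powr \<eta>" unfolding \<rho>_def by (rule powr_add)
            also have "\<dots> \<le> \<rho> * (T - S) powr \<eta>" using False \<eta> \<rho>0 by (intro mult_left_mono powr_mono2) auto
            finally show ?thesis .
          qed
          have "?c + 4 * K / real n = G1 * (a0 + N) * (T - S) powr ((1 + \<beta>) / 2) + (G2 + G3) * \<rho> * sqrt (real (b - a) / real n) + 4 * K * (1 / real n)"
            by (simp add: algebra_simps)
          also have "\<dots> \<le> G1 * (a0 + N) * (T - S) powr ((1 + \<beta>) / 2) + (G2 + G3) * \<rho> * (2 * (T - S) powr \<eta>) + 4 * K * (\<rho> * (T - S) powr \<eta>)"
            using sq n1 G2 G3 K \<rho>0 by (intro add_mono mult_left_mono order_refl) auto
          also have "\<dots> = G1 * (a0 + N) * (T - S) powr ((1 + \<beta>) / 2) + G4 * \<rho> * (T - S) powr \<eta>"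
            by (simp add: G4_def algebra_simps)
          finally show "?c + 4 * K / real n \<le> G1 * (a0 + N) * (T - S) powr ((1 + \<beta>) / 2) + G4 * \<rho> * (T - S) powr \<eta>" .
        qed
      qed
    qed
    have step: "Lq_le M (2 * m) (G * (a0 + N) * (T - S) powr ((1 + \<beta>) / 2) + G * \<rho> * (T - S) powr \<eta>) (\<lambda>\<omega>. norm (E T \<omega> - E S \<omega>))"
      if ST: "0 \<le> S" "S < T" "T \<le> 1" and a0: "0 < a0" and N: "0 \<le> N"
        and Ea: "\<forall>t. S \<le> t \<longrightarrow> t \<le> T \<longrightarrow> Lq_le M (2 * m) a0 (\<lambda>\<omega>. norm (E t \<omega>))"
        and EN: "\<forall>s t. S \<le> s \<longrightarrow> s < t \<longrightarrow> t \<le> T \<longrightarrow> Lq_le M (2 * m) (N * (t - s) powr \<eta>) (\<lambda>\<omega>. norm (E t \<omega> - E s \<omega>))"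
      for S T a0 N
    proof -
      let ?k = "G1 * (a0 + N) * (T - S) powr ((1 + \<beta>) / 2) + G4 * \<rho> * (T - S) powr \<eta>"
      have [measurable]: "E T \<in> borel_measurable M" "E S \<in> borel_measurable M" using Em ST by auto
      have "Lq_le M (2 * m) (\<Sum>i\<in>(UNIV::'d set). ?k) (\<lambda>\<omega>. \<Sum>i\<in>UNIV. \<bar>(E T \<omega> - E S \<omega>) $ i\<bar>)"
        by (intro Lq_le_sum m2 Lq_le_mono[OF comp[OF that]]) auto
      then show ?thesis
      proof (rule Lq_le_mono)
        show "AE \<omega> in M. \<bar>norm (E T \<omega> - E S \<omega>)\<bar> \<le> \<bar>\<Sum>i\<in>UNIV. \<bar>(E T \<omega> - E S \<omega>) $ i\<bar>\<bar>"
          by (intro AE_I2) (simp only: abs_norm_cancel, rule order_trans[OF norm_le_l1_cart abs_ge_self])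
        have "(\<Sum>i\<in>(UNIV::'d set). ?k) = real CARD('d) * ?k" by simp
        also have "\<dots> \<le> real CARD('d) * ((G1 + G4) * (a0 + N) * (T - S) powr ((1 + \<beta>) / 2) + (G1 + G4) * \<rho> * (T - S) powr \<eta>)"
          using G1 G4 a0 N \<rho>0 by (intro mult_left_mono add_mono mult_right_mono) auto
        also have "\<dots> = G * (a0 + N) * (T - S) powr ((1 + \<beta>) / 2) + G * \<rho> * (T - S) powr \<eta>"
          by (simp add: G_def algebra_simps)
        finally show "(\<Sum>i\<in>(UNIV::'d set). ?k) \<le> G * (a0 + N) * (T - S) powr ((1 + \<beta>) / 2) + G * \<rho> * (T - S) powr \<eta>" .
      qed measurable
    qed
    have "\<forall>t. 0 \<le> t \<longrightarrow> t \<le> 1 \<longrightarrow> Lq_le M (2 * m) (C * \<rho>) (\<lambda>\<omega>. norm (E t \<omega>))"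
    proof (rule close[OF \<rho>0])
      show "AE \<omega> in M. E 0 \<omega> = 0" using Y0 by eventually_elim (simp add: E_def)
    qed (use Em lip step in auto)
    then show "Lq_le M (2 * m) (C * (1 / real n) powr \<theta>) (\<lambda>\<omega>. norm (X t0 \<omega> - Y t0 \<omega>))"
      using t0 by (simp add: E_def \<rho>_def)
  qed
qed

end

section \<open>Brownian motion on the product space\<close>

lemma measure_eq_atMost:
  fixes M N :: "(real^'d) measure"
  assumes "prob_space M" "prob_space N" and sets: "sets M = sets borel" "sets N = sets borel"
    and eq: "\<And>a. emeasure M {..a} = emeasure N {..a}"
  shows "M = N"
proof -
  interpret M: prob_space M by fact
  interpret N: prob_space N by fact
  let ?A = "\<lambda>n::nat. {..(\<chi> i. real n)} :: (real^'d) set"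
  show ?thesis
  proof (rule measure_eqI_generator_eq[where E = "range atMost" and \<Omega> = UNIV and A = ?A])
    show "Int_stable (range atMost :: (real^'d) set set)"
    proof (rule Int_stableI, safe)
      fix a b :: "real^'d"
      have "{..a} \<inter> {..b} = {..(\<chi> i. min (a $ i) (b $ i))}"
        by (auto simp: less_eq_vec_def)
      then show "{..a} \<inter> {..b} \<in> range atMost" by simp
    qed
    show "(\<Union>n. ?A n) = UNIV"
    proof safe
      fix x :: "real^'d"
      obtain n :: nat where n: "norm x \<le> real n" using real_arch_simple by blast
      have "x $ i \<le> real n" for i using component_le_norm_cart[of x i] n by linarith
      then show "x \<in> (\<Union>n. ?A n)" by (auto simp: less_eq_vec_def)
    qed auto
    show "sets M = sigma_sets UNIV (range atMost)" "sets N = sigma_sets UNIV (range atMost)"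
      using sets by (simp_all add: borel_eq_atMost)
  qed (auto simp: eq)
qed

lemma bm_times:
  assumes bm: "brownian_motion M B" and "\<And>j. j \<le> k \<Longrightarrow> 0 \<le> ts j \<and> ts j \<le> 1" "\<And>j. j < k \<Longrightarrow> ts j < ts (Suc j)"
  shows "prob_space.indep_vars M (\<lambda>_. borel) (\<lambda>(i, j) \<omega>. (B (ts (Suc j)) \<omega> - B (ts j) \<omega>) $ i) (UNIV \<times> {..<k})"
    and "j < k \<Longrightarrow> distributed M lborel (\<lambda>\<omega>. (B (ts (Suc j)) \<omega> - B (ts j) \<omega>) $ i)
                     (\<lambda>x. ennreal (normal_density 0 (sqrt (ts (Suc j) - ts j)) x))"
proof -
  have "(\<forall>j\<le>k. 0 \<le> ts j \<and> ts j \<le> 1) \<and> (\<forall>j<k. ts j < ts (Suc j))" using assms by auto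
  with bm have *: "prob_space.indep_vars M (\<lambda>_. borel)
           (\<lambda>(i, j) \<omega>. (B (ts (Suc j)) \<omega> - B (ts j) \<omega>) $ i) (UNIV \<times> {..<k}) \<and>
        (\<forall>i. \<forall>j<k. distributed M lborel (\<lambda>\<omega>. (B (ts (Suc j)) \<omega> - B (ts j) \<omega>) $ i)
                     (\<lambda>x. ennreal (normal_density 0 (sqrt (ts (Suc j) - ts j)) x)))"
    unfolding brownian_motion_def by blast
  then show "prob_space.indep_vars M (\<lambda>_. borel) (\<lambda>(i, j) \<omega>. (B (ts (Suc j)) \<omega> - B (ts j) \<omega>) $ i) (UNIV \<times> {..<k})"
    by blast
  show "j < k \<Longrightarrow> distributed M lborel (\<lambda>\<omega>. (B (ts (Suc j)) \<omega> - B (ts j) \<omega>) $ i)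
                     (\<lambda>x. ennreal (normal_density 0 (sqrt (ts (Suc j) - ts j)) x))"
    using * by blast
qed

text \<open>The definition of Brownian motion speaks of single coordinates. On lower orthants both
  laws factor into the same one-dimensional normal probabilities, and orthants determine a
  probability measure.\<close>

lemma bm_increment_law:
  fixes B :: "real \<Rightarrow> 'a \<Rightarrow> real^'d"
  assumes bm: "brownian_motion M B" and st: "0 \<le> s" "s < t" "t \<le> 1"
  shows "distr M borel (\<lambda>\<omega>. B t \<omega> - B s \<omega>) = distr gauss borel (\<lambda>z. sqrt (t - s) *\<^sub>R z)"
proof -
  interpret prob_space M using bm by (simp add: brownian_motion_def)
  have [measurable]: "B t \<in> borel_measurable M" "B s \<in> borel_measurable M"
    using bm st by (auto simp: brownian_motion_def)
  define \<sigma> where "\<sigma> = sqrt (t - s)"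
  have \<sigma>: "0 < \<sigma>" using st by (simp add: \<sigma>_def)
  define ts where "ts = (\<lambda>j::nat. if j = 0 then s else t)"
  define D where "D i \<omega> = (B t \<omega> - B s \<omega>) $ i" for i \<omega>
  have [measurable]: "D i \<in> borel_measurable M" for i unfolding D_def by measurable
  have tsj: "0 \<le> ts j \<and> ts j \<le> 1" "j < 1 \<Longrightarrow> ts j < ts (Suc j)" for j using st by (auto simp: ts_def)
  have ind: "indep_vars (\<lambda>_. borel) (\<lambda>(i::'d, j::nat). D i) (UNIV \<times> {..<1})"
  proof (rule iffD1[OF indep_vars_cong[OF refl _ refl]])
    show "indep_vars (\<lambda>_. borel) (\<lambda>(i::'d, j) \<omega>. (B (ts (Suc j)) \<omega> - B (ts j) \<omega>) $ i) (UNIV \<times> {..<1})"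
      using tsj by (intro bm_times(1)[OF bm]) auto
  qed (auto simp: ts_def D_def)
  have dist: "distributed M lborel (\<lambda>\<omega>. D i \<omega> / \<sigma>) (\<lambda>x. ennreal (std_normal_density x))" for i
    using bm_times(2)[OF bm, of 1 ts 0 i] tsj normal_standard_normal_convert[OF \<sigma>, of "D i" 0]
    by (simp add: ts_def D_def[abs_def] \<sigma>_def)
  show ?thesis
  proof (rule measure_eq_atMost)
    show "prob_space (distr M borel (\<lambda>\<omega>. B t \<omega> - B s \<omega>))" by (rule prob_space_distr) simp
    show "prob_space (distr (gauss :: (real^'d) measure) borel (\<lambda>z. sqrt (t - s) *\<^sub>R z))"
      by (rule gauss.prob_space_distr) simp
    fix a :: "real^'d"
    have am [measurable]: "{..a} \<in> sets borel" by simp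
    have m1: "emeasure M (D i -` {..a $ i} \<inter> space M)
       = (\<integral>\<^sup>+x. indicator {x. \<sigma> * x \<le> a $ i} x \<partial>density lborel (\<lambda>x. ennreal (std_normal_density x)))" for i
    proof -
      have "D i -` {..a $ i} \<inter> space M = (\<lambda>\<omega>. D i \<omega> / \<sigma>) -` {x. \<sigma> * x \<le> a $ i} \<inter> space M"
        using \<sigma> by auto
      also have "emeasure M \<dots> = emeasure (distr M lborel (\<lambda>\<omega>. D i \<omega> / \<sigma>)) {x. \<sigma> * x \<le> a $ i}"
        by (subst emeasure_distr) auto
      also have "distr M lborel (\<lambda>\<omega>. D i \<omega> / \<sigma>) = density lborel (\<lambda>x. ennreal (std_normal_density x))"
        using dist by (rule distributed_distr_eq_density)
      finally show ?thesis by simp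
    qed
    have "emeasure (distr M borel (\<lambda>\<omega>. B t \<omega> - B s \<omega>)) {..a} = emeasure M (\<Inter>i\<in>UNIV. D i -` {..a $ i} \<inter> space M)"
      by (subst emeasure_distr) (auto simp: less_eq_vec_def D_def intro!: arg_cong[where f = "emeasure M"])
    also have "\<dots> = ennreal (\<Prod>i\<in>UNIV. prob (D i -` {..a $ i} \<inter> space M))"
    proof -
      have P: "(UNIV :: 'd set) \<times> {0::nat} = (\<lambda>i. (i, 0)) ` UNIV" by auto
      have inj: "inj (\<lambda>i::'d. (i, 0::nat))" by (auto simp: inj_on_def)
      have "prob (\<Inter>p\<in>UNIV \<times> {0}. (\<lambda>(i::'d, j::nat). D i) p -` {..a $ fst p} \<inter> space M)
         = (\<Prod>p\<in>UNIV \<times> {0}. prob ((\<lambda>(i::'d, j::nat). D i) p -` {..a $ fst p} \<inter> space M))"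
        by (rule indep_varsD[OF ind]) auto
      then show ?thesis
        unfolding emeasure_eq_measure P by (simp add: prod.reindex[OF inj])
    qed
    also have "\<dots> = (\<Prod>i\<in>UNIV. emeasure M (D i -` {..a $ i} \<inter> space M))"
      by (simp add: emeasure_eq_measure prod_ennreal)
    also have "\<dots> = (\<Prod>i\<in>UNIV. (\<integral>\<^sup>+x. indicator {x. \<sigma> * x \<le> a $ i} x \<partial>density lborel (\<lambda>x. ennreal (std_normal_density x))))"
      by (simp only: m1)
    also have "\<dots> = (\<integral>\<^sup>+z. (\<Prod>i\<in>UNIV. indicator {x. \<sigma> * x \<le> a $ i} ((z::real^'d) $ i)) \<partial>gauss)"
      by (rule nn_integral_gauss_prod[symmetric]) simp
    also have "\<dots> = (\<integral>\<^sup>+z. indicator {..a} (\<sigma> *\<^sub>R z) \<partial>(gauss :: (real^'d) measure))"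
      by (intro nn_integral_cong) (auto simp: indicator_def less_eq_vec_def prod.If_cases)
    also have "\<dots> = emeasure (distr gauss borel (\<lambda>z. sqrt (t - s) *\<^sub>R z)) {..a}"
      unfolding \<sigma>_def[symmetric] by (subst nn_integral_indicator[symmetric], simp, subst nn_integral_distr) auto
    finally show "emeasure (distr M borel (\<lambda>\<omega>. B t \<omega> - B s \<omega>)) {..a} = emeasure (distr gauss borel (\<lambda>z. sqrt (t - s) *\<^sub>R z)) {..a}" .
  qed simp_all
qed

section \<open>Independence of Brownian increments from the past\<close>

text \<open>Past values are sums of increments over a sorted grid, hence functions of the increments
  before s, while B t - B s is the last increment of the same independent family.\<close>

lemma bm_finite_past_independent:
  fixes B :: "real \<Rightarrow> 'a \<Rightarrow> real^'d"
  assumes bm: "brownian_motion M B" and st: "0 \<le> s" "s < t" "t \<le> 1"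
    and R: "finite R" "R \<subseteq> {0..s}" and Ar: "\<And>r. r \<in> R \<Longrightarrow> Ar r \<in> sets borel" and D: "D \<in> sets borel"
  shows "measure M ({\<omega> \<in> space M. \<forall>r\<in>R. B r \<omega> \<in> Ar r} \<inter> {\<omega> \<in> space M. B t \<omega> - B s \<omega> \<in> D})
    = measure M {\<omega> \<in> space M. \<forall>r\<in>R. B r \<omega> \<in> Ar r} * measure M {\<omega> \<in> space M. B t \<omega> - B s \<omega> \<in> D}"
proof -
  interpret prob_space M using bm by (simp add: brownian_motion_def)
  have Bm: "B r \<in> borel_measurable M" if "0 \<le> r" "r \<le> 1" for r using bm that by (auto simp: brownian_motion_def)
  \<comment> \<open>Adding 0 makes the values recoverable from increments; adding s makes the final
    increment start exactly at s.\<close>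
  define xs where "xs = sorted_list_of_set (insert 0 (insert s R))"
  have fin: "finite (insert 0 (insert s R))" using R by simp
  have setxs: "set xs = insert 0 (insert s R)" unfolding xs_def by (rule set_sorted_list_of_set[OF fin])
  have srt: "sorted_wrt (<) xs" unfolding xs_def by (rule strict_sorted_list_of_set)
  have ne: "xs \<noteq> []" using setxs by auto
  define k where "k = length xs - 1"
  have len: "length xs = Suc k" using ne by (simp add: k_def)
  have range: "0 \<le> x \<and> x \<le> s" if "x \<in> set xs" for x using that setxs R st by auto
  have mono: "xs ! i < xs ! j" if "i < j" "j \<le> k" for i j
    using sorted_wrt_nth_less[OF srt, of i j] that len by simp
  have x0: "xs ! 0 = 0"
  proof -
    obtain i where i: "i \<le> k" "xs ! i = 0" using setxs len by (metis insertI1 in_set_conv_nth less_Suc_eq_le)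
    show ?thesis
    proof (cases "i = 0")
      case False
      then have "xs ! 0 < 0" using mono[of 0 i] i by simp
      moreover have "0 \<le> xs ! 0" using range[of "xs ! 0"] len by simp
      ultimately show ?thesis by simp
    qed (use i in simp)
  qed
  have xk: "xs ! k = s"
  proof -
    obtain i where i: "i \<le> k" "xs ! i = s" using setxs len by (metis insertI1 insertI2 in_set_conv_nth less_Suc_eq_le)
    show ?thesis
    proof (cases "i = k")
      case False
      then have "s < xs ! k" using mono[of i k] i by simp
      moreover have "xs ! k \<le> s" using range[of "xs ! k"] len by simp
      ultimately show ?thesis by simp
    qed (use i in simp)
  qed
  define ts where "ts j = (if j \<le> k then xs ! j else t)" for j
  have ts1: "0 \<le> ts j \<and> ts j \<le> 1" for j
    using range[of "xs ! j"] len st by (auto simp: ts_def)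
  have ts2: "ts j < ts (Suc j)" if "j < Suc k" for j
  proof (cases "j = k")
    case True
    then show ?thesis using xk st by (simp add: ts_def)
  next
    case False
    then show ?thesis using mono[of j "Suc j"] that by (simp add: ts_def)
  qed
  define inc where "inc = (\<lambda>(i::'d, j::nat) \<omega>. (B (ts (Suc j)) \<omega> - B (ts j) \<omega>) $ i)"
  have ind: "indep_vars (\<lambda>_. borel) inc (UNIV \<times> {..<Suc k})"
    unfolding inc_def using ts1 ts2 by (intro bm_times(1)[OF bm]) auto
  define I1 where "I1 = (UNIV :: 'd set) \<times> {..<k}"
  define I2 where "I2 = (UNIV :: 'd set) \<times> {k}"
  have iv: "indep_var (PiM I1 (\<lambda>_. borel)) (\<lambda>\<omega>. restrict (\<lambda>p. inc p \<omega>) I1) (PiM I2 (\<lambda>_. borel)) (\<lambda>\<omega>. restrict (\<lambda>p. inc p \<omega>) I2)"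
    by (rule indep_var_restrict[OF ind]) (auto simp: I1_def I2_def)
  \<comment> \<open>\<open>\<Phi> j\<close> reassembles the vector B at the j-th grid time, relative
    to B 0, from the coordinate increments; \<open>\<Psi>\<close> does the same for the last
    increment.\<close>
  define \<Phi> where "\<Phi> j x = (\<Sum>i\<in>UNIV. (\<Sum>l<j. x (i, l)) *\<^sub>R axis i (1::real))" for j and x :: "'d \<times> nat \<Rightarrow> real"
  define \<Psi> where "\<Psi> x = (\<Sum>i\<in>UNIV. x (i, k) *\<^sub>R axis i (1::real))" for x :: "'d \<times> nat \<Rightarrow> real"
  have expand: "(\<Sum>i\<in>UNIV. (x $ i) *\<^sub>R axis i (1::real)) = x" for x :: "real^'d"
    using basis_expansion[of x] by (simp add: scalar_mult_eq_scaleR)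
  have \<Phi>m: "\<Phi> j \<in> measurable (PiM I1 (\<lambda>_. borel)) borel" if "j \<le> k" for j
    unfolding \<Phi>_def[abs_def] using that
    by (intro borel_measurable_sum borel_measurable_scaleR borel_measurable_const measurable_component_singleton) (auto simp: I1_def)
  have \<Psi>m: "\<Psi> \<in> measurable (PiM I2 (\<lambda>_. borel)) borel"
    unfolding \<Psi>_def[abs_def]
    by (intro borel_measurable_sum borel_measurable_scaleR borel_measurable_const measurable_component_singleton) (auto simp: I2_def)
  have \<Phi>B: "\<Phi> j (restrict (\<lambda>p. inc p \<omega>) I1) = B (ts j) \<omega> - B 0 \<omega>" if "j \<le> k" for j \<omega>
  proof -
    have "\<Phi> j (restrict (\<lambda>p. inc p \<omega>) I1) = (\<Sum>i\<in>UNIV. ((\<Sum>l<j. B (ts (Suc l)) \<omega> - B (ts l) \<omega>) $ i) *\<^sub>R axis i (1::real))"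
      using that unfolding \<Phi>_def by (intro sum.cong refl arg_cong2[where f = scaleR]) (auto simp: I1_def inc_def intro!: sum.cong)
    also have "\<dots> = (\<Sum>l<j. B (ts (Suc l)) \<omega> - B (ts l) \<omega>)" by (rule expand)
    also have "\<dots> = B (ts j) \<omega> - B (ts 0) \<omega>" by (rule sum_lessThan_telescope)
    finally show ?thesis using x0 by (simp add: ts_def)
  qed
  have \<Psi>B: "\<Psi> (restrict (\<lambda>p. inc p \<omega>) I2) = B t \<omega> - B s \<omega>" for \<omega>
  proof -
    have "\<Psi> (restrict (\<lambda>p. inc p \<omega>) I2) = (\<Sum>i\<in>UNIV. ((B (ts (Suc k)) \<omega> - B (ts k) \<omega>) $ i) *\<^sub>R axis i (1::real))"
      unfolding \<Psi>_def by (intro sum.cong) (auto simp: I2_def inc_def)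
    also have "\<dots> = B (ts (Suc k)) \<omega> - B (ts k) \<omega>" by (rule expand)
    finally show ?thesis using xk by (simp add: ts_def)
  qed
  have "\<exists>idx. \<forall>r\<in>R. idx r \<le> k \<and> ts (idx r) = r"
  proof (rule bchoice, rule ballI)
    fix r assume "r \<in> R"
    then have "r \<in> set xs" using setxs by simp
    then obtain i where "i \<le> k" "xs ! i = r" using len by (metis in_set_conv_nth less_Suc_eq_le)
    then show "\<exists>i. i \<le> k \<and> ts i = r" by (auto simp: ts_def)
  qed
  then obtain idx where idx: "\<And>r. r \<in> R \<Longrightarrow> idx r \<le> k" "\<And>r. r \<in> R \<Longrightarrow> ts (idx r) = r" by blast
  define C1 where "C1 = {x \<in> space (PiM I1 (\<lambda>_. borel)). \<forall>r\<in>R. \<Phi> (idx r) x \<in> Ar r}"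
  define C2 where "C2 = {x \<in> space (PiM I2 (\<lambda>_. borel)). \<Psi> x \<in> D}"
  have C1: "C1 \<in> sets (PiM I1 (\<lambda>_. borel))"
    unfolding C1_def using R idx(1) Ar \<Phi>m by (intro sets.sets_Collect_finite_All) (auto intro: measurable_sets_Collect)
  have C2: "C2 \<in> sets (PiM I2 (\<lambda>_. borel))"
    unfolding C2_def using \<Psi>m D by measurable
  have sp: "restrict (\<lambda>p. inc p \<omega>) J \<in> space (PiM J (\<lambda>_. borel))" for J \<omega>
    by (auto simp: space_PiM)
  let ?A = "{\<omega> \<in> space M. \<forall>r\<in>R. B r \<omega> \<in> Ar r}" and ?E = "{\<omega> \<in> space M. B t \<omega> - B s \<omega> \<in> D}"
  let ?A' = "(\<lambda>\<omega>. restrict (\<lambda>p. inc p \<omega>) I1) -` C1 \<inter> space M"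
  have E: "?E = (\<lambda>\<omega>. restrict (\<lambda>p. inc p \<omega>) I2) -` C2 \<inter> space M"
    using sp by (auto simp: C2_def \<Psi>B)
  have [measurable]: "B t \<in> borel_measurable M" "B s \<in> borel_measurable M" using Bm st by auto
  have Am: "?A \<in> sets M"
  proof (intro sets.sets_Collect_finite_All R)
    fix r assume r: "r \<in> R"
    then have "B r \<in> borel_measurable M" using R st by (intro Bm) auto
    then show "{\<omega> \<in> space M. B r \<omega> \<in> Ar r} \<in> sets M" using Ar[OF r] by measurable
  qed
  have Em: "?E \<in> sets M" using D by measurable
  have A'm: "?A' \<in> sets M" using indep_var_rv1[OF iv] C1 by (rule measurable_sets)
  have AE: "AE \<omega> in M. B 0 \<omega> = 0" using bm by (auto simp: brownian_motion_def)
  \<comment> \<open>The two descriptions of the past event agree only almost surely, because B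
    starts at 0 only almost surely.\<close>
  then have AA: "AE \<omega> in M. \<omega> \<in> ?A \<longleftrightarrow> \<omega> \<in> ?A'"
  proof eventually_elim
    case (elim \<omega>)
    then show ?case using sp[of \<omega> I1] idx \<Phi>B by (auto simp: C1_def)
  qed
  have "prob (?A \<inter> ?E) = prob (?A' \<inter> ?E)"
    using AA Am A'm Em by (intro finite_measure_eq_AE) auto
  also have "\<dots> = prob ((\<lambda>\<omega>. (restrict (\<lambda>p. inc p \<omega>) I1, restrict (\<lambda>p. inc p \<omega>) I2)) -` (C1 \<times> C2) \<inter> space M)"
    unfolding E by (intro arg_cong[where f = prob]) auto
  also have "\<dots> = prob ?A' * prob ?E"
    unfolding E by (rule indep_varD[OF iv C1 C2])
  also have "prob ?A' = prob ?A"
    using AA Am A'm by (intro finite_measure_eq_AE) auto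
  finally show ?thesis .
qed

lemma sets_nat_filtration:
  "sets (nat_filtration M B t) = sigma_sets (space M) ({B s -` A \<inter> space M | s A. s \<in> {0..t} \<and> A \<in> sets borel} \<union>
      {N \<in> sets M. emeasure M N = 0})"
  unfolding nat_filtration_def by (intro sets_measure_of) (auto dest: sets.sets_into_space)

lemma space_nat_filtration [simp]: "space (nat_filtration M B t) = space M"
  unfolding nat_filtration_def by (intro space_measure_of) (auto dest: sets.sets_into_space)

lemma sets_nat_filtration_subset:
  assumes "\<And>s. s \<in> {0..t} \<Longrightarrow> B s \<in> borel_measurable M"
  shows "sets (nat_filtration M B t) \<subseteq> sets M"
  unfolding sets_nat_filtration using assms by (intro sets.sigma_sets_subset) (auto intro: measurable_sets)

text \<open>A Dynkin argument. Cylinder events together with the null sets of M remain stable under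
  intersection, since meeting a null set gives a null set, and they generate the completed
  filtration.\<close>

lemma bm_past_independent:
  fixes B :: "real \<Rightarrow> 'a \<Rightarrow> real^'d"
  assumes bm: "brownian_motion M B" and st: "0 \<le> s" "s < t" "t \<le> 1"
    and A: "A \<in> sets (nat_filtration M B s)" and D: "D \<in> sets borel"
  shows "measure M (A \<inter> {\<omega> \<in> space M. B t \<omega> - B s \<omega> \<in> D}) = measure M A * measure M {\<omega> \<in> space M. B t \<omega> - B s \<omega> \<in> D}"
proof -
  interpret prob_space M using bm by (simp add: brownian_motion_def)
  have Bm: "B r \<in> borel_measurable M" if "0 \<le> r" "r \<le> 1" for r using bm that by (auto simp: brownian_motion_def)
  have [measurable]: "B t \<in> borel_measurable M" "B s \<in> borel_measurable M" using Bm st by auto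
  let ?E = "{\<omega> \<in> space M. B t \<omega> - B s \<omega> \<in> D}"
  have E: "?E \<in> sets M" using D by measurable
  define Fin where "Fin = {{\<omega> \<in> space M. \<forall>r\<in>R. B r \<omega> \<in> Ar r} | R Ar. finite R \<and> R \<subseteq> {0..s} \<and> (\<forall>r. Ar r \<in> sets (borel :: (real^'d) measure))}"
  define Nul where "Nul = {N \<in> sets M. emeasure M N = 0}"
  have FinM: "X \<in> sets M" if "X \<in> Fin" for X
  proof -
    obtain R Ar where X: "X = {\<omega> \<in> space M. \<forall>r\<in>R. B r \<omega> \<in> Ar r}" "finite R" "R \<subseteq> {0..s}" "\<And>r. Ar r \<in> sets borel"
      using \<open>X \<in> Fin\<close> by (auto simp: Fin_def)
    show ?thesis
      unfolding X(1)
    proof (intro sets.sets_Collect_finite_All X)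
      fix r assume "r \<in> R"
      then have "B r \<in> borel_measurable M" using X st by (intro Bm) auto
      then show "{\<omega> \<in> space M. B r \<omega> \<in> Ar r} \<in> sets M" using X(4)[of r] by measurable
    qed
  qed
  have GM: "Fin \<union> Nul \<subseteq> sets M" using FinM by (auto simp: Nul_def)
  have null_Int: "X \<inter> Y \<in> Nul" if "X \<in> Nul" "Y \<in> sets M" for X Y
  proof -
    have "emeasure M (X \<inter> Y) \<le> emeasure M X" using that by (intro emeasure_mono) (auto simp: Nul_def)
    then show ?thesis using that by (auto simp: Nul_def)
  qed
  have stable: "Int_stable (Fin \<union> Nul)"
  proof (rule Int_stableI)
    fix X Y assume X: "X \<in> Fin \<union> Nul" and Y: "Y \<in> Fin \<union> Nul"
    consider "X \<in> Nul" | "Y \<in> Nul" | "X \<in> Fin" "Y \<in> Fin" using X Y by auto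
    then show "X \<inter> Y \<in> Fin \<union> Nul"
    proof cases
      case 1
      then show ?thesis using null_Int[of X Y] Y GM by auto
    next
      case 2
      then show ?thesis using null_Int[of Y X] X GM by (auto simp: Int_commute)
    next
      case 3
      obtain R1 A1 where 1: "X = {\<omega> \<in> space M. \<forall>r\<in>R1. B r \<omega> \<in> A1 r}" "finite R1" "R1 \<subseteq> {0..s}" "\<forall>r. A1 r \<in> sets borel"
        using 3(1) unfolding Fin_def by blast
      obtain R2 A2 where 2: "Y = {\<omega> \<in> space M. \<forall>r\<in>R2. B r \<omega> \<in> A2 r}" "finite R2" "R2 \<subseteq> {0..s}" "\<forall>r. A2 r \<in> sets borel"
        using 3(2) unfolding Fin_def by blast
      define A3 where "A3 r = (if r \<in> R1 then A1 r else UNIV) \<inter> (if r \<in> R2 then A2 r else UNIV)" for r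
      have "X \<inter> Y = {\<omega> \<in> space M. \<forall>r\<in>R1 \<union> R2. B r \<omega> \<in> A3 r}"
        unfolding 1(1) 2(1) A3_def by auto
      moreover have "finite (R1 \<union> R2)" "R1 \<union> R2 \<subseteq> {0..s}" "\<forall>r. A3 r \<in> sets borel"
        using 1 2 by (auto simp: A3_def)
      ultimately have "X \<inter> Y \<in> Fin" unfolding Fin_def by blast
      then show ?thesis by simp
    qed
  qed
  have gen: "sets (nat_filtration M B s) \<subseteq> sigma_sets (space M) (Fin \<union> Nul)"
    unfolding sets_nat_filtration
  proof (rule sigma_sets_mono'; safe)
    fix r :: real and A :: "(real^'d) set" assume r: "r \<in> {0..s}" and A: "A \<in> sets borel"
    have "B r -` A \<inter> space M = {\<omega> \<in> space M. \<forall>q\<in>{r}. B q \<omega> \<in> A}" by auto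
    moreover have "{\<omega> \<in> space M. \<forall>q\<in>{r}. B q \<omega> \<in> (\<lambda>_. A) q} \<in> Fin"
      unfolding Fin_def using r A by (intro CollectI exI[of _ "{r}"] exI[of _ "\<lambda>_. A"]) auto
    moreover assume "B r -` A \<inter> space M \<notin> Nul"
    ultimately show "B r -` A \<inter> space M \<in> Fin" by simp
  next
    fix N assume "N \<in> sets M" "emeasure M N = 0" "N \<notin> Nul"
    then show "N \<in> Fin" by (simp add: Nul_def)
  qed
  have sub: "sigma_sets (space M) (Fin \<union> Nul) \<subseteq> sets M"
    using GM by (rule sets.sigma_sets_subset)
  have clos: "Fin \<union> Nul \<subseteq> Pow (space M)" using GM sets.sets_into_space by blast
  have A': "A \<in> sigma_sets (space M) (Fin \<union> Nul)" using A gen by auto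
  from stable clos A' show ?thesis
  proof (induction rule: sigma_sets_induct_disjoint)
    case (basic A)
    then show ?case
    proof
      assume "A \<in> Nul"
      then have "emeasure M A = 0" "emeasure M (A \<inter> ?E) = 0"
        using null_Int[of A ?E] E by (auto simp: Nul_def)
      then show ?thesis by (simp add: measure_def)
    next
      assume "A \<in> Fin"
      then obtain R Ar where "A = {\<omega> \<in> space M. \<forall>r\<in>R. B r \<omega> \<in> Ar r}" "finite R" "R \<subseteq> {0..s}" "\<forall>r. Ar r \<in> sets (borel :: (real^'d) measure)"
        unfolding Fin_def by blast
      then show ?thesis using bm_finite_past_independent[OF bm st, of R Ar D] D by simp
    qed
  next
    case empty
    then show ?case by simp
  next
    case (compl A)
    have AM: "A \<in> sets M" using compl sub by auto
    have "(space M - A) \<inter> ?E = ?E - (A \<inter> ?E)" by auto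
    then have "prob ((space M - A) \<inter> ?E) = prob ?E - prob (A \<inter> ?E)"
      using AM E by (simp add: finite_measure_Diff)
    also have "\<dots> = (1 - prob A) * prob ?E" using compl(2) by (simp add: algebra_simps)
    finally show ?case using prob_compl[OF AM] by simp
  next
    case (union A)
    have AM: "A i \<in> sets M" for i using union(2) sub by auto
    have "(\<lambda>i. prob (A i \<inter> ?E)) sums prob (\<Union>i. A i \<inter> ?E)"
      using AM E union(1) by (intro finite_measure_UNION) (auto simp: disjoint_family_on_def)
    moreover have "(\<lambda>i. prob (A i) * prob ?E) sums (prob (\<Union>i. A i) * prob ?E)"
      using AM union(1) by (intro sums_mult2 finite_measure_UNION) auto
    moreover have "(\<lambda>i. prob (A i \<inter> ?E)) = (\<lambda>i. prob (A i) * prob ?E)" using union(3) by (rule ext)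
    ultimately have "prob (\<Union>i. A i \<inter> ?E) = prob (\<Union>i. A i) * prob ?E" by (simp only: sums_unique2)
    moreover have "(\<Union>i. A i) \<inter> ?E = (\<Union>i. A i \<inter> ?E)" by auto
    ultimately show ?case by (simp only:)
  qed
qed

text \<open>Every \<sigma>-algebra of the filtration carries all of \<open>MT\<close>. For a fixed
  sampling point the section of a past event is a past event of the Brownian space, so Fubini
  reduces the product formula to the Brownian component.\<close>

lemma filtered_bm_product:
  fixes B :: "real \<Rightarrow> 'a \<Rightarrow> real^'d"
  assumes bm: "brownian_motion MB B" and MT: "prob_space MT"
  shows "filtered_bm (MB \<Otimes>\<^sub>M MT) (\<lambda>t. nat_filtration MB B t \<Otimes>\<^sub>M MT) (\<lambda>t \<omega>. B t (fst \<omega>))"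
proof -
  interpret MB: prob_space MB using bm by (simp add: brownian_motion_def)
  interpret MT: prob_space MT by fact
  interpret P: pair_prob_space MB MT ..
  have Bm: "B r \<in> borel_measurable MB" if "0 \<le> r" "r \<le> 1" for r using bm that by (auto simp: brownian_motion_def)
  have subM: "sets (nat_filtration MB B t) \<subseteq> sets MB" if "t \<le> 1" for t
    using that by (intro sets_nat_filtration_subset Bm) auto
  have pair_mono: "sets (N1 \<Otimes>\<^sub>M MT) \<subseteq> sets (N2 \<Otimes>\<^sub>M MT)" if "sets N1 \<subseteq> sets N2" "space N1 = space N2"
    for N1 N2 :: "'a measure"
    unfolding sets_pair_measure using that by (auto intro!: sigma_sets_mono')
  show ?thesis
  proof
    fix t :: real assume t: "0 \<le> t" "t \<le> 1"
    show "subalgebra (MB \<Otimes>\<^sub>M MT) (nat_filtration MB B t \<Otimes>\<^sub>M MT)"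
      using pair_mono[OF subM[OF t(2)]] by (auto simp: subalgebra_def space_pair_measure)
    have "B t \<in> borel_measurable (nat_filtration MB B t)"
      using t by (intro measurableI) (auto simp: sets_nat_filtration intro!: sigma_sets.Basic)
    then show "(\<lambda>\<omega>. B t (fst \<omega>)) \<in> borel_measurable (nat_filtration MB B t \<Otimes>\<^sub>M MT)"
      by measurable
  next
    fix s t :: real assume st: "0 \<le> s" "s \<le> t" "t \<le> 1"
    have "{B r -` A \<inter> space MB |r A. r \<in> {0..s} \<and> A \<in> sets borel} \<subseteq> {B r -` A \<inter> space MB |r A. r \<in> {0..t} \<and> A \<in> sets borel}"
    proof
      fix X assume "X \<in> {B r -` A \<inter> space MB |r A. r \<in> {0..s} \<and> A \<in> sets borel}"
      then obtain r A where "X = B r -` A \<inter> space MB" "r \<in> {0..s}" "A \<in> sets borel" by blast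
      moreover have "r \<in> {0..t}" using \<open>r \<in> {0..s}\<close> st by auto
      ultimately show "X \<in> {B r -` A \<inter> space MB |r A. r \<in> {0..t} \<and> A \<in> sets borel}" by blast
    qed
    then show "sets (nat_filtration MB B s \<Otimes>\<^sub>M MT) \<subseteq> sets (nat_filtration MB B t \<Otimes>\<^sub>M MT)"
      by (intro pair_mono) (auto simp only: sets_nat_filtration space_nat_filtration intro!: sigma_sets_mono' Un_mono)
  next
    fix s t :: real and A and D :: "(real^'d) set"
    assume st: "0 \<le> s" "s < t" "t \<le> 1" and A: "A \<in> sets (nat_filtration MB B s \<Otimes>\<^sub>M MT)" and D: "D \<in> sets borel"
    have [measurable]: "B t \<in> borel_measurable MB" "B s \<in> borel_measurable MB" using Bm st by auto
    have AM: "A \<in> sets (MB \<Otimes>\<^sub>M MT)" using A pair_mono[OF subM[of s]] st by auto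
    let ?E = "{\<omega> \<in> space MB. B t \<omega> - B s \<omega> \<in> D}"
    have E: "?E \<in> sets MB" using D by measurable
    have "{\<omega> \<in> space (MB \<Otimes>\<^sub>M MT). B t (fst \<omega>) - B s (fst \<omega>) \<in> D} = ?E \<times> space MT"
      by (auto simp: space_pair_measure)
    then have E2: "{\<omega> \<in> space (MB \<Otimes>\<^sub>M MT). B t (fst \<omega>) - B s (fst \<omega>) \<in> D} \<in> sets (MB \<Otimes>\<^sub>M MT)"
      using E by simp
    have "emeasure (MB \<Otimes>\<^sub>M MT) (A \<inter> {\<omega> \<in> space (MB \<Otimes>\<^sub>M MT). B t (fst \<omega>) - B s (fst \<omega>) \<in> D})
       = (\<integral>\<^sup>+y. emeasure MB ((\<lambda>x. (x, y)) -` (A \<inter> {\<omega> \<in> space (MB \<Otimes>\<^sub>M MT). B t (fst \<omega>) - B s (fst \<omega>) \<in> D})) \<partial>MT)"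
      using AM E2 by (intro P.emeasure_pair_measure_alt2) auto
    also have "\<dots> = (\<integral>\<^sup>+y. emeasure MB ((\<lambda>x. (x, y)) -` A) * emeasure MB ?E \<partial>MT)"
    proof (rule nn_integral_cong)
      fix y assume y: "y \<in> space MT"
      have sec: "(\<lambda>x. (x, y)) -` A \<in> sets (nat_filtration MB B s)" using A by (rule sets_Pair2)
      have "(\<lambda>x. (x, y)) -` (A \<inter> {\<omega> \<in> space (MB \<Otimes>\<^sub>M MT). B t (fst \<omega>) - B s (fst \<omega>) \<in> D}) = ((\<lambda>x. (x, y)) -` A) \<inter> ?E"
        using y by (auto simp: space_pair_measure)
      then show "emeasure MB ((\<lambda>x. (x, y)) -` (A \<inter> {\<omega> \<in> space (MB \<Otimes>\<^sub>M MT). B t (fst \<omega>) - B s (fst \<omega>) \<in> D}))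
         = emeasure MB ((\<lambda>x. (x, y)) -` A) * emeasure MB ?E"
        using bm_past_independent[OF bm st sec D] by (simp add: MB.emeasure_eq_measure ennreal_mult)
    qed
    also have "\<dots> = (\<integral>\<^sup>+y. emeasure MB ((\<lambda>x. (x, y)) -` A) \<partial>MT) * emeasure MB ?E"
      using P.measurable_emeasure_Pair2[OF AM] by (intro nn_integral_multc) 
    also have "(\<integral>\<^sup>+y. emeasure MB ((\<lambda>x. (x, y)) -` A) \<partial>MT) = emeasure (MB \<Otimes>\<^sub>M MT) A"
      using AM by (rule P.emeasure_pair_measure_alt2[symmetric])
    also have "emeasure MB ?E = emeasure (distr MB borel (\<lambda>\<omega>. B t \<omega> - B s \<omega>)) D"
      using D by (subst emeasure_distr) (auto intro!: arg_cong[where f = "emeasure MB"])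
    finally show "emeasure (MB \<Otimes>\<^sub>M MT) (A \<inter> {\<omega> \<in> space (MB \<Otimes>\<^sub>M MT). B t (fst \<omega>) - B s (fst \<omega>) \<in> D})
       = emeasure (MB \<Otimes>\<^sub>M MT) A * emeasure (distr gauss borel (\<lambda>z. sqrt (t - s) *\<^sub>R z)) D"
      unfolding bm_increment_law[OF bm st] .
  qed
qed

section \<open>Randomised quadrature\<close>

text \<open>Composing \<open>f\<close> with \<open>clamp01\<close> in time gives a drift with global bounds; clamping \<open>\<tau>\<^sub>j\<close> removes
  the null set on which it leaves \<open>[0, 1]\<close>.\<close>

definition clamp01 :: "real \<Rightarrow> real" where "clamp01 u = max 0 (min 1 u)"

lemma clamp01_bounds: "0 \<le> clamp01 u" "clamp01 u \<le> 1"
  by (auto simp: clamp01_def)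

lemma clamp01_id: "0 \<le> u \<Longrightarrow> u \<le> 1 \<Longrightarrow> clamp01 u = u"
  by (simp add: clamp01_def)

lemma clamp01_dist: "\<bar>clamp01 u - clamp01 v\<bar> \<le> \<bar>u - v\<bar>"
  by (auto simp: clamp01_def)

lemma clamp01_measurable [measurable]: "clamp01 \<in> borel_measurable borel"
  unfolding clamp01_def[abs_def] by measurable

text \<open>The scheme along a fixed path \<open>b\<close> and fixed sampling points \<open>c\<close>: \<open>yg\<close> is its value at the \<open>j\<close>-th grid
  point, \<open>vg\<close> the drift it uses on the \<open>j\<close>-th cell, \<open>wt\<close> the time spent in that cell before \<open>t\<close>, and \<open>yc\<close>
  its continuous-time version.\<close>

primrec yg :: "(real \<Rightarrow> real^'d \<Rightarrow> real^'d) \<Rightarrow> real^'d \<Rightarrow> nat \<Rightarrow> (real \<Rightarrow> real^'d) \<Rightarrow> (nat \<Rightarrow> real) \<Rightarrow> nat \<Rightarrow> real^'d" where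
  "yg f x0 n b c 0 = x0 + b 0"
| "yg f x0 n b c (Suc j) = yg f x0 n b c j + (1 / real n) *\<^sub>R f ((real j + c (Suc j)) / real n) (yg f x0 n b c j)
     + (b (real (Suc j) / real n) - b (real j / real n))"

definition vg :: "(real \<Rightarrow> real^'d \<Rightarrow> real^'d) \<Rightarrow> real^'d \<Rightarrow> nat \<Rightarrow> (real \<Rightarrow> real^'d) \<Rightarrow> (nat \<Rightarrow> real) \<Rightarrow> nat \<Rightarrow> real^'d" where
  "vg f x0 n b c j = f ((real j + c (Suc j)) / real n) (yg f x0 n b c j)"

definition wt :: "nat \<Rightarrow> nat \<Rightarrow> real \<Rightarrow> real" where
  "wt n j t = min t (real (Suc j) / real n) - min t (real j / real n)"

definition yc :: "(real \<Rightarrow> real^'d \<Rightarrow> real^'d) \<Rightarrow> real^'d \<Rightarrow> nat \<Rightarrow> (real \<Rightarrow> real^'d) \<Rightarrow> (nat \<Rightarrow> real) \<Rightarrow> real \<Rightarrow> real^'d" where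
  "yc f x0 n b c t = x0 + (\<Sum>j<n. wt n j t *\<^sub>R vg f x0 n b c j) + b t"

lemma wt_cell:
  assumes "1 \<le> n" "real k / real n \<le> t" "t \<le> real (Suc k) / real n"
  shows "wt n j t = (if j < k then 1 / real n else if j = k then t - real k / real n else 0)"
proof -
  have d: "real (Suc j) / real n - real j / real n = 1 / real n" by (simp flip: diff_divide_distrib)
  have mono: "i \<le> l \<Longrightarrow> real i / real n \<le> real l / real n" for i l by (simp add: divide_right_mono)
  consider "j < k" | "j = k" | "k < j" by linarith
  then show ?thesis
  proof cases
    case 1
    then have "real (Suc j) / real n \<le> t" "real j / real n \<le> t" using mono[of "Suc j" k] mono[of j k] assms by auto
    then show ?thesis using 1 d by (simp add: wt_def min_def)
  next
    case 2
    then show ?thesis using assms by (simp add: wt_def min_def)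
  next
    case 3
    then have "t \<le> real (Suc j) / real n" "t \<le> real j / real n" using mono[of "Suc k" "Suc j"] mono[of "Suc k" j] assms by auto
    then show ?thesis using 3 by (simp add: wt_def min_def)
  qed
qed

lemma sum_wt_cell:
  fixes v :: "nat \<Rightarrow> real^'d"
  assumes "k < n" "real k / real n \<le> t" "t \<le> real (Suc k) / real n"
  shows "(\<Sum>j<n. wt n j t *\<^sub>R v j) = (\<Sum>j<k. (1 / real n) *\<^sub>R v j) + (t - real k / real n) *\<^sub>R v k"
proof -
  have n: "1 \<le> n" using assms by simp
  have "(\<Sum>j<n. wt n j t *\<^sub>R v j) = (\<Sum>j<Suc k. wt n j t *\<^sub>R v j)"
    using assms(1) wt_cell[OF n assms(2,3)] by (intro sum.mono_neutral_right) auto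
  also have "\<dots> = (\<Sum>j<k. (1 / real n) *\<^sub>R v j) + (t - real k / real n) *\<^sub>R v k"
    using wt_cell[OF n assms(2,3)] by simp
  finally show ?thesis .
qed

lemma yg_eq: "yg f x0 n b c k = x0 + (\<Sum>j<k. (1 / real n) *\<^sub>R vg f x0 n b c j) + b (real k / real n)"
  by (induction k) (auto simp: vg_def)

lemma yc_cell:
  assumes "k < n" "real k / real n \<le> t" "t \<le> real (Suc k) / real n"
  shows "yc f x0 n b c t = yg f x0 n b c k + (t - real k / real n) *\<^sub>R vg f x0 n b c k + (b t - b (real k / real n))"
  unfolding yc_def sum_wt_cell[OF assms] yg_eq by simp

lemma yc_grid:
  assumes "1 \<le> n" "k \<le> n"
  shows "yc f x0 n b c (real k / real n) = yg f x0 n b c k"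
proof (cases "k = n")
  case True
  obtain l where l: "n = Suc l" using assms by (cases n) auto
  have "yc f x0 n b c (real (Suc l) / real n) = yg f x0 n b c l + (real (Suc l) / real n - real l / real n) *\<^sub>R vg f x0 n b c l
     + (b (real (Suc l) / real n) - b (real l / real n))"
    using l by (intro yc_cell) (auto simp: divide_right_mono)
  moreover have "real (Suc l) / real n - real l / real n = 1 / real n" by (simp flip: diff_divide_distrib)
  ultimately show ?thesis using True l by (simp add: vg_def)
next
  case False
  then show ?thesis using assms yc_cell[of k n "real k / real n"] by (simp add: divide_right_mono)
qed

lemma wt_mono: "s \<le> u \<Longrightarrow> wt n j s \<le> wt n j u"
  using divide_right_mono[of "real j" "real (Suc j)" "real n"] unfolding wt_def by (auto simp: min_def)

lemma sum_wt:
  assumes "1 \<le> n" "0 \<le> t" "t \<le> 1"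
  shows "(\<Sum>j<n. wt n j t) = t"
  unfolding wt_def using sum_lessThan_telescope[of "\<lambda>j. min t (real j / real n)" n] assms by (simp add: min_def)

text \<open>The times spent in the cells are nondecreasing in t and add up to t, so over [s, u] the
  drifts are averaged with nonnegative weights of total mass u - s.\<close>

lemma yc_drift_lipschitz:
  assumes "1 \<le> n" "\<And>t x. norm (f t x) \<le> K" "0 \<le> s" "s \<le> u" "u \<le> 1"
  shows "norm (yc f x0 n b c u - yc f x0 n b c s - (b u - b s)) \<le> K * (u - s)"
proof -
  have "yc f x0 n b c u - yc f x0 n b c s - (b u - b s) = (\<Sum>j<n. (wt n j u - wt n j s) *\<^sub>R vg f x0 n b c j)"
    by (simp add: yc_def scaleR_diff_left sum_subtractf)
  also have "norm \<dots> \<le> (\<Sum>j<n. (wt n j u - wt n j s) * K)"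
  proof (rule sum_norm_le)
    fix j
    show "norm ((wt n j u - wt n j s) *\<^sub>R vg f x0 n b c j) \<le> (wt n j u - wt n j s) * K"
      using wt_mono[OF assms(4), of n j] assms(2) by (auto simp: vg_def intro!: mult_left_mono)
  qed
  also have "\<dots> = ((\<Sum>j<n. wt n j u) - (\<Sum>j<n. wt n j s)) * K"
    by (simp add: sum_distrib_right[symmetric] sum_subtractf)
  also have "\<dots> = K * (u - s)" using assms by (simp add: sum_wt)
  finally show ?thesis .
qed

lemma yc_continuous: "continuous_on A b \<Longrightarrow> continuous_on A (yc f x0 n b c)"
  unfolding yc_def wt_def by (intro continuous_intros)

section \<open>Unbiased quadrature over the cells\<close>

lemma reg_drift_measurable:
  fixes f :: "real \<Rightarrow> real^'d \<Rightarrow> real^'d"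
  assumes f: "reg_drift K \<alpha> \<beta> f" and ab: "0 < \<alpha>" "0 < \<beta>"
  shows "(\<lambda>p. f (fst p) (snd p)) \<in> borel_measurable (borel \<Otimes>\<^sub>M borel)"
proof -
  have "continuous_on UNIV (\<lambda>p. f (fst p) (snd p))"
    unfolding continuous_on_def
  proof
    fix p :: "real \<times> (real^'d)"
    show "((\<lambda>q. f (fst q) (snd q)) \<longlongrightarrow> f (fst p) (snd p)) (at p)"
    proof (rule LIM_zero_cancel, rule Lim_null_comparison)
      show "\<forall>\<^sub>F q in at p. norm (f (fst q) (snd q) - f (fst p) (snd p)) \<le> K * \<bar>fst q - fst p\<bar> powr \<alpha> + K * norm (snd q - snd p) powr \<beta>"
      proof (rule always_eventually, rule allI)
        fix q
        have "norm (f (fst p) (snd q) - f (fst p) (snd p)) \<le> K * norm (snd q - snd p) powr \<beta>"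
          "norm (f (fst q) (snd q) - f (fst p) (snd q)) \<le> K * \<bar>fst q - fst p\<bar> powr \<alpha>"
          using f by (auto simp: reg_drift_def)
        then show "norm (f (fst q) (snd q) - f (fst p) (snd p)) \<le> K * \<bar>fst q - fst p\<bar> powr \<alpha> + K * norm (snd q - snd p) powr \<beta>"
          using norm_triangle_ineq[of "f (fst q) (snd q) - f (fst p) (snd q)" "f (fst p) (snd q) - f (fst p) (snd p)"] by simp
      qed
      have "((\<lambda>q. K * \<bar>fst q - fst p\<bar> powr \<alpha> + K * norm (snd q - snd p) powr \<beta>) \<longlongrightarrow> K * \<bar>fst p - fst p\<bar> powr \<alpha> + K * norm (snd p - snd p) powr \<beta>) (at p)"
        using ab by (intro tendsto_intros tendsto_powr') auto
      then show "((\<lambda>q. K * \<bar>fst q - fst p\<bar> powr \<alpha> + K * norm (snd q - snd p) powr \<beta>) \<longlongrightarrow> 0) (at p)" by simp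
    qed
  qed
  then have "(\<lambda>p. f (fst p) (snd p)) \<in> borel_measurable borel"
    by (rule borel_measurable_continuous_onI)
  then show ?thesis by (simp add: borel_prod)
qed

text \<open>Not divided by the cell length: it is the integral over the cell, and the average is n
  times it.\<close>

definition cell_mean :: "(real \<Rightarrow> real^'d \<Rightarrow> real^'d) \<Rightarrow> nat \<Rightarrow> 'd \<Rightarrow> nat \<Rightarrow> real^'d \<Rightarrow> real" where
  "cell_mean f n i j y = integral {real j / real n..real (Suc j) / real n} (\<lambda>r. f r y $ i)"

lemma reg_drift_time_continuous:
  assumes "reg_drift K \<alpha> \<beta> f" "0 < \<alpha>" "0 < \<beta>"
  shows "continuous_on A (\<lambda>r. f r y $ i)"
  by (intro continuous_on_component reg_drift_continuous[OF assms] continuous_on_const)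

lemma cell_mean_measurable:
  fixes f :: "real \<Rightarrow> real^'d \<Rightarrow> real^'d"
  assumes f: "reg_drift K \<alpha> \<beta> f" and ab: "0 < \<alpha>" "0 < \<beta>" and n: "1 \<le> n"
  shows "cell_mean f n i j \<in> borel_measurable borel"
proof -
  let ?I = "{real j / real n..real (Suc j) / real n}"
  have le: "real j / real n \<le> real (Suc j) / real n" by (simp add: divide_right_mono)
  have d: "real (Suc j) / real n - real j / real n = 1 / real n" by (simp flip: diff_divide_distrib)
  have K0: "0 \<le> K" using reg_drift_nonneg[OF f] .
  have lip: "\<bar>cell_mean f n i j y - cell_mean f n i j y'\<bar> \<le> K * norm (y - y') powr \<beta> * (1 / real n)" for y y'
  proof -
    have "cell_mean f n i j y - cell_mean f n i j y' = integral ?I (\<lambda>r. f r y $ i - f r y' $ i)"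
      unfolding cell_mean_def
      by (intro Henstock_Kurzweil_Integration.integral_diff[symmetric] integrable_continuous_real reg_drift_time_continuous[OF f ab])
    also have "norm \<dots> \<le> K * norm (y - y') powr \<beta> * (real (Suc j) / real n - real j / real n)"
    proof (rule integral_bound[OF le])
      show "continuous_on ?I (\<lambda>r. f r y $ i - f r y' $ i)"
        by (intro continuous_on_diff reg_drift_time_continuous[OF f ab])
      show "norm (f r y $ i - f r y' $ i) \<le> K * norm (y - y') powr \<beta>" for r
        using reg_drift_component(1)[OF f, of r i] by (auto simp: holder_def)
    qed
    finally show ?thesis unfolding d by simp
  qed
  have "continuous_on UNIV (cell_mean f n i j)"
    unfolding continuous_on_def
  proof
    fix y :: "real^'d"
    show "(cell_mean f n i j \<longlongrightarrow> cell_mean f n i j y) (at y)"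
    proof (rule LIM_zero_cancel, rule Lim_null_comparison)
      show "\<forall>\<^sub>F z in at y. norm (cell_mean f n i j z - cell_mean f n i j y) \<le> K * norm (z - y) powr \<beta> * (1 / real n)"
        using lip by (intro always_eventually) auto
      have "((\<lambda>z. K * norm (z - y) powr \<beta> * (1 / real n)) \<longlongrightarrow> K * norm (y - y) powr \<beta> * (1 / real n)) (at y)"
        using ab n by (intro tendsto_intros tendsto_powr') auto
      then show "((\<lambda>z. K * norm (z - y) powr \<beta> * (1 / real n)) \<longlongrightarrow> 0) (at y)" by simp
    qed
  qed
  then show ?thesis by (rule borel_measurable_continuous_onI)
qed

text \<open>Unbiasedness, the reason for randomising: the affine map sends [0, 1] onto the cell, so
  a uniform sampling point reproduces the integral in the mean. Clamping does nothing on the support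
  of the uniform law.\<close>

lemma uniform_cell_mean:
  fixes f :: "real \<Rightarrow> real^'d \<Rightarrow> real^'d" and u :: "'b \<Rightarrow> real"
  assumes f: "reg_drift K \<alpha> \<beta> f" and ab: "0 < \<alpha>" "0 < \<beta>" and n: "1 \<le> n"
    and u: "distributed MT lborel u (indicator {0..1})"
  shows "(\<integral>w. f ((real j + clamp01 (u w)) / real n) y $ i \<partial>MT) = real n * cell_mean f n i j y"
proof -
  let ?a = "real j / real n" and ?b = "real (Suc j) / real n"
  define \<psi> where "\<psi> r = f r y $ i" for r
  have c: "continuous_on A \<psi>" for A unfolding \<psi>_def by (rule reg_drift_time_continuous[OF f ab])
  have [measurable]: "\<psi> \<in> borel_measurable borel" using c by (rule borel_measurable_continuous_onI)
  have u': "distributed MT lborel u (\<lambda>x. ennreal (indicator {0..1} x))"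
    using u by (simp add: ennreal_indicator)
  have "(\<integral>w. \<psi> ((real j + clamp01 (u w)) / real n) \<partial>MT) = (\<integral>x. indicator {0..1} x * \<psi> ((real j + clamp01 x) / real n) \<partial>lborel)"
    by (rule distributed_integral[OF u', symmetric]) auto
  also have "\<dots> = (\<integral>x. indicator {?a..?b} (?a + 1 / real n * x) * \<psi> (?a + 1 / real n * x) \<partial>lborel)"
  proof (rule Bochner_Integration.integral_cong)
    fix x :: real
    have "indicator {?a..?b} (?a + 1 / real n * x) = (indicator {0..1} x :: real)"
      using n by (auto simp: indicator_def field_simps)
    then show "indicator {0..1} x * \<psi> ((real j + clamp01 x) / real n) = indicator {?a..?b} (?a + 1 / real n * x) * \<psi> (?a + 1 / real n * x)"
      by (auto simp: indicator_def clamp01_id add_divide_distrib)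
  qed simp
  also have "\<dots> = real n * (\<integral>r. indicator {?a..?b} r * \<psi> r \<partial>lborel)"
    using lborel_integral_real_affine[of "1 / real n" "\<lambda>r. indicator {?a..?b} r * \<psi> r" ?a] n by simp
  also have "(\<integral>r. indicator {?a..?b} r * \<psi> r \<partial>lborel) = integral {?a..?b} \<psi>"
    using set_borel_integral_eq_integral(2)[of "{?a..?b}" \<psi>] borel_integrable_atLeastAtMost'[OF c]
    by (simp add: set_lebesgue_integral_def)
  finally show ?thesis unfolding cell_mean_def \<psi>_def[abs_def] .
qed

text \<open>Any sampling point lies in the cell itself, within 1/n of every other point; this gives
  n^(-\<alpha>) for the integrand and one more 1/n for the length.\<close>

lemma cell_error_bound:
  fixes f :: "real \<Rightarrow> real^'d \<Rightarrow> real^'d"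
  assumes f: "reg_drift K \<alpha> \<beta> f" and ab: "0 < \<alpha>" "0 < \<beta>" and n: "1 \<le> n" and c: "0 \<le> c" "c \<le> 1"
  shows "\<bar>cell_mean f n i j y - f ((real j + c) / real n) y $ i / real n\<bar> \<le> K * (1 / real n) powr \<alpha> * (1 / real n)"
proof -
  let ?a = "real j / real n" and ?b = "real (Suc j) / real n"
  have le: "?a \<le> ?b" by (simp add: divide_right_mono)
  have d: "?b - ?a = 1 / real n" by (simp flip: diff_divide_distrib)
  have K0: "0 \<le> K" using reg_drift_nonneg[OF f] .
  let ?s = "(real j + c) / real n"
  have "cell_mean f n i j y - f ?s y $ i / real n = integral {?a..?b} (\<lambda>r. f r y $ i) - integral {?a..?b} (\<lambda>r. f ?s y $ i)"
    using le d by (simp add: cell_mean_def)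
  also have "\<dots> = integral {?a..?b} (\<lambda>r. f r y $ i - f ?s y $ i)"
    by (intro Henstock_Kurzweil_Integration.integral_diff[symmetric] integrable_continuous_real reg_drift_time_continuous[OF f ab] continuous_on_const)
  also have "norm \<dots> \<le> K * (1 / real n) powr \<alpha> * (?b - ?a)"
  proof (rule integral_bound[OF le])
    show "continuous_on {?a..?b} (\<lambda>r. f r y $ i - f ?s y $ i)"
      by (intro continuous_on_diff reg_drift_time_continuous[OF f ab] continuous_on_const)
    fix r assume r: "r \<in> {?a..?b}"
    have s: "?s \<in> {?a..?b}" using c n by (auto simp: divide_right_mono)
    have "norm (f r y $ i - f ?s y $ i) \<le> K * \<bar>r - ?s\<bar> powr \<alpha>"
      using reg_drift_component(2)[OF f] by simp
    also have "\<bar>r - ?s\<bar> \<le> ?b - ?a" using r s by (auto simp: abs_le_iff)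
    then have "K * \<bar>r - ?s\<bar> powr \<alpha> \<le> K * (1 / real n) powr \<alpha>"
      unfolding d using K0 ab by (intro mult_left_mono powr_mono2) auto
    finally show "norm (f r y $ i - f ?s y $ i) \<le> K * (1 / real n) powr \<alpha>" .
  qed
  finally show ?thesis unfolding d by simp
qed

text \<open>For a fixed path the grid value at j depends on the first j sampling points only, and
  the next one is independent of them, so the cell errors are bounded martingale differences. P of
  them, each of size n^(-1-\<alpha>), sum to n^(-1/2-\<alpha>) sqrt(P/n).\<close>

lemma quadrature_bound:
  fixes f :: "real \<Rightarrow> real^'d \<Rightarrow> real^'d" and tau :: "nat \<Rightarrow> 'b \<Rightarrow> real"
    and bp :: "real \<Rightarrow> real^'d" and x0 :: "real^'d" and i :: 'd
  assumes PT: "prob_space MT" and ind: "prob_space.indep_vars MT (\<lambda>_. borel) tau {1..}"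
    and unif: "\<And>j. j \<ge> 1 \<Longrightarrow> distributed MT lborel (tau j) (indicator {0..1})"
    and f: "reg_drift K \<alpha> \<beta> f" and K: "0 < K" and ab: "0 < \<alpha>" "0 < \<beta>" and \<theta>: "\<theta> \<le> 1 / 2 + \<alpha>"
    and m: "1 \<le> m" and n: "1 \<le> n" and pq: "p < q" "q \<le> n"
  defines "Z \<equiv> \<lambda>j w. cell_mean f n i j (yg f x0 n bp (\<lambda>j. clamp01 (tau j w)) j) - vg f x0 n bp (\<lambda>j. clamp01 (tau j w)) j $ i / real n"
  shows "Lq_le MT (2 * m) (sqrt (3 * 4 ^ m) * K * (1 / real n) powr \<theta> * sqrt (real (q - p) / real n)) (\<lambda>w. \<Sum>j\<in>{p..<q}. Z j w)"
proof -
  interpret prob_space MT by fact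
  have taum: "tau j \<in> borel_measurable MT" if "1 \<le> j" for j
    using unif[OF that] by (auto simp: distributed_def)
  define path where "path j w = restrict (\<lambda>l. tau l w) {1..j}" for j w
  have pathm: "path j \<in> measurable MT (PiM {1..j} (\<lambda>_. borel))" for j
    unfolding path_def[abs_def] using taum by (intro measurable_restrict) auto
  \<comment> \<open>The filtration of the sampling points as a pullback along the vector of the
    first j of them; every event is then a preimage, to which independence of disjoint blocks
    applies.\<close>
  define H where "H j = vimage_algebra (space MT) (path j) (PiM {1..j} (\<lambda>_. borel))" for j
  have spH: "space (H j) = space MT" for j by (simp add: H_def)
  have subH: "subalgebra MT (H j)" for j
    unfolding subalgebra_def
  proof (intro conjI)
    show "sets (H j) \<subseteq> sets MT" unfolding H_def by (rule sets_image_in_sets[OF refl pathm])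
  qed (rule spH)
  have pathH: "path j \<in> measurable (H j) (PiM {1..j} (\<lambda>_. borel))" for j
    unfolding H_def using measurable_space[OF pathm] by (intro measurable_vimage_algebra1) blast
  have tauH: "tau l \<in> borel_measurable (H j)" if "1 \<le> l" "l \<le> j" for l j
  proof -
    have "(\<lambda>w. path j w l) \<in> borel_measurable (H j)"
      using measurable_component_singleton[of l "{1..j}" "\<lambda>_. borel"] that
      by (intro measurable_compose[OF pathH]) auto
    moreover have "(\<lambda>w. path j w l) = tau l" using that by (auto simp: path_def)
    ultimately show ?thesis by simp
  qed
  have monoH: "sets (H i) \<subseteq> sets (H j)" if "i \<le> j" for i j
    unfolding H_def[of i]
  proof (rule sets_image_in_sets)
    show "path i \<in> measurable (H j) (PiM {1..i} (\<lambda>_. borel))"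
      unfolding path_def[abs_def] using that tauH by (intro measurable_restrict) auto
  qed (simp add: spH)
  define y where "y j w = yg f x0 n bp (\<lambda>j. clamp01 (tau j w)) j" for j w
  note [measurable] = reg_drift_measurable[OF f ab]
  have fm: "(\<lambda>w. f ((real j + clamp01 (s w)) / real n) (x w)) \<in> borel_measurable N"
    if "s \<in> borel_measurable N" "x \<in> borel_measurable N" for s :: "'b \<Rightarrow> real" and x :: "'b \<Rightarrow> real^'d" and N j
  proof -
    note [measurable] = that
    have "(\<lambda>w. (\<lambda>p. f (fst p) (snd p)) ((real j + clamp01 (s w)) / real n, x w)) \<in> borel_measurable N"
      by (rule measurable_compose[OF _ reg_drift_measurable[OF f ab]]) measurable
    then show ?thesis by simp
  qed
  have yH: "y j \<in> borel_measurable (H j)" for j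
  proof (induction j)
    case 0
    then show ?case by (simp add: y_def[abs_def])
  next
    case (Suc j)
    have yS: "y j \<in> borel_measurable (H (Suc j))"
      using monoH[of j "Suc j"] Suc spH by (intro measurable_from_subalg[OF _ Suc]) (auto simp: subalgebra_def)
    note [measurable] = yS fm[OF tauH[of "Suc j" "Suc j"] yS, of j]
    have "y (Suc j) = (\<lambda>w. y j w + (1 / real n) *\<^sub>R f ((real j + clamp01 (tau (Suc j) w)) / real n) (y j w)
       + (bp (real (Suc j) / real n) - bp (real j / real n)))"
      by (auto simp: y_def fun_eq_iff)
    moreover have "\<dots> \<in> borel_measurable (H (Suc j))"
      by (intro borel_measurable_add borel_measurable_scaleR borel_measurable_const yS fm tauH) auto
    ultimately show ?case by simp
  qed
  have Zeq: "Z j w = cell_mean f n i j (y j w) - f ((real j + clamp01 (tau (Suc j) w)) / real n) (y j w) $ i / real n" for j w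
    by (simp add: Z_def y_def vg_def)
  note [measurable] = cell_mean_measurable[OF f ab n]
  have ZH: "Z j \<in> borel_measurable (H (Suc j))" for j
  proof -
    have yS: "y j \<in> borel_measurable (H (Suc j))"
      using monoH[of j "Suc j"] yH[of j] spH by (intro measurable_from_subalg[OF _ yH[of j]]) (auto simp: subalgebra_def)
    have "(\<lambda>w. cell_mean f n i j (y j w)) \<in> borel_measurable (H (Suc j))"
      by (rule measurable_compose[OF yS cell_mean_measurable[OF f ab n]])
    moreover have "(\<lambda>w. f ((real j + clamp01 (tau (Suc j) w)) / real n) (y j w)) \<in> borel_measurable (H (Suc j))"
      by (intro fm yS tauH) auto
    ultimately show ?thesis unfolding Zeq[abs_def] by measurable
  qed
  define z where "z = K * (1 / real n) powr \<alpha> * (1 / real n)"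
  have z0: "0 < z" using K n by (simp add: z_def)
  have Zb: "\<bar>Z j w\<bar> \<le> z" for j w
    unfolding Zeq z_def by (rule cell_error_bound[OF f ab n clamp01_bounds])
  define P where "P = q - p"
  have "Lq_le MT (2 * m) (sqrt (3 * 4 ^ m) * sqrt (real P) * z) (\<lambda>w. \<Sum>l<P. Z (p + l) w)"
  proof (rule Lq_le_martingale_sum[where F = "\<lambda>l. H (p + l)" and A = z])
    fix l assume "l < P"
    show "Z (p + l) \<in> borel_measurable (H (p + Suc l))" using ZH[of "p + l"] by simp
    show "Lq_le MT (2 * m) z (Z (p + l))"
      using Zb z0 measurable_from_subalg[OF subH ZH] by (intro Lq_le_bounded) auto
  next
    fix l :: nat and S :: "'b \<Rightarrow> real" and Ab :: real
    assume l: "l < P" and S: "S \<in> borel_measurable (H (p + l))" "\<And>w. w \<in> space MT \<Longrightarrow> \<bar>S w\<bar> \<le> Ab"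
    define j where "j = p + l"
    define h where "h = (\<lambda>x. cell_mean f n i j (fst x) - f ((real j + clamp01 (snd x)) / real n) (fst x) $ i / real n)"
    have hm: "h \<in> borel_measurable (borel \<Otimes>\<^sub>M borel)"
    proof -
      have "(\<lambda>x. (\<lambda>p. f (fst p) (snd p)) ((real j + clamp01 (snd x)) / real n, fst x)) \<in> borel_measurable (borel \<Otimes>\<^sub>M borel)"
        by (rule measurable_compose[OF _ reg_drift_measurable[OF f ab]]) measurable
      then have [measurable]: "(\<lambda>x. f ((real j + clamp01 (snd x)) / real n) (fst x)) \<in> borel_measurable (borel \<Otimes>\<^sub>M borel)"
        by simp
      show ?thesis unfolding h_def by measurable
    qed
    have hb: "\<bar>h x\<bar> \<le> z" for x
      unfolding h_def z_def by (rule cell_error_bound[OF f ab n clamp01_bounds])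
    have tm [measurable]: "tau (Suc j) \<in> borel_measurable MT" using taum by simp
    have indj: "emeasure MT (A \<inter> {w \<in> space MT. tau (Suc j) w \<in> D}) = emeasure MT A * emeasure (distr MT borel (tau (Suc j))) D"
      if A: "A \<in> sets (H j)" and D: "D \<in> sets borel" for A D
    proof -
      have "sets (H j) = {path j -` C \<inter> space MT | C. C \<in> sets (PiM {1..j} (\<lambda>_. borel))}"
        unfolding H_def using measurable_space[OF pathm] by (intro sets_vimage_algebra2) blast
      then obtain C where C: "A = path j -` C \<inter> space MT" "C \<in> sets (PiM {1..j} (\<lambda>_. borel))" using A by auto
      have iv: "indep_var (PiM {1..j} (\<lambda>_. borel)) (\<lambda>w. restrict (\<lambda>l. tau l w) {1..j}) (PiM {Suc j} (\<lambda>_. borel)) (\<lambda>w. restrict (\<lambda>l. tau l w) {Suc j})"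
        by (rule indep_var_restrict[OF ind]) auto
      define D' where "D' = (\<lambda>x. x (Suc j)) -` D \<inter> space (PiM {Suc j} (\<lambda>_. borel :: real measure))"
      have D': "D' \<in> sets (PiM {Suc j} (\<lambda>_. borel))"
      proof -
        have "(\<lambda>x. x (Suc j)) \<in> measurable (PiM {Suc j} (\<lambda>_. borel :: real measure)) borel"
          by (rule measurable_component_singleton) simp
        then show ?thesis unfolding D'_def using D by (rule measurable_sets)
      qed
      have E: "(\<lambda>w. restrict (\<lambda>l. tau l w) {Suc j}) -` D' \<inter> space MT = {w \<in> space MT. tau (Suc j) w \<in> D}"
      proof -
        have "restrict (\<lambda>l. tau l w) {Suc j} \<in> space (PiM {Suc j} (\<lambda>_. borel))" for w
          by (simp add: space_PiM)
        then show ?thesis unfolding D'_def by auto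
      qed
      have "prob ((\<lambda>w. (restrict (\<lambda>l. tau l w) {1..j}, restrict (\<lambda>l. tau l w) {Suc j})) -` (C \<times> D') \<inter> space MT)
         = prob (path j -` C \<inter> space MT) * prob {w \<in> space MT. tau (Suc j) w \<in> D}"
        using indep_varD[OF iv C(2) D'] unfolding E by (simp add: path_def[abs_def])
      moreover have "(\<lambda>w. (restrict (\<lambda>l. tau l w) {1..j}, restrict (\<lambda>l. tau l w) {Suc j})) -` (C \<times> D') \<inter> space MT
          = A \<inter> {w \<in> space MT. tau (Suc j) w \<in> D}"
        unfolding C(1) E[symmetric] path_def by auto
      moreover have "emeasure (distr MT borel (tau (Suc j))) D = emeasure MT {w \<in> space MT. tau (Suc j) w \<in> D}"
        using D by (subst emeasure_distr) (auto intro!: arg_cong[where f = "emeasure MT"])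
      ultimately show ?thesis using C(1) by (simp add: emeasure_eq_measure ennreal_mult)
    qed
    have "expectation (\<lambda>w. S w * h (y j w, tau (Suc j) w)) = expectation (\<lambda>w. S w * (\<integral>u. h (y j w, u) \<partial>distr MT borel (tau (Suc j))))"
      using S unfolding j_def[symmetric] by (intro expectation_independent(2)[OF subH tm indj _ _ yH hm hb]) auto
    also have "(\<lambda>w. S w * (\<integral>u. h (y j w, u) \<partial>distr MT borel (tau (Suc j)))) = (\<lambda>w. 0)"
    proof
      fix w
      have f1: "(\<lambda>w'. f ((real j + clamp01 (tau (Suc j) w')) / real n) (y j w) $ i) \<in> borel_measurable MT"
        using fm[OF tm, of "\<lambda>_. y j w" j] by measurable
      have int: "integrable MT (\<lambda>w'. f ((real j + clamp01 (tau (Suc j) w')) / real n) (y j w) $ i)"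
        by (rule integrable_const_bound[where B = K, OF _ f1])
           (use reg_drift_component(1)[OF f] in \<open>auto simp: holder_def\<close>)
      have "(\<integral>u. h (y j w, u) \<partial>distr MT borel (tau (Suc j))) = expectation (\<lambda>w'. h (y j w, tau (Suc j) w'))"
        using hm by (subst integral_distr) auto
      also have "\<dots> = expectation (\<lambda>w'. cell_mean f n i j (y j w) - f ((real j + clamp01 (tau (Suc j) w')) / real n) (y j w) $ i / real n)"
        by (simp add: h_def)
      also have "\<dots> = cell_mean f n i j (y j w) - expectation (\<lambda>w'. f ((real j + clamp01 (tau (Suc j) w')) / real n) (y j w) $ i) / real n"
        using int by (simp add: prob_space)
      also have "\<dots> = 0"
        using uniform_cell_mean[OF f ab n unif[of "Suc j"], of j "y j w" i] n by simp
      finally show "S w * (\<integral>u. h (y j w, u) \<partial>distr MT borel (tau (Suc j))) = 0" by simp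
    qed
    finally show "expectation (\<lambda>w. S w * Z (p + l) w) = 0"
      by (simp add: Zeq h_def j_def)
  qed (use m z0 subH monoH Zb in auto)
  moreover have "(\<Sum>l<P. Z (p + l) w) = (\<Sum>j\<in>{p..<q}. Z j w)" for w
    by (rule sum.reindex_bij_witness[of _ "\<lambda>j. j - p" "\<lambda>l. p + l"]) (auto simp: P_def)
  ultimately have "Lq_le MT (2 * m) (sqrt (3 * 4 ^ m) * sqrt (real P) * z) (\<lambda>w. \<Sum>j\<in>{p..<q}. Z j w)" by simp
  then show ?thesis
  proof (rule Lq_le_weaken)
    have n1: "0 < 1 / real n" "1 / real n \<le> 1" using n by auto
    have "z = K * ((1 / real n) powr \<alpha> * (1 / real n) powr 1)" using n by (simp add: z_def)
    also have "(1 / real n) powr \<alpha> * (1 / real n) powr 1 = (1 / real n) powr ((1 / 2 + \<alpha>) + 1 / 2)"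
      unfolding powr_add[symmetric] by (rule arg_cong[where f = "\<lambda>e. (1 / real n) powr e"]) simp
    also have "\<dots> = (1 / real n) powr (1 / 2 + \<alpha>) * sqrt (1 / real n)"
      using n1 by (simp only: powr_add[of _ "1 / 2 + \<alpha>"] powr_half_sqrt)
    also have "K * \<dots> \<le> K * ((1 / real n) powr \<theta> * sqrt (1 / real n))"
      using K \<theta> n1 by (intro mult_left_mono mult_right_mono powr_mono2_le_one) auto
    finally have "sqrt (3 * 4 ^ m) * sqrt (real P) * z \<le> sqrt (3 * 4 ^ m) * sqrt (real P) * (K * ((1 / real n) powr \<theta> * sqrt (1 / real n)))"
      by (intro mult_left_mono) auto
    also have "\<dots> = sqrt (3 * 4 ^ m) * K * (1 / real n) powr \<theta> * (sqrt (real P) * sqrt (1 / real n))"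
      by (simp add: mult_ac)
    also have "sqrt (real P) * sqrt (1 / real n) = sqrt (real (q - p) / real n)"
      by (simp add: P_def real_sqrt_divide)
    finally show "sqrt (3 * 4 ^ m) * sqrt (real P) * z \<le> sqrt (3 * 4 ^ m) * K * (1 / real n) powr \<theta> * sqrt (real (q - p) / real n)" .
  qed
qed

section \<open>The randomised Euler--Maruyama scheme\<close>

text \<open>On a cell the integrand is a constant determined by the value at the left grid point, so
  the integral equation fixes the process cell by cell; grid value and integral up to the grid point
  are carried jointly by induction.\<close>

lemma scheme_eq_yc:
  fixes f :: "real \<Rightarrow> real^'d \<Rightarrow> real^'d" and xn b :: "real \<Rightarrow> real^'d" and c :: "nat \<Rightarrow> real"
  assumes n: "1 \<le> n" and c: "\<And>j. 1 \<le> j \<Longrightarrow> 0 \<le> c j \<and> c j \<le> 1"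
    and xn: "\<And>t. 0 \<le> t \<Longrightarrow> t \<le> 1 \<Longrightarrow> xn t = x0 + integral {0..t}
        (\<lambda>s. f ((real_of_int \<lfloor>real n * s\<rfloor> + c (nat \<lfloor>real n * s\<rfloor> + 1)) / real n) (xn (kappa n s))) + b t"
    and t: "0 \<le> t" "t \<le> 1"
  shows "xn t = yc (\<lambda>s. f (clamp01 s)) x0 n b c t"
proof -
  define f' where "f' s = f (clamp01 s)" for s
  define h where "h s = f ((real_of_int \<lfloor>real n * s\<rfloor> + c (nat \<lfloor>real n * s\<rfloor> + 1)) / real n) (xn (kappa n s))" for s
  define v where "v k = vg f' x0 n b c k" for k
  have n0: "0 < real n" using n by simp
  have kS: "real k / real n \<le> real (Suc k) / real n" for k by (simp add: divide_right_mono)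
  have d: "real (Suc k) / real n - real k / real n = 1 / real n" for k by (simp flip: diff_divide_distrib)
  have cell: "(h has_integral (u - real k / real n) *\<^sub>R v k) {real k / real n..u}"
    if k: "k < n" "xn (real k / real n) = yg f' x0 n b c k" and u: "real k / real n \<le> u" "u \<le> real (Suc k) / real n" for k u
  proof -
    have "((\<lambda>s. v k) has_integral (u - real k / real n) *\<^sub>R v k) {real k / real n..u}"
      using has_integral_const_real[of "v k" "real k / real n" u] u by simp
    then show ?thesis
    \<comment> \<open>The right end point is excluded: there the floor may already jump to the next
      cell.\<close>
    proof (rule has_integral_spike_finite[of "{u}", rotated 2])
      fix s assume s: "s \<in> {real k / real n..u} - {u}"
      then have "real k / real n \<le> s" "s < (real k + 1) / real n" using u by (auto simp: add.commute)
      then have "real k \<le> real n * s" "real n * s < real k + 1"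
        using n0 by (simp_all only: pos_divide_le_eq pos_less_divide_eq mult.commute)
      then have fl: "\<lfloor>real n * s\<rfloor> = int k" by (intro floor_unique) auto
      have ck: "0 \<le> c (Suc k)" "c (Suc k) \<le> 1" using c[of "Suc k"] by auto
      then have "0 \<le> (real k + c (Suc k)) / real n" "(real k + c (Suc k)) / real n \<le> 1"
        using k n0 by (auto simp: divide_le_eq)
      then have "f ((real k + c (Suc k)) / real n) = f' ((real k + c (Suc k)) / real n)"
        by (simp add: f'_def clamp01_id)
      then show "h s = v k"
        unfolding h_def fl v_def vg_def using k(2) by (simp add: kappa_def fl)
    qed simp
  qed
  have xn': "xn u = x0 + integral {0..u} h + b u" if "0 \<le> u" "u \<le> 1" for u
    using xn[OF that] by (simp add: h_def[abs_def])
  have step: "(h has_integral (\<Sum>j<k. (1 / real n) *\<^sub>R v j) + (u - real k / real n) *\<^sub>R v k) {0..u} \<and> xn u = yc f' x0 n b c u"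
    if k: "k < n" "xn (real k / real n) = yg f' x0 n b c k" "(h has_integral (\<Sum>j<k. (1 / real n) *\<^sub>R v j)) {0..real k / real n}"
      and u: "real k / real n \<le> u" "u \<le> real (Suc k) / real n" for k u
  proof -
    have hi: "(h has_integral (\<Sum>j<k. (1 / real n) *\<^sub>R v j) + (u - real k / real n) *\<^sub>R v k) {0..u}"
      using u by (intro has_integral_combine[OF _ _ k(3) cell[OF k(1,2) u]]) auto
    have "real (Suc k) / real n \<le> 1" using k n0 by simp
    then have "0 \<le> u" "u \<le> 1" using u order_trans[of 0 "real k / real n" u] by auto
    then have "xn u = x0 + ((\<Sum>j<k. (1 / real n) *\<^sub>R v j) + (u - real k / real n) *\<^sub>R v k) + b u"
      using xn' integral_unique[OF hi] by simp
    also have "\<dots> = yc f' x0 n b c u"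
      unfolding yc_def v_def sum_wt_cell[OF k(1) u] ..
    finally show ?thesis using hi by blast
  qed
  have grid: "k \<le> n \<Longrightarrow> xn (real k / real n) = yg f' x0 n b c k \<and> (h has_integral (\<Sum>j<k. (1 / real n) *\<^sub>R v j)) {0..real k / real n}" for k
  proof (induction k)
    case 0
    then show ?case using xn'[of 0] has_integral_refl(2)[of h 0] by simp
  next
    case (Suc k)
    then have k: "k < n" "xn (real k / real n) = yg f' x0 n b c k" "(h has_integral (\<Sum>j<k. (1 / real n) *\<^sub>R v j)) {0..real k / real n}" by auto
    from step[OF k kS order_refl] show ?case
      using yc_grid[OF n Suc.prems] unfolding d by simp
  qed
  \<comment> \<open>At t = 1 the floor would name a cell beyond the last one, hence the cap.\<close>
  define k where "k = min (n - 1) (nat \<lfloor>real n * t\<rfloor>)"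
  have kn: "k < n" using n by (auto simp: k_def)
  have "real k / real n \<le> t \<and> t \<le> real (Suc k) / real n"
  proof (cases "nat \<lfloor>real n * t\<rfloor> \<le> n - 1")
    case True
    then have "k = nat \<lfloor>real n * t\<rfloor>" by (simp add: k_def)
    then show ?thesis using grid_index[OF n t] by (simp add: add_divide_distrib)
  next
    case False
    then have g: "nat \<lfloor>real n * t\<rfloor> = n" using grid_index(3)[OF n t] by linarith
    then have "t = 1" using grid_index(1)[OF n t] t n0 by simp
    moreover have "k = n - 1" using g by (simp add: k_def)
    ultimately show ?thesis using n n0 by (simp add: of_nat_diff divide_le_eq)
  qed
  then have "xn t = yc f' x0 n b c t" using step[OF kn] grid[of k] kn by auto
  then show ?thesis by (simp add: f'_def[abs_def])
qed

locale randomised_euler =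
  fixes MB :: "'a measure" and MT :: "'b measure" and B :: "real \<Rightarrow> 'a \<Rightarrow> real^'d" and tau :: "nat \<Rightarrow> 'b \<Rightarrow> real"
    and K \<alpha> \<beta> :: real and f :: "real \<Rightarrow> real^'d \<Rightarrow> real^'d" and x0 :: "real^'d"
  assumes bm: "brownian_motion MB B" and PT: "prob_space MT"
    and tau_indep: "prob_space.indep_vars MT (\<lambda>_. borel) tau {1..}"
    and tau_unif: "\<And>j. j \<ge> 1 \<Longrightarrow> distributed MT lborel (tau j) (indicator {0..1})"
    and f: "reg_drift K \<alpha> \<beta> f" and K: "0 < K" and ab: "0 < \<alpha>" "0 < \<beta>"
begin

sublocale filtered_bm "MB \<Otimes>\<^sub>M MT" "\<lambda>t. nat_filtration MB B t \<Otimes>\<^sub>M MT" "\<lambda>t \<omega>. B t (fst \<omega>)"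
  by (rule filtered_bm_product[OF bm PT])

abbreviation "M \<equiv> MB \<Otimes>\<^sub>M MT"
abbreviation "F \<equiv> \<lambda>t. nat_filtration MB B t \<Otimes>\<^sub>M MT"

definition yn :: "nat \<Rightarrow> nat \<Rightarrow> 'a \<times> 'b \<Rightarrow> real^'d" where
  "yn n j \<omega> = yg f x0 n (\<lambda>t. B t (fst \<omega>)) (\<lambda>j. clamp01 (tau j (snd \<omega>))) j"

definition vn :: "nat \<Rightarrow> nat \<Rightarrow> 'a \<times> 'b \<Rightarrow> real^'d" where
  "vn n j \<omega> = vg f x0 n (\<lambda>t. B t (fst \<omega>)) (\<lambda>j. clamp01 (tau j (snd \<omega>))) j"

definition Yn :: "nat \<Rightarrow> real \<Rightarrow> 'a \<times> 'b \<Rightarrow> real^'d" where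
  "Yn n t \<omega> = yc f x0 n (\<lambda>t. B t (fst \<omega>)) (\<lambda>j. clamp01 (tau j (snd \<omega>))) t"

lemma tau_measurable: "1 \<le> j \<Longrightarrow> tau j \<in> borel_measurable MT"
  using tau_unif by (auto simp: distributed_def)

lemma AE_fst: "AE x in MB. P x \<Longrightarrow> AE \<omega> in M. P (fst \<omega>)"
proof -
  interpret MT: prob_space MT by (rule PT)
  assume "AE x in MB. P x"
  then obtain N where N: "{x \<in> space MB. \<not> P x} \<subseteq> N" "N \<in> sets MB" "emeasure MB N = 0"
    by (auto elim: AE_E)
  show "AE \<omega> in M. P (fst \<omega>)"
  proof (rule AE_I[of _ _ "N \<times> space MT"])
    show "{\<omega> \<in> space M. \<not> P (fst \<omega>)} \<subseteq> N \<times> space MT" using N(1) by (auto simp: space_pair_measure)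
    show "emeasure M (N \<times> space MT) = 0" using N by (simp add: MT.emeasure_pair_measure_Times)
  qed (use N in simp)
qed

lemma AE_snd: "AE x in MT. P x \<Longrightarrow> AE \<omega> in M. P (snd \<omega>)"
proof -
  interpret MB: prob_space MB using bm by (simp add: brownian_motion_def)
  interpret MT: prob_space MT by (rule PT)
  interpret P: pair_prob_space MB MT ..
  assume "AE x in MT. P x"
  then obtain N where N: "{x \<in> space MT. \<not> P x} \<subseteq> N" "N \<in> sets MT" "emeasure MT N = 0"
    by (auto elim: AE_E)
  show "AE \<omega> in M. P (snd \<omega>)"
  proof (rule AE_I[of _ _ "space MB \<times> N"])
    show "{\<omega> \<in> space M. \<not> P (snd \<omega>)} \<subseteq> space MB \<times> N" using N(1) by (auto simp: space_pair_measure)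
    show "emeasure M (space MB \<times> N) = 0" using N by (simp add: MT.emeasure_pair_measure_Times)
  qed (use N in simp)
qed

lemma AE_tau_range: "AE \<omega> in M. \<forall>j\<ge>1. 0 \<le> tau j (snd \<omega>) \<and> tau j (snd \<omega>) \<le> 1"
proof -
  have "AE w in MT. 0 \<le> tau j w \<and> tau j w \<le> 1" if j: "1 \<le> j" for j
  proof -
    have "AE x in density lborel (indicator {0..1::real}). 0 \<le> x \<and> x \<le> 1"
      by (subst AE_density) (auto simp: indicator_def)
    then have "AE x in distr MT lborel (tau j). 0 \<le> x \<and> x \<le> 1"
      unfolding distributed_distr_eq_density[OF tau_unif[OF j]] .
    then show ?thesis by (rule AE_distrD[rotated]) (use tau_measurable[OF j] in simp)
  qed
  then have "AE w in MT. \<forall>j. 1 \<le> j \<longrightarrow> 0 \<le> tau j w \<and> tau j w \<le> 1"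
    by (intro AE_all_countable[THEN iffD2] allI) auto
  then show ?thesis by (rule AE_snd)
qed

lemma drift_measurable:
  assumes "1 \<le> j" "x \<in> borel_measurable (F t)"
  shows "(\<lambda>\<omega>. f ((real k + clamp01 (tau j (snd \<omega>))) / real n) (x \<omega>)) \<in> borel_measurable (F t)"
proof -
  note [measurable] = assms(2) tau_measurable[OF assms(1)]
  have "(\<lambda>\<omega>. (\<lambda>p. f (fst p) (snd p)) ((real k + clamp01 (tau j (snd \<omega>))) / real n, x \<omega>)) \<in> borel_measurable (F t)"
    by (rule measurable_compose[OF _ reg_drift_measurable[OF f ab]]) measurable
  then show ?thesis by simp
qed

lemma yn_measurable:
  assumes n: "1 \<le> n"
  shows "j \<le> n \<Longrightarrow> yn n j \<in> borel_measurable (F (real j / real n))"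
proof (induction j)
  case 0
  have "(\<lambda>\<omega>. B 0 (fst \<omega>)) \<in> borel_measurable (F 0)" by (rule adapted) auto
  then show ?case by (simp add: yn_def[abs_def])
next
  case (Suc j)
  have t1: "0 \<le> real j / real n" by simp
  have t2: "real j / real n \<le> real (Suc j) / real n" by (rule divide_right_mono) simp_all
  have t3: "real (Suc j) / real n \<le> 1" using Suc.prems n by (simp add: divide_le_eq del: of_nat_Suc)
  have y: "yn n j \<in> borel_measurable (F (real (Suc j) / real n))"
    using Suc.prems by (intro measurable_F_mono[OF Suc.IH t1 t2 t3]) simp
  have b: "(\<lambda>\<omega>. B (real j / real n) (fst \<omega>)) \<in> borel_measurable (F (real (Suc j) / real n))"
    "(\<lambda>\<omega>. B (real (Suc j) / real n) (fst \<omega>)) \<in> borel_measurable (F (real (Suc j) / real n))"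
    subgoal using order_trans[OF t2 t3] by (rule measurable_F_mono[OF adapted[OF t1] t1 t2 t3])
    subgoal by (rule adapted[OF order_trans[OF t1 t2] t3])
    done
  have "yn n (Suc j) = (\<lambda>\<omega>. yn n j \<omega> + (1 / real n) *\<^sub>R f ((real j + clamp01 (tau (Suc j) (snd \<omega>))) / real n) (yn n j \<omega>)
     + (B (real (Suc j) / real n) (fst \<omega>) - B (real j / real n) (fst \<omega>)))"
    by (auto simp: yn_def fun_eq_iff)
  moreover have "\<dots> \<in> borel_measurable (F (real (Suc j) / real n))"
    by (intro borel_measurable_add borel_measurable_diff borel_measurable_scaleR borel_measurable_const y b drift_measurable) auto
  ultimately show ?case by simp
qed

text \<open>The sampling point with index j + 1 is used already at time j/n; it is measurable there
  because it belongs to the filtration from time 0.\<close>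

lemma vn_measurable:
  assumes "1 \<le> n" "j \<le> n"
  shows "vn n j \<in> borel_measurable (F (real j / real n))"
  using drift_measurable[OF _ yn_measurable[OF assms], of "Suc j" j n]
  by (simp add: vn_def[abs_def] vg_def yn_def)

lemma Yn_measurable:
  assumes n: "1 \<le> n" and t: "0 \<le> t" "t \<le> 1"
  shows "Yn n t \<in> borel_measurable (F t)"
  unfolding Yn_def[abs_def] yc_def vn_def[symmetric]
proof (intro borel_measurable_add borel_measurable_const borel_measurable_sum)
  show "(\<lambda>\<omega>. B t (fst \<omega>)) \<in> borel_measurable (F t)" using t by (rule adapted)
  fix j assume j: "j \<in> {..<n}"
  show "(\<lambda>\<omega>. wt n j t *\<^sub>R vn n j \<omega>) \<in> borel_measurable (F t)"
  proof (cases "real j / real n \<le> t")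
    case True
    then have "vn n j \<in> borel_measurable (F t)"
      using j n t by (intro measurable_F_mono[OF vn_measurable]) auto
    then show ?thesis by simp
  next
    case False
    then have "t \<le> real (Suc j) / real n" using divide_right_mono[of "real j" "real (Suc j)" "real n"] by simp
    then have "wt n j t = 0" using False by (simp add: wt_def)
    then show ?thesis by simp
  qed
qed

lemma norm_drift: "norm (f t x) \<le> K"
  using f by (simp add: reg_drift_def)

lemma scheme:
  assumes n: "1 \<le> n"
  shows "euler_scheme K n (Yn n) (vn n)"
  unfolding euler_scheme_def
proof (intro conjI ballI allI impI)
  fix j assume j: "j < n"
  show "vn n j \<in> borel_measurable (F (real j / real n))" using j n by (intro vn_measurable) auto
  fix \<omega>
  show "norm (vn n j \<omega>) \<le> K" by (simp add: vn_def vg_def norm_drift)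
  fix r assume "r \<in> {real j / real n..real (Suc j) / real n}"
  then show "Yn n r \<omega> = Yn n (real j / real n) \<omega> + (r - real j / real n) *\<^sub>R vn n j \<omega> + (B r (fst \<omega>) - B (real j / real n) (fst \<omega>))"
    using j n yc_cell[OF j, of r f x0] yc_grid[OF n, of j f x0] by (simp add: Yn_def vn_def)
qed (use Yn_measurable n in auto)

lemma scheme_lipschitz:
  assumes "1 \<le> n" "0 \<le> s" "s \<le> u" "u \<le> 1"
  shows "norm (Yn n u \<omega> - Yn n s \<omega> - (B u (fst \<omega>) - B s (fst \<omega>))) \<le> K * (u - s)"
  unfolding Yn_def by (rule yc_drift_lipschitz[OF assms(1) norm_drift assms(2-4)])

lemma scheme_drifted:
  assumes n: "1 \<le> n"
  shows "drifted K (Yn n)"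
  unfolding drifted_def using Yn_measurable[OF n] scheme_lipschitz[OF n] by auto

lemma scheme_continuous: "AE \<omega> in M. continuous_on {0..1} (\<lambda>t. Yn n t \<omega>)"
proof -
  have "AE x in MB. continuous_on {0..1} (\<lambda>t. B t x)" using bm by (auto simp: brownian_motion_def)
  from AE_fst[OF this] show ?thesis
    unfolding Yn_def by eventually_elim (rule yc_continuous)
qed

text \<open>The bound for a frozen Brownian path does not depend on that path, so Fubini carries it
  over to the product space.\<close>

lemma scheme_quadrature:
  assumes \<theta>: "\<theta> \<le> 1 / 2 + \<alpha>" and m: "1 \<le> m" and n: "1 \<le> n" and pq: "p < q" "q \<le> n"
  shows "Lq_le M (2 * m) (sqrt (3 * 4 ^ m) * K * (1 / real n) powr \<theta> * sqrt (real (q - p) / real n))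
    (\<lambda>\<omega>. \<Sum>j\<in>{p..<q}. quad_error f n (Yn n) (vn n) i j \<omega>)"
proof -
  interpret MB: prob_space MB using bm by (simp add: brownian_motion_def)
  interpret MT: prob_space MT by (rule PT)
  define c where "c = sqrt (3 * 4 ^ m) * K * (1 / real n) powr \<theta> * sqrt (real (q - p) / real n)"
  define Z where "Z \<omega> = (\<Sum>j\<in>{p..<q}. quad_error f n (Yn n) (vn n) i j \<omega>)" for \<omega>
  have qe: "quad_error f n (Yn n) (vn n) i j \<omega> = cell_mean f n i j (yn n j \<omega>) - vn n j \<omega> $ i / real n" if "j < n" for j \<omega>
    using yc_grid[OF n, of j f x0] that by (simp add: quad_error_def cell_mean_def Yn_def yn_def)
  have Zm: "Z \<in> borel_measurable M"
    unfolding Z_def[abs_def]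
  proof (intro borel_measurable_sum)
    fix j assume "j \<in> {p..<q}"
    then have j: "j < n" using pq by simp
    have t: "0 \<le> real j / real n" "real j / real n \<le> 1" using j by (auto simp: divide_le_eq)
    have [measurable]: "yn n j \<in> borel_measurable M" "vn n j \<in> borel_measurable M"
      using measurable_F_M[OF yn_measurable[OF n] t] measurable_F_M[OF vn_measurable[OF n] t] j by auto
    note [measurable] = cell_mean_measurable[OF f ab n]
    show "quad_error f n (Yn n) (vn n) i j \<in> borel_measurable M"
      unfolding qe[OF j, abs_def] by measurable
  qed
  have sec: "(\<integral>\<^sup>+w. ennreal (\<bar>Z (x, w)\<bar> ^ (2 * m)) \<partial>MT) \<le> ennreal (c ^ (2 * m))" for x
  proof -
    have "Lq_le MT (2 * m) c (\<lambda>w. \<Sum>j\<in>{p..<q}. cell_mean f n i j (yg f x0 n (\<lambda>t. B t x) (\<lambda>j. clamp01 (tau j w)) j)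
        - vg f x0 n (\<lambda>t. B t x) (\<lambda>j. clamp01 (tau j w)) j $ i / real n)"
      unfolding c_def by (rule quadrature_bound[OF PT tau_indep tau_unif f K ab \<theta> m n pq])
    moreover have "Z (x, w) = (\<Sum>j\<in>{p..<q}. cell_mean f n i j (yg f x0 n (\<lambda>t. B t x) (\<lambda>j. clamp01 (tau j w)) j)
        - vg f x0 n (\<lambda>t. B t x) (\<lambda>j. clamp01 (tau j w)) j $ i / real n)" for w
      unfolding Z_def using pq by (intro sum.cong) (auto simp: qe yn_def vn_def)
    ultimately show ?thesis using Lq_leD(3) by simp
  qed
  have "(\<integral>\<^sup>+\<omega>. ennreal (\<bar>Z \<omega>\<bar> ^ (2 * m)) \<partial>M) = (\<integral>\<^sup>+x. \<integral>\<^sup>+w. ennreal (\<bar>Z (x, w)\<bar> ^ (2 * m)) \<partial>MT \<partial>MB)"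
    using Zm by (intro MT.nn_integral_fst[symmetric]) measurable
  also have "\<dots> \<le> (\<integral>\<^sup>+x. ennreal (c ^ (2 * m)) \<partial>MB)" by (intro nn_integral_mono sec)
  also have "\<dots> = ennreal (c ^ (2 * m))" by (simp add: MB.emeasure_space_1)
  finally have "Lq_le M (2 * m) c Z" using Zm K by (simp add: Lq_le_def c_def)
  then show ?thesis by (simp add: c_def Z_def[abs_def])
qed

context
  fixes X :: "real \<Rightarrow> 'a \<Rightarrow> real^'d"
  assumes X_adapted: "\<And>t. t \<in> {0..1} \<Longrightarrow> X t \<in> borel_measurable (nat_filtration MB B t)"
    and X_cont: "AE \<omega> in MB. continuous_on {0..1} (\<lambda>t. X t \<omega>)"
    and X_sde: "AE \<omega> in MB. \<forall>t\<in>{0..1}. X t \<omega> = x0 + integral {0..t} (\<lambda>s. f s (X s \<omega>)) + B t \<omega>"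
begin

lemma pointwise_rate:
  assumes \<beta>: "\<beta> < 1" and \<theta>: "1 / 2 \<le> \<theta>" "\<theta> < 1 / 2 + \<beta> / 2" "\<theta> \<le> 1 / 2 + \<alpha>" and m: "1 \<le> m"
  shows "\<exists>C>0. \<forall>n t. 1 \<le> n \<longrightarrow> 0 \<le> t \<longrightarrow> t \<le> 1 \<longrightarrow>
    Lq_le M (2 * m) (C * (1 / real n) powr \<theta>) (\<lambda>\<omega>. norm (X t (fst \<omega>) - Yn n t \<omega>))"
proof -
  define G3 where "G3 = sqrt (3 * 4 ^ m) * K"
  have G3: "0 \<le> G3" using K by (simp add: G3_def)
  have Xm: "(\<lambda>\<omega>. X t (fst \<omega>)) \<in> borel_measurable (F t)" if "t \<in> {0..1}" for t
    using X_adapted[OF that] by measurable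
  obtain C where C: "0 < C" and bound: "\<And>n Y v. 1 \<le> n \<Longrightarrow> euler_scheme K n Y v \<Longrightarrow> drifted K Y \<Longrightarrow> (AE \<omega> in M. continuous_on {0..1} (\<lambda>t. Y t \<omega>)) \<Longrightarrow>
    (AE \<omega> in M. Y 0 \<omega> = X 0 (fst \<omega>)) \<Longrightarrow>
    (\<forall>a b i. a < b \<longrightarrow> b \<le> n \<longrightarrow> Lq_le M (2 * m) (G3 * (1 / real n) powr \<theta> * sqrt (real (b - a) / real n)) (\<lambda>\<omega>. \<Sum>j\<in>{a..<b}. quad_error f n Y v i j \<omega>)) \<Longrightarrow>
    (\<forall>t. 0 \<le> t \<longrightarrow> t \<le> 1 \<longrightarrow> Lq_le M (2 * m) (C * (1 / real n) powr \<theta>) (\<lambda>\<omega>. norm (X t (fst \<omega>) - Y t \<omega>)))"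
    using euler_error_bound[OF ab(2) \<beta> ab(1) \<theta>(1,2) m K G3 f Xm AE_fst[OF X_cont] AE_fst[OF X_sde]] by blast
  have Y0: "AE \<omega> in M. Yn n 0 \<omega> = X 0 (fst \<omega>)" if "1 \<le> n" for n
    using AE_fst[OF X_sde]
  proof eventually_elim
    case (elim \<omega>)
    have "Yn n 0 \<omega> = x0 + B 0 (fst \<omega>)" using yc_grid[OF that, of 0 f x0] by (simp add: Yn_def)
    moreover have "X 0 (fst \<omega>) = x0 + B 0 (fst \<omega>)" using elim[rule_format, of 0] by simp
    ultimately show ?case by simp
  qed
  show ?thesis
    using C bound[OF _ scheme scheme_drifted scheme_continuous Y0] scheme_quadrature[OF \<theta>(3) m]
    unfolding G3_def by blast
qed

section \<open>From grid points to the supremum over time\<close>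

text \<open>The Brownian parts of the two processes cancel, so their difference is 2K-Lipschitz in
  time and the nearest grid point to the left is within 2K/n. One null set serves all n and
  t.\<close>

lemma error_grid_bound:
  "AE \<omega> in M. \<forall>n\<ge>1. \<forall>t\<in>{0..1}. \<exists>j\<le>n.
     norm (X t (fst \<omega>) - Yn n t \<omega>) \<le> norm (X (real j / real n) (fst \<omega>) - Yn n (real j / real n) \<omega>) + 2 * K / real n"
  using AE_fst[OF X_sde] AE_fst[OF X_cont]
proof eventually_elim
  case (elim \<omega>)
  show ?case
  proof (intro allI impI ballI)
    fix n :: nat and t :: real assume n: "1 \<le> n" and t: "t \<in> {0..1}"
    define j where "j = nat \<lfloor>real n * t\<rfloor>"
    define s where "s = real j / real n"
    have s: "0 \<le> s" "s \<le> t" "t \<le> s + 1 / real n" "j \<le> n" "t \<le> 1"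
      using grid_index[OF n, of t] t by (auto simp: j_def s_def)
    have c: "continuous_on {0..1} (\<lambda>r. f r (X r (fst \<omega>)))" using reg_drift_continuous[OF f ab elim(2)] .
    have "integral {0..s} (\<lambda>r. f r (X r (fst \<omega>))) + integral {s..t} (\<lambda>r. f r (X r (fst \<omega>))) = integral {0..t} (\<lambda>r. f r (X r (fst \<omega>)))"
      using s by (intro Henstock_Kurzweil_Integration.integral_combine integrable_continuous_real continuous_on_subset[OF c]) auto
    moreover have "X t (fst \<omega>) = x0 + integral {0..t} (\<lambda>s. f s (X s (fst \<omega>))) + B t (fst \<omega>)"
      "X s (fst \<omega>) = x0 + integral {0..s} (\<lambda>s. f s (X s (fst \<omega>))) + B s (fst \<omega>)"
      using elim(1) s by auto
    ultimately have e: "X t (fst \<omega>) - X s (fst \<omega>) - (B t (fst \<omega>) - B s (fst \<omega>)) = integral {s..t} (\<lambda>r. f r (X r (fst \<omega>)))"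
      by (simp add: algebra_simps)
    have "norm (integral {s..t} (\<lambda>r. f r (X r (fst \<omega>)))) \<le> K * (t - s)"
      using s norm_drift by (intro integral_bound continuous_on_subset[OF c]) auto
    moreover have "norm (Yn n t \<omega> - Yn n s \<omega> - (B t (fst \<omega>) - B s (fst \<omega>))) \<le> K * (t - s)"
      using s by (intro scheme_lipschitz n) auto
    moreover have "K * (t - s) \<le> K * (1 / real n)" using s K by (intro mult_left_mono) auto
    moreover have "X t (fst \<omega>) - Yn n t \<omega> = (X s (fst \<omega>) - Yn n s \<omega>) + (integral {s..t} (\<lambda>r. f r (X r (fst \<omega>)))
        - (Yn n t \<omega> - Yn n s \<omega> - (B t (fst \<omega>) - B s (fst \<omega>))))"
      unfolding e[symmetric] by simp
    ultimately have "norm (X t (fst \<omega>) - Yn n t \<omega>) \<le> norm (X s (fst \<omega>) - Yn n s \<omega>) + (K * (1 / real n) + K * (1 / real n))"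
      by (smt (verit) norm_triangle_ineq norm_triangle_ineq4)
    then show "\<exists>j\<le>n. norm (X t (fst \<omega>) - Yn n t \<omega>) \<le> norm (X (real j / real n) (fst \<omega>) - Yn n (real j / real n) \<omega>) + 2 * K / real n"
      using s unfolding s_def by (intro exI[of _ j]) simp
  qed
qed

text \<open>The supremum over the grid is handled by a union bound in \<open>L\<^sup>q\<close> with \<open>q\<close> large: it costs a factor
  \<open>n\<^bsup>p/q\<^esup>\<close>, which is absorbed by the arbitrarily small loss in the exponent.\<close>

lemma sup_rate:
  assumes \<beta>: "\<beta> < 1" and \<theta>: "1 / 2 \<le> \<theta>" "\<theta> < 1 / 2 + \<beta> / 2" "\<theta> \<le> 1 / 2 + \<alpha>"
    and p: "1 \<le> p" and e: "0 < e" and \<kappa>: "\<kappa> \<le> \<theta> - e" "\<kappa> \<le> 1"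
  shows "\<exists>C>0. \<forall>n\<ge>1. (\<integral>\<^sup>+\<omega>. (SUP t\<in>{0..1}. ennreal (norm (X t (fst \<omega>) - Yn n t \<omega>) powr p)) \<partial>M)
     \<le> ennreal (C * real n powr (- \<kappa> * p))"
proof -
  \<comment> \<open>Makes q = 2m at least p and at least 1/e, so that the loss n^(1/q) of the union
    bound is at most n^e.\<close>
  obtain m :: nat where m0: "p + 1 / e < real m" using reals_Archimedean2 by blast
  have ep: "0 < 1 / e" using e by simp
  have m: "1 \<le> m"
  proof -
    have "1 < real m" using m0 p ep by linarith
    then show ?thesis by simp
  qed
  define q where "q = 2 * m"
  have "p \<le> real m" "1 / e \<le> real m" using m0 p ep by linarith+
  moreover have "real m \<le> real q" by (simp add: q_def)
  ultimately have qp: "p \<le> real q" "1 / e \<le> real q" by linarith+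
  have q1: "1 \<le> q" using m by (simp add: q_def)
  obtain C where C: "0 < C" and rate: "\<And>n t. 1 \<le> n \<Longrightarrow> 0 \<le> t \<Longrightarrow> t \<le> 1 \<Longrightarrow>
    Lq_le M q (C * (1 / real n) powr \<theta>) (\<lambda>\<omega>. norm (X t (fst \<omega>) - Yn n t \<omega>))"
    using pointwise_rate[OF \<beta> \<theta> m] unfolding q_def by blast
  \<comment> \<open>2^p comes from splitting a sum inside the power p; the 3 counts the threshold
    once and the union bound twice.\<close>
  define D where "D = 2 powr p * (3 * C powr p + (2 * K) powr p)"
  have D: "0 < D" using C by (simp add: D_def add_pos_nonneg)
  show ?thesis
  proof (intro exI[of _ D] conjI allI impI D)
    fix n :: nat assume n: "1 \<le> n"
    have n0: "0 < real n" "1 \<le> real n" using n by auto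
    define r where "r = C * (1 / real n) powr \<theta>"
    have r: "0 < r" using C n0 by (simp add: r_def)
    \<comment> \<open>The threshold that balances the two parts: r^q = lam^q / n, so the sum over n
      + 1 grid points contributes at most 2 lam^p.\<close>
    define lam where "lam = r * real n powr (1 / real q)"
    have lam: "0 < lam" using r n0 by (simp add: lam_def)
    define en where "en j \<omega> = norm (X (real j / real n) (fst \<omega>) - Yn n (real j / real n) \<omega>)" for j \<omega>
    have tj: "0 \<le> real j / real n" "real j / real n \<le> 1" if "j \<le> n" for j using that n0 by (auto simp: divide_le_eq)
    have em: "en j \<in> borel_measurable M" if "j \<le> n" for j
      using Lq_leD(2)[OF rate[OF n tj[OF that]]] by (simp add: en_def[abs_def])
    have eL: "(\<integral>\<^sup>+\<omega>. ennreal (en j \<omega> ^ q) \<partial>M) \<le> ennreal (r ^ q)" if "j \<le> n" for j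
      using Lq_leD(3)[OF rate[OF n tj[OF that]]] by (simp add: en_def r_def)
    define A where "A = 2 powr p * (lam powr p + (2 * K / real n) powr p)"
    define b where "b = 2 powr p * lam powr (p - real q)"
    have AB: "0 \<le> A" "0 \<le> b" by (auto simp: A_def b_def)
    have sup: "AE \<omega> in M. (SUP t\<in>{0..1}. ennreal (norm (X t (fst \<omega>) - Yn n t \<omega>) powr p)) \<le> ennreal A + ennreal b * (\<Sum>j\<le>n. ennreal (en j \<omega> ^ q))"
      using error_grid_bound
    proof eventually_elim
      case (elim \<omega>)
      show ?case
      proof (rule SUP_least)
        fix t :: real assume t: "t \<in> {0..1}"
        obtain j where j: "j \<le> n" "norm (X t (fst \<omega>) - Yn n t \<omega>) \<le> en j \<omega> + 2 * K / real n"
          using elim n t unfolding en_def by blast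
        have e0: "0 \<le> en j \<omega>" by (simp add: en_def)
        have k0: "0 \<le> 2 * K / real n" using K by simp
        have "norm (X t (fst \<omega>) - Yn n t \<omega>) powr p \<le> (2 * max (en j \<omega>) (2 * K / real n)) powr p"
          using j(2) p by (intro powr_mono2) auto
        also have "\<dots> = 2 powr p * max (en j \<omega>) (2 * K / real n) powr p"
          using e0 by (simp add: powr_mult)
        finally have s0: "norm (X t (fst \<omega>) - Yn n t \<omega>) powr p \<le> 2 powr p * max (en j \<omega>) (2 * K / real n) powr p" .
        have s1: "max (en j \<omega>) (2 * K / real n) powr p \<le> en j \<omega> powr p + (2 * K / real n) powr p"
          by (simp add: max_def)
        \<comment> \<open>Below the threshold the p-th power is at most lam^p; above it, the surplus
          power q - p is bought by dividing by lam^(q-p). This replaces Jensen's inequality when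
          passing from q to p.\<close>
        have s2: "en j \<omega> powr p \<le> lam powr p + lam powr (p - real q) * en j \<omega> ^ q"
        proof (cases "en j \<omega> \<le> lam")
          case True
          then have "en j \<omega> powr p \<le> lam powr p" using e0 p by (intro powr_mono2) auto
          then show ?thesis using e0 by (smt (verit) mult_nonneg_nonneg powr_ge_zero zero_le_power)
        next
          case False
          then have pos: "0 < en j \<omega>" using lam by simp
          have "en j \<omega> powr p = en j \<omega> powr (p - real q) * en j \<omega> powr real q" by (simp flip: powr_add)
          also have "\<dots> \<le> lam powr (p - real q) * en j \<omega> powr real q"
            using False lam qp by (intro mult_right_mono powr_mono2') auto
          also have "en j \<omega> powr real q = en j \<omega> ^ q" using pos by (rule powr_realpow)
          finally show ?thesis by (smt (verit) powr_ge_zero)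
        qed
        have s3: "en j \<omega> ^ q \<le> (\<Sum>j\<le>n. en j \<omega> ^ q)"
          using j(1) by (intro member_le_sum) (auto simp: en_def)
        have s4: "lam powr (p - real q) * en j \<omega> ^ q \<le> lam powr (p - real q) * (\<Sum>j\<le>n. en j \<omega> ^ q)"
          by (rule mult_left_mono[OF s3]) simp
        have "max (en j \<omega>) (2 * K / real n) powr p
            \<le> lam powr p + (2 * K / real n) powr p + lam powr (p - real q) * (\<Sum>j\<le>n. en j \<omega> ^ q)"
          using s1 s2 s4 by linarith
        then have "2 powr p * max (en j \<omega>) (2 * K / real n) powr p
            \<le> 2 powr p * (lam powr p + (2 * K / real n) powr p + lam powr (p - real q) * (\<Sum>j\<le>n. en j \<omega> ^ q))"
          by (rule mult_left_mono) simp
        also have "\<dots> = A + b * (\<Sum>j\<le>n. en j \<omega> ^ q)" unfolding A_def b_def by (simp only: distrib_left mult.assoc)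
        finally have "norm (X t (fst \<omega>) - Yn n t \<omega>) powr p \<le> A + b * (\<Sum>j\<le>n. en j \<omega> ^ q)"
          using s0 by linarith
        then have "ennreal (norm (X t (fst \<omega>) - Yn n t \<omega>) powr p) \<le> ennreal (A + b * (\<Sum>j\<le>n. en j \<omega> ^ q))"
          by (rule ennreal_leI)
        also have "\<dots> = ennreal A + ennreal b * (\<Sum>j\<le>n. ennreal (en j \<omega> ^ q))"
        proof -
          have "0 \<le> (\<Sum>j\<le>n. en j \<omega> ^ q)" by (intro sum_nonneg) (simp add: en_def)
          moreover have "(\<Sum>j\<le>n. ennreal (en j \<omega> ^ q)) = ennreal (\<Sum>j\<le>n. en j \<omega> ^ q)"
            by (intro sum_ennreal) (simp add: en_def)
          ultimately show ?thesis using AB by (simp add: ennreal_mult)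
        qed
        finally show "ennreal (norm (X t (fst \<omega>) - Yn n t \<omega>) powr p) \<le> ennreal A + ennreal b * (\<Sum>j\<le>n. ennreal (en j \<omega> ^ q))" .
      qed
    qed
    have "(\<integral>\<^sup>+\<omega>. (SUP t\<in>{0..1}. ennreal (norm (X t (fst \<omega>) - Yn n t \<omega>) powr p)) \<partial>M)
       \<le> (\<integral>\<^sup>+\<omega>. ennreal A + ennreal b * (\<Sum>j\<le>n. ennreal (en j \<omega> ^ q)) \<partial>M)"
      by (rule nn_integral_mono_AE[OF sup])
    also have "\<dots> = ennreal A + ennreal b * (\<Sum>j\<le>n. \<integral>\<^sup>+\<omega>. ennreal (en j \<omega> ^ q) \<partial>M)"
    proof -
      have [measurable]: "(\<lambda>\<omega>. ennreal (en j \<omega> ^ q)) \<in> borel_measurable M" if "j \<le> n" for j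
        using em[OF that] by measurable
      have sm: "(\<lambda>\<omega>. \<Sum>j\<le>n. ennreal (en j \<omega> ^ q)) \<in> borel_measurable M"
        by (intro borel_measurable_sum) auto
      have "(\<integral>\<^sup>+\<omega>. ennreal A + ennreal b * (\<Sum>j\<le>n. ennreal (en j \<omega> ^ q)) \<partial>M)
         = (\<integral>\<^sup>+\<omega>. ennreal A \<partial>M) + (\<integral>\<^sup>+\<omega>. ennreal b * (\<Sum>j\<le>n. ennreal (en j \<omega> ^ q)) \<partial>M)"
        using sm by (intro nn_integral_add) auto
      also have "(\<integral>\<^sup>+\<omega>. ennreal b * (\<Sum>j\<le>n. ennreal (en j \<omega> ^ q)) \<partial>M) = ennreal b * (\<integral>\<^sup>+\<omega>. (\<Sum>j\<le>n. ennreal (en j \<omega> ^ q)) \<partial>M)"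
        using sm by (rule nn_integral_cmult)
      also have "(\<integral>\<^sup>+\<omega>. (\<Sum>j\<le>n. ennreal (en j \<omega> ^ q)) \<partial>M) = (\<Sum>j\<le>n. \<integral>\<^sup>+\<omega>. ennreal (en j \<omega> ^ q) \<partial>M)"
        by (intro nn_integral_sum) auto
      finally show ?thesis by (simp add: emeasure_space_1)
    qed
    also have "\<dots> \<le> ennreal A + ennreal b * (\<Sum>j\<le>n. ennreal (r ^ q))"
      using eL by (intro add_left_mono mult_left_mono sum_mono) auto
    also have "\<dots> = ennreal (A + b * (real (Suc n) * r ^ q))"
      using AB r by (simp add: ennreal_mult ennreal_of_nat_eq_real_of_nat)
    also have "\<dots> \<le> ennreal (D * real n powr (- \<kappa> * p))"
    proof (rule ennreal_leI)
      have bq: "b * (real (Suc n) * r ^ q) \<le> 2 powr p * (2 * lam powr p)"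
      proof -
        have "lam ^ q = r ^ q * (real n powr (1 / real q)) powr real q"
          using n0 by (simp add: lam_def power_mult_distrib powr_realpow)
        also have "(real n powr (1 / real q)) powr real q = real n" using q1 n0 by (simp add: powr_powr)
        finally have "r ^ q = lam ^ q / real n" using n0 by simp
        moreover have "real (Suc n) / real n \<le> 2" using n0 by (simp add: divide_le_eq)
        ultimately have "real (Suc n) * r ^ q \<le> 2 * lam ^ q"
          using mult_right_mono[of "real (Suc n) / real n" 2 "lam ^ q"] lam by simp
        also have "lam ^ q = lam powr real q" using lam by (simp add: powr_realpow)
        finally have "b * (real (Suc n) * r ^ q) \<le> b * (2 * lam powr real q)"
          using AB by (intro mult_left_mono) auto
        also have "\<dots> = 2 powr p * (2 * (lam powr (p - real q) * lam powr real q))"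
          by (simp add: b_def mult_ac)
        also have "lam powr (p - real q) * lam powr real q = lam powr p"
          by (simp flip: powr_add)
        finally show ?thesis .
      qed
      have n1: "real n powr (- x) = (1 / real n) powr x" for x
        using n0 by (simp add: powr_minus_divide powr_divide)
      have "lam = C * real n powr (1 / real q - \<theta>)"
        unfolding lam_def r_def n1[symmetric] using n0 by (simp add: mult.assoc flip: powr_add)
      also have "\<dots> \<le> C * real n powr (- \<kappa>)"
      proof (intro mult_left_mono powr_mono)
        have "1 / real q \<le> e"
          using qp q1 e by (simp add: field_simps)
        then show "1 / real q - \<theta> \<le> - \<kappa>" using \<kappa> by linarith
      qed (use C n0 in auto)
      finally have "lam powr p \<le> (C * real n powr (- \<kappa>)) powr p"
        using lam p by (intro powr_mono2) auto
      also have "\<dots> = C powr p * real n powr (- \<kappa> * p)"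
        using C n0 by (simp add: powr_mult powr_powr)
      finally have lp: "lam powr p \<le> C powr p * real n powr (- \<kappa> * p)" .
      have "2 * K / real n \<le> 2 * K * real n powr (- \<kappa>)"
      proof -
        have "real n powr (- 1) \<le> real n powr (- \<kappa>)" using \<kappa> n0 by (intro powr_mono) auto
        then have "1 / real n \<le> real n powr (- \<kappa>)" using n0 by (simp add: powr_minus_divide)
        then show ?thesis using K mult_left_mono[of "1 / real n" "real n powr (- \<kappa>)" "2 * K"] by simp
      qed
      then have "(2 * K / real n) powr p \<le> (2 * K * real n powr (- \<kappa>)) powr p"
        using K p by (intro powr_mono2) auto
      also have "\<dots> = (2 * K) powr p * real n powr (- \<kappa> * p)"
        using K n0 by (simp add: powr_mult powr_powr)
      finally have kp: "(2 * K / real n) powr p \<le> (2 * K) powr p * real n powr (- \<kappa> * p)" .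
      have "A + b * (real (Suc n) * r ^ q) \<le> 2 powr p * (lam powr p + (2 * K / real n) powr p) + 2 powr p * (2 * lam powr p)"
        using bq by (simp add: A_def)
      also have "\<dots> = 2 powr p * (3 * lam powr p + (2 * K / real n) powr p)" by (simp add: algebra_simps)
      also have "\<dots> \<le> 2 powr p * (3 * (C powr p * real n powr (- \<kappa> * p)) + (2 * K) powr p * real n powr (- \<kappa> * p))"
        using lp kp by (intro mult_left_mono add_mono) auto
      also have "\<dots> = D * real n powr (- \<kappa> * p)" by (simp add: D_def algebra_simps)
      finally show "A + b * (real (Suc n) * r ^ q) \<le> D * real n powr (- \<kappa> * p)" .
    qed
    finally show "(\<integral>\<^sup>+\<omega>. (SUP t\<in>{0..1}. ennreal (norm (X t (fst \<omega>) - Yn n t \<omega>) powr p)) \<partial>M) \<le> ennreal (D * real n powr (- \<kappa> * p))" .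
  qed
qed

end

end

section \<open>Reduction to a globally regular drift and choice of exponents\<close>

text \<open>Boundedness allows the spatial exponent to be lowered: at distance at most 1 the smaller
  exponent gives the weaker bound, and farther apart twice the supremum suffices. Clamping is
  1-Lipschitz, so the time regularity survives the extension.\<close>

lemma holder_Cb_reg_drift:
  assumes f: "holder_Cb \<alpha> \<beta> f" and \<alpha>: "0 < \<alpha>" and \<beta>: "0 < \<beta>'" "\<beta>' \<le> \<beta>"
  shows "\<exists>K>0. reg_drift K \<alpha> \<beta>' (\<lambda>t. f (clamp01 t))"
proof -
  obtain K1 K2 K3 where K1: "\<And>t x. t \<in> {0..1} \<Longrightarrow> norm (f t x) \<le> K1"
    and K2: "\<And>s t x. s \<in> {0..1} \<Longrightarrow> t \<in> {0..1} \<Longrightarrow> norm (f t x - f s x) \<le> K2 * \<bar>t - s\<bar> powr \<alpha>"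
    and K3: "\<And>t x y. t \<in> {0..1} \<Longrightarrow> norm (f t x - f t y) \<le> K3 * norm (x - y) powr \<beta>"
    using f unfolding holder_Cb_def by metis
  define K where "K = 1 + 2 * \<bar>K1\<bar> + \<bar>K2\<bar> + \<bar>K3\<bar>"
  have cl: "clamp01 t \<in> {0..1}" for t using clamp01_bounds[of t] by simp
  have "norm (f (clamp01 t) x) \<le> K" for t x
    using K1[OF cl, of t x] unfolding K_def by linarith
  moreover have "norm (f (clamp01 t) x - f (clamp01 t) y) \<le> K * norm (x - y) powr \<beta>'" for t x y
  proof (cases "norm (x - y) \<le> 1")
    case True
    have "norm (f (clamp01 t) x - f (clamp01 t) y) \<le> K3 * norm (x - y) powr \<beta>" by (rule K3[OF cl])
    also have "\<dots> \<le> K * norm (x - y) powr \<beta>"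
      by (intro mult_right_mono) (auto simp: K_def)
    also have "\<dots> \<le> K * norm (x - y) powr \<beta>'"
    proof (intro mult_left_mono)
      show "norm (x - y) powr \<beta> \<le> norm (x - y) powr \<beta>'"
        using True \<beta> by (intro powr_mono') auto
    qed (simp add: K_def)
    finally show ?thesis .
  next
    case False
    have "norm (f (clamp01 t) x - f (clamp01 t) y) \<le> norm (f (clamp01 t) x) + norm (f (clamp01 t) y)"
      by (rule norm_triangle_ineq4)
    also have "\<dots> \<le> 2 * \<bar>K1\<bar>" using K1[OF cl, of t x] K1[OF cl, of t y] abs_ge_self[of K1] by linarith
    also have "\<dots> \<le> K * 1" by (simp add: K_def)
    also have "\<dots> \<le> K * norm (x - y) powr \<beta>'"
      using False \<beta> by (intro mult_left_mono ge_one_powr_ge_zero) (auto simp: K_def)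
    finally show ?thesis .
  qed
  moreover have "norm (f (clamp01 s) x - f (clamp01 t) x) \<le> K * \<bar>s - t\<bar> powr \<alpha>" for s t x
  proof -
    have "norm (f (clamp01 s) x - f (clamp01 t) x) \<le> K2 * \<bar>clamp01 s - clamp01 t\<bar> powr \<alpha>" by (rule K2[OF cl cl])
    also have "\<dots> \<le> K * \<bar>clamp01 s - clamp01 t\<bar> powr \<alpha>"
      by (intro mult_right_mono) (auto simp: K_def)
    also have "\<dots> \<le> K * \<bar>s - t\<bar> powr \<alpha>"
      using \<alpha> clamp01_dist by (intro mult_left_mono powr_mono2) (auto simp: K_def)
    finally show ?thesis .
  qed
  ultimately have "reg_drift K \<alpha> \<beta>' (\<lambda>t. f (clamp01 t))" unfolding reg_drift_def by blast
  moreover have "0 < K" by (simp add: K_def)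
  ultimately show ?thesis by blast
qed

theorem theorem4p2:
  fixes MB :: "'a measure" and MT :: "'b measure"
    and B :: "real \<Rightarrow> 'a \<Rightarrow> real^'d"
    and tau :: "nat \<Rightarrow> 'b \<Rightarrow> real"
    and \<alpha> \<beta> :: real and x0 :: "real^'d"
    and f :: "real \<Rightarrow> real^'d \<Rightarrow> real^'d"
    and X :: "real \<Rightarrow> 'a \<Rightarrow> real^'d"
    and Xn :: "nat \<Rightarrow> real \<Rightarrow> 'a \<times> 'b \<Rightarrow> real^'d"
  assumes BM: "brownian_motion MB B"
    and PT: "prob_space MT"
    and tau_indep: "prob_space.indep_vars MT (\<lambda>_. borel) tau {1..}"
    and tau_unif: "\<And>j. j \<ge> 1 \<Longrightarrow> distributed MT lborel (tau j) (indicator {0..1})"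
    and \<alpha>: "0 < \<alpha>" "\<alpha> \<le> 1" and \<beta>: "0 < \<beta>" "\<beta> \<le> 1"
    and f: "holder_Cb \<alpha> \<beta> f"
    and X_adapted: "\<And>t. t \<in> {0..1} \<Longrightarrow> X t \<in> borel_measurable (nat_filtration MB B t)"
    and X_cont: "AE \<omega> in MB. continuous_on {0..1} (\<lambda>t. X t \<omega>)"
    and X_sde: "AE \<omega> in MB. \<forall>t\<in>{0..1}.
                  X t \<omega> = x0 + integral {0..t} (\<lambda>s. f s (X s \<omega>)) + B t \<omega>"
    and Xn_def: "\<And>n t \<omega>. n \<ge> 1 \<Longrightarrow> t \<in> {0..1} \<Longrightarrow> \<omega> \<in> space (MB \<Otimes>\<^sub>M MT) \<Longrightarrow>
                  Xn n t \<omega> = x0 + integral {0..t}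
                     (\<lambda>s. f (kappa_tau tau n s (snd \<omega>)) (Xn n (kappa n s) \<omega>)) + B t (fst \<omega>)"
  shows "\<forall>p \<ge> 1. \<forall>\<epsilon>. 0 < \<epsilon> \<and> \<epsilon> < 1/2 \<longrightarrow>
           (\<exists>C > 0. \<forall>n::nat. n \<ge> 1 \<longrightarrow>
              (\<integral>\<^sup>+ \<omega>. (SUP t\<in>{0..1}. ennreal (norm (X t (fst \<omega>) - Xn n t \<omega>) powr p)) \<partial>(MB \<Otimes>\<^sub>M MT))
                \<le> ennreal (C * real n powr (- (1/2 + min \<alpha> (\<beta>/2) - \<epsilon>) * p)))"
proof (intro allI impI)
  fix p \<epsilon> :: real assume p: "1 \<le> p" and "0 < \<epsilon> \<and> \<epsilon> < 1/2"
  then have \<epsilon>: "0 < \<epsilon>" "\<epsilon> < 1/2" by auto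
  define \<gamma> where "\<gamma> = min \<alpha> (\<beta> / 2)"
  \<comment> \<open>Half of the relative loss goes into \<beta>', which makes it less than 1 even
    for \<beta> = 1, and the full loss into \<theta>; the gap between them gives the strict
    inequality \<theta> < 1/2 + \<beta>'/2.\<close>
  define \<beta>' where "\<beta>' = (1 - \<epsilon> / 2) * \<beta>"
  define \<theta> where "\<theta> = 1 / 2 + (1 - \<epsilon>) * \<gamma>"
  have \<gamma>: "0 < \<gamma>" "\<gamma> \<le> \<alpha>" "\<gamma> \<le> \<beta> / 2" "\<gamma> \<le> 1 / 2" using \<alpha> \<beta> by (auto simp: \<gamma>_def)
  have \<beta>': "0 < \<beta>'" "\<beta>' < \<beta>" "\<beta>' < 1"
  proof -
    show "0 < \<beta>'" using \<beta> \<epsilon> by (simp add: \<beta>'_def)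
    have "0 < \<epsilon> / 2 * \<beta>" using \<beta> \<epsilon> by simp
    then show "\<beta>' < \<beta>" by (simp add: \<beta>'_def left_diff_distrib)
    then show "\<beta>' < 1" using \<beta> by simp
  qed
  have \<theta>: "1 / 2 \<le> \<theta>" "\<theta> < 1 / 2 + \<beta>' / 2" "\<theta> \<le> 1 / 2 + \<alpha>" and \<kappa>: "1 / 2 + \<gamma> - \<epsilon> \<le> \<theta> - \<epsilon> / 2" "1 / 2 + \<gamma> - \<epsilon> \<le> 1"
  proof -
    have e\<gamma>: "0 \<le> \<epsilon> * \<gamma>" "\<epsilon> * \<gamma> \<le> \<epsilon> * (1 / 2)"
      using \<epsilon> \<gamma> by (auto intro!: mult_left_mono)
    show "1 / 2 \<le> \<theta>" using \<epsilon> \<gamma> by (simp add: \<theta>_def)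
    have "(1 - \<epsilon>) * \<gamma> \<le> (1 - \<epsilon>) * (\<beta> / 2)" using \<epsilon> \<gamma> by (intro mult_left_mono) auto
    also have "\<dots> < (1 - \<epsilon> / 2) * (\<beta> / 2)" using \<epsilon> \<beta> by (intro mult_strict_right_mono) auto
    finally show "\<theta> < 1 / 2 + \<beta>' / 2" by (simp add: \<theta>_def \<beta>'_def)
    show "\<theta> \<le> 1 / 2 + \<alpha>" using e\<gamma> \<gamma> by (simp add: \<theta>_def left_diff_distrib)
    show "1 / 2 + \<gamma> - \<epsilon> \<le> \<theta> - \<epsilon> / 2" using e\<gamma> by (simp add: \<theta>_def left_diff_distrib)
    show "1 / 2 + \<gamma> - \<epsilon> \<le> 1" using \<epsilon> \<gamma> by linarith
  qed
  obtain K where K: "0 < K" and reg: "reg_drift K \<alpha> \<beta>' (\<lambda>t. f (clamp01 t))"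
    using holder_Cb_reg_drift[OF f \<alpha>(1) \<beta>'(1)] \<beta>'(2) by auto
  interpret E: randomised_euler MB MT B tau K \<alpha> \<beta>' "\<lambda>t. f (clamp01 t)" x0
    by (rule randomised_euler.intro) (fact BM PT tau_indep tau_unif reg K \<alpha>(1) \<beta>'(1))+
  have sde: "AE \<omega> in MB. \<forall>t\<in>{0..1}. X t \<omega> = x0 + integral {0..t} (\<lambda>s. f (clamp01 s) (X s \<omega>)) + B t \<omega>"
    using X_sde
  proof eventually_elim
    case (elim \<omega>)
    show ?case
    proof
      fix t :: real assume t: "t \<in> {0..1}"
      have "integral {0..t} (\<lambda>s. f s (X s \<omega>)) = integral {0..t} (\<lambda>s. f (clamp01 s) (X s \<omega>))"
        using t by (intro integral_cong) (simp add: clamp01_id)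
      then show "X t \<omega> = x0 + integral {0..t} (\<lambda>s. f (clamp01 s) (X s \<omega>)) + B t \<omega>"
        using elim t by simp
    qed
  qed
  \<comment> \<open>\<theta> gives up \<epsilon> \<gamma> \<le> \<epsilon>/2 of the exponent, so
    \<epsilon>/2 remains for the passage to the supremum.\<close>
  have \<epsilon>2: "0 < \<epsilon> / 2" using \<epsilon> by simp
  obtain C where C: "0 < C" and rate: "\<And>n. 1 \<le> n \<Longrightarrow>
      (\<integral>\<^sup>+\<omega>. (SUP t\<in>{0..1}. ennreal (norm (X t (fst \<omega>) - E.Yn n t \<omega>) powr p)) \<partial>(MB \<Otimes>\<^sub>M MT))
       \<le> ennreal (C * real n powr (- (1 / 2 + \<gamma> - \<epsilon>) * p))"
    using E.sup_rate[OF X_adapted X_cont sde \<beta>'(3) \<theta> p \<epsilon>2 \<kappa>] by blast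
  show "\<exists>C > 0. \<forall>n::nat. n \<ge> 1 \<longrightarrow>
      (\<integral>\<^sup>+ \<omega>. (SUP t\<in>{0..1}. ennreal (norm (X t (fst \<omega>) - Xn n t \<omega>) powr p)) \<partial>(MB \<Otimes>\<^sub>M MT))
        \<le> ennreal (C * real n powr (- (1/2 + min \<alpha> (\<beta>/2) - \<epsilon>) * p))"
  proof (intro exI[of _ C] conjI allI impI C)
    fix n :: nat assume n: "1 \<le> n"
    \<comment> \<open>Outside a null set every sampling point lies in [0, 1], clamping changes
      nothing, and the given scheme is the constructed one at all times.\<close>
    have "AE \<omega> in MB \<Otimes>\<^sub>M MT. \<forall>t\<in>{0..1}. Xn n t \<omega> = E.Yn n t \<omega>"
      using E.AE_tau_range AE_space
    proof eventually_elim
      case (elim \<omega>)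
      have c: "clamp01 (tau j (snd \<omega>)) = tau j (snd \<omega>)" if "1 \<le> j" for j
        using elim(1) that by (simp add: clamp01_id)
      show ?case
      proof
        fix t :: real assume t: "t \<in> {0..1}"
        show "Xn n t \<omega> = E.Yn n t \<omega>"
          unfolding E.Yn_def
        proof (rule scheme_eq_yc[OF n])
          fix u :: real assume u: "0 \<le> u" "u \<le> 1"
          show "Xn n u \<omega> = x0 + integral {0..u} (\<lambda>s. f ((real_of_int \<lfloor>real n * s\<rfloor>
              + clamp01 (tau (nat \<lfloor>real n * s\<rfloor> + 1) (snd \<omega>))) / real n) (Xn n (kappa n s) \<omega>)) + B u (fst \<omega>)"
            using Xn_def[OF n _ elim(2), of u] u by (simp add: c kappa_tau_def)
        qed (use t clamp01_bounds in auto)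
      qed
    qed
    then have "(\<integral>\<^sup>+ \<omega>. (SUP t\<in>{0..1}. ennreal (norm (X t (fst \<omega>) - Xn n t \<omega>) powr p)) \<partial>(MB \<Otimes>\<^sub>M MT))
        = (\<integral>\<^sup>+ \<omega>. (SUP t\<in>{0..1}. ennreal (norm (X t (fst \<omega>) - E.Yn n t \<omega>) powr p)) \<partial>(MB \<Otimes>\<^sub>M MT))"
      by (intro nn_integral_cong_AE) (auto elim!: eventually_mono intro!: SUP_cong)
    then show "(\<integral>\<^sup>+ \<omega>. (SUP t\<in>{0..1}. ennreal (norm (X t (fst \<omega>) - Xn n t \<omega>) powr p)) \<partial>(MB \<Otimes>\<^sub>M MT))
        \<le> ennreal (C * real n powr (- (1/2 + min \<alpha> (\<beta>/2) - \<epsilon>) * p))"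
      using rate[OF n] by (simp add: \<gamma>_def)
  qed
qed

end
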